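(* Let $K$ be an algebraically closed field, and let $H(s)=h(s)/(1-s)$ be the Hilbert series of $S/J'$ for some ideal $J'\subset S=K[x,y,z]$ defining a zero-dimensional subscheme of $\mathbb{P}^2$, with $h(s)=\sum_jh_js^j$. Assume that the characteristic of $K$ is $0$ or $p>\max\{j:h_j\neq0\}$. Let $\beta=(\beta_1,\ldots,\beta_j,\ldots)$ be a vector with integral entries. Then: (a) each $V(H,j,\ge\beta_j)$ is a determinantal variety; (b) the variety $V(H,\ge\beta)$ is the transversal intersection of the varieties $V(H,j,\ge\beta_j)$; (c) the variety $V(H,j,\ge\beta_j)$, when nonempty, is irreducible, and it coincides with the closure of $V(H,j,\beta_j)$ provided $V(H,j,\beta_j)$ is not empty.
   Context: $R=K[x,y]$, $S=K[x,y,z]$. An ideal $J\subset S$ defining a zero-dimensional subscheme of $\mathbb{P}^2$ means a homogeneous ideal such that $S/J$ is Cohen–Macaulay of Krull dimension $1$. For such $J$ the Hilbert series of $S/J$ has the form $h(s)/(1-s)$, where $h(s)=\sum_jh_js^j$ is the Hilbert series of $S/(J+(\ell))$ for a linear nonzerodivisor $\ell$ on $S/J$. $\mathrm{Lex}(h)$ is the lex-segment ideal of $R$ (with $x>y$) such that $R/\mathrm{Lex}(h)$ has Hilbert series $h(s)$. Initial ideals $\operatorname{in}(\cdot)$ are with respect to the degree reverse lexicographic order induced by $x>y>z$. Put $$\mathbb{G}^*_{\mathrm{Lex}}(H)=\{J\subset S: J\text{ defines a zero-dimensional subscheme of }\mathbb{P}^2,\ H_{S/J}=H,\ z\text{ is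 a nonzerodivisor on }S/J,\ \operatorname{in}(J)=\mathrm{Lex}(h)S\}.$$ $\beta_{0,j}(J)$ is the number of minimal generators of $J$ of degree $j$. For integers $j,u$ put $$V(H,j,u)=\{J\in\mathbb{G}^*_{\mathrm{Lex}}(H):\beta_{0,j}(J)=u\},\quad V(H,j,\ge u)=\{J\in\mathbb{G}^*_{\mathrm{Lex}}(H):\beta_{0,j}(J)\ge u\},$$ and $V(H,\beta)=\bigcap_jV(H,j,\beta_j)$, $V(H,\ge\beta)=\bigcap_jV(H,j,\ge\beta_j)$. Closures are taken in $\mathbb{G}^*_{\mathrm{Lex}}(H)$. Affine structure on $\mathbb{G}^*_{\mathrm{Lex}}(H)$. Let $I_0=\mathrm{Lex}(h)$, $t=\min\{j:x^j\in I_0\}$, $m_0=0$, $m_i=\min\{j:x^{t-i}y^j\in I_0\}$ for $1\le i\le t$, $d_i=m_i-m_{i-1}$, $u_{i,j}=i-j+m_j-m_{i-1}$ ($1\le i\le t+1$, $1\le j\le t$). Let $X$ be the $(t+1)\times t$ matrix with $X_{i,i}=y^{d_i}$, $X_{i+1,i}=-x$, other entries $0$. Let $\mathscr{A}_{I_0}$ be the set of $(t+1)\times t$ matrices $A=(a_{i,j})$ over $K[y]$ with $\deg a_{i,j}\le\min\{u_{i,j}-1,d_i-1\}$ if $i\le j$ and $\deg a_{i,j}\le\min\{u_{i,j},d_j-1\}$ if $i>j$ ($a_{i,j}=0$ if the bound is negative); it is an affine space $\mathbb{A}^N$ with coordinates the coefficients of the entries. Let $A^{\underline{hom}}$ have entries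 $z^{u_{i,j}-\deg a_{i,j}}a_{i,j}^{hom}$, where $a^{hom}$ is the usual homogenization with respect to $z$ (and $0$ if $a_{i,j}=0$). The set $\mathbb{G}^*_{\mathrm{Lex}}(H)$ is identified with $\mathscr{A}_{I_0}=\mathbb{A}^N$ through the bijection $A\mapsto I_t(X+A^{\underline{hom}})$ (ideal of $t\times t$ minors). For an integer $j$, let $M_j$ be the submatrix of $M=X+A^{\underline{hom}}$ with rows those $i\in\{1,\ldots,t+1\}$ such that $t+1-i+m_{i-1}=j$ and columns those $i\in\{1,\ldots,t\}$ such that $t+1-i+m_i=j$; its entries have degree $0$, i.e. are elements of $K$ given by coordinates of $\mathbb{A}^N$. "Determinantal variety" means a locus in $\mathbb{A}^N$ defined by a condition $\operatorname{rank}(M_j)\le r$ on such a matrix of coordinates (here with $r=\beta_{0,j}(\mathrm{Lex}(h))-\beta_j$); "transversal intersection" refers to the fact that the varieties being intersected are defined by equations in pairwise disjoint sets of coordinates of $\mathbb{A}^N$. *)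

theory Defs
  imports
    "HOL-Library.Poly_Mapping"
    "HOL-Library.Numeral_Type"
    "HOL-Library.Extended_Real"
    "HOL-Library.Disjoint_Sets"
    "HOL-Computational_Algebra.Polynomial_FPS"
    "HOL-Analysis.Abstract_Topology"
    "Jordan_Normal_Form.DL_Rank"
    "Jordan_Normal_Form.DL_Submatrix"
begin

section \<open>Polynomial rings\<close>

type_synonym ('v, 'a) mpoly = "('v \<Rightarrow>\<^sub>0 nat) \<Rightarrow>\<^sub>0 'a"

text \<open>\<open>R = K[x,y]\<close> and \<open>S = K[x,y,z]\<close>: the variables are the elements of the numeral types
  \<open>2\<close> and \<open>3\<close>, with \<open>x = 0\<close>, \<open>y = 1\<close>, \<open>z = 2\<close>.\<close>

type_synonym 'a ring_R = "(2, 'a) mpoly"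
type_synonym 'a ring_S = "(3, 'a) mpoly"

definition Const :: "'a::zero \<Rightarrow> ('v, 'a) mpoly" where
  "Const c = Poly_Mapping.single 0 c"

definition monomial :: "('v \<Rightarrow>\<^sub>0 nat) \<Rightarrow> ('v, 'a::zero_neq_one) mpoly" where
  "monomial m = Poly_Mapping.single m 1"

definition Var :: "'v \<Rightarrow> ('v, 'a::zero_neq_one) mpoly" where
  "Var v = monomial (Poly_Mapping.single v 1)"

abbreviation xR :: "'a::zero_neq_one ring_R" where "xR \<equiv> Var 0"
abbreviation yR :: "'a::zero_neq_one ring_R" where "yR \<equiv> Var 1"
abbreviation xS :: "'a::zero_neq_one ring_S" where "xS \<equiv> Var 0"
abbreviation yS :: "'a::zero_neq_one ring_S" where "yS \<equiv> Var 1"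
abbreviation zS :: "'a::zero_neq_one ring_S" where "zS \<equiv> Var 2"

definition vars :: "('v, 'a::zero) mpoly \<Rightarrow> 'v set" where
  "vars f = (\<Union>m\<in>Poly_Mapping.keys f. Poly_Mapping.keys m)"

text \<open>The value of \<open>f\<close> under \<open>c\<close> on coefficients and \<open>\<phi>\<close> on variables.\<close>

definition insertion :: "('a::zero \<Rightarrow> 'b::comm_ring_1) \<Rightarrow> ('v \<Rightarrow> 'b) \<Rightarrow> ('v, 'a) mpoly \<Rightarrow> 'b" where
  "insertion c \<phi> f =
     (\<Sum>m\<in>Poly_Mapping.keys f.
        c (Poly_Mapping.lookup f m) * (\<Prod>v\<in>Poly_Mapping.keys m. \<phi> v ^ Poly_Mapping.lookup m v))"

definition mdeg :: "('v \<Rightarrow>\<^sub>0 nat) \<Rightarrow> nat" where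
  "mdeg m = (\<Sum>v\<in>Poly_Mapping.keys m. Poly_Mapping.lookup m v)"

definition forms :: "nat \<Rightarrow> ('v, 'a::zero) mpoly set" where
  "forms n = {f. \<forall>m\<in>Poly_Mapping.keys f. mdeg m = n}"

definition scale :: "'a::comm_ring_1 \<Rightarrow> ('v, 'a) mpoly \<Rightarrow> ('v, 'a) mpoly" where
  "scale c f = Const c * f"

global_interpretation mpoly_vs: vector_space "scale :: 'a::field \<Rightarrow> ('v, 'a) mpoly \<Rightarrow> _"
proof
  fix a b :: 'a and f g :: "('v, 'a) mpoly"
  show "scale a (f + g) = scale a f + scale a g"
    by (simp add: scale_def distrib_left)
  show "scale (a + b) f = scale a f + scale b f"
    by (simp add: scale_def Const_def single_add distrib_right)
  show "scale a (scale b f) = scale (a * b) f"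
    by (simp add: scale_def Const_def mult_single mult.assoc[symmetric])
  show "scale 1 f = f"
    by (simp add: scale_def Const_def)
qed

section \<open>Ideals\<close>

text \<open>Ideals of a commutative ring are its submodules, and the ideal generated by a set is
  its span.\<close>

global_interpretation ring_module: Modules.module "(*) :: 'r::comm_ring_1 \<Rightarrow> 'r \<Rightarrow> 'r"
  by standard (simp_all add: algebra_simps)

abbreviation is_ideal :: "'r::comm_ring_1 set \<Rightarrow> bool" where
  "is_ideal \<equiv> ring_module.subspace"

abbreviation ideal_gen :: "'r::comm_ring_1 set \<Rightarrow> 'r set" where
  "ideal_gen \<equiv> ring_module.span"

definition prime_ideal :: "'r::comm_ring_1 set \<Rightarrow> bool" where
  "prime_ideal P \<longleftrightarrow> is_ideal P \<and> P \<noteq> UNIV \<and> (\<forall>a b. a * b \<in> P \<longrightarrow> a \<in> P \<or> b \<in> P)"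

definition homogeneous_ideal :: "('v, 'a::comm_ring_1) mpoly set \<Rightarrow> bool" where
  "homogeneous_ideal J \<longleftrightarrow> (\<exists>G \<subseteq> (\<Union>n. forms n). J = ideal_gen G)"

text \<open>\<open>f\<close> is a nonzerodivisor on the quotient by \<open>J\<close>.\<close>

definition nonzerodivisor_on_quotient :: "'r::comm_ring_1 \<Rightarrow> 'r set \<Rightarrow> bool" where
  "nonzerodivisor_on_quotient f J \<longleftrightarrow> (\<forall>g. f * g \<in> J \<longrightarrow> g \<in> J)"

text \<open>Krull dimension of the quotient by \<open>J\<close>, by chains of primes containing \<open>J\<close>;
  it is \<open>-\<infinity>\<close> for the zero ring.\<close>

definition quotient_krull_dim :: "'r::comm_ring_1 set \<Rightarrow> ereal" where
  "quotient_krull_dim J = (SUP n \<in> {n. \<exists>P :: nat \<Rightarrow> 'r set.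
      (\<forall>i\<le>n. prime_ideal (P i) \<and> J \<subseteq> P i) \<and> (\<forall>i<n. P i \<subset> P (Suc i))}. ereal (real n))"

text \<open>Regular sequences on the quotient by \<open>J\<close>.\<close>

definition regular_sequence :: "'r::comm_ring_1 set \<Rightarrow> 'r list \<Rightarrow> bool" where
  "regular_sequence J fs \<longleftrightarrow>
     (\<forall>i<length fs. nonzerodivisor_on_quotient (fs ! i) (ideal_gen (J \<union> set (take i fs)))) \<and>
     ideal_gen (J \<union> set fs) \<noteq> UNIV"

definition irrelevant_ideal :: "('v, 'a::comm_ring_1) mpoly set" where
  "irrelevant_ideal = ideal_gen (range Var)"

definition quotient_depth :: "('v, 'a::comm_ring_1) mpoly set \<Rightarrow> ereal" where
  "quotient_depth J =
     (SUP fs \<in> {fs. set fs \<subseteq> irrelevant_ideal \<and> regular_sequence J fs}. ereal (real (length fs)))"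

text \<open>The Cohen--Macaulay property of a standard graded algebra over a field: depth with respect
  to the irrelevant maximal ideal equals Krull dimension.\<close>

definition cohen_macaulay_quotient :: "('v, 'a::field) mpoly set \<Rightarrow> bool" where
  "cohen_macaulay_quotient J \<longleftrightarrow> quotient_depth J = quotient_krull_dim J"

definition zero_dim_subscheme_ideal :: "'a::field ring_S set \<Rightarrow> bool" where
  "zero_dim_subscheme_ideal J \<longleftrightarrow>
     homogeneous_ideal J \<and> cohen_macaulay_quotient J \<and> quotient_krull_dim J = 1"

section \<open>Hilbert series and minimal generators\<close>

definition hilbert_function :: "('v::finite, 'a::field) mpoly set \<Rightarrow> nat \<Rightarrow> nat" where
  "hilbert_function J n =
     mpoly_vs.dim (forms n :: ('v, 'a) mpoly set) - mpoly_vs.dim (J \<inter> forms n)"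

definition hilbert_series :: "('v::finite, 'a::field) mpoly set \<Rightarrow> int fps" where
  "hilbert_series J = Abs_fps (\<lambda>n. int (hilbert_function J n))"

definition minimal_homogeneous_generators ::
    "('v, 'a::comm_ring_1) mpoly set \<Rightarrow> ('v, 'a) mpoly set \<Rightarrow> bool" where
  "minimal_homogeneous_generators G J \<longleftrightarrow>
     G \<subseteq> (\<Union>n. forms n) \<and> ideal_gen G = J \<and> (\<forall>G'. G' \<subset> G \<longrightarrow> ideal_gen G' \<noteq> J)"

text \<open>The number of minimal generators of degree \<open>j\<close> of a homogeneous ideal; it does not depend
  on the minimal system of homogeneous generators.\<close>

definition beta0 :: "('v, 'a::field) mpoly set \<Rightarrow> nat \<Rightarrow> nat" where
  "beta0 J j = (THE n. \<exists>G. minimal_homogeneous_generators G J \<and> n = card (G \<inter> forms j))"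

section \<open>Lex-segment ideals and initial ideals\<close>

text \<open>The library order on \<^typ>\<open>2 \<Rightarrow>\<^sub>0 nat\<close> compares exponents at the first variable where they
  differ, so it is the lexicographic order with \<open>x > y\<close>.\<close>

definition lex_segment_ideal :: "'a::comm_ring_1 ring_R set \<Rightarrow> bool" where
  "lex_segment_ideal L \<longleftrightarrow> (\<exists>B. L = ideal_gen (monomial ` B)) \<and>
     (\<forall>m m'. mdeg m = mdeg m' \<and> m < m' \<and> monomial m \<in> L \<longrightarrow> monomial m' \<in> L)"

definition Lex :: "int fps \<Rightarrow> 'a::field ring_R set" where
  "Lex h = (THE L. lex_segment_ideal L \<and> hilbert_series L = h)"

definition R_to_S :: "'a::comm_ring_1 ring_R \<Rightarrow> 'a ring_S" where
  "R_to_S = insertion Const (\<lambda>v. if v = 0 then xS else yS)"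

definition extend_to_S :: "'a::comm_ring_1 ring_R set \<Rightarrow> 'a ring_S set" where
  "extend_to_S I = ideal_gen (R_to_S ` I)"

text \<open>The degree reverse lexicographic order with \<open>x > y > z\<close>: in equal degree, the larger
  monomial has the smaller exponent at the last variable where the exponents differ.\<close>

definition drl_less :: "(3 \<Rightarrow>\<^sub>0 nat) \<Rightarrow> (3 \<Rightarrow>\<^sub>0 nat) \<Rightarrow> bool" where
  "drl_less m m' \<longleftrightarrow> mdeg m < mdeg m' \<or> mdeg m = mdeg m' \<and>
     (\<exists>v. Poly_Mapping.lookup m' v < Poly_Mapping.lookup m v \<and>
          (\<forall>w>v. Poly_Mapping.lookup m w = Poly_Mapping.lookup m' w))"

definition is_leading_monomial :: "(3 \<Rightarrow>\<^sub>0 nat) \<Rightarrow> 'a::zero ring_S \<Rightarrow> bool" where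
  "is_leading_monomial m f \<longleftrightarrow> m \<in> Poly_Mapping.keys f \<and>
     (\<forall>m'\<in>Poly_Mapping.keys f. m' \<noteq> m \<longrightarrow> drl_less m' m)"

definition initial_ideal :: "'a::comm_ring_1 ring_S set \<Rightarrow> 'a ring_S set" where
  "initial_ideal J = ideal_gen {monomial m | m. \<exists>f\<in>J. is_leading_monomial m f}"

section \<open>The stratum and its Betti loci\<close>

text \<open>In terms of the Hilbert series \<open>H\<close>, the \<open>h\<close>-polynomial is \<open>H (1 - s)\<close>.\<close>

definition G_Lex :: "int fps \<Rightarrow> 'a::field ring_S set set" where
  "G_Lex H = {J. zero_dim_subscheme_ideal J \<and> hilbert_series J = H \<and>
                 nonzerodivisor_on_quotient zS J \<and>
                 initial_ideal J = extend_to_S (Lex (H * (1 - fps_X)))}"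

definition V_eq :: "int fps \<Rightarrow> nat \<Rightarrow> int \<Rightarrow> 'a::field ring_S set set" where
  "V_eq H j u = {J \<in> G_Lex H. int (beta0 J j) = u}"

definition V_ge :: "int fps \<Rightarrow> nat \<Rightarrow> int \<Rightarrow> 'a::field ring_S set set" where
  "V_ge H j u = {J \<in> G_Lex H. int (beta0 J j) \<ge> u}"

definition V_ge_all :: "int fps \<Rightarrow> (nat \<Rightarrow> int) \<Rightarrow> 'a::field ring_S set set" where
  "V_ge_all H \<beta> = (\<Inter>j\<in>{1..}. V_ge H j (\<beta> j))"

section \<open>The affine structure\<close>

text \<open>Row and column indices \<open>i\<close>, \<open>j\<close> below start from \<open>1\<close>, whereas the entries of a library
  matrix are indexed from \<open>0\<close>. The monomial ideal \<open>I\<close> plays the role of \<open>I\<^sub>0\<close>.\<close>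

definition t_of :: "'a::comm_ring_1 ring_R set \<Rightarrow> nat" where
  "t_of I = (LEAST j. xR ^ j \<in> I)"

definition m_of :: "'a::comm_ring_1 ring_R set \<Rightarrow> nat \<Rightarrow> nat" where
  "m_of I i = (if i = 0 then 0 else LEAST j. xR ^ (t_of I - i) * yR ^ j \<in> I)"

definition d_of :: "'a::comm_ring_1 ring_R set \<Rightarrow> nat \<Rightarrow> int" where
  "d_of I i = int (m_of I i) - int (m_of I (i - 1))"

definition u_of :: "'a::comm_ring_1 ring_R set \<Rightarrow> nat \<Rightarrow> nat \<Rightarrow> int" where
  "u_of I i j = int i - int j + int (m_of I j) - int (m_of I (i - 1))"

definition X_mat :: "'a::comm_ring_1 ring_R set \<Rightarrow> 'a ring_S mat" where
  "X_mat I = mat (t_of I + 1) (t_of I) (\<lambda>(r, c).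
     if r = c then yS ^ nat (d_of I (c + 1)) else if r = c + 1 then - xS else 0)"

definition deg_bound :: "'a::comm_ring_1 ring_R set \<Rightarrow> nat \<Rightarrow> nat \<Rightarrow> int" where
  "deg_bound I i j =
     (if i \<le> j then min (u_of I i j - 1) (d_of I i - 1) else min (u_of I i j) (d_of I j - 1))"

text \<open>The points of \<open>\<bbbA>\<^sup>N\<close>; a negative degree bound forces the entry to vanish.\<close>

definition A_space :: "'a::comm_ring_1 ring_R set \<Rightarrow> 'a poly mat set" where
  "A_space I = {A \<in> carrier_mat (t_of I + 1) (t_of I).
     \<forall>i\<in>{1..t_of I + 1}. \<forall>j\<in>{1..t_of I}.
       A $$ (i - 1, j - 1) = 0 \<or> int (Polynomial.degree (A $$ (i - 1, j - 1))) \<le> deg_bound I i j}"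

definition hom_yz :: "'a::comm_ring_1 poly \<Rightarrow> 'a ring_S" where
  "hom_yz p = (\<Sum>k\<le>Polynomial.degree p.
     Const (Polynomial.coeff p k) * yS ^ k * zS ^ (Polynomial.degree p - k))"

definition A_hom :: "'a::comm_ring_1 ring_R set \<Rightarrow> 'a poly mat \<Rightarrow> 'a ring_S mat" where
  "A_hom I A = mat (t_of I + 1) (t_of I) (\<lambda>(r, c).
     let a = A $$ (r, c) in
     if a = 0 then 0
     else zS ^ nat (u_of I (r + 1) (c + 1) - int (Polynomial.degree a)) * hom_yz a)"

definition M_mat :: "'a::comm_ring_1 ring_R set \<Rightarrow> 'a poly mat \<Rightarrow> 'a ring_S mat" where
  "M_mat I A = X_mat I + A_hom I A"

definition maximal_minors_ideal :: "'r::comm_ring_1 mat \<Rightarrow> 'r set" where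
  "maximal_minors_ideal M =
     ideal_gen {det (submatrix M B UNIV) | B. B \<subseteq> {..<dim_row M} \<and> card B = dim_col M}"

text \<open>The map identifying \<open>\<bbbA>\<^sup>N\<close> with the stratum, and the subset of \<open>\<bbbA>\<^sup>N\<close> that
  corresponds to a subset of the stratum.\<close>

definition param :: "'a::comm_ring_1 ring_R set \<Rightarrow> 'a poly mat \<Rightarrow> 'a ring_S set" where
  "param I A = maximal_minors_ideal (M_mat I A)"

definition in_chart :: "'a::comm_ring_1 ring_R set \<Rightarrow> 'a ring_S set set \<Rightarrow> 'a poly mat set" where
  "in_chart I V = {A \<in> A_space I. param I A \<in> V}"

text \<open>Coordinates of \<open>\<bbbA>\<^sup>N\<close>: \<open>(i, j, e)\<close> stands for the coefficient of \<open>y\<^sup>e\<close> in the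
  entry \<open>a\<^sub>i\<^sub>j\<close>.\<close>

type_synonym coordinate = "nat \<times> nat \<times> nat"

definition coordinates :: "'a::comm_ring_1 ring_R set \<Rightarrow> coordinate set" where
  "coordinates I =
     {(i, j, e). i \<in> {1..t_of I + 1} \<and> j \<in> {1..t_of I} \<and> int e \<le> deg_bound I i j}"

definition coord :: "'a::zero poly mat \<Rightarrow> coordinate \<Rightarrow> 'a" where
  "coord A = (\<lambda>(i, j, e). Polynomial.coeff (A $$ (i - 1, j - 1)) e)"

definition zero_locus ::
    "'a::comm_ring_1 ring_R set \<Rightarrow> (coordinate, 'a) mpoly set \<Rightarrow> 'a poly mat set" where
  "zero_locus I E = {A \<in> A_space I. \<forall>f\<in>E. insertion (\<lambda>a. a) (coord A) f = 0}"

definition zariski_open :: "'a::comm_ring_1 ring_R set \<Rightarrow> 'a poly mat set \<Rightarrow> bool" where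
  "zariski_open I U \<longleftrightarrow>
     (\<exists>E. (\<forall>f\<in>E. vars f \<subseteq> coordinates I) \<and> U = A_space I - zero_locus I E)"

definition zariski :: "'a::comm_ring_1 ring_R set \<Rightarrow> 'a poly mat topology" where
  "zariski I = topology (zariski_open I)"

text \<open>The Zariski topology of the stratum, transported from \<open>\<bbbA>\<^sup>N\<close> along \<open>param\<close>: a set is
  open if its preimage is. As \<open>param\<close> is a bijection onto the stratum, this makes it a
  homeomorphism.\<close>

definition stratum_open :: "int fps \<Rightarrow> 'a::field ring_S set set \<Rightarrow> bool" where
  "stratum_open H U \<longleftrightarrow>
     U \<subseteq> G_Lex H \<and> openin (zariski (Lex (H * (1 - fps_X)))) (in_chart (Lex (H * (1 - fps_X))) U)"

definition stratum_topology :: "int fps \<Rightarrow> 'a::field ring_S set topology" where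
  "stratum_topology H = topology (stratum_open H)"

definition irreducible_in :: "'b topology \<Rightarrow> 'b set \<Rightarrow> bool" where
  "irreducible_in T V \<longleftrightarrow> V \<subseteq> topspace T \<and> V \<noteq> {} \<and>
     (\<forall>C D. closedin T C \<and> closedin T D \<and> V \<subseteq> C \<union> D \<longrightarrow> V \<subseteq> C \<or> V \<subseteq> D)"

subsection \<open>The degree-zero blocks\<close>

definition deg_rows :: "'a::comm_ring_1 ring_R set \<Rightarrow> nat \<Rightarrow> nat set" where
  "deg_rows I j = {i \<in> {1..t_of I + 1}. t_of I + 1 - i + m_of I (i - 1) = j}"

definition deg_cols :: "'a::comm_ring_1 ring_R set \<Rightarrow> nat \<Rightarrow> nat set" where
  "deg_cols I j = {i \<in> {1..t_of I}. t_of I + 1 - i + m_of I i = j}"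

text \<open>The submatrix \<open>M\<^sub>j\<close>, whose entries are constant polynomials, read as a matrix over \<open>K\<close>.\<close>

definition M_block :: "'a::comm_ring_1 ring_R set \<Rightarrow> nat \<Rightarrow> 'a poly mat \<Rightarrow> 'a mat" where
  "M_block I j A = map_mat (\<lambda>p. Poly_Mapping.lookup p 0)
     (submatrix (M_mat I A) ((\<lambda>i. i - 1) ` deg_rows I j) ((\<lambda>i. i - 1) ` deg_cols I j))"

definition M_block_coordinates :: "'a::comm_ring_1 ring_R set \<Rightarrow> nat \<Rightarrow> coordinate set" where
  "M_block_coordinates I j = {(i, k, 0) | i k. i \<in> deg_rows I j \<and> k \<in> deg_cols I j}"

definition matrix_rank :: "'a::field mat \<Rightarrow> nat" where
  "matrix_rank A = vec_space.rank (dim_row A) A"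

subsection \<open>The topologies are well defined\<close>

lemma insertion_superset:
  assumes "finite B" "Poly_Mapping.keys f \<subseteq> B" "c 0 = 0"
  shows "insertion c \<phi> f =
    (\<Sum>m\<in>B. c (Poly_Mapping.lookup f m) * (\<Prod>v\<in>Poly_Mapping.keys m. \<phi> v ^ Poly_Mapping.lookup m v))"
  unfolding insertion_def
  by (rule sum.mono_neutral_left) (use assms in \<open>auto simp: in_keys_iff\<close>)

lemma monomial_value_add:
  "(\<Prod>v\<in>Poly_Mapping.keys (m + n). \<phi> v ^ Poly_Mapping.lookup (m + n) v) =
   (\<Prod>v\<in>Poly_Mapping.keys m. \<phi> v ^ Poly_Mapping.lookup m v) *
   (\<Prod>v\<in>Poly_Mapping.keys n. (\<phi> v :: 'b::comm_ring_1) ^ Poly_Mapping.lookup n v)"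
proof -
  have *: "(\<Prod>v\<in>Poly_Mapping.keys q. \<phi> v ^ Poly_Mapping.lookup q v) =
      (\<Prod>v\<in>Poly_Mapping.keys m \<union> Poly_Mapping.keys n. \<phi> v ^ Poly_Mapping.lookup q v)"
    if "Poly_Mapping.keys q \<subseteq> Poly_Mapping.keys m \<union> Poly_Mapping.keys n" for q
    by (rule prod.mono_neutral_left) (use that in \<open>auto simp: in_keys_iff\<close>)
  show ?thesis
    unfolding *[OF keys_add[of m n]] *[OF Un_upper1] *[OF Un_upper2]
    by (simp add: lookup_add power_add prod.distrib)
qed

lemma insertion_zero: "insertion (\<lambda>a. a) \<phi> 0 = 0"
  by (simp add: insertion_def)

lemma insertion_add:
  "insertion (\<lambda>a. a) \<phi> (f + g) = insertion (\<lambda>a. a) \<phi> f + insertion (\<lambda>a. a) \<phi> g"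
proof -
  let ?B = "Poly_Mapping.keys f \<union> Poly_Mapping.keys g"
  have "Poly_Mapping.keys (f + g) \<subseteq> ?B"
    by (rule keys_add)
  then show ?thesis
    by (simp add: insertion_superset[of ?B] lookup_add distrib_right sum.distrib)
qed

lemma insertion_sum:
  "insertion (\<lambda>a. a) \<phi> (sum F B) = (\<Sum>i\<in>B. insertion (\<lambda>a. a) \<phi> (F i))"
  by (induction B rule: infinite_finite_induct) (simp_all add: insertion_add insertion_zero)

lemma insertion_single:
  "insertion (\<lambda>a. a) \<phi> (Poly_Mapping.single m a) =
   a * (\<Prod>v\<in>Poly_Mapping.keys m. (\<phi> v :: 'a::comm_ring_1) ^ Poly_Mapping.lookup m v)"
  by (cases "a = 0") (simp_all add: insertion_def)

lemma mpoly_as_sum: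
  "f = (\<Sum>m\<in>Poly_Mapping.keys f. Poly_Mapping.single m (Poly_Mapping.lookup f m))"
proof (rule poly_mapping_eqI)
  fix k
  have "(\<Sum>m\<in>Poly_Mapping.keys f. Poly_Mapping.lookup (Poly_Mapping.single m (Poly_Mapping.lookup f m)) k) =
      (\<Sum>m\<in>Poly_Mapping.keys f. if m = k then Poly_Mapping.lookup f k else 0)"
    by (intro sum.cong) (auto simp: lookup_single when_def)
  then show "Poly_Mapping.lookup f k = Poly_Mapping.lookup
      (\<Sum>m\<in>Poly_Mapping.keys f. Poly_Mapping.single m (Poly_Mapping.lookup f m)) k"
    by (simp add: lookup_sum in_keys_iff)
qed

lemma insertion_mult:
  fixes f g :: "('v, 'a::comm_ring_1) mpoly"
  shows "insertion (\<lambda>a. a) \<phi> (f * g) = insertion (\<lambda>a. a) \<phi> f * insertion (\<lambda>a. a) \<phi> g"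
proof -
  let ?s = "\<lambda>f m. Poly_Mapping.single m (Poly_Mapping.lookup f m)"
  let ?i = "insertion (\<lambda>a. a) \<phi>"
  have single: "?i (?s f m * ?s g n) = ?i (?s f m) * ?i (?s g n)" for m n
    unfolding mult_single insertion_single monomial_value_add by (simp only: mult_ac)
  have "f * g = (\<Sum>m\<in>Poly_Mapping.keys f. ?s f m) * (\<Sum>n\<in>Poly_Mapping.keys g. ?s g n)"
    by (rule arg_cong2[of _ _ _ _ "(*)", OF mpoly_as_sum mpoly_as_sum])
  then have "f * g = (\<Sum>m\<in>Poly_Mapping.keys f. \<Sum>n\<in>Poly_Mapping.keys g. ?s f m * ?s g n)"
    unfolding sum_product .
  then have "?i (f * g) =
      (\<Sum>m\<in>Poly_Mapping.keys f. \<Sum>n\<in>Poly_Mapping.keys g. ?i (?s f m) * ?i (?s g n))"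
    by (simp only: insertion_sum single)
  also have "\<dots> = ?i (\<Sum>m\<in>Poly_Mapping.keys f. ?s f m) * ?i (\<Sum>n\<in>Poly_Mapping.keys g. ?s g n)"
    unfolding insertion_sum sum_product ..
  finally show ?thesis
    unfolding mpoly_as_sum[symmetric] .
qed

lemma vars_mult: "vars (f * g) \<subseteq> vars f \<union> vars (g :: ('v, 'a::comm_ring_1) mpoly)"
proof
  fix v assume "v \<in> vars (f * g)"
  then obtain m where m: "m \<in> Poly_Mapping.keys (f * g)" "v \<in> Poly_Mapping.keys m"
    by (auto simp: vars_def)
  then obtain a b where "a \<in> Poly_Mapping.keys f" "b \<in> Poly_Mapping.keys g" "m = a + b"
    using keys_mult[of f g] by blast
  with m show "v \<in> vars f \<union> vars g"
    using keys_add[of a b] by (auto simp: vars_def)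
qed

lemma istopology_zariski:
  "istopology (zariski_open (I :: 'a::idom ring_R set))"
  unfolding istopology_def
proof (intro conjI allI impI)
  fix U V assume UV: "zariski_open I U" "zariski_open I V"
  from UV(1)[unfolded zariski_open_def] obtain E where
    E: "\<forall>f\<in>E. vars f \<subseteq> coordinates I" and U: "U = A_space I - zero_locus I E"
    by (elim exE conjE) (rule that)
  from UV(2)[unfolded zariski_open_def] obtain F where
    F: "\<forall>f\<in>F. vars f \<subseteq> coordinates I" and V: "V = A_space I - zero_locus I F"
    by (elim exE conjE) (rule that)
  define EF where "EF = (\<lambda>(f, g). f * g) ` (E \<times> F)"
  have "vars (f * g) \<subseteq> coordinates I" if "f \<in> E" "g \<in> F" for f g
    using vars_mult[of f g] E F that by blast
  then have "\<forall>f\<in>EF. vars f \<subseteq> coordinates I"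
    unfolding EF_def by auto
  moreover have "U \<inter> V = A_space I - zero_locus I EF"
    unfolding U V zero_locus_def EF_def by (force simp: insertion_mult)
  ultimately show "zariski_open I (U \<inter> V)"
    unfolding zariski_open_def by (intro exI[of _ EF] conjI)
next
  fix \<K> assume K: "\<forall>U\<in>\<K>. zariski_open I U"
  from bchoice[OF K[unfolded zariski_open_def]] obtain E where
    E: "\<forall>U\<in>\<K>. (\<forall>f\<in>E U. vars f \<subseteq> coordinates I) \<and> U = A_space I - zero_locus I (E U)"
    by (elim exE) (rule that)
  let ?F = "\<Union>U\<in>\<K>. E U"
  have "\<forall>f\<in>?F. vars f \<subseteq> coordinates I"
    using E by blast
  moreover have "\<Union>\<K> = (\<Union>U\<in>\<K>. A_space I - zero_locus I (E U))"
  proof -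
    have "id ` \<K> = (\<lambda>U. A_space I - zero_locus I (E U)) ` \<K>"
      by (rule image_cong) (use E in simp_all)
    then show ?thesis by simp
  qed
  moreover have "(\<Union>U\<in>\<K>. A_space I - zero_locus I (E U)) = A_space I - zero_locus I ?F"
    unfolding zero_locus_def by blast
  ultimately show "zariski_open I (\<Union>\<K>)"
    unfolding zariski_open_def by (intro exI[of _ ?F] conjI) simp_all
qed

lemma openin_zariski: "openin (zariski (I :: 'a::idom ring_R set)) = zariski_open I"
  unfolding zariski_def by (rule topology_inverse'[OF istopology_zariski])

lemma istopology_stratum: "istopology (stratum_open H :: 'a::field ring_S set set \<Rightarrow> bool)"
  unfolding istopology_def
proof (intro conjI allI impI)
  let ?I = "Lex (H * (1 - fps_X))"
  fix U V :: "'a ring_S set set"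
  assume UV: "stratum_open H U" "stratum_open H V"
  have "in_chart ?I (U \<inter> V) = in_chart ?I U \<inter> in_chart ?I V"
    by (auto simp: in_chart_def)
  with UV show "stratum_open H (U \<inter> V)"
    by (auto simp: stratum_open_def)
next
  let ?I = "Lex (H * (1 - fps_X))"
  fix \<K> :: "'a ring_S set set set"
  assume K: "\<forall>U\<in>\<K>. stratum_open H U"
  have "in_chart ?I (\<Union>\<K>) = (\<Union>U\<in>\<K>. in_chart ?I U)"
    by (auto simp: in_chart_def)
  with K show "stratum_open H (\<Union>\<K>)"
    by (auto simp: stratum_open_def)
qed

lemma openin_stratum_topology: "openin (stratum_topology H) = stratum_open H"
  unfolding stratum_topology_def by (rule topology_inverse'[OF istopology_stratum])

end

theory Submission
 imports Defs "Jordan_Normal_Form.Char_Poly"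
begin

text \<open>
The proof turns everything into statements about relation matrices. Write \<open>I\<^sub>0\<close> for the lex-segment
ideal, with corners \<open>x^(t - k) y^(m k)\<close>, \<open>k = 0, \<dots>, t\<close>. Its exponents are \<open>(a, b)\<close> with
\<open>h (a + b) \<le> a\<close>, and the bound \<open>h (n + 1) \<le> h n\<close> once \<open>h n \<le> n\<close> makes \<open>m\<close> strictly increasing.
That \<open>h\<close> has these properties for every zero-dimensional subscheme needs a linear nonzerodivisor
that can be moved to \<open>z\<close>; it is found on the curve of forms \<open>z + s x + s\<^sup>2 y\<close>, because a zero divisor
vanishes at one of finitely many points (\<open>linear_nonzerodivisor_exists\<close>, \<open>h_vector_std_count\<close>).

An ideal of the stratum has a basis \<open>f 0, \<dots>, f t\<close> with the corners as leading monomials, and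
multiplication by \<open>x\<close> gives relations \<open>x f j = \<Sum>k C k j f k\<close> with homogeneous coefficients in
\<open>K[y,z]\<close>. Modulo \<open>z\<close> the coefficients above the diagonal are just the powers of \<open>y\<close> next to it. Two
facts make such relations work well. Read at the lowest power of \<open>z\<close>, they determine the whole basis
up to a scalar (\<open>relation_unique\<close>), so \<open>f\<close> consists of the signed maximal minors of the relation matrix,
which satisfy the same relations by Cramer's rule. Conversely, for any matrix of this shape the
elements \<open>x^i y^j z^l f k\<close>, with \<open>i > 0\<close> only for \<open>k = 0\<close>, span the ideal of minors, hence the
leading monomials are those of \<open>I\<^sub>0 S\<close> (\<open>lead_mons_stair_ideal\<close>) and the minors define a point of the
stratum (\<open>one_dimensional_zero_dim_subscheme\<close>, \<open>param_in_G_Lex\<close>). A change of basis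
\<open>f b \<mapsto> f b - q f a\<close> is a column operation followed by a row operation; in a suitable order these
operations bring the matrix into the form \<open>X + A\<close> with \<open>A\<close> in the affine space
(\<open>canonical_minors_exist\<close>). Thus \<open>param\<close> maps the affine space onto the stratum.

The elements of degree \<open>j\<close> that come from smaller degrees are spanned by multiples of the \<open>f k\<close> of
smaller degree and by the constant parts of the relations of degree \<open>j\<close>. So the number of minimal
generators drops from that of \<open>I\<^sub>0\<close> by the rank of the block of constants
(\<open>beta0_stair_ideal\<close>, \<open>beta0_param\<close>), and this gives (a). A block entry in row \<open>i\<close> belongs to a single
degree, which makes the sets of coordinates in (b) disjoint; minors of the block are the equations.
For (c), two matrices of rank at most \<open>r\<close> are joined by the curve that interpolates their
factorizations through \<open>K^r\<close>. As \<open>K\<close> is infinite, one of two polynomials vanishes on the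
curve if their product does. This yields irreducibility, and, if one of the two is an \<open>r\<close>-minor, density
of the locus of rank exactly \<open>r\<close>.
\<close>

section \<open>Polynomials as functions on monomials\<close>

abbreviation coeff :: "'c::zero poly \<Rightarrow> nat \<Rightarrow> 'c" where "coeff \<equiv> Polynomial.coeff"
abbreviation degree :: "'c::zero poly \<Rightarrow> nat" where "degree \<equiv> Polynomial.degree"
abbreviation monom :: "'c::zero \<Rightarrow> nat \<Rightarrow> 'c poly" where "monom \<equiv> Polynomial.monom"
abbreviation lookup :: "('b \<Rightarrow>\<^sub>0 'c::zero) \<Rightarrow> 'b \<Rightarrow> 'c" where
 "lookup \<equiv> Poly_Mapping.lookup"
abbreviation keys :: "('b \<Rightarrow>\<^sub>0 'c::zero) \<Rightarrow> 'b set" where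
 "keys \<equiv> Poly_Mapping.keys"
abbreviation single :: "'b \<Rightarrow> 'c \<Rightarrow> ('b \<Rightarrow>\<^sub>0 'c::zero)" where
 "single \<equiv> Poly_Mapping.single"

lemma lookup_single_times:
 fixes f :: "'m::cancel_comm_monoid_add \<Rightarrow>\<^sub>0 'a::comm_semiring_1"
 shows "lookup (single m c * f) (m + k) = c * lookup f k"
 by (simp add: lookup_mult lookup_single when_mult)

lemma lookup_single_times_eq_0:
 fixes f :: "'m::comm_monoid_add \<Rightarrow>\<^sub>0 'a::comm_semiring_1"
 assumes "\<And>k. n \<noteq> m + k"
 shows "lookup (single m c * f) n = 0"
 using assms by (simp add: lookup_mult lookup_single when_mult)

lemma lookup_scale [simp]: "lookup (scale a f) m = a * lookup f m"
 using lookup_single_times[of 0 a f m] by (simp add: scale_def Const_def)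

lemma scale_single: "scale a (single m c) = single m (a * c)"
 by (simp add: scale_def Const_def mult_single)

lemma scale_mult_left: "scale a f * g = scale a (f * g)"
 by (simp only: scale_def mult.assoc)

lemma scale_mult_right: "f * scale a g = scale a (f * g)"
 by (simp only: scale_def mult.left_commute)

lemma mpoly_scale_as_sum: "f = (\<Sum>m\<in>keys f. scale (lookup f m) (single m 1))"
 using mpoly_as_sum[of f] by (simp only: scale_single mult_1_right)

lemma keys_scale: "keys (scale a f) \<subseteq> keys f"
 by (auto simp: in_keys_iff)

lemma keys_sum_subset: "keys (sum F A) \<subseteq> (\<Union>i\<in>A. keys (F i))"
proof
 fix m assume "m \<in> keys (sum F A)"
 hence "(\<Sum>i\<in>A. lookup (F i) m) \<noteq> 0"
  by (simp add: in_keys_iff lookup_sum)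
 then obtain i where "i \<in> A" "lookup (F i) m \<noteq> 0"
  by (rule sum.not_neutral_contains_not_neutral)
 thus "m \<in> (\<Union>i\<in>A. keys (F i))"
  by (auto simp: in_keys_iff)
qed

lemma subspace_keys_subset: "mpoly_vs.subspace {f :: ('v, 'a::field) mpoly. keys f \<subseteq> U}"
proof -
 have eq: "{f :: ('v, 'a) mpoly. keys f \<subseteq> U} = {f. \<forall>m. m \<notin> U \<longrightarrow> lookup f m = 0}"
  by (auto simp: in_keys_iff)
 show ?thesis unfolding eq mpoly_vs.subspace_def by (simp add: lookup_add)
qed

lemma is_ideal_imp_subspace:
 "is_ideal (J :: ('v, 'a::field) mpoly set) \<Longrightarrow> mpoly_vs.subspace J"
 unfolding ring_module.subspace_def mpoly_vs.subspace_def scale_def by blast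

subsection \<open>Substitution homomorphisms\<close>

lemma comm_ring_hom_insertion:
 fixes c :: "'a::comm_ring_1 \<Rightarrow> 'b::comm_ring_1"
 assumes c: "comm_ring_hom c"
 shows "comm_ring_hom (insertion c \<phi> :: ('v, 'a) mpoly \<Rightarrow> 'b)"
proof -
 interpret c: comm_ring_hom c by (rule c)
 let ?i = "insertion c \<phi> :: ('v, 'a) mpoly \<Rightarrow> 'b"
 have add: "?i (f + g) = ?i f + ?i g" for f g
 proof -
  let ?B = "keys f \<union> keys g"
  have "keys (f + g) \<subseteq> ?B" by (rule keys_add)
  thus ?thesis
   by (simp add: insertion_superset[of ?B] lookup_add distrib_right sum.distrib c.hom_add)
 qed
 have zero: "?i 0 = 0" by (simp add: insertion_def)
 have sum: "?i (sum F B) = (\<Sum>i\<in>B. ?i (F i))" for F :: "'z \<Rightarrow> _" and B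
  by (induction B rule: infinite_finite_induct) (simp_all add: add zero)
 have single: "?i (Poly_Mapping.single m a) =
   c a * (\<Prod>v\<in>keys m. \<phi> v ^ lookup m v)" for m a
  by (cases "a = 0") (simp_all add: insertion_def)
 let ?s = "\<lambda>f m. Poly_Mapping.single m (lookup f m)"
 have mult: "?i (f * g) = ?i f * ?i g" for f g
 proof -
  have ss: "?i (?s f m * ?s g n) = ?i (?s f m) * ?i (?s g n)" for m n
   unfolding mult_single single monomial_value_add c.hom_mult by (simp only: mult_ac)
  have "f * g = (\<Sum>m\<in>keys f. ?s f m) * (\<Sum>n\<in>keys g. ?s g n)"
   by (rule arg_cong2[of _ _ _ _ "(*)", OF mpoly_as_sum mpoly_as_sum])
  hence "f * g = (\<Sum>m\<in>keys f. \<Sum>n\<in>keys g. ?s f m * ?s g n)"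
   unfolding sum_product .
  hence "?i (f * g) = (\<Sum>m\<in>keys f. \<Sum>n\<in>keys g. ?i (?s f m) * ?i (?s g n))"
   by (simp only: sum ss)
  also have "\<dots> = ?i (\<Sum>m\<in>keys f. ?s f m) * ?i (\<Sum>n\<in>keys g. ?s g n)"
   unfolding sum sum_product ..
  finally show ?thesis unfolding mpoly_as_sum[symmetric] .
 qed
 have one: "?i 1 = 1" by (simp add: insertion_def)
 show ?thesis
  by unfold_locales (simp_all add: add mult one zero)
qed

lemma comm_ring_hom_Const: "comm_ring_hom (Const :: 'a::comm_ring_1 \<Rightarrow> ('v, 'a) mpoly)"
 by unfold_locales (simp_all add: Const_def single_add mult_single)

lemma comm_ring_hom_id: "comm_ring_hom (\<lambda>a::'a::comm_ring_1. a)"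
 by unfold_locales simp_all

lemma insertion_Var:
 fixes c :: "'a::comm_ring_1 \<Rightarrow> 'b::comm_ring_1"
 assumes "comm_ring_hom c"
 shows "insertion c \<phi> (Var v) = \<phi> v"
proof -
 interpret comm_ring_hom c by fact
 show ?thesis by (simp add: insertion_def Var_def monomial_def)
qed

lemma insertion_Const:
 fixes c :: "'a::comm_ring_1 \<Rightarrow> 'b::comm_ring_1"
 assumes "comm_ring_hom c"
 shows "insertion c \<phi> (Const a) = c a"
proof -
 interpret comm_ring_hom c by fact
 show ?thesis by (simp add: insertion_def Const_def)
qed

lemma insertion_single_hom:
 fixes c :: "'a::comm_ring_1 \<Rightarrow> 'b::comm_ring_1"
 assumes "comm_ring_hom c"
 shows "insertion c \<phi> (single m a) = c a * (\<Prod>v\<in>keys m. \<phi> v ^ lookup m v)"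
proof -
 interpret comm_ring_hom c by fact
 show ?thesis by (cases "a = 0") (simp_all add: insertion_def)
qed

section \<open>Leading monomials and dimensions\<close>

definition lead :: "('m \<Rightarrow> nat) \<Rightarrow> 'm \<Rightarrow> ('m \<Rightarrow>\<^sub>0 'a::zero) \<Rightarrow> bool" where
 "lead \<rho> m f \<longleftrightarrow> m \<in> keys f \<and> (\<forall>m'\<in>keys f. m' \<noteq> m \<longrightarrow> \<rho> m' < \<rho> m)"

lemma lead_exists:
 assumes "f \<noteq> 0" "inj_on \<rho> (keys f)"
 shows "\<exists>m. lead \<rho> m f"
proof -
 have "keys f \<noteq> {}" using assms(1) by simp
 then obtain m where m: "m \<in> keys f" "\<forall>m'\<in>keys f. \<rho> m' \<le> \<rho> m"
  using Max_in[of "\<rho> ` keys f"] Max_ge[of "\<rho> ` keys f"] by fastforce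
 hence "lead \<rho> m f"
  unfolding lead_def using assms(2) by (metis inj_onD le_neq_implies_less)
 thus ?thesis ..
qed

lemma span_image_sum:
 assumes "finite L" "f \<in> mpoly_vs.span (w ` L)"
 shows "\<exists>c. f = (\<Sum>m\<in>L. scale (c m) (w m))"
 using assms(2)
proof (induction rule: mpoly_vs.span_induct_alt)
 case base
 show ?case by (intro exI[of _ "\<lambda>_. 0"]) simp
next
 case (step k x y)
 then obtain c m0 where c: "y = (\<Sum>m\<in>L. scale (c m) (w m))" and m0: "m0 \<in> L" "x = w m0"
  by blast
 have "(\<Sum>m\<in>L. scale (if m = m0 then c m + k else c m) (w m)) =
   (\<Sum>m\<in>L. scale (c m) (w m) + (if m = m0 then scale k (w m) else 0))"
  by (intro sum.cong) (auto simp: mpoly_vs.scale_left_distrib)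
 also have "\<dots> = y + scale k x"
  using m0 assms(1) by (simp add: sum.distrib c)
 finally show ?case by (metis add.commute)
qed

text \<open>Elements with pairwise different leading monomials cannot cancel each other: the largest
 leading monomial that occurs in a combination is its leading monomial.\<close>

lemma lead_of_combination:
 fixes w :: "('v \<Rightarrow>\<^sub>0 nat) \<Rightarrow> ('v, 'a::field) mpoly"
 assumes fin: "finite L" and inj: "inj_on \<rho> L"
  and w: "\<And>m. m \<in> L \<Longrightarrow> lead \<rho> m (w m)"
  and nz: "\<exists>m\<in>L. c m \<noteq> 0"
 shows "\<exists>m\<in>L. lead \<rho> m (\<Sum>m\<in>L. scale (c m) (w m))"
proof -
 let ?f = "\<Sum>m\<in>L. scale (c m) (w m)"
 let ?L = "{m \<in> L. c m \<noteq> 0}"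
 have "finite (\<rho> ` ?L)" "\<rho> ` ?L \<noteq> {}" using fin nz by auto
 then obtain m where m: "m \<in> L" "c m \<noteq> 0" and max: "\<And>m'. m' \<in> L \<Longrightarrow> c m' \<noteq> 0 \<Longrightarrow> \<rho> m' \<le> \<rho> m"
  using Max_in[of "\<rho> ` ?L"] Max_ge[of "\<rho> ` ?L"] by fastforce
 have less: "\<rho> m' < \<rho> m" if "m' \<in> L" "c m' \<noteq> 0" "m' \<noteq> m" for m'
  using max[OF that(1,2)] inj that m(1) by (metis inj_onD le_neq_implies_less)
 have notkey: "lookup (w m') m = 0" if "m' \<in> L" "c m' \<noteq> 0" "m' \<noteq> m" for m'
  using w[OF that(1)] less[OF that] that unfolding lead_def
  by (metis in_keys_iff less_asym)
 have "lookup ?f m = (\<Sum>m'\<in>L. c m' * lookup (w m') m)"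
  by (simp add: lookup_sum)
 also have "\<dots> = (\<Sum>m'\<in>L. if m' = m then c m * lookup (w m) m else 0)"
  by (rule sum.cong) (use notkey in auto)
 also have "\<dots> = c m * lookup (w m) m" using m fin by simp
 finally have "m \<in> keys ?f"
  using m w[OF m(1)] by (simp add: in_keys_iff lead_def)
 moreover have "\<rho> k < \<rho> m" if "k \<in> keys ?f" "k \<noteq> m" for k
 proof -
  have "k \<in> (\<Union>m'\<in>L. keys (scale (c m') (w m')))"
   by (rule subsetD[OF keys_sum_subset that(1)])
  then obtain m' where m': "m' \<in> L" "k \<in> keys (scale (c m') (w m'))" by (rule UN_E)
  hence k: "k \<in> keys (w m')" "c m' \<noteq> 0" by (simp_all add: in_keys_iff)
  hence "k = m' \<or> \<rho> k < \<rho> m'" using w[OF m'(1)] unfolding lead_def by blast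
  moreover have "\<rho> m' \<le> \<rho> m" by (rule max[OF m'(1) k(2)])
  moreover have "m' = m \<or> \<rho> m' < \<rho> m" using less[OF m'(1) k(2)] by blast
  ultimately show ?thesis using that(2) by auto
 qed
 ultimately have "lead \<rho> m ?f" by (auto simp: lead_def)
 with m show ?thesis by blast
qed

lemma lead_in_span:
 fixes w :: "('v \<Rightarrow>\<^sub>0 nat) \<Rightarrow> ('v, 'a::field) mpoly"
 assumes "finite L" "inj_on \<rho> L" "\<And>m. m \<in> L \<Longrightarrow> lead \<rho> m (w m)"
  and "f \<in> mpoly_vs.span (w ` L)" "f \<noteq> 0"
 shows "\<exists>m\<in>L. lead \<rho> m f"
proof -
 obtain c where c: "f = (\<Sum>m\<in>L. scale (c m) (w m))"
  using span_image_sum[OF assms(1,4)] by blast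
 moreover have "\<exists>m\<in>L. c m \<noteq> 0"
 proof (rule ccontr)
  assume "\<not> ?thesis"
  hence "f = 0" unfolding c by (intro sum.neutral) simp
  with assms(5) show False by simp
 qed
 ultimately show ?thesis using lead_of_combination[OF assms(1-3)] by simp
qed

lemma lead_independent:
 fixes w :: "('v \<Rightarrow>\<^sub>0 nat) \<Rightarrow> ('v, 'a::field) mpoly"
 assumes fin: "finite L" and inj: "inj_on \<rho> L" and w: "\<And>m. m \<in> L \<Longrightarrow> lead \<rho> m (w m)"
 shows "inj_on w L" "mpoly_vs.independent (w ` L)"
proof -
 show injw: "inj_on w L"
 proof (rule inj_onI)
  fix m n assume mn: "m \<in> L" "n \<in> L" "w m = w n"
  have "lead \<rho> m (w m)" by (rule w[OF mn(1)])
  moreover have "lead \<rho> n (w m)" unfolding mn(3) by (rule w[OF mn(2)])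
  ultimately show "m = n" unfolding lead_def using less_asym by blast
 qed
 show "mpoly_vs.independent (w ` L)"
 proof (rule mpoly_vs.independent_if_scalars_zero)
  show "finite (w ` L)" using fin by simp
  fix f x assume sum: "(\<Sum>x\<in>w ` L. scale (f x) x) = 0" and x: "x \<in> w ` L"
  hence 0: "(\<Sum>m\<in>L. scale (f (w m)) (w m)) = 0" by (simp add: sum.reindex[OF injw])
  show "f x = 0"
  proof (rule ccontr)
   assume "f x \<noteq> 0"
   with x have "\<exists>m\<in>L. f (w m) \<noteq> 0" by blast
   from lead_of_combination[OF fin inj w this] show False by (auto simp: 0 lead_def)
  qed
 qed
qed

text \<open>Division: a polynomial is reduced modulo elements with prescribed leading monomials until
 none of these monomials is left.\<close>

lemma lead_division:
 fixes w :: "('v \<Rightarrow>\<^sub>0 nat) \<Rightarrow> ('v, 'a::field) mpoly"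
 assumes inj: "inj_on \<rho> U"
  and w: "\<And>m. m \<in> L \<Longrightarrow> lead \<rho> m (w m) \<and> keys (w m) \<subseteq> U"
  and f: "keys f \<subseteq> U"
 shows "\<exists>v\<in>mpoly_vs.span (w ` L). keys (f - v) \<subseteq> U - L"
proof -
 have *: "\<exists>v\<in>mpoly_vs.span (w ` L). keys (f - v) \<subseteq> U - L"
  if "keys f \<subseteq> U" "\<And>m. m \<in> keys f \<Longrightarrow> m \<in> L \<Longrightarrow> \<rho> m < N" for N and f :: "('v, 'a) mpoly"
  using that
 proof (induction N arbitrary: f)
  case 0
  hence "keys (f - 0) \<subseteq> U - L" by auto
  thus ?case by (rule bexI[OF _ mpoly_vs.span_zero])
 next
  case (Suc N)
  show ?case
  proof (cases "\<exists>m. m \<in> keys f \<and> m \<in> L \<and> \<rho> m = N")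
   case False
   have "\<rho> m < N" if "m \<in> keys f" "m \<in> L" for m
    using Suc.prems(2)[OF that] False that by (metis less_SucE)
   thus ?thesis by (rule Suc.IH[OF Suc.prems(1)])
  next
   case True
   then obtain m where m: "m \<in> keys f" "m \<in> L" "\<rho> m = N" by auto
   let ?a = "lookup f m / lookup (w m) m"
   let ?f = "f - scale ?a (w m)"
   have lm: "lookup (w m) m \<noteq> 0" using w[OF m(2)] by (auto simp: lead_def in_keys_iff)
   have kf: "k \<in> keys f \<or> k \<in> keys (w m)" if "k \<in> keys ?f" for k
    using that by (auto simp: in_keys_iff lookup_minus)
   have kU: "keys ?f \<subseteq> U" using kf Suc.prems(1) w[OF m(2)] by (meson subsetD subsetI)
   have "\<rho> k < N" if k: "k \<in> keys ?f" "k \<in> L" for k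
   proof -
    have "lookup ?f m = 0" using lm by (simp add: lookup_minus)
    hence km: "k \<noteq> m" using k by (auto simp: in_keys_iff)
    consider "k \<in> keys f" | "k \<in> keys (w m)" using kf[OF k(1)] by blast
    thus ?thesis
    proof cases
     case 1
     hence k': "\<rho> k < Suc N" "k \<in> U" "m \<in> U"
      using Suc.prems(1) Suc.prems(2)[OF 1 k(2)] m(1) by auto
     hence "\<rho> k \<noteq> N" using inj_onD[OF inj, of k m] km m(3) by auto
     with k' show ?thesis by simp
    next
     case 2
     thus ?thesis using w[OF m(2)] km m(3) by (auto simp: lead_def)
    qed
   qed
   from Suc.IH[OF kU this] obtain v where
    v: "v \<in> mpoly_vs.span (w ` L)" "keys (?f - v) \<subseteq> U - L" by auto
   have "w m \<in> mpoly_vs.span (w ` L)" by (rule mpoly_vs.span_base) (rule imageI[OF m(2)])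
   hence "scale ?a (w m) + v \<in> mpoly_vs.span (w ` L)"
    by (intro mpoly_vs.span_add[OF mpoly_vs.span_scale v(1)])
   moreover have "f - (scale ?a (w m) + v) = ?f - v" by simp
   ultimately show ?thesis using v(2) by (intro bexI[of _ "scale ?a (w m) + v"]) (simp_all only:)
  qed
 qed
 have "\<rho> m < Suc (Max (\<rho> ` keys f))" if "m \<in> keys f" for m
  using that by (auto simp: less_Suc_eq_le)
 thus ?thesis by (rule *[OF f])
qed

text \<open>Macaulay's principle: one element for each leading monomial of the subspace gives a basis of it,
 and every polynomial has a normal form modulo it.\<close>

lemma subspace_lead_basis:
 fixes W :: "('v, 'a::field) mpoly set"
 assumes W: "mpoly_vs.subspace W" and keys: "\<And>f. f \<in> W \<Longrightarrow> keys f \<subseteq> U" and fin: "finite U"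
  and inj: "inj_on \<rho> U"
 defines "L \<equiv> {m. \<exists>f\<in>W. lead \<rho> m f}"
 shows "mpoly_vs.dim W = card L"
  and "L \<subseteq> U"
  and "\<And>f. keys f \<subseteq> U \<Longrightarrow> \<exists>v\<in>W. keys (f - v) \<subseteq> U - L"
proof -
 define w where "w = (\<lambda>m. SOME f. f \<in> W \<and> lead \<rho> m f)"
 have w: "w m \<in> W \<and> lead \<rho> m (w m)" if "m \<in> L" for m
  unfolding w_def by (rule someI_ex) (use that in \<open>auto simp: L_def\<close>)
 show LU: "L \<subseteq> U" using keys unfolding L_def lead_def by blast
 have wk: "lead \<rho> m (w m) \<and> keys (w m) \<subseteq> U" if "m \<in> L" for m using w[OF that] keys by blast
 have finL: "finite L" using LU fin finite_subset by blast
 have injL: "inj_on \<rho> L" using LU inj inj_on_subset by blast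
 have sp: "mpoly_vs.span (w ` L) \<subseteq> W"
  using w W by (intro mpoly_vs.span_minimal) auto
 show "\<exists>v\<in>W. keys (f - v) \<subseteq> U - L" if "keys f \<subseteq> U" for f
  using lead_division[OF inj wk that] sp by blast
 have "W \<subseteq> mpoly_vs.span (w ` L)"
 proof
  fix f assume f: "f \<in> W"
  obtain v where v: "v \<in> mpoly_vs.span (w ` L)" "keys (f - v) \<subseteq> U - L"
   using lead_division[OF inj wk keys[OF f]] by blast
  have "f - v \<in> W" using f v sp W by (auto intro: mpoly_vs.subspace_diff)
  moreover have "inj_on \<rho> (keys (f - v))" using v(2) inj by (meson Diff_subset inj_on_subset order_trans)
  ultimately have "f - v = 0"
   using lead_exists[of "f - v" \<rho>] v(2) unfolding L_def lead_def by fastforce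
  thus "f \<in> mpoly_vs.span (w ` L)" using v by simp
 qed
 hence "mpoly_vs.dim W = card (w ` L)"
  using lead_independent(2)[OF finL injL, of w] w
  by (intro mpoly_vs.dim_unique[of "w ` L"]) auto
 thus "mpoly_vs.dim W = card L"
  using card_image[OF lead_independent(1)[OF finL injL, of w]] w by auto
qed

lemma family_dependent:
 fixes e :: "'i \<Rightarrow> ('v, 'a::field) mpoly"
 assumes "finite I" "finite T" "\<And>i. i \<in> I \<Longrightarrow> e i \<in> mpoly_vs.span T" "card T < card I"
 shows "\<exists>c. (\<exists>i\<in>I. c i \<noteq> 0) \<and> (\<Sum>i\<in>I. scale (c i) (e i)) = 0"
proof (cases "inj_on e I")
 case True
 have "\<not> mpoly_vs.independent (e ` I)"
  using mpoly_vs.independent_span_bound[OF assms(2), of "e ` I"] assms card_image[OF True] by auto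
 then obtain u where u: "\<exists>v\<in>e ` I. u v \<noteq> 0" "(\<Sum>v\<in>e ` I. scale (u v) v) = 0"
  using mpoly_vs.dependent_finite[of "e ` I"] assms(1) by auto
 thus ?thesis
  by (intro exI[of _ "u \<circ> e"]) (auto simp: sum.reindex[OF True])
next
 case False
 then obtain i j where ij: "i \<in> I" "j \<in> I" "i \<noteq> j" "e i = e j" by (auto simp: inj_on_def)
 let ?c = "\<lambda>k. if k = i then 1 else if k = j then - 1 else 0 :: 'a"
 have "(\<Sum>k\<in>I. scale (?c k) (e k)) =
   (\<Sum>k\<in>I. (if k = i then e i else 0) + (if k = j then - e j else 0))"
  by (rule sum.cong) (use ij in auto)
 also have "\<dots> = 0" using ij assms(1) by (simp add: sum.distrib)
 finally show ?thesis using ij(1) by (intro exI[of _ ?c]) auto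
qed

text \<open>A homogeneous linear system with more unknowns than equations has a nontrivial
 solution.\<close>

lemma underdetermined_system:
 fixes V :: "nat \<Rightarrow> 'k \<Rightarrow> 'a::field"
 assumes "finite K" "r < card K"
 shows "\<exists>c. (\<exists>k\<in>K. c k \<noteq> 0) \<and> (\<forall>l<r. (\<Sum>k\<in>K. V l k * c k) = 0)"
proof -
 let ?m = "\<lambda>l. single (single (0::nat) l) (1::'a)"
 let ?T = "?m ` {..<r}"
 define e where "e k = (\<Sum>l<r. scale (V l k) (?m l))" for k
 have "e k \<in> mpoly_vs.span ?T" for k
  unfolding e_def by (intro mpoly_vs.span_sum mpoly_vs.span_scale mpoly_vs.span_base) auto
 moreover have "card ?T < card K"
  using card_image_le[of "{..<r}" ?m] assms(2) by simp
 ultimately obtain c where c: "\<exists>k\<in>K. c k \<noteq> 0" "(\<Sum>k\<in>K. scale (c k) (e k)) = 0"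
  using family_dependent[of K ?T e] assms(1) by auto
 have "(\<Sum>k\<in>K. V l k * c k) = 0" if "l < r" for l
 proof -
  have e: "lookup (e k) (single 0 l) = V l k" for k
  proof -
   have "lookup (e k) (single 0 l) = (\<Sum>l'<r. if l' = l then V l k else 0)"
    unfolding e_def lookup_sum
   proof (rule sum.cong)
    fix l' show "lookup (scale (V l' k) (?m l')) (single 0 l) = (if l' = l then V l k else 0)"
     by (auto simp: lookup_single when_def dest!: arg_cong[of _ _ "\<lambda>m. lookup m 0"])
   qed simp
   thus ?thesis using that by simp
  qed
  have "0 = lookup (\<Sum>k\<in>K. scale (c k) (e k)) (single 0 l)" using c(2) by simp
  also have "\<dots> = (\<Sum>k\<in>K. c k * V l k)" by (simp add: lookup_sum e)
  finally show ?thesis by (simp add: mult.commute)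
 qed
 with c(1) show ?thesis by blast
qed

section \<open>Homogeneous components\<close>

lemma mdeg_superset: "finite B \<Longrightarrow> keys m \<subseteq> B \<Longrightarrow> mdeg m = (\<Sum>v\<in>B. lookup m v)"
 unfolding mdeg_def by (rule sum.mono_neutral_left) (auto simp: in_keys_iff)

lemma mdeg_add: "mdeg (m + n) = mdeg m + mdeg n"
 using keys_add[of m n]
 by (simp add: mdeg_superset[of "keys m \<union> keys n"] lookup_add sum.distrib)

lemma mdeg_single [simp]: "mdeg (single v k) = k"
 by (cases "k = 0") (simp_all add: mdeg_def)

lemma mdeg_0 [simp]: "mdeg 0 = 0"
 by (simp add: mdeg_def)

lemma mdeg_eq_0_iff: "mdeg m = 0 \<longleftrightarrow> m = 0"
 by (auto simp: mdeg_def in_keys_iff intro!: poly_mapping_eqI)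

lemma finite_mdeg: "finite {m :: 'v::finite \<Rightarrow>\<^sub>0 nat. mdeg m = n}"
proof -
 have "lookup ` {m :: 'v \<Rightarrow>\<^sub>0 nat. mdeg m = n} \<subseteq> Pi\<^sub>E UNIV (\<lambda>_. {..n})"
 proof -
  have "lookup m v \<le> mdeg m" for m :: "'v \<Rightarrow>\<^sub>0 nat" and v
   by (subst mdeg_superset[of UNIV]) (auto intro: member_le_sum)
  thus ?thesis by auto
 qed
 hence "finite (lookup ` {m :: 'v \<Rightarrow>\<^sub>0 nat. mdeg m = n})"
  by (rule finite_subset) (simp add: finite_PiE)
 thus ?thesis
  by (rule finite_imageD) (auto simp: inj_on_def intro: poly_mapping_eqI)
qed

lemma keys_forms: "f \<in> forms n \<Longrightarrow> keys f \<subseteq> {m. mdeg m = n}"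
 by (auto simp: forms_def)

lemma forms_iff: "f \<in> forms n \<longleftrightarrow> keys f \<subseteq> {m. mdeg m = n}"
 by (auto simp: forms_def)

lemma subspace_forms: "mpoly_vs.subspace (forms n :: ('v, 'a::field) mpoly set)"
 using subspace_keys_subset[of "{m. mdeg m = n}"] by (simp add: forms_iff[abs_def] forms_def subset_iff Ball_def)

lemma forms_zero [simp]: "0 \<in> forms n"
 by (simp add: forms_def)

lemma forms_add: "f \<in> forms n \<Longrightarrow> g \<in> forms n \<Longrightarrow> f + g \<in> forms n"
 unfolding forms_iff by (rule order_trans[OF keys_add Un_least])

lemma forms_sum: "(\<And>i. i \<in> A \<Longrightarrow> F i \<in> forms n) \<Longrightarrow> sum F A \<in> forms n"
 unfolding forms_iff by (rule order_trans[OF keys_sum_subset UN_least])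

lemma forms_uminus: "f \<in> forms n \<Longrightarrow> - f \<in> forms n" for f :: "('v, 'a::ab_group_add) mpoly"
 by (auto simp: forms_def in_keys_iff)

lemma forms_diff: "f \<in> forms n \<Longrightarrow> g \<in> forms n \<Longrightarrow> f - g \<in> forms n"
 for f :: "('v, 'a::ab_group_add) mpoly"
 using forms_add[of f n "- g"] forms_uminus[of g n] by simp

lemma forms_scale: "f \<in> forms n \<Longrightarrow> scale a f \<in> forms n"
 unfolding forms_iff by (rule order_trans[OF keys_scale])

lemma forms_mult: "f \<in> forms a \<Longrightarrow> g \<in> forms b \<Longrightarrow> f * g \<in> forms (a + b)"
 using keys_mult[of f g] unfolding forms_def by (force simp: mdeg_add)

lemma forms_single: "single m c \<in> forms (mdeg m)"
 by (auto simp: forms_def split: if_splits)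

lemma forms_monomial: "monomial m \<in> forms (mdeg m)"
 by (auto simp: monomial_def forms_single)

lemma forms_Var: "Var v \<in> forms 1"
 unfolding Var_def using forms_monomial[of "single v 1"] by simp

lemma forms_one: "1 \<in> forms 0"
 by (simp add: forms_def)

lemma forms_prod: "finite A \<Longrightarrow> (\<And>i. i \<in> A \<Longrightarrow> F i \<in> forms (d i)) \<Longrightarrow>
  prod F A \<in> forms (\<Sum>i\<in>A. d i)"
 by (induction A rule: finite_induct) (auto simp: forms_one intro: forms_mult)

lemma forms_unique: "f \<in> forms a \<Longrightarrow> f \<in> forms b \<Longrightarrow> f \<noteq> 0 \<Longrightarrow> a = b"
 unfolding forms_def by (metis (mono_tags, lifting) keys_eq_empty mem_Collect_eq ex_in_conv)

definition hcomp :: "nat \<Rightarrow> ('v, 'a::zero) mpoly \<Rightarrow> ('v, 'a) mpoly" where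
 "hcomp n f = Poly_Mapping.mapp (\<lambda>m c. c when mdeg m = n) f"

lemma lookup_hcomp: "lookup (hcomp n f) m = (lookup f m when mdeg m = n)"
 by (auto simp: hcomp_def lookup_mapp when_def in_keys_iff)

lemma hcomp_forms: "hcomp n f \<in> forms n"
 by (auto simp: forms_def in_keys_iff lookup_hcomp)

lemma hcomp_of_form: "f \<in> forms k \<Longrightarrow> hcomp n f = (if k = n then f else 0)"
 by (rule poly_mapping_eqI) (auto simp: lookup_hcomp when_def forms_def in_keys_iff)

lemma hcomp_add: "hcomp n (f + g) = hcomp n f + hcomp n g"
 by (rule poly_mapping_eqI) (auto simp: lookup_hcomp lookup_add when_def)

lemma hcomp_sum: "hcomp n (sum F A) = (\<Sum>i\<in>A. hcomp n (F i))"
 by (rule poly_mapping_eqI) (auto simp: lookup_hcomp lookup_sum when_def)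

lemma hcomp_scale: "hcomp n (scale a f) = scale a (hcomp n f)"
 by (rule poly_mapping_eqI) (auto simp: lookup_hcomp when_def)

lemma hcomp_zero [simp]: "hcomp n 0 = 0"
 by (rule poly_mapping_eqI) (auto simp: lookup_hcomp)

lemma hcomp_mult_form:
 fixes r g :: "('v, 'a::comm_ring_1) mpoly"
 assumes g: "g \<in> forms d"
 shows "hcomp n (r * g) = (if d \<le> n then hcomp (n - d) r * g else 0)"
proof -
 let ?s = "\<lambda>m. single m (lookup r m)"
 have r: "r = (\<Sum>m\<in>keys r. ?s m)" by (rule mpoly_as_sum)
 have s: "hcomp n (?s m * g) = (if d \<le> n then hcomp (n - d) (?s m) * g else 0)" for m
  using hcomp_of_form[OF forms_mult[OF forms_single[of m "lookup r m"] g], of n]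
   hcomp_of_form[OF forms_single[of m "lookup r m"], of "n - d"] by auto
 have "hcomp n (r * g) = (\<Sum>m\<in>keys r. hcomp n (?s m * g))"
  by (subst r) (simp add: sum_distrib_right hcomp_sum)
 also have "\<dots> = (if d \<le> n then hcomp (n - d) (\<Sum>m\<in>keys r. ?s m) * g else 0)"
  by (simp add: s hcomp_sum sum_distrib_right)
 finally show ?thesis by (simp only: r[symmetric])
qed

lemma sum_hcomp:
 assumes "\<And>m. m \<in> keys f \<Longrightarrow> mdeg m \<le> N"
 shows "f = (\<Sum>n\<le>N. hcomp n f)"
proof (rule poly_mapping_eqI)
 fix m
 have "(\<Sum>n\<le>N. lookup (hcomp n f) m) = (\<Sum>n\<le>N. if n = mdeg m then lookup f m else 0)"
  by (rule sum.cong) (auto simp: lookup_hcomp when_def)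
 also have "\<dots> = lookup f m" using assms[of m] by (auto simp: in_keys_iff)
 finally show "lookup f m = lookup (\<Sum>n\<le>N. hcomp n f) m" by (simp add: lookup_sum)
qed

lemma mdeg_bound: "\<exists>N. \<forall>m\<in>keys f. mdeg m \<le> N"
 by (intro exI[of _ "Max (mdeg ` keys f)"]) auto

lemma hcomp_ideal_gen:
 fixes G :: "('v, 'a::comm_ring_1) mpoly set"
 assumes G: "G \<subseteq> (\<Union>n. forms n)" and f: "f \<in> ideal_gen G"
 shows "hcomp n f \<in> ideal_gen (G \<inter> (\<Union>k\<le>n. forms k))"
 using f
proof (induction rule: ring_module.span_induct_alt)
 case base
 show ?case by (simp add: ring_module.span_zero)
next
 case (step c x y)
 then obtain d where d: "x \<in> forms d" using G by blast
 have "hcomp n (c * x) \<in> ideal_gen (G \<inter> (\<Union>k\<le>n. forms k))"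
 proof (cases "d \<le> n")
  case True
  hence "x \<in> ideal_gen (G \<inter> (\<Union>k\<le>n. forms k))"
   using step(1) d by (intro ring_module.span_base) auto
  with True show ?thesis by (simp add: hcomp_mult_form[OF d] ring_module.span_scale)
 qed (simp add: hcomp_mult_form[OF d] ring_module.span_zero)
 with step show ?case by (simp add: hcomp_add ring_module.span_add)
qed

lemma homogeneous_ideal_hcomp:
 assumes "homogeneous_ideal J" "f \<in> J"
 shows "hcomp n f \<in> J"
proof -
 obtain G where G: "G \<subseteq> (\<Union>n. forms n)" "J = ideal_gen G"
  using assms(1) unfolding homogeneous_ideal_def by (elim exE conjE)
 have "hcomp n f \<in> ideal_gen (G \<inter> (\<Union>k\<le>n. forms k))"
  using hcomp_ideal_gen[OF G(1)] assms(2) unfolding G(2) .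
 thus ?thesis unfolding G(2) using ring_module.span_mono[OF Int_lower1] by (rule rev_subsetD)
qed

lemma homogeneous_ideal_is_ideal: "homogeneous_ideal J \<Longrightarrow> is_ideal J"
 unfolding homogeneous_ideal_def by (auto simp: ring_module.subspace_span)

lemma homogeneous_idealI:
 assumes J: "is_ideal J" and "\<And>f n. f \<in> J \<Longrightarrow> hcomp n f \<in> J"
 shows "homogeneous_ideal J"
 unfolding homogeneous_ideal_def
proof (intro exI[of _ "J \<inter> (\<Union>n. forms n)"] conjI)
 show "J = ideal_gen (J \<inter> (\<Union>n. forms n))"
 proof (rule antisym[OF subsetI])
  fix f assume f: "f \<in> J"
  obtain N where "\<forall>m\<in>keys f. mdeg m \<le> N" using mdeg_bound by blast
  hence "f = (\<Sum>n\<le>N. hcomp n f)" by (intro sum_hcomp) auto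
  moreover have "hcomp n f \<in> ideal_gen (J \<inter> (\<Union>n. forms n))" for n
   using assms(2)[OF f] hcomp_forms by (intro ring_module.span_base) blast
  ultimately show "f \<in> ideal_gen (J \<inter> (\<Union>n. forms n))"
   using ring_module.span_sum[of "{..N}" "\<lambda>n. hcomp n f" "J \<inter> (\<Union>n. forms n)"] by simp
 next
  show "ideal_gen (J \<inter> (\<Union>n. forms n)) \<subseteq> J"
   using J by (intro ring_module.span_minimal) auto
 qed
qed simp

section \<open>Monomials in two and three variables\<close>

lemma UNIV_2_eq: "(UNIV :: 2 set) = {0, 1}"
proof -
 have "card {0, 1 :: 2} = card (UNIV :: 2 set)" by simp
 thus ?thesis by (metis card_subset_eq finite_UNIV subset_UNIV finite)
qed

lemma three_distinct: "(0::3) \<noteq> 1" "(0::3) \<noteq> 2" "(1::3) \<noteq> 2"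
 "(1::3) \<noteq> 0" "(2::3) \<noteq> 0" "(2::3) \<noteq> 1"
 by simp_all

lemma UNIV_3_eq: "(UNIV :: 3 set) = {0, 1, 2}"
proof -
 have "card {0, 1, 2 :: 3} = card (UNIV :: 3 set)" by (simp add: three_distinct)
 thus ?thesis by (metis card_subset_eq finite_UNIV subset_UNIV finite)
qed

lemma all_3: "(\<forall>v::3. P v) \<longleftrightarrow> P 0 \<and> P 1 \<and> P 2"
 by (metis UNIV_3_eq UNIV_I empty_iff insert_iff)

lemma ex_3: "(\<exists>v::3. P v) \<longleftrightarrow> P 0 \<or> P 1 \<or> P 2"
 using all_3[of "\<lambda>v. \<not> P v"] by blast

lemma all_2: "(\<forall>v::2. P v) \<longleftrightarrow> P 0 \<and> P 1"
 by (metis UNIV_2_eq UNIV_I empty_iff insert_iff)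

lemma ex_2: "(\<exists>v::2. P v) \<longleftrightarrow> P 0 \<or> P 1"
 using all_2[of "\<lambda>v. \<not> P v"] by blast

definition mS :: "nat \<Rightarrow> nat \<Rightarrow> nat \<Rightarrow> (3 \<Rightarrow>\<^sub>0 nat)" where
 "mS a b c = single 0 a + single 1 b + single 2 c"

definition mR :: "nat \<Rightarrow> nat \<Rightarrow> (2 \<Rightarrow>\<^sub>0 nat)" where
 "mR a b = single 0 a + single 1 b"

lemma lookup_mS [simp]: "lookup (mS a b c) 0 = a" "lookup (mS a b c) 1 = b" "lookup (mS a b c) 2 = c"
 using three_distinct by (simp_all add: mS_def lookup_add lookup_single when_def)

lemma lookup_mR [simp]: "lookup (mR a b) 0 = a" "lookup (mR a b) 1 = b"
 by (simp_all add: mR_def lookup_add lookup_single when_def)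

lemma mS_eqI: "lookup m 0 = a \<Longrightarrow> lookup m 1 = b \<Longrightarrow> lookup m 2 = c \<Longrightarrow> m = mS a b c"
proof (rule poly_mapping_eqI)
 fix v :: 3
 assume "lookup m 0 = a" "lookup m 1 = b" "lookup m 2 = c"
 hence "\<forall>v. lookup m v = lookup (mS a b c) v" by (subst all_3) simp
 thus "lookup m v = lookup (mS a b c) v" ..
qed

lemma mR_eqI: "lookup m 0 = a \<Longrightarrow> lookup m 1 = b \<Longrightarrow> m = mR a b"
proof (rule poly_mapping_eqI)
 fix v :: 2
 assume "lookup m 0 = a" "lookup m 1 = b"
 hence "\<forall>v. lookup m v = lookup (mR a b) v" by (subst all_2) simp
 thus "lookup m v = lookup (mR a b) v" ..
qed

lemma mS_cases: obtains a b c where "m = mS a b c"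
 using mS_eqI by blast

lemma mR_cases: obtains a b where "m = mR a b"
 using mR_eqI by blast

lemma mS_inject [simp]: "mS a b c = mS a' b' c' \<longleftrightarrow> a = a' \<and> b = b' \<and> c = c'"
 by (metis lookup_mS)

lemma mR_inject [simp]: "mR a b = mR a' b' \<longleftrightarrow> a = a' \<and> b = b'"
 by (metis lookup_mR)

lemma mS_add: "mS a b c + mS a' b' c' = mS (a + a') (b + b') (c + c')"
 by (rule mS_eqI) (simp_all add: lookup_add)

lemma mR_add: "mR a b + mR a' b' = mR (a + a') (b + b')"
 by (rule mR_eqI) (simp_all add: lookup_add)

lemma mS_0: "mS 0 0 0 = 0"
 by (rule mS_eqI[symmetric]) simp_all

lemma mR_0: "mR 0 0 = 0"
 by (rule mR_eqI[symmetric]) simp_all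

lemma mdeg_mS [simp]: "mdeg (mS a b c) = a + b + c"
 by (simp add: mS_def mdeg_add)

lemma mdeg_mR [simp]: "mdeg (mR a b) = a + b"
 by (simp add: mR_def mdeg_add)

lemma mS_single: "single 0 a = mS a 0 0" "single 1 a = mS 0 a 0" "single 2 a = mS 0 0 a"
 by (simp_all add: mS_def)

lemma mR_single: "single 0 a = mR a 0" "single 1 a = mR 0 a"
 by (simp_all add: mR_def)

lemma Var_S: "xS = single (mS 1 0 0) 1" "yS = single (mS 0 1 0) 1" "zS = single (mS 0 0 1) 1"
 by (simp_all add: Var_def monomial_def mS_single)

lemma Var_R: "xR = single (mR 1 0) 1" "yR = single (mR 0 1) 1"
 by (simp_all add: Var_def monomial_def mR_single)

lemma Var_S_power: "xS ^ a = single (mS a 0 0) 1" "yS ^ a = single (mS 0 a 0) 1"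
  "zS ^ a = (single (mS 0 0 a) 1 :: 'a::comm_ring_1 ring_S)"
 by (induction a) (simp_all add: mS_0 Var_S mult_single mS_add)

lemma Var_R_power: "xR ^ a = single (mR a 0) 1" "yR ^ a = (single (mR 0 a) 1 :: 'a::comm_ring_1 ring_R)"
 by (induction a) (simp_all add: mR_0 Var_R mult_single mR_add)

lemma lookup_mS_times:
 fixes f :: "'a::comm_ring_1 ring_S"
 shows "lookup (single (mS i j k) e * f) (mS a b c) =
  (if i \<le> a \<and> j \<le> b \<and> k \<le> c then e * lookup f (mS (a - i) (b - j) (c - k)) else 0)"
proof (cases "i \<le> a \<and> j \<le> b \<and> k \<le> c")
 case True
 hence "mS a b c = mS i j k + mS (a - i) (b - j) (c - k)" by (simp add: mS_add)
 thus ?thesis using True lookup_single_times by metis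
next
 case False
 have "mS a b c \<noteq> mS i j k + m" for m
  using False by (cases m rule: mS_cases) (auto simp: mS_add)
 thus ?thesis unfolding if_not_P[OF False] by (rule lookup_single_times_eq_0)
qed

section \<open>Monomial ideals and initial ideals\<close>

lemma mem_monomial_ideal:
 fixes f :: "('v, 'a::comm_ring_1) mpoly"
 shows "f \<in> ideal_gen (monomial ` T) \<longleftrightarrow> (\<forall>m\<in>keys f. \<exists>t\<in>T. \<exists>k. m = t + k)"
proof
 assume "f \<in> ideal_gen (monomial ` T)"
 thus "\<forall>m\<in>keys f. \<exists>t\<in>T. \<exists>k. m = t + k"
 proof (induction rule: ring_module.span_induct_alt)
  case base
  show ?case by simp
 next
  case (step c x y)
  then obtain t where t: "t \<in> T" "x = monomial t" by blast
  show ?case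
  proof
   fix m assume "m \<in> keys (c * x + y)"
   hence "m \<in> keys (x * c) \<or> m \<in> keys y" using keys_add by (metis UnE subsetD mult.commute)
   thus "\<exists>t\<in>T. \<exists>k. m = t + k"
   proof
    assume "m \<in> keys (x * c)"
    hence "\<exists>k. m = t + k"
     using lookup_single_times_eq_0[of m t 1 c] by (auto simp: t monomial_def in_keys_iff)
    with t show ?thesis by blast
   qed (use step in blast)
  qed
 qed
next
 assume r: "\<forall>m\<in>keys f. \<exists>t\<in>T. \<exists>k. m = t + k"
 have "single m (lookup f m) \<in> ideal_gen (monomial ` T)" if m: "m \<in> keys f" for m
 proof -
  from r m obtain t k where t: "t \<in> T" "m = t + k" by blast
  have eq: "single m (lookup f m) = single k (lookup f m) * monomial t"
   by (simp add: t(2) monomial_def mult_single add.commute)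
  have "monomial t \<in> ideal_gen (monomial ` T :: ('v, 'a) mpoly set)"
   by (rule ring_module.span_base) (rule imageI[OF t(1)])
  thus ?thesis unfolding eq by (rule ring_module.span_scale)
 qed
 hence "(\<Sum>m\<in>keys f. single m (lookup f m)) \<in> ideal_gen (monomial ` T)"
  by (rule ring_module.span_sum)
 thus "f \<in> ideal_gen (monomial ` T)" by (simp only: mpoly_as_sum[symmetric])
qed

lemma monomial_mem_monomial_ideal:
 "(monomial m :: ('v, 'a::comm_ring_1) mpoly) \<in> ideal_gen (monomial ` T) \<longleftrightarrow> (\<exists>t\<in>T. \<exists>k. m = t + k)"
 by (subst mem_monomial_ideal) (simp add: monomial_def)

definition lead_mons :: "'a::comm_ring_1 ring_S set \<Rightarrow> (3 \<Rightarrow>\<^sub>0 nat) set" where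
 "lead_mons J = {m. \<exists>f\<in>J. is_leading_monomial m f}"

lemma initial_ideal_eq: "initial_ideal J = ideal_gen (monomial ` lead_mons J)"
 unfolding initial_ideal_def lead_mons_def by (rule arg_cong[of _ _ ideal_gen]) blast

text \<open>On monomials of a fixed degree \<open>n\<close>, the degree reverse lexicographic order is the order of
 the numbers \<open>rank_drl n\<close>.\<close>

definition rank_drl :: "nat \<Rightarrow> (3 \<Rightarrow>\<^sub>0 nat) \<Rightarrow> nat" where
 "rank_drl n m = (n - lookup m 2) * (n + 1) + lookup m 0"

lemma less_3: "(w::3) > 0 \<longleftrightarrow> w = 1 \<or> w = 2" "(w::3) > 1 \<longleftrightarrow> w = 2" "\<not> (w::3) > 2"
proof -
 have "\<forall>w::3. (w > 0 \<longleftrightarrow> w = 1 \<or> w = 2) \<and> (w > 1 \<longleftrightarrow> w = 2) \<and> \<not> w > 2"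
  by (subst all_3) (simp add: three_distinct less_bit1_def bit1.Rep_0 bit1.Rep_1 bit1.Rep_numeral)
 thus "(w::3) > 0 \<longleftrightarrow> w = 1 \<or> w = 2" "(w::3) > 1 \<longleftrightarrow> w = 2" "\<not> (w::3) > 2" by blast+
qed

lemma drl_less_mS:
 "drl_less (mS a b c) (mS a' b' c') \<longleftrightarrow> a + b + c < a' + b' + c' \<or> a + b + c = a' + b' + c' \<and>
  (c' < c \<or> c = c' \<and> (b' < b \<or> b = b' \<and> a' < a))"
 unfolding drl_less_def by (subst ex_3) (auto simp: less_3)

lemma rank_drl_less_iff:
 assumes "mdeg m = n" "mdeg m' = n"
 shows "rank_drl n m < rank_drl n m' \<longleftrightarrow> drl_less m m'"
proof -
 obtain a b c where m: "m = mS a b c" by (rule mS_cases)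
 obtain a' b' c' where m': "m' = mS a' b' c'" by (rule mS_cases)
 have n: "a + b + c = n" "a' + b' + c' = n" using assms m m' by auto
 have *: "i * (n + 1) + p < j * (n + 1) + q" if "i < j" "p \<le> n" for i j p q :: nat
 proof -
  have "Suc i * (n + 1) \<le> j * (n + 1)" using that by (intro mult_le_mono1) simp
  thus ?thesis using that by simp
 qed
 consider "c' < c" | "c < c'" | "c = c'" by linarith
 thus ?thesis
 proof cases
  case 1
  hence "n - c < n - c'" using n by linarith
  from *[OF this, of a a'] n 1 show ?thesis
   unfolding m m' drl_less_mS by (simp add: rank_drl_def)
 next
  case 2
  hence "n - c' < n - c" using n by linarith
  from *[OF this, of a' a] n 2 show ?thesis
   unfolding m m' drl_less_mS by (simp add: rank_drl_def)
 next
  case 3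
  thus ?thesis using n unfolding m m' drl_less_mS by (auto simp: rank_drl_def)
 qed
qed

lemma inj_rank_drl: "inj_on (rank_drl n) {m. mdeg m = n}"
proof (rule inj_onI)
 fix m m' :: "3 \<Rightarrow>\<^sub>0 nat"
 assume mm: "m \<in> {m. mdeg m = n}" "m' \<in> {m. mdeg m = n}" and eq: "rank_drl n m = rank_drl n m'"
 obtain a b c where m: "m = mS a b c" by (rule mS_cases)
 obtain a' b' c' where m': "m' = mS a' b' c'" by (rule mS_cases)
 have "\<not> drl_less m m'" "\<not> drl_less m' m"
  using rank_drl_less_iff[of m n m'] rank_drl_less_iff[of m' n m] eq mm by auto
 thus "m = m'" using mm unfolding m m' drl_less_mS by auto
qed

lemma lead_rank_drl_iff:
 assumes "f \<in> forms n"
 shows "lead (rank_drl n) m f \<longleftrightarrow> is_leading_monomial m f"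
 using rank_drl_less_iff assms unfolding lead_def is_leading_monomial_def forms_def by blast

lemma is_leading_monomial_hcomp:
 assumes "is_leading_monomial m f"
 shows "is_leading_monomial m (hcomp (mdeg m) f)"
 using assms unfolding is_leading_monomial_def by (auto simp: in_keys_iff lookup_hcomp when_def split: if_splits)

lemma lead_mons_homogeneous:
 assumes J: "homogeneous_ideal J"
 shows "m \<in> lead_mons J \<longleftrightarrow> (\<exists>f\<in>J \<inter> forms (mdeg m). lead (rank_drl (mdeg m)) m f)"
proof
 assume "m \<in> lead_mons J"
 then obtain f where f: "f \<in> J" "is_leading_monomial m f" by (auto simp: lead_mons_def)
 have "hcomp (mdeg m) f \<in> J \<inter> forms (mdeg m)"
  using homogeneous_ideal_hcomp[OF J f(1)] hcomp_forms by blast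
 with is_leading_monomial_hcomp[OF f(2)] show "\<exists>f\<in>J \<inter> forms (mdeg m). lead (rank_drl (mdeg m)) m f"
  using lead_rank_drl_iff[OF hcomp_forms, of "mdeg m" m f] by blast
next
 assume "\<exists>f\<in>J \<inter> forms (mdeg m). lead (rank_drl (mdeg m)) m f"
 thus "m \<in> lead_mons J" unfolding lead_mons_def using lead_rank_drl_iff by blast
qed

lemma keys_monomial_times:
 fixes f :: "('v, 'a::comm_ring_1) mpoly"
 shows "keys (monomial k * f) = (\<lambda>m. k + m) ` keys f"
proof (intro equalityI subsetI)
 fix m assume m: "m \<in> keys (monomial k * f)"
 then obtain n where n: "m = k + n"
  using lookup_single_times_eq_0[of m k 1 f] by (auto simp: monomial_def in_keys_iff)
 with m show "m \<in> (\<lambda>m. k + m) ` keys f"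
  using lookup_single_times[of k 1 f n] by (auto simp: monomial_def in_keys_iff)
next
 fix m assume "m \<in> (\<lambda>m. k + m) ` keys f"
 thus "m \<in> keys (monomial k * f)"
  using lookup_single_times[of k 1 f] by (auto simp: monomial_def in_keys_iff)
qed

lemma drl_less_add: "drl_less (k + m) (k + m') \<longleftrightarrow> drl_less m m'"
 unfolding drl_less_def by (simp add: mdeg_add lookup_add)

lemma is_leading_monomial_times:
 "is_leading_monomial (k + m) (monomial k * f) \<longleftrightarrow> is_leading_monomial m (f :: 'a::comm_ring_1 ring_S)"
 unfolding is_leading_monomial_def keys_monomial_times by (auto simp: drl_less_add)

lemma lead_mons_add:
 assumes "is_ideal J" "m \<in> lead_mons J"
 shows "k + m \<in> lead_mons J"
proof -
 obtain f where "f \<in> J" "is_leading_monomial m f" using assms by (auto simp: lead_mons_def)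
 hence "monomial k * f \<in> J" "is_leading_monomial (k + m) (monomial k * f)"
  using assms(1) by (auto simp: is_leading_monomial_times ring_module.subspace_scale)
 thus ?thesis by (auto simp: lead_mons_def)
qed

lemma monomial_mem_initial_ideal:
 assumes "is_ideal J"
 shows "(monomial m :: 'a::comm_ring_1 ring_S) \<in> initial_ideal J \<longleftrightarrow> m \<in> lead_mons J"
 unfolding initial_ideal_eq monomial_mem_monomial_ideal
proof
 assume "\<exists>t\<in>lead_mons J. \<exists>k. m = t + k"
 thus "m \<in> lead_mons J" using lead_mons_add[OF assms] by (metis add.commute)
next
 show "m \<in> lead_mons J \<Longrightarrow> \<exists>t\<in>lead_mons J. \<exists>k. m = t + k" by (metis add.right_neutral)
qed

lemma lead_mons_degree_part:
 assumes "homogeneous_ideal J"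
 shows "{m. \<exists>f\<in>J \<inter> forms n. lead (rank_drl n) m f} = {m \<in> lead_mons J. mdeg m = n}"
 unfolding lead_mons_homogeneous[OF assms]
 by (auto simp: lead_def forms_def)

lemma subspace_ideal_forms:
 "is_ideal J \<Longrightarrow> mpoly_vs.subspace (J \<inter> forms n :: ('v, 'a::field) mpoly set)"
 by (intro mpoly_vs.subspace_inter is_ideal_imp_subspace subspace_forms)

lemma keys_Int_forms: "f \<in> J \<inter> forms n \<Longrightarrow> keys f \<subseteq> {m. mdeg m = n}"
 by (simp add: keys_forms)

lemma normal_form:
 fixes J :: "'a::field ring_S set"
 assumes "homogeneous_ideal J" "f \<in> forms n"
 shows "\<exists>v\<in>J \<inter> forms n. keys (f - v) \<subseteq> {m. mdeg m = n} - lead_mons J"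
proof -
 have "mpoly_vs.subspace (J \<inter> forms n)"
  by (rule subspace_ideal_forms[OF homogeneous_ideal_is_ideal[OF assms(1)]])
 hence "\<exists>v\<in>J \<inter> forms n. keys (f - v) \<subseteq> {m. mdeg m = n} - {m. \<exists>f\<in>J \<inter> forms n. lead (rank_drl n) m f}"
  by (intro subspace_lead_basis(3)[where U = "{m. mdeg m = n}"])
   (assumption | rule keys_Int_forms finite_mdeg inj_rank_drl keys_forms assms)+
 hence "\<exists>v\<in>J \<inter> forms n. keys (f - v) \<subseteq> {m. mdeg m = n} - {m \<in> lead_mons J. mdeg m = n}"
  unfolding lead_mons_degree_part[OF assms(1)] .
 thus ?thesis by auto
qed

lemma dim_ideal_forms:
 fixes J :: "'a::field ring_S set"
 assumes "homogeneous_ideal J"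
 shows "mpoly_vs.dim (J \<inter> forms n) = card {m \<in> lead_mons J. mdeg m = n}"
proof -
 have "mpoly_vs.subspace (J \<inter> forms n)"
  by (rule subspace_ideal_forms[OF homogeneous_ideal_is_ideal[OF assms]])
 hence "mpoly_vs.dim (J \<inter> forms n) = card {m. \<exists>f\<in>J \<inter> forms n. lead (rank_drl n) m f}"
  by (intro subspace_lead_basis(1)[where U = "{m. mdeg m = n}"])
   (assumption | rule keys_Int_forms finite_mdeg inj_rank_drl)+
 thus ?thesis unfolding lead_mons_degree_part[OF assms(1)] .
qed

lemma dim_monomial_span:
 assumes fin: "finite U"
 shows "mpoly_vs.dim {f :: ('v, 'a::field) mpoly. keys f \<subseteq> U} = card U"
proof (rule mpoly_vs.dim_unique[of "monomial ` U"])
 have inj: "inj_on (monomial :: _ \<Rightarrow> ('v, 'a) mpoly) U"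
  by (auto simp: inj_on_def monomial_def) (metis (no_types) keys_single singleton_iff zero_neq_one)
 show "card (monomial ` U :: ('v, 'a) mpoly set) = card U" by (rule card_image[OF inj])
 show "monomial ` U \<subseteq> {f :: ('v, 'a) mpoly. keys f \<subseteq> U}" by (auto simp: monomial_def)
 show "{f :: ('v, 'a) mpoly. keys f \<subseteq> U} \<subseteq> mpoly_vs.span (monomial ` U)"
 proof
  fix f :: "('v, 'a) mpoly" assume "f \<in> {f. keys f \<subseteq> U}"
  hence "(\<Sum>m\<in>keys f. scale (lookup f m) (single m 1)) \<in> mpoly_vs.span (monomial ` U)"
   unfolding monomial_def by (intro mpoly_vs.span_sum mpoly_vs.span_scale mpoly_vs.span_base) auto
  thus "f \<in> mpoly_vs.span (monomial ` U)" by (simp only: mpoly_scale_as_sum[symmetric])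
 qed
 show "mpoly_vs.independent (monomial ` U :: ('v, 'a) mpoly set)"
 proof (rule mpoly_vs.independent_if_scalars_zero)
  fix f :: "('v, 'a) mpoly \<Rightarrow> 'a" and x :: "('v, 'a) mpoly"
  assume 0: "(\<Sum>x\<in>monomial ` U. scale (f x) x) = 0" and "x \<in> monomial ` U"
  then obtain m where m: "m \<in> U" "x = monomial m" by blast
  have "0 = lookup (\<Sum>k\<in>U. scale (f (monomial k)) (monomial k)) m"
   using 0 by (simp add: sum.reindex[OF inj])
  also have "\<dots> = (\<Sum>k\<in>U. if k = m then f x else 0)"
   unfolding lookup_sum by (rule sum.cong) (auto simp: m monomial_def lookup_single)
  also have "\<dots> = f x" using m fin by simp
  finally show "f x = 0" ..
 qed (use fin in simp)
qed

lemma dim_forms: "mpoly_vs.dim (forms n :: ('v::finite, 'a::field) mpoly set) = card {m :: 'v \<Rightarrow>\<^sub>0 nat. mdeg m = n}"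
proof -
 have "forms n = {f :: ('v, 'a) mpoly. keys f \<subseteq> {m. mdeg m = n}}" by (simp add: set_eq_iff forms_iff)
 thus ?thesis by (simp only: dim_monomial_span[OF finite_mdeg])
qed

text \<open>The monomials that are no leading monomials form a basis of the quotient.\<close>

lemma hilbert_function_lead_mons:
 fixes J :: "'a::field ring_S set"
 assumes "homogeneous_ideal J"
 shows "hilbert_function J n = card {m. mdeg m = n \<and> m \<notin> lead_mons J}"
proof -
 have "{m. mdeg m = n \<and> m \<notin> lead_mons J} = {m. mdeg m = n} - {m \<in> lead_mons J. mdeg m = n}" by auto
 thus ?thesis
  unfolding hilbert_function_def dim_ideal_forms[OF assms] dim_forms
  by (simp add: card_Diff_subset[OF finite_subset[OF _ finite_mdeg[of n]]] Collect_mono)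
qed

section \<open>Hilbert series modulo a nonzerodivisor\<close>

text \<open>The Hilbert function of \<open>K[x,y]\<close> modulo the monomial ideal with exponent set \<open>E\<close>.\<close>

definition std_count :: "(nat \<Rightarrow> nat \<Rightarrow> bool) \<Rightarrow> nat \<Rightarrow> nat" where
 "std_count E k = card {a. a \<le> k \<and> \<not> E a (k - a)}"

definition z_extended :: "(3 \<Rightarrow>\<^sub>0 nat) set \<Rightarrow> bool" where
 "z_extended T \<longleftrightarrow> (\<forall>a b c. mS a b c \<in> T \<longleftrightarrow> mS a b 0 \<in> T)"

lemma hilbert_function_z_extended:
 fixes J :: "'a::field ring_S set"
 assumes "homogeneous_ideal J" "z_extended (lead_mons J)"
 shows "hilbert_function J n = (\<Sum>k\<le>n. std_count (\<lambda>a b. mS a b 0 \<in> lead_mons J) k)"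
proof -
 let ?E = "\<lambda>a b. mS a b 0 \<in> lead_mons J"
 let ?S = "SIGMA k:{..n}. {a. a \<le> k \<and> \<not> ?E a (k - a)}"
 have "bij_betw (\<lambda>(k, a). mS a (k - a) (n - k)) ?S {m. mdeg m = n \<and> m \<notin> lead_mons J}"
  unfolding bij_betw_def
 proof
  show "inj_on (\<lambda>(k, a). mS a (k - a) (n - k)) ?S" by (auto simp: inj_on_def)
  show "(\<lambda>(k, a). mS a (k - a) (n - k)) ` ?S = {m. mdeg m = n \<and> m \<notin> lead_mons J}"
  proof (intro equalityI subsetI)
   fix m assume "m \<in> (\<lambda>(k, a). mS a (k - a) (n - k)) ` ?S"
   thus "m \<in> {m. mdeg m = n \<and> m \<notin> lead_mons J}"
    using assms(2) by (auto simp: z_extended_def)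
  next
   fix m assume m: "m \<in> {m. mdeg m = n \<and> m \<notin> lead_mons J}"
   obtain a b c where abc: "m = mS a b c" by (rule mS_cases)
   have "m = (\<lambda>(k, a). mS a (k - a) (n - k)) (a + b, a)" "(a + b, a) \<in> ?S"
    using m assms(2) unfolding abc z_extended_def by auto
   thus "m \<in> (\<lambda>(k, a). mS a (k - a) (n - k)) ` ?S" by blast
  qed
 qed
 hence "card {m. mdeg m = n \<and> m \<notin> lead_mons J} = card ?S"
  by (rule bij_betw_same_card[symmetric])
 also have "\<dots> = (\<Sum>k\<le>n. std_count ?E k)"
  unfolding std_count_def by (subst card_SigmaI) auto
 finally show ?thesis using hilbert_function_lead_mons[OF assms(1)] by simp
qed

lemma fps_times_one_minus_X_nth:
 "fps_nth (F * (1 - fps_X)) n = fps_nth F n - (if n = 0 then 0 else fps_nth F (n - 1))" for F :: "int fps"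
 by (simp add: right_diff_distrib)

lemma hilbert_series_z_extended:
 fixes J :: "'a::field ring_S set"
 assumes "homogeneous_ideal J" "z_extended (lead_mons J)"
 shows "hilbert_series J * (1 - fps_X) = Abs_fps (\<lambda>k. int (std_count (\<lambda>a b. mS a b 0 \<in> lead_mons J) k))"
proof (rule fps_ext)
 fix n
 show "fps_nth (hilbert_series J * (1 - fps_X)) n =
   fps_nth (Abs_fps (\<lambda>k. int (std_count (\<lambda>a b. mS a b 0 \<in> lead_mons J) k))) n"
  unfolding fps_times_one_minus_X_nth hilbert_series_def
  by (cases n) (simp_all add: hilbert_function_z_extended[OF assms])
qed

lemma divide_by_z:
 fixes f :: "'a::comm_ring_1 ring_S"
 assumes "\<And>m. m \<in> keys f \<Longrightarrow> lookup m 2 > 0"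
 shows "\<exists>g. f = zS * g"
proof -
 let ?g = "\<Sum>m\<in>keys f. single (mS (lookup m 0) (lookup m 1) (lookup m 2 - 1)) (lookup f m)"
 have "zS * ?g = (\<Sum>m\<in>keys f. single m (lookup f m))"
  unfolding sum_distrib_left
 proof (rule sum.cong)
  fix m assume "m \<in> keys f"
  from assms[OF this] show "zS * single (mS (lookup m 0) (lookup m 1) (lookup m 2 - 1)) (lookup f m) =
    single m (lookup f m)"
   by (cases m rule: mS_cases) (simp add: Var_S mult_single mS_add)
 qed simp
 hence "f = zS * ?g" by (simp only: mpoly_as_sum[symmetric])
 thus ?thesis by (rule exI)
qed

text \<open>In degree reverse lexicographic order, \<open>z\<close> divides a form as soon as it divides its leading
 monomial. So if \<open>z\<close> is a nonzerodivisor, it can be cancelled in the leading monomials.\<close>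

lemma nonzerodivisor_imp_z_extended:
 fixes J :: "'a::field ring_S set"
 assumes J: "homogeneous_ideal J" and z: "nonzerodivisor_on_quotient zS J"
 shows "z_extended (lead_mons J)"
proof -
 have id: "is_ideal J" using J by (rule homogeneous_ideal_is_ideal)
 have down: "mS a b c \<in> lead_mons J" if c: "mS a b (Suc c) \<in> lead_mons J" for a b c
 proof -
  let ?n = "a + b + Suc c"
  obtain f where f: "f \<in> J" "f \<in> forms ?n" "lead (rank_drl ?n) (mS a b (Suc c)) f"
   using c unfolding lead_mons_homogeneous[OF J] by auto
  have lm: "is_leading_monomial (mS a b (Suc c)) f" using f lead_rank_drl_iff by blast
  have "lookup m 2 > 0" if m: "m \<in> keys f" for m
  proof -
   obtain a' b' c' where m': "m = mS a' b' c'" by (rule mS_cases)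
   have "mdeg m = ?n" using f m by (auto simp: forms_def)
   moreover have "m = mS a b (Suc c) \<or> drl_less m (mS a b (Suc c))"
    using lm m unfolding is_leading_monomial_def by blast
   ultimately show ?thesis unfolding m' by (auto simp: drl_less_mS)
  qed
  then obtain g where g: "f = zS * g" using divide_by_z by blast
  hence "g \<in> J" using z f unfolding nonzerodivisor_on_quotient_def by blast
  moreover have "is_leading_monomial (mS a b c) g"
   using lm is_leading_monomial_times[of "mS 0 0 1" "mS a b c" g]
   by (simp add: g Var_S monomial_def mS_add)
  ultimately show ?thesis by (auto simp: lead_mons_def)
 qed
 have "mS a b 0 \<in> lead_mons J" if "mS a b c \<in> lead_mons J" for a b c
  using that by (induction c) (auto dest: down)
 moreover have "mS a b c \<in> lead_mons J" if "mS a b 0 \<in> lead_mons J" for a b c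
  using lead_mons_add[OF id that, of "mS 0 0 c"] by (simp add: mS_add)
 ultimately show ?thesis unfolding z_extended_def by blast
qed

text \<open>Conversely, if the initial ideal is extended from \<open>K[x,y]\<close>, a normal form is annihilated
 by \<open>z\<close> only if it is zero.\<close>

lemma z_extended_imp_nonzerodivisor:
 fixes J :: "'a::field ring_S set"
 assumes J: "homogeneous_ideal J" and ext: "z_extended (lead_mons J)"
 shows "nonzerodivisor_on_quotient zS J"
 unfolding nonzerodivisor_on_quotient_def
proof (intro allI impI)
 fix g assume zg: "zS * g \<in> J"
 have id: "is_ideal J" using J by (rule homogeneous_ideal_is_ideal)
 have h: "hcomp n g \<in> J" for n
 proof -
  have "hcomp (Suc n) (g * zS) = hcomp n g * zS"
   using hcomp_mult_form[OF forms_Var, of "Suc n" g 2] by simp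
  hence zh: "zS * hcomp n g \<in> J"
   using homogeneous_ideal_hcomp[OF J zg, of "Suc n"] by (simp add: mult.commute)
  obtain v where v: "v \<in> J" "v \<in> forms n" "keys (hcomp n g - v) \<subseteq> {m. mdeg m = n} - lead_mons J"
   using normal_form[OF J hcomp_forms] by blast
  let ?r = "hcomp n g - v"
  have "zS * ?r \<in> J"
   using zh v(1) id by (simp add: right_diff_distrib ring_module.subspace_diff ring_module.subspace_scale)
  moreover have "?r = 0"
  proof (rule ccontr)
   assume r0: "?r \<noteq> 0"
   have "inj_on (rank_drl n) (keys ?r)"
    by (rule inj_on_subset[OF inj_rank_drl]) (use v(3) in blast)
   then obtain m where m: "lead (rank_drl n) m ?r" using lead_exists r0 by blast
   have "?r \<in> forms n" using v(2) hcomp_forms forms_diff by blast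
   hence "is_leading_monomial m ?r" using m lead_rank_drl_iff by blast
   hence "is_leading_monomial (mS 0 0 1 + m) (zS * ?r)"
    using is_leading_monomial_times[of "mS 0 0 1" m ?r] by (simp add: Var_S monomial_def)
   with \<open>zS * ?r \<in> J\<close> have "mS 0 0 1 + m \<in> lead_mons J" by (auto simp: lead_mons_def)
   moreover obtain a b c where abc: "m = mS a b c" by (rule mS_cases)
   ultimately have "mS a b (Suc c) \<in> lead_mons J" by (simp add: mS_add)
   hence "mS a b 0 \<in> lead_mons J" using ext unfolding z_extended_def by blast
   hence "m \<in> lead_mons J" using ext unfolding z_extended_def abc by blast
   with m v(3) show False by (auto simp: lead_def)
  qed
  ultimately show ?thesis using v by simp
 qed
 obtain N where "\<forall>m\<in>keys g. mdeg m \<le> N" using mdeg_bound by blast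
 hence "g = (\<Sum>n\<le>N. hcomp n g)" by (intro sum_hcomp) auto
 moreover have "(\<Sum>n\<le>N. hcomp n g) \<in> J" by (rule ring_module.subspace_sum[OF id h])
 ultimately show "g \<in> J" by (simp only:)
qed

text \<open>Macaulay's bound in two variables: multiplication by \<open>x\<close> and \<open>y\<close> increases the number of
 monomials of a monomial ideal in each degree by at least one.\<close>

lemma std_count_bounds:
 assumes up: "\<And>a b. E a b \<Longrightarrow> E (Suc a) b \<and> E a (Suc b)"
 shows "std_count E k \<le> k + 1" "std_count E k \<le> k \<Longrightarrow> std_count E (Suc k) \<le> std_count E k"
proof -
 let ?A = "\<lambda>k. {a. a \<le> k \<and> E a (k - a)}"
 have std: "std_count E k + card (?A k) = k + 1" for k
 proof -
  have "card ({a. a \<le> k \<and> \<not> E a (k - a)} \<union> ?A k) = std_count E k + card (?A k)"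
   unfolding std_count_def by (rule card_Un_disjoint) auto
  moreover have "{a. a \<le> k \<and> \<not> E a (k - a)} \<union> ?A k = {..k}" by auto
  ultimately show ?thesis by simp
 qed
 show "std_count E k \<le> k + 1" using std[of k] by simp
 assume "std_count E k \<le> k"
 hence "card (?A k) \<noteq> 0" using std[of k] by linarith
 hence ne: "?A k \<noteq> {}" by (rule contrapos_nn) (simp only: card.empty)
 have fin: "finite (?A k)" by simp
 have "insert (Min (?A k)) (Suc ` ?A k) \<subseteq> ?A (Suc k)"
 proof -
  have "Min (?A k) \<in> ?A k" using fin ne by (rule Min_in)
  moreover have "a \<in> ?A (Suc k)" "Suc a \<in> ?A (Suc k)" if "a \<in> ?A k" for a
   using that up[of a "k - a"] by (auto simp: Suc_diff_le)
  ultimately show ?thesis by blast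
 qed
 moreover have "Min (?A k) \<notin> Suc ` ?A k"
 proof
  assume "Min (?A k) \<in> Suc ` ?A k"
  then obtain a where "a \<in> ?A k" "Min (?A k) = Suc a" by blast
  thus False using Min_le[OF fin] by fastforce
 qed
 ultimately have "card (?A k) + 1 \<le> card (?A (Suc k))"
  using card_mono[of "?A (Suc k)" "insert (Min (?A k)) (Suc ` ?A k)"] fin
  by (simp add: card_image)
 thus "std_count E (Suc k) \<le> std_count E k" using std[of k] std[of "Suc k"] by linarith
qed

section \<open>Graded relation systems over a staircase\<close>

text \<open>The form of degree \<open>u\<close> in \<open>y, z\<close> with dehomogenization \<open>p\<close>; its coefficient at \<open>y\<close> to the \<open>u\<close> is the
 part that survives modulo \<open>z\<close>.\<close>

definition hm :: "nat \<Rightarrow> 'a::comm_ring_1 poly \<Rightarrow> 'a ring_S" where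
 "hm u p = (\<Sum>e\<le>u. single (mS 0 e (u - e)) (coeff p e))"

lemma hm_forms: "hm u p \<in> forms u"
 unfolding hm_def
proof (rule forms_sum)
 fix e assume "e \<in> {..u}"
 thus "single (mS 0 e (u - e)) (coeff p e) \<in> forms u"
  using forms_single[of "mS 0 e (u - e)" "coeff p e"] by simp
qed

lemma lookup_hm_times_level:
 assumes "\<And>a b c. c < s \<Longrightarrow> lookup f (mS a b c) = 0"
 shows "lookup (hm u p * f) (mS a b s) =
  (if u \<le> b then coeff p u * lookup f (mS a (b - u) s) else 0)"
proof -
 have "lookup (hm u p * f) (mS a b s) =
   (\<Sum>e\<le>u. if e = u then (if u \<le> b then coeff p u * lookup f (mS a (b - u) s) else 0) else 0)"
  unfolding hm_def sum_distrib_right lookup_sum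
 proof (rule sum.cong)
  fix e assume e: "e \<in> {..u}"
  show "lookup (single (mS 0 e (u - e)) (coeff p e) * f) (mS a b s) =
   (if e = u then (if u \<le> b then coeff p u * lookup f (mS a (b - u) s) else 0) else 0)"
  proof (cases "e = u")
   case True
   thus ?thesis by (simp add: lookup_mS_times)
  next
   case False
   hence "s - (u - e) < s \<or> \<not> u - e \<le> s" using e by auto
   thus ?thesis using False assms by (auto simp: lookup_mS_times)
  qed
 qed simp
 thus ?thesis by simp
qed

lemma hm_0 [simp]: "hm u 0 = 0"
 by (simp add: hm_def)

lemma hm_add: "hm u (p + q) = hm u p + hm u q"
 by (simp add: hm_def single_add sum.distrib)

lemma hm_diff: "hm u (p - q) = hm u p - hm u q"
 by (simp add: hm_def single_diff sum_subtractf)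

text \<open>A monomial ideal with corners \<open>x^(t - k) y^(m k)\<close>; \<open>D k\<close> below is the degree of the \<open>k\<close>-th corner.\<close>

locale staircase =
 fixes t :: nat and m :: "nat \<Rightarrow> nat"
 assumes m_0: "m 0 = 0" and m_less: "\<And>i. i < t \<Longrightarrow> m i < m (Suc i)" and t_pos: "0 < t"
begin

definition D :: "nat \<Rightarrow> nat" where
 "D k = t - k + m k"

definition graded :: "(nat \<Rightarrow> nat \<Rightarrow> 'a::field poly) \<Rightarrow> bool" where
 "graded C \<longleftrightarrow> (\<forall>k\<le>t. \<forall>j\<in>{1..t}. C k j \<noteq> 0 \<longrightarrow> D k \<le> D j + 1 \<and> degree (C k j) \<le> D j + 1 - D k)"

text \<open>Modulo \<open>z\<close>, the part above the diagonal of \<open>x f j = \<Sum>k C k j f k\<close> is the power of \<open>y\<close> on \<open>f (j - 1)\<close>.\<close>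

definition triangular :: "(nat \<Rightarrow> nat \<Rightarrow> 'a::field poly) \<Rightarrow> bool" where
 "triangular C \<longleftrightarrow> (\<forall>j\<in>{1..t}. \<forall>k<j. coeff (C k j) (D j + 1 - D k) = (if k = j - 1 then 1 else 0))"

definition relation :: "(nat \<Rightarrow> 'a::field ring_S) \<Rightarrow> (nat \<Rightarrow> nat \<Rightarrow> 'a poly) \<Rightarrow> bool" where
 "relation f C \<longleftrightarrow> (\<forall>j\<in>{1..t}. xS * f j = (\<Sum>k\<le>t. hm (D j + 1 - D k) (C k j) * f k))"

definition stairs :: "(3 \<Rightarrow>\<^sub>0 nat) set" where
 "stairs = {\<mu>. m (t - lookup \<mu> 0) \<le> lookup \<mu> 1}"

definition stair_basis :: "(nat \<Rightarrow> 'a::field ring_S) \<Rightarrow> bool" where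
 "stair_basis f \<longleftrightarrow> (\<forall>k\<le>t. f k \<in> forms (D k) \<and> lookup (f k) (mS (t - k) (m k) 0) = 1 \<and>
  (\<forall>a b. t - k < a \<longrightarrow> lookup (f k) (mS a b 0) = 0))"

lemma m_mono: "i \<le> j \<Longrightarrow> j \<le> t \<Longrightarrow> m i + (j - i) \<le> m j"
proof (induction j rule: dec_induct)
 case (step n)
 thus ?case using m_less[of n] by simp
qed simp

lemma D_mono: "i \<le> j \<Longrightarrow> j \<le> t \<Longrightarrow> D i \<le> D j"
 using m_mono[of i j] unfolding D_def by linarith

lemma D_step: "1 \<le> j \<Longrightarrow> j \<le> t \<Longrightarrow> D j + 1 - D (j - 1) = m j - m (j - 1) \<and> D (j - 1) \<le> D j + 1"
 using m_mono[of "j - 1" j] unfolding D_def by auto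

lemma mS_in_stairs: "mS a b c \<in> stairs \<longleftrightarrow> m (t - a) \<le> b"
 by (simp add: stairs_def)

lemma level_equation:
 assumes rel: "relation f C" and tri: "triangular C" and j: "j \<in> {1..t}"
  and zord: "\<forall>k a b c. k \<le> t \<longrightarrow> c < s \<longrightarrow> lookup (f k) (mS a b c) = 0"
 shows "(if a = 0 then 0 else lookup (f j) (mS (a - 1) b s)) =
  (if m j - m (j - 1) \<le> b then lookup (f (j - 1)) (mS a (b - (m j - m (j - 1))) s) else 0) +
  (\<Sum>k\<in>{j..t}. if D j + 1 - D k \<le> b
   then coeff (C k j) (D j + 1 - D k) * lookup (f k) (mS a (b - (D j + 1 - D k)) s) else 0)"
proof -
 let ?T = "\<lambda>k. if D j + 1 - D k \<le> b
   then coeff (C k j) (D j + 1 - D k) * lookup (f k) (mS a (b - (D j + 1 - D k)) s) else 0"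
 have "(if a = 0 then 0 else lookup (f j) (mS (a - 1) b s)) = lookup (xS * f j) (mS a b s)"
  by (simp add: Var_S lookup_mS_times)
 also have "\<dots> = (\<Sum>k\<le>t. lookup (hm (D j + 1 - D k) (C k j) * f k) (mS a b s))"
  using rel j unfolding relation_def by (simp add: lookup_sum)
 also have "\<dots> = (\<Sum>k\<le>t. ?T k)"
  by (rule sum.cong[OF refl]) (simp add: lookup_hm_times_level zord)
 also have "{..t} = insert (j - 1) ({..<j - 1} \<union> {j..t})" using j by auto
 also have "(\<Sum>k\<in>insert (j - 1) ({..<j - 1} \<union> {j..t}). ?T k) =
   ?T (j - 1) + (\<Sum>k\<in>{..<j - 1} \<union> {j..t}. ?T k)"
  using j by (intro sum.insert) auto
 also have "(\<Sum>k\<in>{..<j - 1} \<union> {j..t}. ?T k) = (\<Sum>k<j - 1. ?T k) + (\<Sum>k\<in>{j..t}. ?T k)"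
  by (rule sum.union_disjoint) auto
 also have "(\<Sum>k<j - 1. ?T k) = 0"
  using tri j unfolding triangular_def by (intro sum.neutral) auto
 also have "?T (j - 1) = (if m j - m (j - 1) \<le> b then lookup (f (j - 1)) (mS a (b - (m j - m (j - 1))) s) else 0)"
 proof -
  have "coeff (C (j - 1) j) (D j + 1 - D (j - 1)) = 1"
   using tri j unfolding triangular_def by auto
  moreover have "D j + 1 - D (j - 1) = m j - m (j - 1)" using D_step[of j] j by simp
  ultimately show ?thesis by simp
 qed
 finally show ?thesis by simp
qed

text \<open>Read at the lowest power of \<open>z\<close>, the relations determine \<open>f (j - 1)\<close> by the later entries;
 each step multiplies by \<open>x\<close> and divides by a power of \<open>y\<close>. The two lemmas below follow the
 powers of \<open>x\<close> in this recursion.\<close>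

lemma level_vanish:
 assumes rel: "relation f C" and tri: "triangular C"
  and zord: "\<forall>k a b c. k \<le> t \<longrightarrow> c < s \<longrightarrow> lookup (f k) (mS a b c) = 0"
  and top: "\<forall>a b. (a0::int) \<le> int a \<longrightarrow> lookup (f t) (mS a b s) = 0"
 shows "k \<le> t \<Longrightarrow> a0 + int (t - k) \<le> int a \<Longrightarrow> lookup (f k) (mS a b s) = 0"
proof (induction "t - k" arbitrary: k a b rule: less_induct)
 case less
 show ?case
 proof (cases "k = t")
  case True
  thus ?thesis using less.prems top by simp
 next
  case False
  let ?j = "Suc k"
  let ?d = "m ?j - m (?j - 1)"
  have j: "?j \<in> {1..t}" using False less.prems by auto
  have "a \<noteq> 0 \<Longrightarrow> lookup (f ?j) (mS (a - 1) (b + ?d) s) = 0"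
   using less.prems False by (intro less.hyps) auto
  moreover have "lookup (f k') (mS a b' s) = 0" if "k' \<in> {?j..t}" for k' b'
   using that less.prems False by (intro less.hyps) auto
  ultimately show ?thesis
   using level_equation[OF rel tri j zord, of a "b + ?d"] by (simp cong: if_cong)
 qed
qed

lemma level_lead:
 assumes rel: "relation f C" and tri: "triangular C"
  and zord: "\<forall>k a b c. k \<le> t \<longrightarrow> c < s \<longrightarrow> lookup (f k) (mS a b c) = 0"
  and top: "\<forall>a b. a0 < a \<longrightarrow> lookup (f t) (mS a b s) = 0"
 shows "k \<le> t \<Longrightarrow> (\<forall>b. lookup (f k) (mS (a0 + (t - k)) b s) = lookup (f t) (mS a0 (b + (m t - m k)) s)) \<and>
  (\<forall>b < m t - m k. lookup (f t) (mS a0 b s) = 0)"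
proof (induction "t - k" arbitrary: k)
 case 0
 thus ?case by simp
next
 case (Suc i)
 let ?j = "Suc k"
 let ?d = "m ?j - m k"
 define a where "a = a0 + (t - k)"
 have j: "?j \<in> {1..t}" "?j \<le> t" "i = t - ?j" using Suc by auto
 note IH = Suc.hyps(1)[OF j(3,2)]
 have mm: "m ?j \<le> m t" "m k \<le> m ?j" using m_mono[of ?j t] m_mono[of k ?j] j by auto
 have a: "a \<noteq> 0" "a - 1 = a0 + (t - ?j)" using j unfolding a_def by auto
 have van: "lookup (f k') (mS a b' s) = 0" if "k' \<in> {?j..t}" for k' b'
  by (rule level_vanish[OF rel tri zord, of "int a0 + 1"]) (use that j top in \<open>auto simp: a_def\<close>)
 have eq: "lookup (f ?j) (mS (a0 + (t - ?j)) b s) =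
   (if ?d \<le> b then lookup (f k) (mS a (b - ?d) s) else 0)" for b
 proof -
  have "(\<Sum>k'\<in>{?j..t}. if D ?j + 1 - D k' \<le> b then coeff (C k' ?j) (D ?j + 1 - D k') *
    lookup (f k') (mS a (b - (D ?j + 1 - D k')) s) else 0) = 0"
   by (rule sum.neutral) (use van in auto)
  thus ?thesis
   using level_equation[OF rel tri j(1) zord, of a b] a(1) unfolding a(2) by simp
 qed
 show ?case
 proof (intro conjI allI impI)
  fix b
  have "lookup (f k) (mS a b s) = lookup (f ?j) (mS (a0 + (t - ?j)) (b + ?d) s)"
   using eq[of "b + ?d"] by simp
  also have "\<dots> = lookup (f t) (mS a0 (b + ?d + (m t - m ?j)) s)" using IH by blast
  also have "b + ?d + (m t - m ?j) = b + (m t - m k)" using mm by simp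
  finally show "lookup (f k) (mS (a0 + (t - k)) b s) = lookup (f t) (mS a0 (b + (m t - m k)) s)"
   by (simp only: a_def)
 next
  fix b assume b: "b < m t - m k"
  show "lookup (f t) (mS a0 b s) = 0"
  proof (cases "b < m t - m ?j")
   case True
   thus ?thesis using IH by blast
  next
   case False
   hence "b = (b - (m t - m ?j)) + (m t - m ?j)" "b - (m t - m ?j) < ?d" using b mm by auto
   thus ?thesis using IH eq[of "b - (m t - m ?j)"] by (metis not_le)
  qed
 qed
qed

text \<open>Since \<open>f (j - 1)\<close> arises from \<open>f j\<close> by a factor \<open>x\<close> and a power of \<open>y\<close> at level \<open>z = 0\<close>, the shape of
 the last element alone forces the leading monomials of all of them.\<close>

lemma stair_basisI:
 assumes rel: "relation f C" and tri: "triangular C"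
  and forms: "\<And>k. k \<le> t \<Longrightarrow> f k \<in> forms (D k)"
  and last: "lookup (f t) (mS 0 (m t) 0) = 1" "\<And>a b. 0 < a \<Longrightarrow> lookup (f t) (mS a b 0) = 0"
 shows "stair_basis f"
 unfolding stair_basis_def
proof (intro allI impI conjI)
 fix k assume k: "k \<le> t"
 show "f k \<in> forms (D k)" by (rule forms[OF k])
 have "lookup (f k) (mS (0 + (t - k)) (m k) 0) = lookup (f t) (mS 0 (m k + (m t - m k)) 0)"
  using level_lead[OF rel tri, of 0 0 k] last(2) k by simp
 thus "lookup (f k) (mS (t - k) (m k) 0) = 1" using last(1) m_mono[OF k] by simp
 fix a b assume "t - k < a"
 thus "lookup (f k) (mS a b 0) = 0"
  by (intro level_vanish[OF rel tri, of 0 1]) (use k last(2) in auto)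
qed

text \<open>If a solution were nonzero, its lowest power of \<open>z\<close> would occur in the last entry, with an \<open>x\<close>-free
 monomial divisible by \<open>y\<close> to the \<open>m t\<close>; by degrees this is the excluded one.\<close>

lemma relation_unique:
 assumes rel: "relation e C" and tri: "triangular C"
  and forms: "\<And>k. k \<le> t \<Longrightarrow> e k \<in> forms (D k)"
  and last: "lookup (e t) (mS 0 (m t) 0) = 0"
  and k: "k \<le> t"
 shows "e k = 0"
proof (rule ccontr)
 assume ek: "e k \<noteq> 0"
 define Z where "Z = (\<lambda>c. \<exists>k a b. k \<le> t \<and> lookup (e k) (mS a b c) \<noteq> 0)"
 have "\<exists>c. Z c"
 proof -
  from ek obtain \<mu> where "lookup (e k) \<mu> \<noteq> 0" by (metis poly_mapping_eqI lookup_zero)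
  thus ?thesis using k unfolding Z_def by (cases \<mu> rule: mS_cases) blast
 qed
 then obtain s where s: "Z s" "\<And>c. c < s \<Longrightarrow> \<not> Z c"
  by (metis LeastI_ex not_less_Least)
 have zord: "\<forall>k a b c. k \<le> t \<longrightarrow> c < s \<longrightarrow> lookup (e k) (mS a b c) = 0"
  using s(2) unfolding Z_def by blast
 have top: "lookup (e t) (mS a b s) = 0" for a b
 proof (rule ccontr)
  assume nz: "lookup (e t) (mS a b s) \<noteq> 0"
  define A where "A = {a. \<exists>b. lookup (e t) (mS a b s) \<noteq> 0}"
  have deg: "a + b + s = m t" if "lookup (e t) (mS a b s) \<noteq> 0" for a b
  proof -
   have "mS a b s \<in> keys (e t)" using that by (simp add: in_keys_iff)
   hence "mdeg (mS a b s) = D t" using forms[of t] unfolding forms_def by auto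
   thus ?thesis by (simp add: D_def)
  qed
  have "A \<subseteq> {..m t}" using deg unfolding A_def by fastforce
  hence finA: "finite A" using finite_subset by blast
  have "A \<noteq> {}" using nz unfolding A_def by blast
  hence "Max A \<in> A" using finA by (rule Max_in[rotated])
  then obtain b0 where b0: "lookup (e t) (mS (Max A) b0 s) \<noteq> 0" unfolding A_def by blast
  have "\<forall>a b. Max A < a \<longrightarrow> lookup (e t) (mS a b s) = 0"
  proof (intro allI impI)
   fix a b assume "Max A < a"
   hence "a \<notin> A" using Max_ge[OF finA, of a] by auto
   thus "lookup (e t) (mS a b s) = 0" unfolding A_def by simp
  qed
  from level_lead[OF rel tri zord this, of 0]
  have "\<forall>b < m t. lookup (e t) (mS (Max A) b s) = 0" by (simp add: m_0)
  hence "m t \<le> b0" using b0 not_less by blast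
  with deg[OF b0] have "Max A = 0" "b0 = m t" "s = 0" by auto
  with b0 last show False by simp
 qed
 from s(1) obtain k a b where kab: "k \<le> t" "lookup (e k) (mS a b s) \<noteq> 0" unfolding Z_def by blast
 have "lookup (e k) (mS a b s) = 0"
  by (rule level_vanish[OF rel tri zord, of "- int t"]) (use top kab(1) in auto)
 with kab(2) show False by simp
qed

lemma stair_basis_lead:
 assumes sb: "stair_basis f" and k: "k \<le> t"
 shows "is_leading_monomial (mS (t - k) (m k) 0) (f k)"
 unfolding is_leading_monomial_def
proof (intro conjI ballI impI)
 have f: "f k \<in> forms (D k)" "lookup (f k) (mS (t - k) (m k) 0) = 1"
  "\<And>a b. t - k < a \<Longrightarrow> lookup (f k) (mS a b 0) = 0"
  using sb k unfolding stair_basis_def by auto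
 show "mS (t - k) (m k) 0 \<in> keys (f k)" using f(2) by (simp add: in_keys_iff)
 fix \<mu> assume \<mu>: "\<mu> \<in> keys (f k)" "\<mu> \<noteq> mS (t - k) (m k) 0"
 obtain a b c where abc: "\<mu> = mS a b c" by (rule mS_cases)
 have deg: "a + b + c = t - k + m k" using f(1) \<mu>(1) unfolding forms_def abc D_def by auto
 have "c > 0 \<or> a \<le> t - k"
 proof (rule ccontr)
  assume "\<not> ?thesis"
  hence "lookup (f k) \<mu> = 0" using f(3)[of a b] unfolding abc by auto
  with \<mu>(1) show False by (simp add: in_keys_iff)
 qed
 thus "drl_less \<mu> (mS (t - k) (m k) 0)"
  using \<mu>(2) deg unfolding abc drl_less_mS by auto
qed

text \<open>The element with leading monomial \<open>\<mu>\<close>: the corner used is the one in the column of \<open>\<mu>\<close>, so that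
 a factor \<open>x\<close> occurs only in front of \<open>f 0\<close>.\<close>

definition stair_elem :: "(nat \<Rightarrow> 'a::field ring_S) \<Rightarrow> (3 \<Rightarrow>\<^sub>0 nat) \<Rightarrow> 'a ring_S" where
 "stair_elem f \<mu> = monomial (mS (lookup \<mu> 0 - t) (lookup \<mu> 1 - m (t - lookup \<mu> 0)) (lookup \<mu> 2)) * f (t - lookup \<mu> 0)"

lemma stair_elem_lead:
 assumes sb: "stair_basis f" and \<mu>: "\<mu> \<in> stairs"
 shows "is_leading_monomial \<mu> (stair_elem f \<mu>)" "stair_elem f \<mu> \<in> forms (mdeg \<mu>)"
proof -
 obtain a b c where abc: "\<mu> = mS a b c" by (rule mS_cases)
 let ?k = "t - a"
 let ?n = "mS (a - t) (b - m ?k) c"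
 have b: "m ?k \<le> b" using \<mu> by (simp add: abc mS_in_stairs)
 have eq: "\<mu> = ?n + mS (t - ?k) (m ?k) 0" unfolding abc mS_add using b by simp
 have el: "stair_elem f \<mu> = monomial ?n * f ?k" by (simp add: stair_elem_def abc)
 show "is_leading_monomial \<mu> (stair_elem f \<mu>)"
  unfolding el by (subst eq) (simp only: is_leading_monomial_times stair_basis_lead[OF sb diff_le_self])
 have fk: "f ?k \<in> forms (D ?k)" using sb unfolding stair_basis_def by auto
 have "mdeg ?n + D ?k = mdeg \<mu>" unfolding abc D_def using b by simp
 thus "stair_elem f \<mu> \<in> forms (mdeg \<mu>)"
  using forms_mult[OF forms_monomial fk, of ?n] unfolding el by simp
qed

lemma stair_elem_yz: "k \<le> t \<Longrightarrow> monomial (mS 0 i j) * f k = stair_elem f (mS (t - k) (m k + i) j)"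
 by (simp add: stair_elem_def)

text \<open>The relations allow one to trade a factor \<open>x\<close> of \<open>f k\<close> for polynomials in \<open>y\<close> and \<open>z\<close>, so
 the span of the elements \<open>stair_elem\<close> is closed under multiplication by \<open>x\<close>.\<close>

lemma span_stair_elem_ideal:
 assumes rel: "relation f C"
 defines "B \<equiv> mpoly_vs.span (stair_elem f ` stairs)"
 shows "is_ideal B"
proof -
 have inB: "stair_elem f \<mu> \<in> B" if "\<mu> \<in> stairs" for \<mu>
  unfolding B_def by (rule mpoly_vs.span_base) (rule imageI[OF that])
 have scaleB: "scale c v \<in> B" if "v \<in> B" for c v
  using that unfolding B_def by (rule mpoly_vs.span_scale)
 have sumB: "sum F A \<in> B" if "\<And>i. i \<in> A \<Longrightarrow> F i \<in> B" for F :: "'z \<Rightarrow> _" and A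
  using that unfolding B_def by (rule mpoly_vs.span_sum)
 have yzB: "monomial (mS 0 i j) * f k \<in> B" if "k \<le> t" for i j k
  unfolding stair_elem_yz[OF that] using that by (intro inB) (simp add: mS_in_stairs)
 have single: "single \<nu> c * v \<in> B" if "monomial \<nu> * v \<in> B" for \<nu> c v
  using scaleB[OF that, of c] by (simp add: scale_single monomial_def scale_mult_left[symmetric])
 have hmB: "monomial (mS 0 i j) * (hm u p * f k) \<in> B" if "k \<le> t" for i j u p k
 proof -
  have "monomial (mS 0 i j) * (hm u p * f k) =
    (\<Sum>e\<le>u. single (mS 0 (i + e) (j + (u - e))) (coeff p e) * f k)"
   unfolding hm_def sum_distrib_right sum_distrib_left monomial_def mult.assoc[symmetric] mult_single mS_add
   by simp
  thus ?thesis using single[OF yzB[OF that]] by (simp add: sumB)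
 qed
 have linear: "r * v \<in> B" if "v \<in> B" "\<And>\<mu>. \<mu> \<in> stairs \<Longrightarrow> r * stair_elem f \<mu> \<in> B" for r v
  using that(1) unfolding B_def
 proof (induction rule: mpoly_vs.span_induct_alt)
  case base
  show ?case by (simp add: mpoly_vs.span_zero)
 next
  case (step c x y)
  hence "r * x \<in> B" using that(2) by blast
  hence "scale c (r * x) + r * y \<in> B"
   using step(2) unfolding B_def by (intro mpoly_vs.span_add mpoly_vs.span_scale)
  thus ?case unfolding B_def by (simp add: distrib_left scale_mult_right)
 qed
 have stepxyz: "monomial (mS 1 0 0) * v \<in> B" "monomial (mS 0 1 0) * v \<in> B" "monomial (mS 0 0 1) * v \<in> B"
  if v: "v \<in> B" for v
 proof -
  show "monomial (mS 0 1 0) * v \<in> B"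
  proof (rule linear[OF v])
   fix \<mu> assume \<mu>: "\<mu> \<in> stairs"
   obtain a b c where abc: "\<mu> = mS a b c" by (rule mS_cases)
   have b: "m (t - a) \<le> b" using \<mu> by (simp add: abc mS_in_stairs)
   have "monomial (mS 0 1 0) * stair_elem f \<mu> = stair_elem f (mS a (Suc b) c)"
    using b by (simp add: stair_elem_def abc monomial_def mult.assoc[symmetric] mult_single mS_add Suc_diff_le)
   thus "monomial (mS 0 1 0) * stair_elem f \<mu> \<in> B"
    using b by (simp add: inB mS_in_stairs)
  qed
  show "monomial (mS 0 0 1) * v \<in> B"
  proof (rule linear[OF v])
   fix \<mu> assume \<mu>: "\<mu> \<in> stairs"
   obtain a b c where abc: "\<mu> = mS a b c" by (rule mS_cases)
   have b: "m (t - a) \<le> b" using \<mu> by (simp add: abc mS_in_stairs)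
   have "monomial (mS 0 0 1) * stair_elem f \<mu> = stair_elem f (mS a b (Suc c))"
    using b by (simp add: stair_elem_def abc monomial_def mult.assoc[symmetric] mult_single mS_add)
   thus "monomial (mS 0 0 1) * stair_elem f \<mu> \<in> B"
    using b by (simp add: inB mS_in_stairs)
  qed
  show "monomial (mS 1 0 0) * v \<in> B"
  proof (rule linear[OF v])
   fix \<mu> assume \<mu>: "\<mu> \<in> stairs"
   obtain a b c where abc: "\<mu> = mS a b c" by (rule mS_cases)
   have b: "m (t - a) \<le> b" using \<mu> by (simp add: abc mS_in_stairs)
   show "monomial (mS 1 0 0) * stair_elem f \<mu> \<in> B"
   proof (cases "t \<le> a")
    case True
    hence "monomial (mS 1 0 0) * stair_elem f \<mu> = stair_elem f (mS (Suc a) b c)"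
     by (simp add: stair_elem_def abc monomial_def mult.assoc[symmetric] mult_single mS_add Suc_diff_le)
    moreover have "mS (Suc a) b c \<in> stairs" using True by (simp add: mS_in_stairs m_0)
    ultimately show ?thesis by (simp add: inB)
   next
    case False
    let ?k = "t - a"
    have k: "?k \<in> {1..t}" using False by auto
    have "monomial (mS 1 0 0) * stair_elem f \<mu> = monomial (mS 0 (b - m ?k) c) * (xS * f ?k)"
     using False by (simp add: stair_elem_def abc Var_S monomial_def mult.assoc[symmetric] mult_single mS_add)
    also have "\<dots> = (\<Sum>l\<le>t. monomial (mS 0 (b - m ?k) c) * (hm (D ?k + 1 - D l) (C l ?k) * f l))"
     using rel k unfolding relation_def by (simp add: sum_distrib_left)
    finally have eq: "monomial (mS 1 0 0) * stair_elem f \<mu> =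
      (\<Sum>l\<le>t. monomial (mS 0 (b - m ?k) c) * (hm (D ?k + 1 - D l) (C l ?k) * f l))" .
    show ?thesis unfolding eq by (rule sumB) (rule hmB, simp)
   qed
  qed
 qed
 have powx: "monomial (mS i 0 0) * v \<in> B" if "v \<in> B" for i v
 proof (induction i)
  case (Suc i)
  have eq: "monomial (mS (Suc i) 0 0) * v = monomial (mS 1 0 0) * (monomial (mS i 0 0) * v)"
   by (simp add: monomial_def mult.assoc[symmetric] mult_single mS_add)
  show ?case unfolding eq by (rule stepxyz(1)[OF Suc])
 qed (simp add: mS_0 monomial_def that)
 have powy: "monomial (mS 0 i 0) * v \<in> B" if "v \<in> B" for i v
 proof (induction i)
  case (Suc i)
  have eq: "monomial (mS 0 (Suc i) 0) * v = monomial (mS 0 1 0) * (monomial (mS 0 i 0) * v)"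
   by (simp add: monomial_def mult.assoc[symmetric] mult_single mS_add)
  show ?case unfolding eq by (rule stepxyz(2)[OF Suc])
 qed (simp add: mS_0 monomial_def that)
 have powz: "monomial (mS 0 0 i) * v \<in> B" if "v \<in> B" for i v
 proof (induction i)
  case (Suc i)
  have eq: "monomial (mS 0 0 (Suc i)) * v = monomial (mS 0 0 1) * (monomial (mS 0 0 i) * v)"
   by (simp add: monomial_def mult.assoc[symmetric] mult_single mS_add)
  show ?case unfolding eq by (rule stepxyz(3)[OF Suc])
 qed (simp add: mS_0 monomial_def that)
 have mon: "monomial \<nu> * v \<in> B" if "v \<in> B" for \<nu> v
 proof -
  obtain i j k where ijk: "\<nu> = mS i j k" by (rule mS_cases)
  have eq: "monomial \<nu> * v = monomial (mS i 0 0) * (monomial (mS 0 j 0) * (monomial (mS 0 0 k) * v))"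
   by (simp add: ijk monomial_def mult.assoc[symmetric] mult_single mS_add)
  show ?thesis unfolding eq by (rule powx[OF powy[OF powz[OF that]]])
 qed
 have "r * v \<in> B" if "v \<in> B" for r v
 proof -
  have "r * v = (\<Sum>\<nu>\<in>keys r. single \<nu> (lookup r \<nu>)) * v"
   by (rule arg_cong2[of _ _ _ _ "(*)", OF mpoly_as_sum refl])
  also have "\<dots> = (\<Sum>\<nu>\<in>keys r. single \<nu> (lookup r \<nu>) * v)" by (rule sum_distrib_right)
  finally show ?thesis using single[OF mon[OF that]] by (simp add: sumB)
 qed
 thus ?thesis
  unfolding ring_module.subspace_def B_def
  by (auto intro: mpoly_vs.span_add mpoly_vs.span_zero)
qed

definition stair_ideal :: "(nat \<Rightarrow> 'a::field ring_S) \<Rightarrow> 'a ring_S set" where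
 "stair_ideal f = ideal_gen (f ` {..t})"

lemma stair_ideal_eq_span:
 assumes rel: "relation f C"
 shows "stair_ideal f = mpoly_vs.span (stair_elem f ` stairs)"
proof
 have "f k \<in> mpoly_vs.span (stair_elem f ` stairs)" if "k \<le> t" for k
 proof -
  have "f k = stair_elem f (mS (t - k) (m k) 0)"
   using stair_elem_yz[OF that, of 0 0 f] by (simp add: mS_0 monomial_def)
  moreover have "mS (t - k) (m k) 0 \<in> stairs" using that by (simp add: mS_in_stairs)
  ultimately show ?thesis by (metis imageI mpoly_vs.span_base)
 qed
 thus "stair_ideal f \<subseteq> mpoly_vs.span (stair_elem f ` stairs)"
  unfolding stair_ideal_def by (intro ring_module.span_minimal span_stair_elem_ideal[OF rel]) auto
 have "stair_elem f \<mu> \<in> stair_ideal f" for \<mu>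
 proof -
  have "f (t - lookup \<mu> 0) \<in> stair_ideal f"
   unfolding stair_ideal_def by (rule ring_module.span_base) simp
  thus ?thesis unfolding stair_elem_def stair_ideal_def by (rule ring_module.span_scale)
 qed
 moreover have "mpoly_vs.subspace (stair_ideal f)"
  unfolding stair_ideal_def by (intro is_ideal_imp_subspace ring_module.subspace_span)
 ultimately show "mpoly_vs.span (stair_elem f ` stairs) \<subseteq> stair_ideal f"
  by (intro mpoly_vs.span_minimal) auto
qed

lemma homogeneous_stair_ideal:
 assumes "stair_basis f"
 shows "homogeneous_ideal (stair_ideal f)"
proof -
 have "f ` {..t} \<subseteq> (\<Union>n. forms n)" using assms unfolding stair_basis_def by blast
 thus ?thesis unfolding homogeneous_ideal_def stair_ideal_def by blast
qed

lemma stair_ideal_degree_span: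
 assumes sb: "stair_basis f" and rel: "relation f C" and g: "g \<in> stair_ideal f"
 shows "hcomp n g \<in> mpoly_vs.span (stair_elem f ` {\<mu> \<in> stairs. mdeg \<mu> = n})"
 using g unfolding stair_ideal_eq_span[OF rel]
proof (induction rule: mpoly_vs.span_induct_alt)
 case base
 show ?case by (simp add: mpoly_vs.span_zero)
next
 case (step c x y)
 then obtain \<mu> where \<mu>: "\<mu> \<in> stairs" "x = stair_elem f \<mu>" by blast
 have "hcomp n x \<in> mpoly_vs.span (stair_elem f ` {\<mu> \<in> stairs. mdeg \<mu> = n})"
  unfolding \<mu>(2) hcomp_of_form[OF stair_elem_lead(2)[OF sb \<mu>(1)]] using \<mu>(1)
  by (auto intro: mpoly_vs.span_base mpoly_vs.span_zero)
 with step show ?case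
  by (simp add: hcomp_add hcomp_scale mpoly_vs.span_add mpoly_vs.span_scale)
qed

text \<open>The elements \<open>stair_elem f \<mu>\<close> span the ideal and have pairwise different leading monomials.\<close>

lemma lead_mons_stair_ideal:
 assumes sb: "stair_basis f" and rel: "relation f C"
 shows "lead_mons (stair_ideal f) = stairs"
proof (intro equalityI subsetI)
 fix \<mu> assume \<mu>: "\<mu> \<in> stairs"
 have "stair_elem f \<mu> \<in> stair_ideal f"
  unfolding stair_ideal_eq_span[OF rel] by (rule mpoly_vs.span_base) (rule imageI[OF \<mu>])
 thus "\<mu> \<in> lead_mons (stair_ideal f)"
  using stair_elem_lead(1)[OF sb \<mu>] unfolding lead_mons_def by blast
next
 fix \<mu> assume "\<mu> \<in> lead_mons (stair_ideal f)"
 then obtain g where g: "g \<in> stair_ideal f" "g \<in> forms (mdeg \<mu>)" "lead (rank_drl (mdeg \<mu>)) \<mu> g"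
  unfolding lead_mons_homogeneous[OF homogeneous_stair_ideal[OF sb]] by blast
 let ?L = "{\<nu> \<in> stairs. mdeg \<nu> = mdeg \<mu>}"
 have "g \<in> mpoly_vs.span (stair_elem f ` ?L)"
  using stair_ideal_degree_span[OF sb rel g(1), of "mdeg \<mu>"] hcomp_of_form[OF g(2), of "mdeg \<mu>"] by simp
 moreover have "g \<noteq> 0" using g(3) unfolding lead_def by auto
 moreover have "finite ?L" by (rule finite_subset[OF _ finite_mdeg[of "mdeg \<mu>"]]) auto
 moreover have "inj_on (rank_drl (mdeg \<mu>)) ?L"
  by (rule inj_on_subset[OF inj_rank_drl]) auto
 moreover have "lead (rank_drl (mdeg \<mu>)) \<nu> (stair_elem f \<nu>)" if "\<nu> \<in> ?L" for \<nu>
 proof -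
  have \<nu>: "\<nu> \<in> stairs" "mdeg \<nu> = mdeg \<mu>" using that by auto
  show ?thesis
   using stair_elem_lead[OF sb \<nu>(1)] lead_rank_drl_iff[of "stair_elem f \<nu>" "mdeg \<mu>" \<nu>] \<nu>(2) by simp
 qed
 ultimately obtain \<nu> where \<nu>: "\<nu> \<in> ?L" "lead (rank_drl (mdeg \<mu>)) \<nu> g"
  using lead_in_span[of ?L "rank_drl (mdeg \<mu>)" "stair_elem f" g] by blast
 have "\<nu> = \<mu>" using \<nu>(2) g(3) unfolding lead_def using less_asym by blast
 with \<nu>(1) show "\<mu> \<in> stairs" by simp
qed

lemma z_extended_stairs: "z_extended stairs"
 unfolding z_extended_def by (simp add: mS_in_stairs)

end

section \<open>Counting minimal generators\<close>

lemma dim_add_family: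
 fixes V W :: "('v, 'a::field) mpoly set" and g :: "'i \<Rightarrow> ('v, 'a) mpoly"
 assumes W: "mpoly_vs.subspace W" and V: "mpoly_vs.subspace V" and WV: "W \<subseteq> V"
  and fin: "finite I" "finite B0" "W \<subseteq> mpoly_vs.span B0" and gV: "\<And>i. i \<in> I \<Longrightarrow> g i \<in> V"
  and gen: "\<And>v. v \<in> V \<Longrightarrow> \<exists>c. v - (\<Sum>i\<in>I. scale (c i) (g i)) \<in> W"
  and ind: "\<And>c. (\<Sum>i\<in>I. scale (c i) (g i)) \<in> W \<Longrightarrow> \<forall>i\<in>I. c i = 0"
 shows "mpoly_vs.dim V = mpoly_vs.dim W + card I"
proof -
 obtain B where B: "B \<subseteq> W" "mpoly_vs.independent B" "W \<subseteq> mpoly_vs.span B" "card B = mpoly_vs.dim W"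
  using mpoly_vs.basis_exists by blast
 have finB: "finite B"
  using mpoly_vs.independent_span_bound[OF fin(2) B(2)] B(1) fin(3) by blast
 have zeroW: "0 \<in> W" using W by (rule mpoly_vs.subspace_0)
 have single_sum: "(\<Sum>k\<in>I. scale (if k = i then 1 else 0) (g k)) = g i" if "i \<in> I" for i
 proof -
  have "(\<Sum>k\<in>I. scale (if k = i then 1 else 0) (g k)) = (\<Sum>k\<in>I. if k = i then g i else 0)"
   by (rule sum.cong) auto
  thus ?thesis using that fin(1) by simp
 qed
 have inj: "inj_on g I"
 proof (rule inj_onI, rule ccontr)
  fix i j assume ij: "i \<in> I" "j \<in> I" "g i = g j" "i \<noteq> j"
  let ?c = "\<lambda>k. (if k = i then 1 else 0) - (if k = j then 1 else 0) :: 'a"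
  have "(\<Sum>k\<in>I. scale (?c k) (g k)) =
    (\<Sum>k\<in>I. scale (if k = i then 1 else 0) (g k) - scale (if k = j then 1 else 0) (g k))"
   by (rule sum.cong[OF refl]) (rule mpoly_vs.scale_left_diff_distrib)
  also have "\<dots> = (\<Sum>k\<in>I. scale (if k = i then 1 else 0) (g k)) - (\<Sum>k\<in>I. scale (if k = j then 1 else 0) (g k))"
   by (rule sum_subtractf)
  also have "\<dots> = 0"
   unfolding single_sum[OF ij(1)] single_sum[OF ij(2)] ij(3) by (rule diff_self)
  finally have sum0: "(\<Sum>k\<in>I. scale (?c k) (g k)) = 0" .
  have "\<forall>k\<in>I. ?c k = 0" by (rule ind) (simp only: sum0 zeroW)
  thus False using ij by auto
 qed
 have disj: "B \<inter> g ` I = {}"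
 proof (rule ccontr)
  assume "B \<inter> g ` I \<noteq> {}"
  then obtain i where i: "i \<in> I" "g i \<in> W" using B(1) by auto
  hence "\<forall>k\<in>I. (if k = i then 1 else 0) = (0::'a)"
   by (intro ind) (simp only: single_sum[OF i(1)] i(2))
  with i(1) show False by auto
 qed
 show ?thesis
 proof (rule mpoly_vs.dim_unique[of "B \<union> g ` I"])
  show "B \<union> g ` I \<subseteq> V" using B(1) WV gV by auto
  show "card (B \<union> g ` I) = mpoly_vs.dim W + card I"
   using card_Un_disjoint[OF finB _ disj] fin(1) card_image[OF inj] B(4) by simp
  show "V \<subseteq> mpoly_vs.span (B \<union> g ` I)"
  proof
   fix v assume "v \<in> V"
   then obtain c where c: "v - (\<Sum>i\<in>I. scale (c i) (g i)) \<in> W" using gen by blast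
   have "mpoly_vs.span B \<subseteq> mpoly_vs.span (B \<union> g ` I)" by (rule mpoly_vs.span_mono) simp
   hence "v - (\<Sum>i\<in>I. scale (c i) (g i)) \<in> mpoly_vs.span (B \<union> g ` I)" using c B(3) by auto
   moreover have "(\<Sum>i\<in>I. scale (c i) (g i)) \<in> mpoly_vs.span (B \<union> g ` I)"
    by (intro mpoly_vs.span_sum mpoly_vs.span_scale mpoly_vs.span_base) simp
   ultimately have "v - (\<Sum>i\<in>I. scale (c i) (g i)) + (\<Sum>i\<in>I. scale (c i) (g i)) \<in> mpoly_vs.span (B \<union> g ` I)"
    by (rule mpoly_vs.span_add)
   thus "v \<in> mpoly_vs.span (B \<union> g ` I)" by simp
  qed
  show "mpoly_vs.independent (B \<union> g ` I)"
  proof (rule mpoly_vs.independent_if_scalars_zero)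
   show "finite (B \<union> g ` I)" using finB fin(1) by simp
   fix f x assume s: "(\<Sum>x\<in>B \<union> g ` I. scale (f x) x) = 0" and x: "x \<in> B \<union> g ` I"
   have s1: "(\<Sum>x\<in>B. scale (f x) x) + (\<Sum>i\<in>I. scale (f (g i)) (g i)) = 0"
    using s sum.union_disjoint[OF finB finite_imageI[OF fin(1)] disj, of "\<lambda>x. scale (f x) x"]
    by (simp add: sum.reindex[OF inj])
   hence s2: "(\<Sum>i\<in>I. scale (f (g i)) (g i)) = - (\<Sum>x\<in>B. scale (f x) x)"
    by (simp add: add_eq_0_iff)
   have "(\<Sum>x\<in>B. scale (f x) x) \<in> W"
    using B(1) W by (intro mpoly_vs.subspace_sum[OF W] mpoly_vs.subspace_scale[OF W]) auto
   hence "(\<Sum>i\<in>I. scale (f (g i)) (g i)) \<in> W"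
    unfolding s2 by (rule mpoly_vs.subspace_neg[OF W])
   from ind[OF this] have fI: "\<forall>i\<in>I. f (g i) = 0" .
   hence "(\<Sum>i\<in>I. scale (f (g i)) (g i)) = 0" by simp
   with s1 have "(\<Sum>x\<in>B. scale (f x) x) = 0" by simp
   hence "\<forall>x\<in>B. f x = 0"
    using mpoly_vs.independentD[OF B(2) finB subset_refl] by blast
   with fI x show "f x = 0" by auto
  qed
 qed
qed

text \<open>The part of degree \<open>i + 1\<close> of the product of the irrelevant ideal and \<open>J\<close>.\<close>

definition decomposables :: "('v, 'a::field) mpoly set \<Rightarrow> nat \<Rightarrow> ('v, 'a) mpoly set" where
 "decomposables J i = mpoly_vs.span {Var v * f | v f. f \<in> J \<inter> forms i}"

lemma subspace_decomposables: "mpoly_vs.subspace (decomposables J i)"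
 unfolding decomposables_def by (rule mpoly_vs.subspace_span)

lemma decomposables_subset:
 assumes "is_ideal J"
 shows "decomposables J i \<subseteq> J \<inter> forms (Suc i)"
 unfolding decomposables_def
proof (rule mpoly_vs.span_minimal[OF _ subspace_ideal_forms[OF assms]], rule subsetI)
 fix x assume "x \<in> {Var v * f | v f. f \<in> J \<inter> forms i}"
 then obtain v f where x: "x = Var v * f" "f \<in> J" "f \<in> forms i" by blast
 thus "x \<in> J \<inter> forms (Suc i)"
  using forms_mult[OF forms_Var x(3), of v] ring_module.subspace_scale[OF assms x(2)] by simp
qed

lemma positive_degree_mult_decomposables:
 fixes J :: "('v, 'a::field) mpoly set"
 assumes J: "is_ideal J" and g: "g \<in> J" "g \<in> forms d" and r: "r \<in> forms n" and n: "0 < n" "n + d = Suc i"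
 shows "r * g \<in> decomposables J i"
proof -
 have "monomial \<mu> * g \<in> decomposables J i" if \<mu>: "mdeg \<mu> = n" for \<mu> :: "'v \<Rightarrow>\<^sub>0 nat"
 proof -
  have "\<mu> \<noteq> 0" using \<mu> n by auto
  then obtain v where v: "lookup \<mu> v \<noteq> 0" by (metis poly_mapping_eqI lookup_zero)
  define \<nu> where "\<nu> = \<mu> - single v 1"
  have eq: "\<mu> = single v 1 + \<nu>"
   by (rule poly_mapping_eqI) (use v in \<open>auto simp: \<nu>_def lookup_add lookup_minus lookup_single when_def\<close>)
  have "mdeg \<nu> + d = i" using \<mu> n(2) unfolding eq mdeg_add by simp
  hence "monomial \<nu> * g \<in> forms i" using forms_mult[OF forms_monomial g(2), of \<nu>] by simp
  moreover have "monomial \<nu> * g \<in> J" by (rule ring_module.subspace_scale[OF J g(1)])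
  moreover have "monomial \<mu> * g = Var v * (monomial \<nu> * g)"
   unfolding eq Var_def monomial_def by (simp add: mult_single mult.assoc[symmetric])
  ultimately show ?thesis unfolding decomposables_def by (intro mpoly_vs.span_base) blast
 qed
 hence "scale (lookup r \<mu>) (monomial \<mu> * g) \<in> decomposables J i" if "\<mu> \<in> keys r" for \<mu>
  using that r by (intro mpoly_vs.subspace_scale[OF subspace_decomposables]) (auto simp: forms_def)
 hence "(\<Sum>\<mu>\<in>keys r. scale (lookup r \<mu>) (monomial \<mu> * g)) \<in> decomposables J i"
  by (rule mpoly_vs.subspace_sum[OF subspace_decomposables])
 also have "(\<Sum>\<mu>\<in>keys r. scale (lookup r \<mu>) (monomial \<mu> * g)) = (\<Sum>\<mu>\<in>keys r. scale (lookup r \<mu>) (single \<mu> 1)) * g"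
  by (simp add: sum_distrib_right monomial_def scale_mult_left)
 also have "\<dots> = r * g" by (simp only: mpoly_scale_as_sum[symmetric])
 finally show ?thesis .
qed

lemma finite_dim_forms: "\<exists>B :: ('v::finite, 'a::field) mpoly set. finite B \<and> forms n \<subseteq> mpoly_vs.span B"
proof (intro exI[of _ "monomial ` {m. mdeg m = n}"] conjI subsetI)
 show "finite (monomial ` {m :: 'v \<Rightarrow>\<^sub>0 nat. mdeg m = n} :: ('v, 'a) mpoly set)"
  using finite_mdeg by (rule finite_imageI)
 fix f :: "('v, 'a) mpoly" assume f: "f \<in> forms n"
 have "(\<Sum>m\<in>keys f. scale (lookup f m) (single m 1)) \<in> mpoly_vs.span (monomial ` {m. mdeg m = n})"
  using f unfolding monomial_def forms_def
  by (intro mpoly_vs.span_sum mpoly_vs.span_scale mpoly_vs.span_base) auto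
 thus "f \<in> mpoly_vs.span (monomial ` {m. mdeg m = n})" by (simp only: mpoly_scale_as_sum[symmetric])
qed

text \<open>The graded form of Nakayama's lemma: the elements of degree \<open>i + 1\<close> in a minimal system of
 homogeneous generators are a basis modulo the decomposable elements.\<close>

lemma minimal_generators_dim:
 fixes J :: "('v::finite, 'a::field) mpoly set"
 assumes G: "minimal_homogeneous_generators G J"
 shows "mpoly_vs.dim (J \<inter> forms (Suc i)) =
  mpoly_vs.dim (decomposables J i) + card (G \<inter> forms (Suc i))"
proof -
 let ?j = "Suc i"
 let ?G = "G \<inter> forms ?j"
 have hom: "G \<subseteq> (\<Union>n. forms n)" and gen: "ideal_gen G = J"
  and min: "\<And>G'. G' \<subset> G \<Longrightarrow> ideal_gen G' \<noteq> J"
  using G unfolding minimal_homogeneous_generators_def by auto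
 have J: "is_ideal J" unfolding gen[symmetric] by (rule ring_module.subspace_span)
 have GJ: "g \<in> J" if "g \<in> G" for g unfolding gen[symmetric] using that by (rule ring_module.span_base)
 have redundant: "g \<notin> ideal_gen (G - {g})" if g: "g \<in> G" for g
 proof
  assume red: "g \<in> ideal_gen (G - {g})"
  have "G \<subseteq> ideal_gen (G - {g})"
  proof
   fix x assume x: "x \<in> G"
   show "x \<in> ideal_gen (G - {g})"
    using red x by (cases "x = g") (auto intro: ring_module.span_base)
  qed
  hence "ideal_gen G \<subseteq> ideal_gen (G - {g})"
   by (intro ring_module.span_minimal ring_module.subspace_span)
  moreover have "ideal_gen (G - {g}) \<subseteq> ideal_gen G" by (rule ring_module.span_mono) auto
  ultimately have "ideal_gen (G - {g}) = J" using gen by auto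
  thus False using min[of "G - {g}"] g by auto
 qed
 have decomp_low: "decomposables J i \<subseteq> ideal_gen (G \<inter> (\<Union>k\<le>i. forms k))"
  unfolding decomposables_def
 proof (rule mpoly_vs.span_minimal)
  show "mpoly_vs.subspace (ideal_gen (G \<inter> (\<Union>k\<le>i. forms k)))"
   by (rule is_ideal_imp_subspace[OF ring_module.subspace_span])
  show "{Var v * f | v f. f \<in> J \<inter> forms i} \<subseteq> ideal_gen (G \<inter> (\<Union>k\<le>i. forms k))"
  proof
   fix x assume "x \<in> {Var v * f | v f. f \<in> J \<inter> forms i}"
   then obtain v f where x: "x = Var v * f" "f \<in> J" "f \<in> forms i" by blast
   have "hcomp i f \<in> ideal_gen (G \<inter> (\<Union>k\<le>i. forms k))"
    using hcomp_ideal_gen[OF hom, of f i] x(2) gen by simp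
   hence "f \<in> ideal_gen (G \<inter> (\<Union>k\<le>i. forms k))" using hcomp_of_form[OF x(3), of i] by simp
   thus "x \<in> ideal_gen (G \<inter> (\<Union>k\<le>i. forms k))" unfolding x(1) by (rule ring_module.span_scale)
  qed
 qed
 have low_other: "G \<inter> (\<Union>k\<le>i. forms k) \<subseteq> G - {g}" if g: "g \<in> ?G" for g
 proof -
  have "g \<noteq> 0" using redundant[of g] g ring_module.span_zero by auto
  hence "g \<notin> forms k" if "k \<le> i" for k using forms_unique[of g k ?j] g that by auto
  thus ?thesis by blast
 qed
 have indep: "\<forall>g\<in>T. c g = 0" if T: "finite T" "T \<subseteq> ?G" and sum: "(\<Sum>g\<in>T. scale (c g) g) \<in> decomposables J i" for T c
 proof (rule ccontr)
  assume "\<not> ?thesis"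
  then obtain g where g: "g \<in> T" "c g \<noteq> 0" by blast
  let ?I = "ideal_gen (G - {g})"
  have gG: "g \<in> ?G" using g T by auto
  have "(\<Sum>g\<in>T. scale (c g) g) \<in> ?I"
   using sum decomp_low ring_module.span_mono[OF low_other[OF gG]] by auto
  moreover have "(\<Sum>g\<in>T - {g}. scale (c g) g) \<in> ?I"
   unfolding scale_def
  proof (rule ring_module.span_sum, rule ring_module.span_scale, rule ring_module.span_base)
   fix x assume "x \<in> T - {g}"
   thus "x \<in> G - {g}" using T(2) by auto
  qed
  ultimately have "(\<Sum>g\<in>T. scale (c g) g) - (\<Sum>g\<in>T - {g}. scale (c g) g) \<in> ?I"
   by (rule ring_module.span_diff)
  hence "Const (c g) * g \<in> ?I"
   using sum.remove[OF T(1) g(1), of "\<lambda>g. scale (c g) g"] by (simp add: scale_def)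
  hence "Const (inverse (c g)) * (Const (c g) * g) \<in> ?I" by (rule ring_module.span_scale)
  hence "g \<in> ?I"
   using g(2) by (simp add: Const_def mult.assoc[symmetric] mult_single)
  thus False using redundant gG by blast
 qed
 obtain B0 :: "('v, 'a) mpoly set" where B0: "finite B0" "forms ?j \<subseteq> mpoly_vs.span B0"
  using finite_dim_forms by blast
 have fin: "finite ?G"
 proof -
  have "mpoly_vs.independent ?G"
   unfolding mpoly_vs.independent_explicit_finite_subsets
  proof (intro allI impI)
   fix S u assume S: "S \<subseteq> ?G" "finite S" "(\<Sum>v\<in>S. scale (u v) v) = 0"
   have "(\<Sum>v\<in>S. scale (u v) v) \<in> decomposables J i"
    unfolding S(3) by (rule mpoly_vs.subspace_0[OF subspace_decomposables])
   thus "\<forall>v\<in>S. u v = 0" using indep S(1,2) by blast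
  qed
  moreover have "?G \<subseteq> mpoly_vs.span B0" using B0(2) by blast
  ultimately show ?thesis using mpoly_vs.independent_span_bound[OF B0(1)] by simp
 qed
 show ?thesis
 proof (rule dim_add_family[where g = "\<lambda>g. g"])
  show "mpoly_vs.subspace (decomposables J i)" by (rule subspace_decomposables)
  show "mpoly_vs.subspace (J \<inter> forms ?j)" by (rule subspace_ideal_forms[OF J])
  show "decomposables J i \<subseteq> J \<inter> forms ?j" by (rule decomposables_subset[OF J])
  thus "decomposables J i \<subseteq> mpoly_vs.span B0" using B0(2) by auto
  show "finite ?G" by (rule fin)
  show "finite B0" by (rule B0(1))
  show "g \<in> J \<inter> forms ?j" if "g \<in> ?G" for g using that GJ by blast
  show "\<forall>g\<in>?G. c g = 0" if "(\<Sum>g\<in>?G. scale (c g) g) \<in> decomposables J i" for c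
   by (rule indep[OF fin subset_refl that])
  have "\<exists>c. hcomp ?j v - (\<Sum>g\<in>?G. scale (c g) g) \<in> decomposables J i" if "v \<in> J" for v
   using that unfolding gen[symmetric]
  proof (induction rule: ring_module.span_induct_alt)
   case base
   show ?case using mpoly_vs.subspace_0[OF subspace_decomposables] by (intro exI[of _ "\<lambda>_. 0"]) simp
  next
   case (step r x y)
   then obtain c where c: "hcomp ?j y - (\<Sum>g\<in>?G. scale (c g) g) \<in> decomposables (ideal_gen G) i" by blast
   obtain d where d: "x \<in> forms d" using hom step(1) by blast
   consider "d > ?j" | "d = ?j" | "d < ?j" by linarith
   thus ?case
   proof cases
    case 1
    thus ?thesis using c by (auto simp: hcomp_add hcomp_mult_form[OF d])
   next
    case 3
    have "hcomp (?j - d) r * x \<in> decomposables J i"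
     using 3 by (intro positive_degree_mult_decomposables[OF J GJ[OF step(1)] d hcomp_forms]) auto
    hence "hcomp (?j - d) r * x + (hcomp ?j y - (\<Sum>g\<in>?G. scale (c g) g)) \<in> decomposables (ideal_gen G) i"
     using c unfolding gen by (intro mpoly_vs.subspace_add[OF subspace_decomposables])
    thus ?thesis using 3 by (intro exI[of _ c]) (simp add: hcomp_add hcomp_mult_form[OF d] add_diff_eq)
   next
    case 2
    define r0 where "r0 = lookup r 0"
    have "hcomp 0 r = Const r0"
     by (rule poly_mapping_eqI) (auto simp: lookup_hcomp Const_def lookup_single when_def mdeg_eq_0_iff r0_def)
    hence hr: "hcomp ?j (r * x) = scale r0 x" using 2 by (simp add: hcomp_mult_form[OF d] scale_def)
    have xG: "x \<in> ?G" using step(1) d 2 by simp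
    have "(\<Sum>g\<in>?G. scale (if g = x then c g + r0 else c g) g) =
      (\<Sum>g\<in>?G. scale (c g) g + (if g = x then scale r0 x else 0))"
     by (rule sum.cong) (auto simp: mpoly_vs.scale_left_distrib)
    also have "\<dots> = (\<Sum>g\<in>?G. scale (c g) g) + scale r0 x"
     using fin xG by (simp add: sum.distrib)
    finally have "hcomp ?j (r * x + y) - (\<Sum>g\<in>?G. scale (if g = x then c g + r0 else c g) g) =
      hcomp ?j y - (\<Sum>g\<in>?G. scale (c g) g)"
     by (simp add: hcomp_add hr)
    thus ?thesis using c by (intro exI[of _ "\<lambda>g. if g = x then c g + r0 else c g"]) simp
   qed
  qed
  thus "\<exists>c. v - (\<Sum>g\<in>?G. scale (c g) g) \<in> decomposables J i" if "v \<in> J \<inter> forms ?j" for v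
   using that hcomp_of_form[of v ?j ?j] by fastforce
 qed
qed

lemma minimal_generators_exist:
 assumes "finite F" "F \<subseteq> (\<Union>n. forms n)" "ideal_gen F = J"
 shows "\<exists>G. minimal_homogeneous_generators G J"
proof -
 let ?P = "\<lambda>G. G \<subseteq> F \<and> ideal_gen G = J"
 obtain G where G: "?P G" "\<And>G'. ?P G' \<Longrightarrow> card G \<le> card G'"
  using ex_has_least_nat[of ?P F card] assms(3) by blast
 have "finite G" using G(1) assms(1) finite_subset by blast
 hence "ideal_gen G' \<noteq> J" if "G' \<subset> G" for G'
  using G(2)[of G'] G(1) that psubset_card_mono[of G G'] by auto
 hence "minimal_homogeneous_generators G J"
  using G(1) assms(2) unfolding minimal_homogeneous_generators_def by auto
 thus ?thesis by (rule exI)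
qed

lemma beta0_card:
 fixes J :: "('v::finite, 'a::field) mpoly set"
 assumes G: "minimal_homogeneous_generators G J"
 shows "beta0 J (Suc i) = card (G \<inter> forms (Suc i))"
 unfolding beta0_def
proof (rule the_equality)
 show "\<exists>G'. minimal_homogeneous_generators G' J \<and> card (G \<inter> forms (Suc i)) = card (G' \<inter> forms (Suc i))"
  using G by blast
 fix n assume "\<exists>G'. minimal_homogeneous_generators G' J \<and> n = card (G' \<inter> forms (Suc i))"
 then obtain G' where G': "minimal_homogeneous_generators G' J" "n = card (G' \<inter> forms (Suc i))"
  by (elim exE conjE)
 show "n = card (G \<inter> forms (Suc i))"
  using minimal_generators_dim[OF G, of i] minimal_generators_dim[OF G'(1), of i] G'(2) by simp
qed

lemma beta0_dim:
 fixes J :: "('v::finite, 'a::field) mpoly set"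
 assumes "finite F" "F \<subseteq> (\<Union>n. forms n)" "ideal_gen F = J"
 shows "mpoly_vs.dim (J \<inter> forms (Suc i)) = mpoly_vs.dim (decomposables J i) + beta0 J (Suc i)"
proof -
 obtain G where G: "minimal_homogeneous_generators G J" using minimal_generators_exist[OF assms] by (rule exE)
 show ?thesis using minimal_generators_dim[OF G, of i] beta0_card[OF G, of i] by simp
qed

subsection \<open>Minimal generators of the ideal of a relation system\<close>

context staircase
begin

definition corner :: "nat \<Rightarrow> (3 \<Rightarrow>\<^sub>0 nat)" where
 "corner k = mS (t - k) (m k) 0"

lemma mdeg_corner [simp]: "mdeg (corner k) = D k"
 by (simp add: corner_def D_def)

lemma corner_in_stairs: "k \<le> t \<Longrightarrow> corner k \<in> stairs"
 by (simp add: corner_def mS_in_stairs)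

lemma stair_elem_corner: "k \<le> t \<Longrightarrow> stair_elem f (corner k) = f k"
 by (simp add: corner_def stair_elem_def mS_0 monomial_def)

lemma inj_corner: "inj_on corner {..t}"
 by (auto simp: inj_on_def corner_def)

text \<open>In degree \<open>j\<close>, the decomposable elements are spanned by the multiples of the generators
 of smaller degree and by the degree zero parts of the relations in degree \<open>j\<close>.\<close>

lemma decomposables_stair_ideal:
 fixes f :: "nat \<Rightarrow> 'a::field ring_S" and i :: nat
 assumes sb: "stair_basis f" and rel: "relation f C" and gr: "graded C"
 defines "NT \<equiv> {\<mu> \<in> stairs. mdeg \<mu> = Suc i} - corner ` {..t}"
  and "v \<equiv> \<lambda>k. \<Sum>l\<in>{l. l \<le> t \<and> D l = Suc i}. scale (coeff (C l k) 0) (f l)"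
 shows "decomposables (stair_ideal f) i =
  mpoly_vs.span (stair_elem f ` NT \<union> v ` {k \<in> {1..t}. D k = i})" (is "?L = mpoly_vs.span ?R")
proof
 have J: "is_ideal (stair_ideal f)" unfolding stair_ideal_def by (rule ring_module.subspace_span)
 have f: "f k \<in> forms (D k)" "f k \<in> stair_ideal f" if "k \<le> t" for k
  using sb that unfolding stair_basis_def stair_ideal_def by (auto intro: ring_module.span_base)
 have xf: "xS * f k = v k + (\<Sum>l\<in>{l. l \<le> t \<and> D l < Suc i}. hm (D k + 1 - D l) (C l k) * f l)"
  if k: "k \<in> {1..t}" "D k = i" for k
 proof -
  have split: "{..t} = {l. l \<le> t \<and> D l = Suc i} \<union> ({l. l \<le> t \<and> D l < Suc i} \<union> {l. l \<le> t \<and> D l > Suc i})" by auto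
  let ?h = "\<lambda>l. hm (D k + 1 - D l) (C l k) * f l"
  have "xS * f k = (\<Sum>l\<le>t. ?h l)" using rel k(1) unfolding relation_def by blast
  also have "\<dots> = (\<Sum>l\<in>{l. l \<le> t \<and> D l = Suc i}. ?h l) + ((\<Sum>l\<in>{l. l \<le> t \<and> D l < Suc i}. ?h l) +
    (\<Sum>l\<in>{l. l \<le> t \<and> D l > Suc i}. ?h l))"
   unfolding split by (subst sum.union_disjoint, simp, simp, force, subst sum.union_disjoint) auto
  also have "(\<Sum>l\<in>{l. l \<le> t \<and> D l > Suc i}. ?h l) = 0"
  proof (rule sum.neutral, rule ballI)
   fix l assume l: "l \<in> {l. l \<le> t \<and> D l > Suc i}"
   hence "C l k = 0" using gr k unfolding graded_def by force
   thus "?h l = 0" by simp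
  qed
  also have "(\<Sum>l\<in>{l. l \<le> t \<and> D l = Suc i}. ?h l) = v k"
   unfolding v_def
  proof (rule sum.cong[OF refl])
   fix l assume l: "l \<in> {l. l \<le> t \<and> D l = Suc i}"
   thus "?h l = scale (coeff (C l k) 0) (f l)"
    using k(2) by (simp add: hm_def mS_0 scale_def Const_def)
  qed
  finally show ?thesis by simp
 qed
 show "?L \<subseteq> mpoly_vs.span ?R"
 proof -
  have NTR: "stair_elem f \<mu> \<in> mpoly_vs.span ?R" if "\<mu> \<in> NT" for \<mu>
   by (rule mpoly_vs.span_base, rule UnI1, rule imageI[OF that])
  have multNT: "monomial (mS 0 e e') * f l \<in> mpoly_vs.span ?R" if "l \<le> t" "D l + (e + e') = Suc i" "0 < e + e'" for l e e'
   unfolding stair_elem_yz[OF that(1)]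
  proof (rule NTR)
   have "mS (t - l) (m l + e) e' \<noteq> corner k" if "k \<le> t" for k
   proof
    assume eq: "mS (t - l) (m l + e) e' = corner k"
    hence "t - l = t - k" by (simp add: corner_def)
    hence "l = k" using that \<open>l \<le> t\<close> by linarith
    thus False using eq \<open>0 < e + e'\<close> by (simp add: corner_def)
   qed
   thus "mS (t - l) (m l + e) e' \<in> NT"
    using that unfolding NT_def by (auto simp: mS_in_stairs D_def)
  qed
  have hmNT: "hm u p * (monomial (mS 0 e e') * f l) \<in> mpoly_vs.span ?R"
   if "l \<le> t" "D l + (u + e + e') = Suc i" "0 < u + e + e'" for l e e' u p
  proof -
   have eq: "hm u p * (monomial (mS 0 e e') * f l) =
     (\<Sum>n\<le>u. scale (coeff p n) (monomial (mS 0 (n + e) (u - n + e')) * f l))"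
    unfolding hm_def sum_distrib_right
    by (rule sum.cong) (simp_all add: monomial_def mult.assoc[symmetric] mult_single mS_add scale_def Const_def)
   show ?thesis unfolding eq
    by (intro mpoly_vs.span_sum mpoly_vs.span_scale multNT) (use that in auto)
  qed
  have vR: "v k \<in> mpoly_vs.span ?R" if "k \<in> {1..t}" "D k = i" for k
   by (rule mpoly_vs.span_base, rule UnI2, rule imageI) (use that in simp)
  have gen: "Var w * stair_elem f \<mu> \<in> mpoly_vs.span ?R" if \<mu>: "\<mu> \<in> stairs" "mdeg \<mu> = i" for w \<mu>
  proof -
   obtain a b c where abc: "\<mu> = mS a b c" by (rule mS_cases)
   let ?k = "t - a"
   have b: "m ?k \<le> b" and deg: "a + b + c = i" using \<mu> by (simp_all add: abc mS_in_stairs)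
   have el: "stair_elem f \<mu> = monomial (mS (a - t) (b - m ?k) c) * f ?k"
    by (simp add: stair_elem_def abc)
   have "w = 0 \<or> w = 1 \<or> w = 2" using UNIV_3_eq by auto
   then consider "w = 1" | "w = 2" | "w = 0" "t \<le> a" | "w = 0" "a < t" by linarith
   thus ?thesis
   proof cases
    case 1
    have "mS a (Suc b) c \<noteq> corner k" if "k \<le> t" for k
     using b that unfolding corner_def by auto
    hence "mS a (Suc b) c \<in> NT" using b deg unfolding NT_def by (auto simp: mS_in_stairs)
    moreover have "Var w * stair_elem f \<mu> = stair_elem f (mS a (Suc b) c)"
     using b 1 by (simp add: stair_elem_def abc Var_S monomial_def mult.assoc[symmetric] mult_single mS_add Suc_diff_le)
    ultimately show ?thesis by (simp only: NTR)
   next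
    case 2
    have "mS a b (Suc c) \<noteq> corner k" for k unfolding corner_def by simp
    hence "mS a b (Suc c) \<in> NT" using b deg unfolding NT_def by (auto simp: mS_in_stairs)
    moreover have "Var w * stair_elem f \<mu> = stair_elem f (mS a b (Suc c))"
     using b 2 by (simp add: stair_elem_def abc Var_S monomial_def mult.assoc[symmetric] mult_single mS_add)
    ultimately show ?thesis by (simp only: NTR)
   next
    case 3
    have "mS (Suc a) b c \<noteq> corner k" for k using 3 unfolding corner_def by auto
    hence "mS (Suc a) b c \<in> NT" using b deg 3 unfolding NT_def by (auto simp: mS_in_stairs m_0)
    moreover have "Var w * stair_elem f \<mu> = stair_elem f (mS (Suc a) b c)"
     using b 3 by (simp add: stair_elem_def abc Var_S monomial_def mult.assoc[symmetric] mult_single mS_add Suc_diff_le)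
    ultimately show ?thesis by (simp only: NTR)
   next
    case 4
    have k: "?k \<in> {1..t}" using 4 by auto
    let ?N = "monomial (mS 0 (b - m ?k) c) :: 'a ring_S"
    have eq: "Var w * stair_elem f \<mu> = ?N * (xS * f ?k)"
     using 4 by (simp add: el Var_S monomial_def mult.assoc[symmetric] mult_single mS_add)
    have Dk: "D ?k + (b - m ?k) + c = i" using deg b 4 unfolding D_def by simp
    show ?thesis
    proof (cases "b - m ?k + c = 0")
     case True
     hence N: "?N = 1" by (simp add: mS_0 monomial_def)
     have Dki: "D ?k = i" using Dk True by simp
     have "xS * f ?k \<in> mpoly_vs.span ?R"
      unfolding xf[OF k Dki]
     proof (intro mpoly_vs.span_add vR[OF k Dki] mpoly_vs.span_sum)
      fix l assume l: "l \<in> {l. l \<le> t \<and> D l < Suc i}"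
      have "hm (D ?k + 1 - D l) (C l ?k) * (monomial (mS 0 0 0) * f l) \<in> mpoly_vs.span ?R"
       by (rule hmNT) (use l Dki in auto)
      thus "hm (D ?k + 1 - D l) (C l ?k) * f l \<in> mpoly_vs.span ?R"
       by (simp add: mS_0 monomial_def)
     qed
     thus ?thesis unfolding eq N by simp
    next
     case False
     have "xS * f ?k = (\<Sum>l\<le>t. hm (D ?k + 1 - D l) (C l ?k) * f l)"
      using rel k unfolding relation_def by blast
     hence "?N * (xS * f ?k) = (\<Sum>l\<le>t. ?N * (hm (D ?k + 1 - D l) (C l ?k) * f l))"
      by (simp only: sum_distrib_left)
     also have "\<dots> = (\<Sum>l\<le>t. hm (D ?k + 1 - D l) (C l ?k) * (?N * f l))"
      by (rule sum.cong[OF refl]) (rule mult.left_commute)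
     also have "\<dots> \<in> mpoly_vs.span ?R"
     proof (rule mpoly_vs.span_sum)
      fix l assume l: "l \<in> {..t}"
      show "hm (D ?k + 1 - D l) (C l ?k) * (?N * f l) \<in> mpoly_vs.span ?R"
      proof (cases "C l ?k = 0")
       case True
       thus ?thesis by (simp add: mpoly_vs.span_zero)
      next
       case nz: False
       hence "D l \<le> D ?k + 1" using gr k l unfolding graded_def by auto
       thus ?thesis using l Dk False by (intro hmNT) auto
      qed
     qed
     finally show ?thesis unfolding eq .
    qed
   qed
  qed
  show ?thesis
   unfolding decomposables_def
  proof (rule mpoly_vs.span_minimal[OF _ mpoly_vs.subspace_span], rule subsetI)
   fix x assume "x \<in> {Var w * g | w g. g \<in> stair_ideal f \<inter> forms i}"
   then obtain w g where x: "x = Var w * g" "g \<in> stair_ideal f" "g \<in> forms i" by blast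
   have "hcomp i g \<in> mpoly_vs.span (stair_elem f ` {\<mu> \<in> stairs. mdeg \<mu> = i})"
    by (rule stair_ideal_degree_span[OF sb rel x(2)])
   hence "g \<in> mpoly_vs.span (stair_elem f ` {\<mu> \<in> stairs. mdeg \<mu> = i})"
    using hcomp_of_form[OF x(3), of i] by simp
   thus "x \<in> mpoly_vs.span ?R"
    unfolding x(1)
   proof (induction rule: mpoly_vs.span_induct_alt)
    case base
    show ?case by (simp add: mpoly_vs.span_zero)
   next
    case (step c x y)
    then obtain \<mu> where \<mu>: "\<mu> \<in> stairs" "mdeg \<mu> = i" "x = stair_elem f \<mu>" by blast
    have "scale c (Var w * x) + Var w * y \<in> mpoly_vs.span ?R"
     using step(2) gen[OF \<mu>(1,2)] unfolding \<mu>(3) by (intro mpoly_vs.span_add mpoly_vs.span_scale)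
    thus ?case by (simp add: distrib_left scale_mult_right)
   qed
  qed
 qed
 show "mpoly_vs.span ?R \<subseteq> ?L"
 proof (rule mpoly_vs.span_minimal[OF _ subspace_decomposables], rule Un_least)
  show "stair_elem f ` NT \<subseteq> ?L"
  proof (rule image_subsetI)
   fix \<mu> assume \<mu>: "\<mu> \<in> NT"
   obtain a b c where abc: "\<mu> = mS a b c" by (rule mS_cases)
   let ?k = "t - a"
   let ?n = "mS (a - t) (b - m ?k) c"
   have b: "m ?k \<le> b" and deg: "a + b + c = Suc i" and nc: "\<mu> \<noteq> corner ?k"
    using \<mu> unfolding NT_def abc by (auto simp: mS_in_stairs)
   have "mdeg ?n + D ?k = Suc i" using b deg unfolding D_def by simp
   moreover have "0 < mdeg ?n"
   proof (rule ccontr)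
    assume "\<not> ?thesis"
    hence "a \<le> t" "b = m ?k" "c = 0" using b by auto
    thus False using nc by (simp add: abc corner_def)
   qed
   ultimately have "monomial ?n * f ?k \<in> ?L"
    by (intro positive_degree_mult_decomposables[OF J f(2) f(1) forms_monomial]) auto
   thus "stair_elem f \<mu> \<in> ?L" by (simp add: stair_elem_def abc)
  qed
  show "v ` {k \<in> {1..t}. D k = i} \<subseteq> ?L"
  proof (rule image_subsetI)
   fix k assume k: "k \<in> {k \<in> {1..t}. D k = i}"
   hence k': "k \<in> {1..t}" "D k = i" by auto
   have "xS * f k \<in> ?L"
    by (rule positive_degree_mult_decomposables[OF J f(2) f(1) forms_Var]) (use k' in auto)
   moreover have "(\<Sum>l\<in>{l. l \<le> t \<and> D l < Suc i}. hm (D k + 1 - D l) (C l k) * f l) \<in> ?L"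
   proof (rule mpoly_vs.subspace_sum[OF subspace_decomposables])
    fix l assume l: "l \<in> {l. l \<le> t \<and> D l < Suc i}"
    show "hm (D k + 1 - D l) (C l k) * f l \<in> ?L"
     by (rule positive_degree_mult_decomposables[OF J f(2) f(1) hm_forms]) (use l k' in auto)
   qed
   ultimately have "xS * f k - (\<Sum>l\<in>{l. l \<le> t \<and> D l < Suc i}. hm (D k + 1 - D l) (C l k) * f l) \<in> ?L"
    by (rule mpoly_vs.subspace_diff[OF subspace_decomposables])
   thus "v k \<in> ?L" unfolding xf[OF k'] by simp
  qed
 qed
qed

text \<open>So the number of minimal generators of degree \<open>j\<close> drops from the number of corners of
 degree \<open>j\<close> by the rank of the block of constant entries of the relation matrix; here \<open>K\<close> is a
 maximal independent set of columns of that block.\<close>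

lemma beta0_stair_ideal:
 fixes f :: "nat \<Rightarrow> 'a::field ring_S"
 assumes sb: "stair_basis f" and rel: "relation f C" and gr: "graded C"
  and K: "K \<subseteq> {k \<in> {1..t}. D k = i}"
  and ind: "\<And>c. (\<forall>l\<in>{l. l \<le> t \<and> D l = Suc i}. (\<Sum>k\<in>K. c k * coeff (C l k) 0) = 0) \<Longrightarrow> \<forall>k\<in>K. c k = 0"
  and span: "\<And>k. k \<in> {1..t} \<Longrightarrow> D k = i \<Longrightarrow>
   \<exists>c. \<forall>l\<in>{l. l \<le> t \<and> D l = Suc i}. coeff (C l k) 0 = (\<Sum>k'\<in>K. c k' * coeff (C l k') 0)"
 shows "beta0 (stair_ideal f) (Suc i) + card K = card {l. l \<le> t \<and> D l = Suc i}"
proof -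
 let ?T = "{\<mu> \<in> stairs. mdeg \<mu> = Suc i}"
 let ?C = "{l. l \<le> t \<and> D l = Suc i}"
 define NT where "NT = ?T - corner ` {..t}"
 define v where "v = (\<lambda>k. \<Sum>l\<in>?C. scale (coeff (C l k) 0) (f l))"
 let ?W = "mpoly_vs.span (stair_elem f ` NT)"
 let ?V = "decomposables (stair_ideal f) i"
 have V: "?V = mpoly_vs.span (stair_elem f ` NT \<union> v ` {k \<in> {1..t}. D k = i})"
  unfolding NT_def v_def by (rule decomposables_stair_ideal[OF sb rel gr])
 have finT: "finite ?T" by (rule finite_subset[OF _ finite_mdeg[of "Suc i"]]) auto
 have finNT: "finite NT" using finT unfolding NT_def by simp
 have finK: "finite K" by (rule finite_subset[OF K]) simp
 have injT: "inj_on (rank_drl (Suc i)) ?T" by (rule inj_on_subset[OF inj_rank_drl]) auto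
 have injNT: "inj_on (rank_drl (Suc i)) NT" by (rule inj_on_subset[OF injT]) (auto simp: NT_def)
 have leadT: "lead (rank_drl (Suc i)) \<mu> (stair_elem f \<mu>)" if "\<mu> \<in> ?T" for \<mu>
 proof -
  have \<mu>: "\<mu> \<in> stairs" "mdeg \<mu> = Suc i" using that by auto
  show ?thesis using stair_elem_lead[OF sb \<mu>(1)] lead_rank_drl_iff[of "stair_elem f \<mu>" "Suc i" \<mu>] \<mu>(2) by simp
 qed
 have leadNT: "lead (rank_drl (Suc i)) \<mu> (stair_elem f \<mu>)" if "\<mu> \<in> NT" for \<mu>
  by (rule leadT) (use that in \<open>simp add: NT_def\<close>)
 have comb: "(\<Sum>k\<in>K. scale (c k) (v k)) = (\<Sum>l\<in>?C. scale (\<Sum>k\<in>K. c k * coeff (C l k) 0) (f l))" for c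
 proof -
  have "(\<Sum>k\<in>K. scale (c k) (v k)) = (\<Sum>k\<in>K. \<Sum>l\<in>?C. scale (c k * coeff (C l k) 0) (f l))"
   by (simp add: v_def mpoly_vs.scale_sum_right)
  also have "\<dots> = (\<Sum>l\<in>?C. \<Sum>k\<in>K. scale (c k * coeff (C l k) 0) (f l))" by (rule sum.swap)
  finally show ?thesis by (simp add: mpoly_vs.scale_sum_left)
 qed
 have "mpoly_vs.dim ?V = mpoly_vs.dim ?W + card K"
 proof (rule dim_add_family[where g = v])
  show "mpoly_vs.subspace ?W" by (rule mpoly_vs.subspace_span)
  show "mpoly_vs.subspace ?V" by (rule subspace_decomposables)
  show "?W \<subseteq> ?V" unfolding V by (rule mpoly_vs.span_mono) simp
  show "finite K" by (rule finK)
  show "finite (stair_elem f ` NT)" using finNT by simp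
  show "?W \<subseteq> mpoly_vs.span (stair_elem f ` NT)" by simp
  show "v k \<in> ?V" if "k \<in> K" for k
   unfolding V by (rule mpoly_vs.span_base, rule UnI2, rule imageI) (use that K in auto)
  show "\<forall>k\<in>K. c k = 0" if sW: "(\<Sum>k\<in>K. scale (c k) (v k)) \<in> ?W" for c
  proof (rule ind, rule ccontr)
   assume "\<not> (\<forall>l\<in>?C. (\<Sum>k\<in>K. c k * coeff (C l k) 0) = 0)"
   then obtain l where l: "l \<in> ?C" "(\<Sum>k\<in>K. c k * coeff (C l k) 0) \<noteq> 0" by blast
   define e where "e = (\<lambda>\<mu> :: 3 \<Rightarrow>\<^sub>0 nat. \<Sum>k\<in>K. c k * coeff (C (t - lookup \<mu> 0) k) 0)"
   have ec: "e (corner l) = (\<Sum>k\<in>K. c k * coeff (C l k) 0)" if "l \<in> ?C" for l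
    using that by (simp add: e_def corner_def)
   have injC: "inj_on corner ?C" by (rule inj_on_subset[OF inj_corner]) auto
   have CT: "corner ` ?C \<subseteq> ?T" using corner_in_stairs by auto
   have eq: "(\<Sum>\<mu>\<in>corner ` ?C. scale (e \<mu>) (stair_elem f \<mu>)) = (\<Sum>k\<in>K. scale (c k) (v k))"
    unfolding comb sum.reindex[OF injC] o_def
    by (rule sum.cong[OF refl]) (simp add: ec stair_elem_corner)
   have "\<exists>\<mu>\<in>corner ` ?C. lead (rank_drl (Suc i)) \<mu> (\<Sum>\<mu>\<in>corner ` ?C. scale (e \<mu>) (stair_elem f \<mu>))"
   proof (rule lead_of_combination)
    show "finite (corner ` ?C)" by simp
    show "inj_on (rank_drl (Suc i)) (corner ` ?C)" by (rule inj_on_subset[OF injT CT])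
    show "lead (rank_drl (Suc i)) \<mu> (stair_elem f \<mu>)" if "\<mu> \<in> corner ` ?C" for \<mu>
     using leadT that CT by blast
    show "\<exists>\<mu>\<in>corner ` ?C. e \<mu> \<noteq> 0" using l ec[OF l(1)] by auto
   qed
   then obtain \<mu> where \<mu>: "\<mu> \<in> corner ` ?C" "lead (rank_drl (Suc i)) \<mu> (\<Sum>k\<in>K. scale (c k) (v k))"
    unfolding eq by blast
   hence "(\<Sum>k\<in>K. scale (c k) (v k)) \<noteq> 0" unfolding lead_def by auto
   from lead_in_span[OF finNT injNT leadNT sW this]
   obtain \<nu> where \<nu>: "\<nu> \<in> NT" "lead (rank_drl (Suc i)) \<nu> (\<Sum>k\<in>K. scale (c k) (v k))" by blast
   have "\<mu> = \<nu>" using \<mu>(2) \<nu>(2) unfolding lead_def using less_asym by blast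
   thus False using \<mu>(1) \<nu>(1) unfolding NT_def by auto
  qed
  show "\<exists>c. x - (\<Sum>k\<in>K. scale (c k) (v k)) \<in> ?W" if x: "x \<in> ?V" for x
   using x unfolding V
  proof (induction rule: mpoly_vs.span_induct_alt)
   case base
   show ?case by (intro exI[of _ "\<lambda>_. 0"]) (simp add: mpoly_vs.span_zero)
  next
   case (step a x y)
   then obtain c where c: "y - (\<Sum>k\<in>K. scale (c k) (v k)) \<in> ?W" by blast
   have "\<exists>c'. x - (\<Sum>k\<in>K. scale (c' k) (v k)) \<in> ?W"
    using step(1)
   proof
    assume "x \<in> stair_elem f ` NT"
    hence "x - (\<Sum>k\<in>K. scale 0 (v k)) \<in> ?W" by (simp add: mpoly_vs.span_base)
    thus ?thesis by (rule exI[of _ "\<lambda>_. 0"])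
   next
    assume "x \<in> v ` {k \<in> {1..t}. D k = i}"
    then obtain k where k: "x = v k" "k \<in> {1..t}" "D k = i" by blast
    obtain c' where c': "\<forall>l\<in>?C. coeff (C l k) 0 = (\<Sum>k'\<in>K. c' k' * coeff (C l k') 0)"
     using span[OF k(2,3)] by blast
    have "x = (\<Sum>k\<in>K. scale (c' k) (v k))"
     unfolding comb k(1) unfolding v_def by (rule sum.cong) (use c' in auto)
    thus ?thesis by (intro exI[of _ c']) (simp add: mpoly_vs.span_zero)
   qed
   then obtain c' where c': "x - (\<Sum>k\<in>K. scale (c' k) (v k)) \<in> ?W" by blast
   have "scale a (x - (\<Sum>k\<in>K. scale (c' k) (v k))) + (y - (\<Sum>k\<in>K. scale (c k) (v k))) \<in> ?W"
    by (rule mpoly_vs.span_add[OF mpoly_vs.span_scale[OF c'] c])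
   also have "scale a (x - (\<Sum>k\<in>K. scale (c' k) (v k))) + (y - (\<Sum>k\<in>K. scale (c k) (v k))) =
     scale a x + y - (\<Sum>k\<in>K. scale (a * c' k + c k) (v k))"
    by (simp add: mpoly_vs.scale_right_diff_distrib mpoly_vs.scale_sum_right mpoly_vs.scale_left_distrib sum.distrib)
   finally show ?case by (rule exI[where x = "\<lambda>k. a * c' k + c k"])
  qed
 qed
 moreover have "mpoly_vs.dim ?W = card NT"
  using mpoly_vs.dim_span_eq_card_independent[OF lead_independent(2)[OF finNT injNT leadNT]]
   card_image[OF lead_independent(1)[OF finNT injNT leadNT]] by simp
 moreover have "mpoly_vs.dim (stair_ideal f \<inter> forms (Suc i)) = card ?T"
  using dim_ideal_forms[OF homogeneous_stair_ideal[OF sb], of "Suc i"] lead_mons_stair_ideal[OF sb rel] by simp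
 moreover have "card ?T = card NT + card ?C"
 proof -
  have "?T = NT \<union> corner ` ?C" "NT \<inter> corner ` ?C = {}" using corner_in_stairs unfolding NT_def by auto
  moreover have "card (corner ` ?C) = card ?C" by (rule card_image[OF inj_on_subset[OF inj_corner]]) auto
  ultimately show ?thesis using card_Un_disjoint[of NT "corner ` ?C"] finNT by simp
 qed
 moreover have "mpoly_vs.dim (stair_ideal f \<inter> forms (Suc i)) = mpoly_vs.dim ?V + beta0 (stair_ideal f) (Suc i)"
  by (rule beta0_dim[of "f ` {..t}"]) (use sb in \<open>auto simp: stair_ideal_def stair_basis_def\<close>)
 ultimately show ?thesis by simp
qed

end

declare ring_module.scale_scale [simp del]

section \<open>Krull dimension and depth\<close>

lemma ring_S_induct [case_names Const Var add mult]:
 fixes f :: "'a::comm_ring_1 ring_S"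
 assumes "\<And>c. P (Const c)" "\<And>v. P (Var v)" and add: "\<And>f g. P f \<Longrightarrow> P g \<Longrightarrow> P (f + g)"
  and mult: "\<And>f g. P f \<Longrightarrow> P g \<Longrightarrow> P (f * g)"
 shows "P f"
proof -
 have zero: "P 0" and one: "P 1"
  using assms(1)[of 0] assms(1)[of 1] by (simp_all add: Const_def)
 have pow: "P (Var v ^ n)" for v n
  by (induction n) (simp_all add: one assms(2) mult)
 have single: "P (single \<mu> c)" for \<mu> c
 proof -
  obtain i j k where ijk: "\<mu> = mS i j k" by (rule mS_cases)
  have "single \<mu> c = Const c * (xS ^ i * (yS ^ j * zS ^ k))"
   by (simp add: Var_S_power ijk Const_def mult_single mS_add)
  thus ?thesis using assms(1) pow mult by simp
 qed
 have "P (sum F A)" if "finite A" "\<And>i. i \<in> A \<Longrightarrow> P (F i)" for A :: "(3 \<Rightarrow>\<^sub>0 nat) set" and F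
  using that by (induction A rule: finite_induct) (simp_all add: zero add)
 hence "P (\<Sum>m\<in>keys f. single m (lookup f m))" using single by simp
 thus ?thesis by (simp only: mpoly_as_sum[symmetric])
qed

lemma ideal_gen_of_ideal: "is_ideal I \<Longrightarrow> ideal_gen I = I"
 by (rule ring_module.span_eq_iff[THEN iffD2])

lemma insertion_congruence:
 fixes I :: "'a::comm_ring_1 ring_S set"
 assumes I: "is_ideal I" and v: "\<And>v. Var v - Const (\<phi> v) \<in> I"
 shows "f - Const (insertion (\<lambda>a. a) \<phi> f) \<in> I"
proof -
 let ?e = "insertion (\<lambda>a. a) \<phi>"
 interpret e: comm_ring_hom ?e by (rule comm_ring_hom_insertion[OF comm_ring_hom_id])
 interpret C: comm_ring_hom "Const :: 'a \<Rightarrow> 'a ring_S" by (rule comm_ring_hom_Const)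
 show ?thesis
 proof (induction f rule: ring_S_induct)
  case (Const c)
  have "Const c - Const (?e (Const c)) = (0 :: 'a ring_S)"
   by (simp add: insertion_Const[OF comm_ring_hom_id])
  thus ?case using ring_module.subspace_0[OF I] by simp
 next
  case (Var w)
  thus ?case using v[of w] by (simp add: insertion_Var[OF comm_ring_hom_id])
 next
  case (add f g)
  have "(f - Const (?e f)) + (g - Const (?e g)) \<in> I" by (rule ring_module.subspace_add[OF I add])
  also have "(f - Const (?e f)) + (g - Const (?e g)) = f + g - Const (?e (f + g))"
   by (simp add: e.hom_add C.hom_add)
  finally show ?case .
 next
  case (mult f g)
  have "g * (f - Const (?e f)) + Const (?e f) * (g - Const (?e g)) \<in> I"
   by (rule ring_module.subspace_add[OF I]; rule ring_module.subspace_scale[OF I]; rule mult)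
  also have "g * (f - Const (?e f)) + Const (?e f) * (g - Const (?e g)) = f * g - Const (?e (f * g))"
   by (simp add: e.hom_mult C.hom_mult algebra_simps)
  finally show ?case .
 qed
qed

lemma prime_ideal_kernel:
 fixes h :: "'r::comm_ring_1 \<Rightarrow> 'd::idom"
 assumes "comm_ring_hom h"
 shows "prime_ideal {f. h f = 0}"
proof -
 interpret h: comm_ring_hom h by fact
 have "is_ideal {f. h f = 0}"
  unfolding ring_module.subspace_def by (simp add: h.hom_add h.hom_mult)
 moreover have "1 \<notin> {f. h f = 0}" by simp
 hence "{f. h f = 0} \<noteq> UNIV" by blast
 ultimately show ?thesis unfolding prime_ideal_def by (simp add: h.hom_mult)
qed

text \<open>Krull's theorem that a proper ideal is contained in a prime ideal.\<close>

lemma prime_ideal_exists: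
 fixes I :: "'r::comm_ring_1 set"
 assumes I: "is_ideal I" "1 \<notin> I"
 shows "\<exists>P. prime_ideal P \<and> I \<subseteq> P"
proof -
 let ?\<A> = "{P. is_ideal P \<and> I \<subseteq> P \<and> 1 \<notin> P}"
 have "\<exists>M\<in>?\<A>. \<forall>X\<in>?\<A>. M \<subseteq> X \<longrightarrow> X = M"
 proof (rule subset_Zorn)
  fix \<C> assume C: "subset.chain ?\<A> \<C>"
  show "\<exists>U\<in>?\<A>. \<forall>X\<in>\<C>. X \<subseteq> U"
  proof (cases "\<C> = {}")
   case True
   thus ?thesis using I by blast
  next
   case False
   then obtain X0 where X0: "X0 \<in> \<C>" by blast
   have mem: "X \<in> ?\<A>" if "X \<in> \<C>" for X using C that unfolding subset.chain_def by blast
   have "is_ideal (\<Union>\<C>)"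
    unfolding ring_module.subspace_def
   proof (intro conjI ballI allI)
    have "is_ideal X0" using mem[OF X0] by simp
    hence "0 \<in> X0" by (rule ring_module.subspace_0)
    thus "0 \<in> \<Union>\<C>" using X0 by blast
    fix x y assume "x \<in> \<Union>\<C>" "y \<in> \<Union>\<C>"
    then obtain X Y where XY: "X \<in> \<C>" "x \<in> X" "Y \<in> \<C>" "y \<in> Y" by blast
    hence "X \<subseteq> Y \<or> Y \<subseteq> X" using C unfolding subset.chain_def by blast
    then obtain Z where Z: "Z \<in> \<C>" "x \<in> Z" "y \<in> Z" using XY by blast
    have "is_ideal Z" using mem[OF Z(1)] by simp
    hence "x + y \<in> Z" using Z(2,3) by (rule ring_module.subspace_add)
    thus "x + y \<in> \<Union>\<C>" using Z(1) by blast
   next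
    fix c x assume "x \<in> \<Union>\<C>"
    then obtain X where X: "X \<in> \<C>" "x \<in> X" by blast
    have "is_ideal X" using mem[OF X(1)] by simp
    hence "c * x \<in> X" using X(2) by (rule ring_module.subspace_scale)
    thus "c * x \<in> \<Union>\<C>" using X(1) by blast
   qed
   moreover have "I \<subseteq> \<Union>\<C>" "1 \<notin> \<Union>\<C>" using X0 mem by blast+
   ultimately have "\<Union>\<C> \<in> ?\<A>" by simp
   thus ?thesis by blast
  qed
 qed
 then obtain M where M0: "M \<in> ?\<A>" and max: "\<forall>X\<in>?\<A>. M \<subseteq> X \<longrightarrow> X = M" by (elim bexE)
 have M: "is_ideal M" "I \<subseteq> M" "1 \<notin> M" using M0 by simp_all
 have maxM: "X = M" if "is_ideal X" "M \<subseteq> X" "1 \<notin> X" for X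
  using max[rule_format, of X] that M(2) by simp
 have gen: "\<exists>r. 1 - r * a \<in> M" if a: "a \<notin> M" for a
 proof -
  let ?X = "ideal_gen (insert a M)"
  have "M \<subseteq> ?X" "a \<in> ?X" using ring_module.span_superset[of "insert a M"] by auto
  hence "1 \<in> ?X" using maxM[OF ring_module.subspace_span, of "insert a M"] a by auto
  moreover have "ideal_gen M = M" using M(1) by (rule ring_module.span_eq_iff[THEN iffD2])
  ultimately show ?thesis by (simp add: ring_module.span_breakdown_eq)
 qed
 have "a \<in> M \<or> b \<in> M" if ab: "a * b \<in> M" for a b
 proof (rule ccontr)
  assume "\<not> ?thesis"
  then obtain r s where rs: "1 - r * a \<in> M" "1 - s * b \<in> M" using gen by blast
  have "(1 - r * a) + (r * a) * (1 - s * b) + (r * s) * (a * b) \<in> M"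
   by (intro ring_module.subspace_add[OF M(1)] rs(1) ring_module.subspace_scale[OF M(1)] rs(2) ab)
  also have "(1 - r * a) + (r * a) * (1 - s * b) + (r * s) * (a * b) = 1"
   by (simp add: algebra_simps)
  finally show False using M(3) by simp
 qed
 hence "prime_ideal M" using M(1,3) unfolding prime_ideal_def by blast
 with M(2) show ?thesis by blast
qed

lemma prime_ideal_nonzerodivisor:
 "prime_ideal P \<Longrightarrow> f \<notin> P \<Longrightarrow> nonzerodivisor_on_quotient f P"
 unfolding prime_ideal_def nonzerodivisor_on_quotient_def by blast

text \<open>A polynomial relation of a nonzerodivisor can be divided by powers of it until its lowest
 coefficient becomes visible.\<close>

lemma lowest_coefficient:
 fixes I :: "'r::comm_ring_1 set"
 assumes I: "is_ideal I" and f: "nonzerodivisor_on_quotient f I"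
  and rel: "(\<Sum>i\<le>n. a i * f ^ i) \<in> I" and nz: "\<exists>i\<le>n. a i \<noteq> 0"
 shows "\<exists>i\<le>n. a i \<noteq> 0 \<and> (\<exists>r. a i - r * f \<in> I)"
proof -
 define i0 where "i0 = (LEAST i. a i \<noteq> 0)"
 obtain i where i: "i \<le> n" "a i \<noteq> 0" using nz by blast
 have a0: "a i0 \<noteq> 0" unfolding i0_def by (rule LeastI[of "\<lambda>i. a i \<noteq> 0", OF i(2)])
 have i0n: "i0 \<le> n" using Least_le[of "\<lambda>i. a i \<noteq> 0", OF i(2)] i(1) unfolding i0_def by linarith
 have below: "a i = 0" if "i < i0" for i using not_less_Least[OF that[unfolded i0_def]] by blast
 have pow: "g \<in> I" if "f ^ k * g \<in> I" for k g
  using that f by (induction k) (auto simp: nonzerodivisor_on_quotient_def mult.assoc)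
 define r where "r = (\<Sum>i\<in>{Suc i0..n}. a i * f ^ (i - Suc i0))"
 have split: "{..n} = {..<i0} \<union> insert i0 {Suc i0..n}" using i0n by auto
 have "(\<Sum>i\<le>n. a i * f ^ i) = (\<Sum>i<i0. a i * f ^ i) + (\<Sum>i\<in>insert i0 {Suc i0..n}. a i * f ^ i)"
  unfolding split by (rule sum.union_disjoint) auto
 also have "(\<Sum>i<i0. a i * f ^ i) = 0" by (rule sum.neutral) (use below in auto)
 also have "(\<Sum>i\<in>insert i0 {Suc i0..n}. a i * f ^ i) = a i0 * f ^ i0 + (\<Sum>i\<in>{Suc i0..n}. a i * f ^ i)"
  by (rule sum.insert) auto
 also have "(\<Sum>i\<in>{Suc i0..n}. a i * f ^ i) = f ^ i0 * (f * r)"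
  unfolding r_def sum_distrib_left
 proof (rule sum.cong[OF refl])
  fix i assume "i \<in> {Suc i0..n}"
  then obtain d where "i = Suc i0 + d" by (auto simp: le_iff_add)
  thus "a i * f ^ i = f ^ i0 * (f * (a i * f ^ (i - Suc i0)))"
   by (simp add: power_add mult_ac)
 qed
 finally have "(\<Sum>i\<le>n. a i * f ^ i) = f ^ i0 * (a i0 - (- r) * f)" by (simp add: algebra_simps)
 with rel have "a i0 - (- r) * f \<in> I" using pow by simp
 with a0 i0n show ?thesis by blast
qed

text \<open>The inclusion of \<open>K[z]\<close>.\<close>

definition zpoly :: "'a::comm_ring_1 poly \<Rightarrow> 'a ring_S" where
 "zpoly p = poly (map_poly Const p) zS"

lemma comm_ring_hom_zpoly: "comm_ring_hom (zpoly :: 'a::comm_ring_1 poly \<Rightarrow> 'a ring_S)"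
proof -
 interpret C: map_poly_comm_ring_hom "Const :: 'a \<Rightarrow> 'a ring_S"
  by (intro map_poly_comm_ring_hom.intro comm_ring_hom_Const)
 show ?thesis by unfold_locales (simp_all add: zpoly_def C.hom_add C.hom_mult)
qed

lemma zpoly_sum_monom: "zpoly (\<Sum>k\<in>A. monom (c k) k) = (\<Sum>k\<in>A. scale (c k) (zS ^ k))"
 for c :: "nat \<Rightarrow> 'a::comm_ring_1"
proof -
 interpret z: comm_ring_hom "zpoly :: 'a poly \<Rightarrow> _" by (rule comm_ring_hom_zpoly)
 interpret C: comm_ring_hom "Const :: 'a \<Rightarrow> 'a ring_S" by (rule comm_ring_hom_Const)
 have "zpoly (monom (c k) k) = scale (c k) (zS ^ k)" for k
  by (simp add: zpoly_def scale_def map_poly_monom poly_monom)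
 thus ?thesis by (simp add: z.hom_sum)
qed

lemma zpoly_altdef: "zpoly p = (\<Sum>k\<le>degree p. scale (coeff p k) (zS ^ k))"
 using zpoly_sum_monom[of "coeff p" "{..degree p}"] by (simp add: poly_as_sum_of_monoms)

definition deg_le :: "nat \<Rightarrow> 'a::zero ring_S \<Rightarrow> bool" where
 "deg_le N f \<longleftrightarrow> (\<forall>m\<in>keys f. mdeg m \<le> N)"

lemma deg_le_mult: "deg_le M f \<Longrightarrow> deg_le N g \<Longrightarrow> deg_le (M + N) (f * g)"
 for f g :: "'a::comm_ring_1 ring_S"
 unfolding deg_le_def using keys_mult[of f g] by (force simp: mdeg_add intro: add_mono)

lemma deg_le_power: "deg_le M f \<Longrightarrow> deg_le (k * M) (f ^ k)" for f :: "'a::comm_ring_1 ring_S"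
proof (induction k)
 case 0
 thus ?case by (simp add: deg_le_def)
next
 case (Suc k)
 thus ?case using deg_le_mult[of M f "k * M" "f ^ k"] by simp
qed

lemma deg_le_mono: "deg_le M f \<Longrightarrow> M \<le> N \<Longrightarrow> deg_le N f"
 unfolding deg_le_def by (meson le_trans)

text \<open>A graded quotient of dimension one in coordinates where \<open>z\<close> is a parameter: modulo \<open>J\<close> the ring is
 generated over \<open>K[z]\<close> by the monomials \<open>x^a y^b\<close> with \<open>a < p\<close>, \<open>b < q\<close>.\<close>

locale one_dimensional =
 fixes J :: "'a::field ring_S set" and p q :: nat
 assumes J: "homogeneous_ideal J" and zext: "z_extended (lead_mons J)"
  and xp: "mS p 0 0 \<in> lead_mons J" and yq: "mS 0 q 0 \<in> lead_mons J" and proper: "0 \<notin> lead_mons J"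
begin

lemma idJ: "is_ideal J"
 by (rule homogeneous_ideal_is_ideal[OF J])

lemma nzd_z: "nonzerodivisor_on_quotient zS J"
 by (rule z_extended_imp_nonzerodivisor[OF J zext])

lemma one_notin: "1 \<notin> J"
proof
 assume "1 \<in> J"
 moreover have "is_leading_monomial 0 (1 :: 'a ring_S)" unfolding is_leading_monomial_def by simp
 ultimately show False using proper unfolding lead_mons_def by blast
qed

lemma z_power_notin: "zS ^ n \<notin> J"
proof (induction n)
 case 0
 thus ?case using one_notin by simp
next
 case (Suc n)
 thus ?case using nzd_z unfolding nonzerodivisor_on_quotient_def by auto
qed

definition std :: "nat \<Rightarrow> (3 \<Rightarrow>\<^sub>0 nat) set" where
 "std N = (\<lambda>(a, b, c). mS a b c) ` ({..<p} \<times> {..<q} \<times> {..N})"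

lemma std_card: "finite (std N)" "card (std N) \<le> p * q * (N + 1)"
proof -
 show "finite (std N)" unfolding std_def by simp
 have "card (std N) \<le> card ({..<p} \<times> {..<q} \<times> {..N})" unfolding std_def by (rule card_image_le) simp
 thus "card (std N) \<le> p * q * (N + 1)" by (simp add: algebra_simps card_cartesian_product)
qed

lemma not_lead_std: "\<mu> \<notin> lead_mons J \<Longrightarrow> mdeg \<mu> \<le> N \<Longrightarrow> \<mu> \<in> std N"
proof -
 assume \<mu>: "\<mu> \<notin> lead_mons J" "mdeg \<mu> \<le> N"
 obtain a b c where abc: "\<mu> = mS a b c" by (rule mS_cases)
 have "a < p"
 proof (rule ccontr)
  assume "\<not> a < p"
  hence "\<mu> = mS (a - p) b c + mS p 0 0" by (simp add: abc mS_add)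
  thus False using lead_mons_add[OF idJ xp, of "mS (a - p) b c"] \<mu>(1) by simp
 qed
 moreover have "b < q"
 proof (rule ccontr)
  assume "\<not> b < q"
  hence "\<mu> = mS a (b - q) c + mS 0 q 0" by (simp add: abc mS_add)
  thus False using lead_mons_add[OF idJ yq, of "mS a (b - q) c"] \<mu>(1) by simp
 qed
 ultimately have "(a, b, c) \<in> {..<p} \<times> {..<q} \<times> {..N}" using \<mu>(2) by (simp add: abc)
 hence "(\<lambda>(a, b, c). mS a b c) (a, b, c) \<in> std N" unfolding std_def by (rule imageI)
 thus ?thesis by (simp add: abc)
qed

lemma reduce:
 assumes "deg_le N g"
 shows "\<exists>r. g - r \<in> J \<and> r \<in> mpoly_vs.span (monomial ` std N)"
proof -
 have "\<exists>r. hcomp n g - r \<in> J \<and> r \<in> mpoly_vs.span (monomial ` std N)" if n: "n \<le> N" for n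
 proof -
  obtain v where v: "v \<in> J" "v \<in> forms n" "keys (hcomp n g - v) \<subseteq> {m. mdeg m = n} - lead_mons J"
   using normal_form[OF J hcomp_forms, of n g] by blast
  let ?r = "hcomp n g - v"
  have "(\<Sum>m\<in>keys ?r. scale (lookup ?r m) (single m 1)) \<in> mpoly_vs.span (monomial ` std N)"
   unfolding monomial_def
  proof (intro mpoly_vs.span_sum mpoly_vs.span_scale mpoly_vs.span_base imageI not_lead_std)
   fix m assume "m \<in> keys ?r"
   thus "m \<notin> lead_mons J" "mdeg m \<le> N" using v(3) n by auto
  qed
  hence "?r \<in> mpoly_vs.span (monomial ` std N)" by (simp only: mpoly_scale_as_sum[symmetric])
  thus ?thesis using v(1) by (intro exI[of _ ?r]) simp
 qed
 then obtain r where r: "\<And>n. n \<le> N \<Longrightarrow> hcomp n g - r n \<in> J"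
  "\<And>n. n \<le> N \<Longrightarrow> r n \<in> mpoly_vs.span (monomial ` std N)" by metis
 have "(\<Sum>n\<le>N. hcomp n g - r n) \<in> J" by (rule ring_module.subspace_sum[OF idJ]) (simp add: r)
 moreover have "g = (\<Sum>n\<le>N. hcomp n g)" by (rule sum_hcomp) (use assms in \<open>simp add: deg_le_def\<close>)
 ultimately have "g - (\<Sum>n\<le>N. r n) \<in> J" by (simp add: sum_subtractf)
 moreover have "(\<Sum>n\<le>N. r n) \<in> mpoly_vs.span (monomial ` std N)"
  by (rule mpoly_vs.span_sum) (simp add: r)
 ultimately show ?thesis by blast
qed

text \<open>Modulo \<open>J\<close> the ring is generated over \<open>K[z]\<close> by the \<open>p q\<close> monomials with exponents below
 \<open>p\<close> and \<open>q\<close>; counting dimensions shows that the powers of \<open>f\<close> satisfy a relation over \<open>K[z]\<close>.\<close>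

lemma algebraic_over_z:
 "\<exists>n c. (\<exists>i\<le>n. c i \<noteq> 0) \<and> (\<Sum>i\<le>n. zpoly (c i) * f ^ i) \<in> J"
proof -
 obtain d where d: "deg_le d f" using mdeg_bound unfolding deg_le_def by blast
 define n where "n = p * q"
 define B where "B = n * n * d"
 define N where "N = B + n * d"
 let ?I = "{..n} \<times> {..B}"
 define e where "e = (\<lambda>(i, k). zS ^ k * f ^ i)"
 have "\<exists>r. e ik - r \<in> J \<and> r \<in> mpoly_vs.span (monomial ` std N)" if ikI: "ik \<in> ?I" for ik
 proof (rule reduce)
  obtain i k where ik: "ik = (i, k)" "i \<le> n" "k \<le> B" using ikI by auto
  have "deg_le 1 zS" unfolding deg_le_def by (simp add: Var_S)
  hence "deg_le (k * 1 + i * d) (zS ^ k * f ^ i)" using d by (intro deg_le_mult deg_le_power)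
  moreover have "k * 1 + i * d \<le> N" unfolding N_def using ik by (simp add: add_mono)
  ultimately show "deg_le N (e ik)" unfolding e_def ik(1) by (simp add: deg_le_mono)
 qed
 then obtain r where r: "\<And>ik. ik \<in> ?I \<Longrightarrow> e ik - r ik \<in> J"
  "\<And>ik. ik \<in> ?I \<Longrightarrow> r ik \<in> mpoly_vs.span (monomial ` std N)" by metis
 have card: "card (monomial ` std N :: 'a ring_S set) < card ?I"
 proof -
  have "card (monomial ` std N :: 'a ring_S set) \<le> card (std N)" by (rule card_image_le[OF std_card(1)])
  also have "\<dots> \<le> n * (N + 1)" unfolding n_def by (rule std_card(2))
  also have "\<dots> = n * (B + 1) + B" unfolding N_def B_def by (simp add: algebra_simps)
  also have "\<dots> < (n + 1) * (B + 1)" by simp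
  finally show ?thesis by (simp add: card_cartesian_product)
 qed
 obtain c where c: "\<exists>ik\<in>?I. c ik \<noteq> 0" "(\<Sum>ik\<in>?I. scale (c ik) (r ik)) = 0"
  using family_dependent[of ?I "monomial ` std N" r] r(2) card std_card(1) by auto
 have "(\<Sum>ik\<in>?I. scale (c ik) (e ik - r ik)) \<in> J"
  by (rule mpoly_vs.subspace_sum[OF is_ideal_imp_subspace[OF idJ]],
    rule mpoly_vs.subspace_scale[OF is_ideal_imp_subspace[OF idJ]], rule r)
 hence 1: "(\<Sum>ik\<in>?I. scale (c ik) (e ik)) \<in> J"
  using c(2) by (simp add: mpoly_vs.scale_right_diff_distrib sum_subtractf)
 define C where "C = (\<lambda>i. \<Sum>k\<le>B. monom (c (i, k)) k)"
 have "(\<Sum>ik\<in>?I. scale (c ik) (e ik)) = (\<Sum>i\<le>n. \<Sum>k\<le>B. scale (c (i, k)) (zS ^ k * f ^ i))"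
  unfolding sum.cartesian_product by (rule sum.cong) (auto simp: e_def)
 also have "\<dots> = (\<Sum>i\<le>n. zpoly (C i) * f ^ i)"
  unfolding C_def zpoly_sum_monom by (simp add: sum_distrib_right scale_mult_left)
 finally have 2: "(\<Sum>i\<le>n. zpoly (C i) * f ^ i) \<in> J" using 1 by simp
 obtain i k where ik: "i \<le> n" "k \<le> B" "c (i, k) \<noteq> 0" using c(1) by auto
 have "coeff (C i) k = (\<Sum>k'\<le>B. if k' = k then c (i, k) else 0)"
  unfolding C_def coeff_sum by (rule sum.cong) (auto simp: coeff_monom)
 hence "C i \<noteq> 0" using ik by auto
 with 2 ik(1) show ?thesis by blast
qed

text \<open>An ideal above \<open>J\<close> that contains a nonzero polynomial in \<open>z\<close> has finite codimension, so
 modulo it the powers of any element are linearly dependent.\<close>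

lemma finite_codimension:
 assumes I: "is_ideal I" "J \<subseteq> I" and c: "zpoly c \<in> I" "c \<noteq> 0"
 shows "\<exists>n k. (\<exists>i\<le>n. k i \<noteq> 0) \<and> (\<Sum>i\<le>n. scale (k i) (f ^ i)) \<in> I"
proof -
 interpret z: comm_ring_hom "zpoly :: 'a poly \<Rightarrow> _" by (rule comm_ring_hom_zpoly)
 let ?T = "monomial ` std (degree c) :: 'a ring_S set"
 note subI = is_ideal_imp_subspace[OF I(1)]
 have mon: "\<exists>r. monomial \<mu> - r \<in> I \<and> r \<in> mpoly_vs.span ?T" if \<mu>N: "\<mu> \<in> std N" for \<mu> N
 proof -
  obtain a b k where \<mu>: "\<mu> = mS a b k" "a < p" "b < q" using \<mu>N unfolding std_def by auto
  define s where "s = monom 1 k mod c"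
  define r where "r = monomial (mS a b 0) * zpoly s"
  have "monomial \<mu> = monomial (mS a b 0) * zpoly (monom (1::'a) k)"
   using zpoly_sum_monom[of "\<lambda>_. 1 :: 'a" "{k}"] by (simp add: \<mu>(1) monomial_def Var_S_power mult_single mS_add scale_def Const_def)
  also have "monom (1::'a) k = (monom 1 k div c) * c + s"
   unfolding s_def by simp
  finally have "monomial \<mu> - r = (monomial (mS a b 0) * zpoly (monom 1 k div c)) * zpoly c"
   by (simp add: r_def z.hom_add z.hom_mult algebra_simps)
  hence "monomial \<mu> - r \<in> I" using ring_module.subspace_scale[OF I(1) c(1)] by simp
  moreover have "r \<in> mpoly_vs.span ?T"
  proof -
   have "degree s \<le> degree c"
    unfolding s_def using degree_mod_less'[of c "monom 1 k"] c(2) by (cases "monom 1 k mod c = 0") auto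
   moreover have "r = (\<Sum>e\<le>degree s. scale (coeff s e) (monomial (mS a b e)))"
    unfolding r_def zpoly_altdef sum_distrib_left
    by (rule sum.cong) (simp_all add: scale_mult_right monomial_def Var_S_power mult_single mS_add)
   moreover have "monomial (mS a b e) \<in> ?T" if "e \<le> degree c" for e
   proof -
    have "(\<lambda>(a, b, c). mS a b c) (a, b, e) \<in> std (degree c)"
     unfolding std_def by (rule imageI) (use that \<mu> in simp)
    thus ?thesis by simp
   qed
   ultimately show ?thesis
    by (simp only:) (intro mpoly_vs.span_sum mpoly_vs.span_scale mpoly_vs.span_base, simp)
  qed
  ultimately show ?thesis by blast
 qed
 have red: "\<exists>r. g - r \<in> I \<and> r \<in> mpoly_vs.span ?T" for g
 proof -
  obtain N where "deg_le N g" using mdeg_bound unfolding deg_le_def by blast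
  then obtain r0 where r0: "g - r0 \<in> J" "r0 \<in> mpoly_vs.span (monomial ` std N)" using reduce by blast
  have "\<exists>r. r0 - r \<in> I \<and> r \<in> mpoly_vs.span ?T"
   using r0(2)
  proof (induction rule: mpoly_vs.span_induct_alt)
   case base
   show ?case using mpoly_vs.subspace_0[OF subI] by (intro exI[of _ 0]) (simp add: mpoly_vs.span_zero)
  next
   case (step a x y)
   obtain r where r: "y - r \<in> I" "r \<in> mpoly_vs.span ?T" using step(2) by blast
   obtain s where s: "x - s \<in> I" "s \<in> mpoly_vs.span ?T" using mon step(1) by blast
   have "scale a (x - s) + (y - r) \<in> I"
    by (rule mpoly_vs.subspace_add[OF subI mpoly_vs.subspace_scale[OF subI s(1)] r(1)])
   also have "scale a (x - s) + (y - r) = scale a x + y - (scale a s + r)"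
    by (simp add: mpoly_vs.scale_right_diff_distrib)
   finally have "scale a x + y - (scale a s + r) \<in> I" .
   moreover have "scale a s + r \<in> mpoly_vs.span ?T"
    by (rule mpoly_vs.span_add[OF mpoly_vs.span_scale[OF s(2)] r(2)])
   ultimately show ?case by blast
  qed
  then obtain r where r: "r0 - r \<in> I" "r \<in> mpoly_vs.span ?T" by blast
  have "(g - r0) + (r0 - r) \<in> I" using r0(1) I(2) r(1) by (intro ring_module.subspace_add[OF I(1)]) auto
  thus ?thesis using r(2) by auto
 qed
 define n where "n = card ?T"
 define r where "r = (\<lambda>i. SOME r. f ^ i - r \<in> I \<and> r \<in> mpoly_vs.span ?T)"
 have r: "f ^ i - r i \<in> I" "r i \<in> mpoly_vs.span ?T" for i
  using someI_ex[OF red[of "f ^ i"]] unfolding r_def by blast+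
 have "finite ?T" using std_card(1) by simp
 then obtain k where k: "\<exists>i\<in>{..n}. k i \<noteq> 0" "(\<Sum>i\<in>{..n}. scale (k i) (r i)) = 0"
  using family_dependent[of "{..n}" ?T r] r(2) unfolding n_def by auto
 have "(\<Sum>i\<in>{..n}. scale (k i) (f ^ i - r i)) \<in> I"
  by (rule mpoly_vs.subspace_sum[OF subI], rule mpoly_vs.subspace_scale[OF subI], rule r)
 hence "(\<Sum>i\<in>{..n}. scale (k i) (f ^ i)) \<in> I"
  using k(2) by (simp add: mpoly_vs.scale_right_diff_distrib sum_subtractf)
 with k(1) show ?thesis by (intro exI[of _ n] exI[of _ k]) auto
qed

text \<open>In a finite-dimensional quotient a nonzerodivisor is a unit: its powers satisfy a relation, whose
 lowest coefficient is a nonzero constant.\<close>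

lemma nonzerodivisor_invertible:
 assumes I: "is_ideal I" "J \<subseteq> I" and c: "zpoly c \<in> I" "c \<noteq> 0" and f: "nonzerodivisor_on_quotient f I"
 shows "\<exists>r. 1 - r * f \<in> I"
proof -
 obtain n k where nk: "\<exists>i\<le>n. k i \<noteq> 0" "(\<Sum>i\<le>n. scale (k i) (f ^ i)) \<in> I"
  using finite_codimension[OF I c, of f] by (elim exE conjE) (rule that, auto)
 have cinj: "(Const (k i) :: 'a ring_S) \<noteq> 0 \<longleftrightarrow> k i \<noteq> 0" for i
  by (simp add: Const_def) (metis lookup_single_eq lookup_zero single_zero)
 have "\<exists>i\<le>n. Const (k i) \<noteq> (0 :: 'a ring_S) \<and> (\<exists>r. Const (k i) - r * f \<in> I)"
  using nk by (intro lowest_coefficient[OF I(1) f]) (simp_all only: scale_def cinj)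
 then obtain i r where ir: "k i \<noteq> 0" "Const (k i) - r * f \<in> I" unfolding cinj by (elim exE conjE) (rule that, auto)
 have "Const (inverse (k i)) * (Const (k i) - r * f) \<in> I" by (rule ring_module.subspace_scale[OF I(1) ir(2)])
 also have "Const (inverse (k i)) * (Const (k i) - r * f) = 1 - (Const (inverse (k i)) * r) * f"
  using ir(1) by (simp add: right_diff_distrib Const_def mult_single mult.assoc)
 finally show ?thesis by blast
qed

text \<open>The lowest coefficient of a relation of \<open>f\<close> over \<open>K[z]\<close> is a multiple of \<open>f\<close> modulo the ideal.\<close>

lemma zpoly_in_sum:
 assumes I: "is_ideal I" "J \<subseteq> I" and f: "nonzerodivisor_on_quotient f I"
 shows "\<exists>c r. c \<noteq> 0 \<and> zpoly c - r * f \<in> I"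
proof -
 obtain n c where nc: "\<exists>i\<le>n. c i \<noteq> 0" "(\<Sum>i\<le>n. zpoly (c i) * f ^ i) \<in> J"
  using algebraic_over_z[of f] by (elim exE conjE) (rule that, auto)
 have zinj: "zpoly d \<noteq> 0" if "d \<noteq> 0" for d :: "'a poly"
 proof
  assume z0: "zpoly d = 0"
  obtain k where k: "coeff d k \<noteq> 0" using \<open>d \<noteq> 0\<close> by (metis leading_coeff_0_iff)
  hence kd: "k \<le> degree d" by (rule le_degree)
  have "lookup (zpoly d) (mS 0 0 k) = (\<Sum>e\<le>degree d. if e = k then coeff d k else 0)"
   unfolding zpoly_altdef lookup_sum by (rule sum.cong) (auto simp: Var_S_power lookup_single when_def)
  thus False using z0 k kd by simp
 qed
 have "\<exists>i\<le>n. zpoly (c i) \<noteq> 0 \<and> (\<exists>r. zpoly (c i) - r * f \<in> I)"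
 proof (rule lowest_coefficient[OF I(1) f])
  show "(\<Sum>i\<le>n. zpoly (c i) * f ^ i) \<in> I" using nc(2) I(2) by (rule rev_subsetD)
  show "\<exists>i\<le>n. zpoly (c i) \<noteq> 0" using nc(1) zinj by auto
 qed
 then obtain i r where "zpoly (c i) \<noteq> 0" "zpoly (c i) - r * f \<in> I" by (elim exE conjE) (rule that, auto)
 moreover have "c i \<noteq> 0" using calculation(1) by (auto simp: zpoly_def)
 ultimately show ?thesis by blast
qed

text \<open>Modulo such a prime the ring is finite-dimensional over \<open>K\<close>, so every element outside the prime
 is a unit modulo it.\<close>

lemma prime_maximal:
 assumes P: "prime_ideal P" "J \<subseteq> P" and c: "zpoly c \<in> P" "c \<noteq> 0" and Q: "is_ideal Q" "P \<subset> Q"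
 shows "Q = UNIV"
proof -
 have idP: "is_ideal P" using P(1) unfolding prime_ideal_def by blast
 obtain f where f: "f \<in> Q" "f \<notin> P" using Q(2) by blast
 obtain r where r: "1 - r * f \<in> P"
  using nonzerodivisor_invertible[OF idP P(2) c prime_ideal_nonzerodivisor[OF P(1) f(2)]] by blast
 have "(1 - r * f) + r * f \<in> Q"
  using r Q(2) by (intro ring_module.subspace_add[OF Q(1)] ring_module.subspace_scale[OF Q(1) f(1)]) auto
 hence "1 \<in> Q" by simp
 hence "g * 1 \<in> Q" for g by (rule ring_module.subspace_scale[OF Q(1)])
 thus ?thesis by auto
qed

text \<open>A prime properly above another one contains a nonzerodivisor modulo it, hence a nonzero polynomial
 in \<open>z\<close>, and is therefore maximal.\<close>

lemma krull_dim_le: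
 assumes "\<forall>i\<le>n. prime_ideal (P i) \<and> J \<subseteq> P i" "\<forall>i<n. P i \<subset> P (Suc i)"
 shows "n \<le> 1"
proof (rule ccontr)
 assume "\<not> n \<le> 1"
 hence n: "0 \<le> n" "1 \<le> n" "2 \<le> n" "0 < n" "1 < n" by auto
 have P: "prime_ideal (P i)" "J \<subseteq> P i" "is_ideal (P i)" "P i \<noteq> UNIV" if "i \<le> n" for i
  using assms(1) that unfolding prime_ideal_def by auto
 have P01: "P 0 \<subset> P 1" and P12: "P 1 \<subset> P 2" using assms(2) n by (auto simp: numeral_2_eq_2)
 obtain f where f: "f \<in> P 1" "f \<notin> P 0" using P01 by blast
 obtain c r where c: "c \<noteq> 0" "zpoly c - r * f \<in> P 0"
  using zpoly_in_sum[OF P(3)[OF n(1)] P(2)[OF n(1)] prime_ideal_nonzerodivisor[OF P(1)[OF n(1)] f(2)]] by blast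
 have "(zpoly c - r * f) + r * f \<in> P 1"
  using c(2) P01 by (intro ring_module.subspace_add[OF P(3)[OF n(2)]] ring_module.subspace_scale[OF P(3)[OF n(2)] f(1)]) auto
 hence "zpoly c \<in> P 1" by simp
 from prime_maximal[OF P(1)[OF n(2)] P(2)[OF n(2)] this c(1) P(3)[OF n(3)] P12]
 show False using P(4)[OF n(3)] by simp
qed

text \<open>After one regular element the quotient is finite over \<open>K\<close>, where nonzerodivisors are units.\<close>

lemma regular_sequence_length:
 assumes reg: "regular_sequence J fs"
 shows "length fs \<le> 1"
proof (rule ccontr)
 assume "\<not> ?thesis"
 then obtain f1 f2 rest where fs: "fs = f1 # f2 # rest" by (cases fs; cases "tl fs") auto
 let ?I = "ideal_gen (J \<union> {f1})"
 have nzd: "nonzerodivisor_on_quotient (fs ! i) (ideal_gen (J \<union> set (take i fs)))" if "i < length fs" for i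
  using reg that unfolding regular_sequence_def by blast
 have f1: "nonzerodivisor_on_quotient f1 J"
  using nzd[of 0] ring_module.span_eq_iff[THEN iffD2, OF idJ] by (simp add: fs)
 have f2: "nonzerodivisor_on_quotient f2 ?I" using nzd[of 1] by (simp add: fs)
 have IJ: "J \<subseteq> ?I" and f1I: "f1 \<in> ?I" using ring_module.span_superset[of "J \<union> {f1}"] by auto
 have idI: "is_ideal ?I" by (rule ring_module.subspace_span)
 obtain c r where c: "c \<noteq> 0" "zpoly c - r * f1 \<in> J" using zpoly_in_sum[OF idJ subset_refl f1] by blast
 have "(zpoly c - r * f1) + r * f1 \<in> ?I"
  using c(2) IJ by (intro ring_module.subspace_add[OF idI] ring_module.subspace_scale[OF idI f1I]) auto
 hence "zpoly c \<in> ?I" by simp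
 from nonzerodivisor_invertible[OF idI IJ this c(1) f2] obtain s where s: "1 - s * f2 \<in> ?I" by blast
 let ?U = "ideal_gen (J \<union> set fs)"
 have "?I \<subseteq> ?U" by (rule ring_module.span_mono) (auto simp: fs)
 moreover have "f2 \<in> ?U" by (rule ring_module.span_base) (simp add: fs)
 ultimately have "(1 - s * f2) + s * f2 \<in> ?U"
  using s by (intro ring_module.span_add ring_module.span_scale) auto
 hence "1 \<in> ?U" by simp
 hence "g * 1 \<in> ?U" for g by (rule ring_module.span_scale)
 hence "?U = UNIV" by auto
 thus False using reg unfolding regular_sequence_def by blast
qed

lemma proper_dehomogenization: "1 \<notin> ideal_gen (insert (zS - 1) J)"
proof
 assume "1 \<in> ideal_gen (insert (zS - 1) J)"
 then obtain g where g: "1 - g * (zS - 1) \<in> J"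
  using ring_module.span_eq_iff[THEN iffD2, OF idJ] by (auto simp: ring_module.span_breakdown_eq)
 have comp: "hcomp n (1 - g * (zS - 1)) = (if n = 0 then 1 else 0) + hcomp n g - (if n = 0 then 0 else hcomp (n - 1) g * zS)" for n
 proof -
  have eq: "1 - g * (zS - 1) = 1 + g + scale (-1) (g * zS)"
   by (simp add: algebra_simps scale_def Const_def single_uminus)
  have "hcomp n (1 - g * (zS - 1)) = hcomp n 1 + hcomp n g + scale (-1) (hcomp n (g * zS))"
   unfolding eq hcomp_add hcomp_scale by (rule refl)
  moreover have "hcomp n (1 :: 'a ring_S) = (if n = 0 then 1 else 0)"
   using hcomp_of_form[OF forms_one, of n] by auto
  moreover have "hcomp n (g * zS) = (if n = 0 then 0 else hcomp (n - 1) g * zS)"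
   using hcomp_mult_form[OF forms_Var, of n g 2] by auto
  ultimately show ?thesis by (simp add: scale_def Const_def single_uminus)
 qed
 have h: "(if n = 0 then 1 else 0) + hcomp n g - (if n = 0 then 0 else hcomp (n - 1) g * zS) \<in> J" for n
  using homogeneous_ideal_hcomp[OF J g, of n] unfolding comp .
 have zn: "zS ^ n + hcomp n g \<in> J" for n
 proof (induction n)
  case 0
  thus ?case using h[of 0] by simp
 next
  case (Suc n)
  have "zS * (zS ^ n + hcomp n g) + (hcomp (Suc n) g - hcomp n g * zS) \<in> J"
   using h[of "Suc n"] by (intro ring_module.subspace_add[OF idJ] ring_module.subspace_scale[OF idJ Suc]) simp
  also have "zS * (zS ^ n + hcomp n g) + (hcomp (Suc n) g - hcomp n g * zS) = zS ^ Suc n + hcomp (Suc n) g"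
   by (simp add: algebra_simps)
  finally show ?case .
 qed
 obtain N where N: "\<forall>m\<in>keys g. mdeg m \<le> N" using mdeg_bound by blast
 have "hcomp (Suc N) g = 0"
  by (rule poly_mapping_eqI) (use N in \<open>force simp: lookup_hcomp when_def in_keys_iff\<close>)
 thus False using zn[of "Suc N"] z_power_notin[of "Suc N"] by simp
qed

end

lemma irrelevant_kernel:
 "irrelevant_ideal = {f :: 'a::comm_ring_1 ring_S. insertion (\<lambda>a. a) (\<lambda>_. 0) f = 0}"
proof -
 let ?e = "insertion (\<lambda>a. a) (\<lambda>_. 0) :: 'a ring_S \<Rightarrow> 'a"
 interpret e: comm_ring_hom ?e by (rule comm_ring_hom_insertion[OF comm_ring_hom_id])
 have id: "is_ideal {f. ?e f = 0}"
  unfolding ring_module.subspace_def by (simp add: e.hom_add e.hom_mult)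
 have "range Var \<subseteq> {f. ?e f = 0}" by (auto simp: insertion_Var[OF comm_ring_hom_id])
 hence 1: "irrelevant_ideal \<subseteq> {f. ?e f = 0}"
  unfolding irrelevant_ideal_def by (intro ring_module.span_minimal id)
 have "f \<in> irrelevant_ideal" if "?e f = 0" for f
 proof -
  have "f - Const (?e f) \<in> irrelevant_ideal"
   unfolding irrelevant_ideal_def
   by (rule insertion_congruence[OF ring_module.subspace_span])
    (simp add: Const_def ring_module.span_base)
  thus ?thesis using that by (simp add: Const_def)
 qed
 with 1 show ?thesis by auto
qed

lemma root_exists: "\<exists>x. poly p x = 0" if "degree p > 0" for p :: "'a::alg_closed_field poly"
 using alg_closed_imp_poly_has_root[of p] that by blast

text \<open>A closed point gives a line through the origin on which \<open>J\<close> vanishes; the prime ideal of the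
 line lies strictly below the irrelevant ideal.\<close>

lemma krull_dim_ge:
 fixes J :: "'a::alg_closed_field ring_S set"
 assumes "one_dimensional J p q"
 shows "\<exists>P :: nat \<Rightarrow> 'a ring_S set. (\<forall>i\<le>1. prime_ideal (P i) \<and> J \<subseteq> P i) \<and> (\<forall>i<1. P i \<subset> P (Suc i))"
proof -
 interpret one_dimensional J p q by fact
 let ?I = "ideal_gen (insert (zS - 1) J)"
 obtain P where P: "prime_ideal P" "?I \<subseteq> P"
  using prime_ideal_exists[OF ring_module.subspace_span proper_dehomogenization] by blast
 have JP: "J \<subseteq> P" and zP: "zS - 1 \<in> P" using ring_module.span_superset[of "insert (zS - 1) J"] P(2) by auto
 have idP: "is_ideal P" and P1: "P \<noteq> UNIV" using P(1) unfolding prime_ideal_def by blast+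
 have unit: "1 \<notin> P"
 proof
  assume "1 \<in> P"
  hence "g * 1 \<in> P" for g by (rule ring_module.subspace_scale[OF idP])
  thus False using P1 by auto
 qed
 have zlin: "zpoly [:- 1, 1:] \<in> P"
  using zP by (simp add: zpoly_def Const_def single_uminus)
 have one_minus_X_nz: "[:- 1, 1:] \<noteq> (0 :: 'a poly)" by simp
 have ex: "\<exists>\<kappa>. f - Const \<kappa> \<in> P" for f
 proof -
  obtain n k where nk: "\<exists>i\<le>n. k i \<noteq> 0" "(\<Sum>i\<le>n. scale (k i) (f ^ i)) \<in> P"
   using finite_codimension[OF idP JP zlin one_minus_X_nz, of f] by (elim exE conjE) (rule that, auto)
  define Q where "Q = (\<lambda>F :: 'a poly. F \<noteq> 0 \<and> poly (map_poly Const F) f \<in> P)"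
  interpret C: map_poly_comm_ring_hom "Const :: 'a \<Rightarrow> 'a ring_S"
   by (intro map_poly_comm_ring_hom.intro comm_ring_hom_Const)
  interpret C': comm_ring_hom "Const :: 'a \<Rightarrow> 'a ring_S" by (rule comm_ring_hom_Const)
  have "Q F \<Longrightarrow> \<exists>\<kappa>. f - Const \<kappa> \<in> P" for F
  proof (induction "degree F" arbitrary: F rule: less_induct)
   case less
   show ?case
   proof (cases "degree F = 0")
    case True
    then obtain \<kappa> where \<kappa>: "F = [:\<kappa>:]" by (rule degree_eq_zeroE)
    with less.prems have "\<kappa> \<noteq> 0" "Const \<kappa> \<in> P" unfolding Q_def by auto
    hence "Const (inverse \<kappa>) * Const \<kappa> \<in> P" by (intro ring_module.subspace_scale[OF idP])
    hence "1 \<in> P" using \<open>\<kappa> \<noteq> 0\<close> by (simp add: Const_def mult_single)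
    with unit show ?thesis by blast
   next
    case False
    then obtain \<kappa> where "poly F \<kappa> = 0" using root_exists[of F] by auto
    then obtain G where G: "F = [:- \<kappa>, 1:] * G" by (metis poly_eq_0_iff_dvd dvdE)
    have F0: "F \<noteq> 0" using less.prems unfolding Q_def by blast
    have "poly (map_poly Const F) f = (f - Const \<kappa>) * poly (map_poly Const G) f"
     unfolding G C.hom_mult by (simp add: Const_def single_uminus left_diff_distrib)
    hence "f - Const \<kappa> \<in> P \<or> poly (map_poly Const G) f \<in> P"
     using less.prems P(1) unfolding Q_def prime_ideal_def by metis
    moreover have "degree G < degree F" "G \<noteq> 0"
    proof -
     show "G \<noteq> 0" using F0 G by auto
     thus "degree G < degree F"
      unfolding G by (subst degree_mult_eq) auto
    qed
    ultimately show ?thesis using less.hyps[of G] unfolding Q_def by blast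
   qed
  qed
  moreover have "Q (\<Sum>i\<le>n. monom (k i) i)"
   unfolding Q_def
  proof
   obtain i where i: "i \<le> n" "k i \<noteq> 0" using nk(1) by blast
   have "coeff (\<Sum>i\<le>n. monom (k i) i) i = (\<Sum>j\<le>n. if j = i then k i else 0)"
    unfolding coeff_sum by (rule sum.cong) (auto simp: coeff_monom)
   thus "(\<Sum>i\<le>n. monom (k i) i) \<noteq> 0" using i by auto
   have "poly (map_poly Const (\<Sum>i\<le>n. monom (k i) i)) f = (\<Sum>i\<le>n. scale (k i) (f ^ i))"
    by (simp add: C.hom_sum poly_sum map_poly_monom poly_monom scale_def)
   thus "poly (map_poly Const (\<Sum>i\<le>n. monom (k i) i)) f \<in> P" using nk(2) by simp
  qed
  ultimately show ?thesis by blast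
 qed
 obtain \<kappa>1 \<kappa>2 where xy: "xS - Const \<kappa>1 \<in> P" "yS - Const \<kappa>2 \<in> P" using ex[of xS] ex[of yS] by (elim exE) (rule that)
 define \<phi> where "\<phi> = (\<lambda>v::3. if v = 0 then \<kappa>1 else if v = 1 then \<kappa>2 else 1)"
 define \<psi> where "\<psi> = (\<lambda>v::3. monom (\<phi> v) 1)"
 let ?e = "insertion (\<lambda>a. a) \<phi> :: 'a ring_S \<Rightarrow> 'a"
 let ?h = "insertion (\<lambda>a. [:a:]) \<psi> :: 'a ring_S \<Rightarrow> 'a poly"
 have hom0: "comm_ring_hom (\<lambda>a::'a. [:a:])" by unfold_locales simp_all
 interpret h: comm_ring_hom ?h by (rule comm_ring_hom_insertion[OF hom0])
 interpret e: comm_ring_hom ?e by (rule comm_ring_hom_insertion[OF comm_ring_hom_id])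
 have \<phi>: "Var v - Const (\<phi> v) \<in> P" for v
 proof -
  have "\<forall>v. Var v - Const (\<phi> v) \<in> P"
   unfolding all_3 using xy zP by (simp add: \<phi>_def Const_def)
  thus ?thesis ..
 qed
 have e0: "?e f = 0" if f: "f \<in> J" for f
 proof (rule ccontr)
  assume nz: "?e f \<noteq> 0"
  have "f - (f - Const (?e f)) \<in> P"
   by (rule ring_module.subspace_diff[OF idP subsetD[OF JP f] insertion_congruence[OF idP \<phi>]])
  hence "Const (inverse (?e f)) * Const (?e f) \<in> P" by (intro ring_module.subspace_scale[OF idP]) simp
  thus False using nz unit by (simp add: Const_def mult_single)
 qed
 have hform: "?h f = monom (?e f) d" if f: "f \<in> forms d" for f d
 proof -
  have mon: "?h (single \<mu> c) = monom (?e (single \<mu> c)) (mdeg \<mu>)" for \<mu> c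
  proof -
   have "(\<Prod>v\<in>A. \<psi> v ^ lookup \<mu> v) = monom (\<Prod>v\<in>A. \<phi> v ^ lookup \<mu> v) (\<Sum>v\<in>A. lookup \<mu> v)" if "finite A" for A
    using that by (induction A rule: finite_induct) (simp_all add: \<psi>_def monom_power mult_monom)
   from this[OF finite_keys] have "(\<Prod>v\<in>keys \<mu>. \<psi> v ^ lookup \<mu> v) = monom (\<Prod>v\<in>keys \<mu>. \<phi> v ^ lookup \<mu> v) (mdeg \<mu>)"
    unfolding mdeg_def .
   thus ?thesis
    by (simp add: insertion_single_hom[OF hom0] insertion_single_hom[OF comm_ring_hom_id] smult_monom)
  qed
  have "?h f = (\<Sum>\<mu>\<in>keys f. ?h (single \<mu> (lookup f \<mu>)))"
   by (subst mpoly_as_sum[of f]) (rule h.hom_sum)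
  also have "\<dots> = (\<Sum>\<mu>\<in>keys f. monom (?e (single \<mu> (lookup f \<mu>))) d)"
   by (rule sum.cong) (use f in \<open>auto simp: mon forms_def\<close>)
  also have "\<dots> = monom (\<Sum>\<mu>\<in>keys f. ?e (single \<mu> (lookup f \<mu>))) d"
   by (rule monom_sum[symmetric])
  also have "(\<Sum>\<mu>\<in>keys f. ?e (single \<mu> (lookup f \<mu>))) = ?e f"
   by (subst (3) mpoly_as_sum[of f]) (rule e.hom_sum[symmetric])
  finally show ?thesis .
 qed
 let ?P0 = "{f. ?h f = 0}"
 have P0: "prime_ideal ?P0" by (rule prime_ideal_kernel) (rule comm_ring_hom_insertion[OF hom0])
 have JP0: "J \<subseteq> ?P0"
 proof
  fix f assume f: "f \<in> J"
  obtain N where N: "\<forall>m\<in>keys f. mdeg m \<le> N" using mdeg_bound by blast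
  have "?h (hcomp n f) = 0" for n
   using hform[OF hcomp_forms, of n f] e0[OF homogeneous_ideal_hcomp[OF J f], of n] by simp
  hence "?h (\<Sum>n\<le>N. hcomp n f) = 0" by (simp add: h.hom_sum)
  moreover have "f = (\<Sum>n\<le>N. hcomp n f)" using N by (intro sum_hcomp) auto
  ultimately show "f \<in> ?P0" by simp
 qed
 have prime_irr: "prime_ideal (irrelevant_ideal :: 'a ring_S set)"
  unfolding irrelevant_kernel by (rule prime_ideal_kernel[OF comm_ring_hom_insertion[OF comm_ring_hom_id]])
 have sub: "?P0 \<subseteq> irrelevant_ideal"
 proof
  fix f assume f: "f \<in> ?P0"
  let ?c = "insertion (\<lambda>a. a) (\<lambda>_. 0) f"
  have low: "poly (?h g) 0 = 0" if "g \<in> irrelevant_ideal" for g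
   using that unfolding irrelevant_ideal_def
  proof (induction rule: ring_module.span_induct_alt)
   case (step r x y)
   then obtain v where "x = Var v" by blast
   hence "poly (?h x) 0 = 0" by (simp add: insertion_Var[OF hom0] \<psi>_def poly_monom)
   with step show ?case by (simp add: h.hom_add h.hom_mult)
  qed simp
  have "f - Const ?c \<in> irrelevant_ideal"
   unfolding irrelevant_ideal_def
   by (rule insertion_congruence[OF ring_module.subspace_span]) (simp add: Const_def ring_module.span_base)
  from low[OF this] have "?c = 0" using f by (simp add: h.hom_minus insertion_Const[OF hom0])
  thus "f \<in> irrelevant_ideal" unfolding irrelevant_kernel by simp
 qed
 have "?h zS \<noteq> 0" by (simp add: insertion_Var[OF hom0] \<psi>_def \<phi>_def)
 moreover have "zS \<in> irrelevant_ideal" unfolding irrelevant_ideal_def by (rule ring_module.span_base) simp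
 ultimately have strict: "?P0 \<subset> irrelevant_ideal" using sub by blast
 show ?thesis
 proof (intro exI[of _ "\<lambda>i. if i = 0 then ?P0 else irrelevant_ideal"] conjI allI impI)
  fix i :: nat
  show "prime_ideal (if i = 0 then ?P0 else irrelevant_ideal)" using P0 prime_irr by simp
  show "J \<subseteq> (if i = 0 then ?P0 else irrelevant_ideal)" using JP0 strict by auto
 next
  fix i :: nat assume "i < 1"
  thus "(if i = 0 then ?P0 else irrelevant_ideal) \<subset> (if Suc i = 0 then ?P0 else irrelevant_ideal)"
   using strict by simp
 qed
qed

text \<open>Krull dimension and depth are both one: \<open>z\<close> itself is a regular sequence.\<close>

lemma one_dimensional_zero_dim_subscheme:
 fixes J :: "'a::alg_closed_field ring_S set"
 assumes od: "one_dimensional J p q"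
 shows "zero_dim_subscheme_ideal J"
proof -
 interpret one_dimensional J p q by (rule od)
 have krull: "quotient_krull_dim J = 1"
  unfolding quotient_krull_dim_def
 proof (rule antisym)
  let ?N = "{n. \<exists>P :: nat \<Rightarrow> 'a ring_S set. (\<forall>i\<le>n. prime_ideal (P i) \<and> J \<subseteq> P i) \<and> (\<forall>i<n. P i \<subset> P (Suc i))}"
  show "(SUP n\<in>?N. ereal (real n)) \<le> 1"
  proof (rule SUP_least)
   fix n assume "n \<in> ?N"
   hence "n \<le> 1" using krull_dim_le by blast
   thus "ereal (real n) \<le> 1" by simp
  qed
  have "1 \<in> ?N" using krull_dim_ge[OF od] by simp
  from SUP_upper[OF this, of "\<lambda>n. ereal (real n)"] show "1 \<le> (SUP n\<in>?N. ereal (real n))"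
   by (simp add: one_ereal_def)
 qed
 have depth: "quotient_depth J = 1"
  unfolding quotient_depth_def
 proof (rule antisym)
  let ?N = "{fs. set fs \<subseteq> irrelevant_ideal \<and> regular_sequence J fs}"
  show "(SUP fs\<in>?N. ereal (real (length fs))) \<le> 1"
  proof (rule SUP_least)
   fix fs assume "fs \<in> ?N"
   hence "length fs \<le> 1" using regular_sequence_length by blast
   thus "ereal (real (length fs)) \<le> 1" by simp
  qed
  have zi: "zS \<in> (irrelevant_ideal :: 'a ring_S set)"
   unfolding irrelevant_ideal_def by (rule ring_module.span_base) simp
  obtain P :: "nat \<Rightarrow> 'a ring_S set" where P: "\<forall>i\<le>1. prime_ideal (P i) \<and> J \<subseteq> P i"
   using krull_dim_ge[OF od] by blast
  have Jirr: "J \<subseteq> irrelevant_ideal"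
  proof
   fix f assume f: "f \<in> J"
   let ?c = "insertion (\<lambda>a. a) (\<lambda>_. 0) f"
   have cl: "?c = lookup f 0"
   proof -
    have nz: "\<exists>v. 0 < lookup m v" if "m \<noteq> 0" for m :: "3 \<Rightarrow>\<^sub>0 nat"
     by (rule ccontr) (use that in \<open>auto intro: poly_mapping_eqI\<close>)
    have "(\<Sum>m\<in>keys f. lookup f m * (\<Prod>v\<in>keys m. 0 ^ lookup m v)) = (\<Sum>m\<in>keys f. if m = 0 then lookup f 0 else 0)"
     by (rule sum.cong) (use nz in \<open>auto simp: in_keys_iff intro!: prod_zero\<close>)
    thus ?thesis unfolding insertion_def by (simp add: in_keys_iff)
   qed
   have "hcomp 0 f = Const (lookup f 0)"
    by (rule poly_mapping_eqI) (auto simp: lookup_hcomp Const_def lookup_single when_def mdeg_eq_0_iff)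
   hence cJ: "Const (lookup f 0) \<in> J" using homogeneous_ideal_hcomp[OF J f, of 0] by simp
   have "lookup f 0 = 0"
   proof (rule ccontr)
    assume nz: "lookup f 0 \<noteq> 0"
    have "Const (inverse (lookup f 0)) * Const (lookup f 0) \<in> J" by (rule ring_module.subspace_scale[OF idJ cJ])
    thus False using nz one_notin by (simp add: Const_def mult_single)
   qed
   thus "f \<in> irrelevant_ideal" unfolding irrelevant_kernel using cl by simp
  qed
  have "ideal_gen (J \<union> {zS}) \<subseteq> irrelevant_ideal"
   unfolding irrelevant_ideal_def
   by (rule ring_module.span_minimal[OF _ ring_module.subspace_span])
    (use Jirr zi in \<open>simp add: irrelevant_ideal_def\<close>)
  moreover have "1 \<notin> (irrelevant_ideal :: 'a ring_S set)" unfolding irrelevant_kernel by (simp add: insertion_def)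
  ultimately have "ideal_gen (J \<union> {zS}) \<noteq> UNIV" by blast
  hence "regular_sequence J [zS]"
   unfolding regular_sequence_def using nzd_z by (simp add: ideal_gen_of_ideal[OF idJ])
  hence "[zS] \<in> ?N" using zi by simp
  from SUP_upper[OF this, of "\<lambda>fs. ereal (real (length fs))"]
  show "1 \<le> (SUP fs\<in>?N. ereal (real (length fs)))" by (simp add: one_ereal_def)
 qed
 show ?thesis
  unfolding zero_dim_subscheme_ideal_def cohen_macaulay_quotient_def using J krull depth by simp
qed

section \<open>Maximal minors\<close>

text \<open>The maximal minors of an \<open>(n + 1) \<times> n\<close> matrix are indexed by the deleted row.\<close>

definition delete_row :: "nat \<Rightarrow> 'r mat \<Rightarrow> 'r mat" where
 "delete_row k M = mat (dim_row M - 1) (dim_col M) (\<lambda>(r, c). M $$ (if r < k then r else Suc r, c))"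

lemma submatrix_delete_row:
 assumes M: "M \<in> carrier_mat (Suc n) n" and k: "k \<le> n"
 shows "submatrix M ({..<Suc n} - {k}) UNIV = delete_row k M"
proof -
 let ?B = "{..<Suc n} - {k}"
 have dims: "dim_row M = Suc n" "dim_col M = n" using M by auto
 have B: "{i. i < dim_row M \<and> i \<in> ?B} = ?B" unfolding dims by auto
 have cardB: "card ?B = n" using k by simp
 have pick: "pick ?B r = (if r < k then r else Suc r)" if r: "r < n" for r
 proof -
  let ?i = "if r < k then r else Suc r"
  have i: "?i \<in> ?B" using r by auto
  have "{a \<in> ?B. a < ?i} = (if r < k then {..<r} else {..<Suc r} - {k})" using r by auto
  hence "card {a \<in> ?B. a < ?i} = r" using k by auto
  thus ?thesis using pick_card_in_set[OF i] by simp
 qed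
 show ?thesis
 proof (rule eq_matI)
  show "dim_row (submatrix M ?B UNIV) = dim_row (delete_row k M)"
   unfolding dim_submatrix B cardB by (simp add: delete_row_def dims)
  show "dim_col (submatrix M ?B UNIV) = dim_col (delete_row k M)"
   by (simp add: dim_submatrix delete_row_def dims)
  fix i j assume "i < dim_row (delete_row k M)" "j < dim_col (delete_row k M)"
  hence ij: "i < n" "j < n" by (simp_all add: delete_row_def dims)
  have "submatrix M ?B UNIV $$ (i, j) = M $$ (pick ?B i, pick UNIV j)"
  proof (rule submatrix_index)
   show "i < card {i. i < dim_row M \<and> i \<in> ?B}" unfolding B cardB by (rule ij(1))
   show "j < card {j. j < dim_col M \<and> j \<in> UNIV}" using ij(2) dims by simp
  qed
  thus "submatrix M ?B UNIV $$ (i, j) = delete_row k M $$ (i, j)"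
   using ij by (simp add: pick[OF ij(1)] pick_UNIV delete_row_def dims)
 qed
qed

lemma maximal_minors_ideal_delete_row:
 fixes M :: "'r::comm_ring_1 mat"
 assumes M: "M \<in> carrier_mat (Suc n) n"
 shows "maximal_minors_ideal M = ideal_gen ((\<lambda>k. (-1) ^ (n - k) * det (delete_row k M)) ` {..n})"
proof -
 have dims: "dim_row M = Suc n" "dim_col M = n" using M by auto
 have sets: "{B. B \<subseteq> {..<Suc n} \<and> card B = n} = (\<lambda>k. {..<Suc n} - {k}) ` {..n}"
 proof (intro equalityI subsetI)
  fix B assume "B \<in> {B. B \<subseteq> {..<Suc n} \<and> card B = n}"
  hence B: "B \<subseteq> {..<Suc n}" "card B = n" by auto
  have "card ({..<Suc n} - B) = 1"
   using card_Diff_subset[of B "{..<Suc n}"] B finite_subset[OF B(1)] by simp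
  then obtain k where k: "{..<Suc n} - B = {k}" by (rule card_1_singletonE)
  hence "B = {..<Suc n} - {k}" "k \<le> n" using B(1) by auto
  thus "B \<in> (\<lambda>k. {..<Suc n} - {k}) ` {..n}" by auto
 qed auto
 have "{det (submatrix M B UNIV) | B. B \<subseteq> {..<dim_row M} \<and> card B = dim_col M} =
   (\<lambda>B. det (submatrix M B UNIV)) ` {B. B \<subseteq> {..<Suc n} \<and> card B = n}"
  unfolding dims by auto
 also have "\<dots> = (\<lambda>k. det (delete_row k M)) ` {..n}"
  unfolding sets image_image by (rule image_cong) (use submatrix_delete_row[OF M] in auto)
 finally have eq: "maximal_minors_ideal M = ideal_gen ((\<lambda>k. det (delete_row k M)) ` {..n})"
  unfolding maximal_minors_ideal_def by simp
 show ?thesis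
  unfolding eq ring_module.span_eq
 proof (intro conjI image_subsetI)
  fix k assume k: "k \<in> {..n}"
  let ?s = "(-1) ^ (n - k) :: 'r"
  have "?s * det (delete_row k M) \<in> ideal_gen ((\<lambda>k. (-1) ^ (n - k) * det (delete_row k M)) ` {..n})"
   by (rule ring_module.span_base) (rule imageI[OF k])
  hence "?s * (?s * det (delete_row k M)) \<in> ideal_gen ((\<lambda>k. (-1) ^ (n - k) * det (delete_row k M)) ` {..n})"
   by (rule ring_module.span_scale)
  moreover have "?s * (?s * det (delete_row k M)) = det (delete_row k M)"
   by (simp add: mult.assoc[symmetric] power_add[symmetric] flip: mult_2)
  ultimately show "det (delete_row k M) \<in> ideal_gen ((\<lambda>k. (-1) ^ (n - k) * det (delete_row k M)) ` {..n})"
   by simp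
  have "det (delete_row k M) \<in> ideal_gen ((\<lambda>k. det (delete_row k M)) ` {..n})"
   by (rule ring_module.span_base) (rule imageI[OF k])
  thus "?s * det (delete_row k M) \<in> ideal_gen ((\<lambda>k. det (delete_row k M)) ` {..n})"
   by (rule ring_module.span_scale)
 qed
qed

text \<open>Cramer's rule: expand along a repeated column.\<close>

lemma minors_relation:
 fixes M :: "'r::comm_ring_1 mat"
 assumes M: "M \<in> carrier_mat (Suc n) n" and j: "j < n"
 shows "(\<Sum>k\<le>n. M $$ (k, j) * ((-1) ^ (n - k) * det (delete_row k M))) = 0"
proof -
 define N where "N = mat (Suc n) (Suc n) (\<lambda>(r, c). if c < n then M $$ (r, c) else M $$ (r, j))"
 have N: "N \<in> carrier_mat (Suc n) (Suc n)" unfolding N_def by simp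
 have dims: "dim_row M = Suc n" "dim_col M = n" using M by auto
 have "col N j = col N n" unfolding N_def by (rule eq_vecI) (use j in auto)
 hence "det N = 0" using det_identical_columns[OF N, of j n] j by simp
 moreover have "det N = (\<Sum>k<Suc n. N $$ (k, n) * cofactor N k n)"
  by (rule laplace_expansion_column[OF N]) simp
 moreover have "N $$ (k, n) * cofactor N k n = M $$ (k, j) * ((-1) ^ (n - k) * det (delete_row k M))" if k: "k < Suc n" for k
 proof -
  have "mat_delete N k n = delete_row k M"
   by (rule eq_matI) (use k in \<open>auto simp: mat_delete_def delete_row_def N_def dims\<close>)
  moreover have "(-1 :: 'r) ^ (k + n) = (-1) ^ (n - k)"
  proof -
   have "k + n = 2 * k + (n - k)" using k by simp
   thus ?thesis by (simp only: power_add power_mult power2_minus power_one) simp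
  qed
  ultimately show ?thesis using k by (simp add: cofactor_def N_def)
 qed
 ultimately have "(\<Sum>k<Suc n. M $$ (k, j) * ((-1) ^ (n - k) * det (delete_row k M))) = 0" by simp
 thus ?thesis by (simp only: lessThan_Suc_atMost)
qed

text \<open>Setting \<open>z = 0\<close>, with values in \<open>K[y][x]\<close>.\<close>

definition at_z0 :: "'a::comm_ring_1 ring_S \<Rightarrow> 'a poly poly" where
 "at_z0 = insertion (\<lambda>a. [:[:a:]:]) (\<lambda>v. if v = 0 then [:0, 1:] else if v = 1 then [:[:0, 1:]:] else 0)"

lemma comm_ring_hom_const_poly_poly: "comm_ring_hom (\<lambda>a::'a::comm_ring_1. [:[:a:]:])"
 by unfold_locales (simp_all add: one_pCons)

lemma comm_ring_hom_at_z0: "comm_ring_hom (at_z0 :: 'a::comm_ring_1 ring_S \<Rightarrow> _)"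
 unfolding at_z0_def by (rule comm_ring_hom_insertion[OF comm_ring_hom_const_poly_poly])

lemma at_z0_single: "at_z0 (single (mS a b c) k) = (if c = 0 then monom (monom k b) a else 0)"
proof -
 interpret h: comm_ring_hom "at_z0 :: 'a ring_S \<Rightarrow> _" by (rule comm_ring_hom_at_z0)
 note V = insertion_Var[OF comm_ring_hom_const_poly_poly] insertion_Const[OF comm_ring_hom_const_poly_poly]
 have x: "at_z0 xS = [:0, 1:]" and y: "at_z0 yS = [:[:0, 1:]:]" and z: "at_z0 zS = 0"
  by (simp_all add: at_z0_def V)
 have C: "at_z0 (Const k) = [:[:k:]:]" by (simp add: at_z0_def V)
 have "single (mS a b c) k = Const k * (xS ^ a * (yS ^ b * zS ^ c))"
  by (simp add: Var_S_power Const_def mult_single mS_add)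
 hence "at_z0 (single (mS a b c) k) = [:[:k:]:] * ([:0, 1:] ^ a * ([:[:0, 1:]:] ^ b * 0 ^ c))"
  by (simp add: h.hom_mult h.hom_power x y z C)
 also have "[:0, 1:] ^ a = monom (1 :: 'a poly) a" by (simp add: monom_altdef)
 also have "[:[:0, 1:]:] ^ b = [:monom (1 :: 'a) b:]" by (simp add: poly_const_pow monom_altdef)
 finally show ?thesis by (simp add: power_0_left smult_monom mult_monom)
qed

lemma coeff_at_z0: "coeff (coeff (at_z0 f) a) b = lookup f (mS a b 0)"
proof -
 interpret h: comm_ring_hom "at_z0 :: 'a ring_S \<Rightarrow> _" by (rule comm_ring_hom_at_z0)
 have single: "coeff (coeff (at_z0 (single \<mu> k)) a) b = lookup (single \<mu> k) (mS a b 0)" for \<mu> and k :: 'a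
  by (cases \<mu> rule: mS_cases) (auto simp: at_z0_single coeff_monom lookup_single when_def)
 have "coeff (coeff (at_z0 (\<Sum>\<mu>\<in>keys f. single \<mu> (lookup f \<mu>))) a) b =
   lookup (\<Sum>\<mu>\<in>keys f. single \<mu> (lookup f \<mu>)) (mS a b 0)"
  by (simp only: h.hom_sum coeff_sum lookup_sum single)
 thus ?thesis by (simp only: mpoly_as_sum[symmetric])
qed

lemma at_z0_hm: "at_z0 (hm u p) = [:monom (coeff p u) u:]"
proof -
 interpret h: comm_ring_hom "at_z0 :: 'a ring_S \<Rightarrow> _" by (rule comm_ring_hom_at_z0)
 have "at_z0 (hm u p) = (\<Sum>e\<le>u. if e = u then [:monom (coeff p u) u:] else 0)"
  unfolding hm_def h.hom_sum by (rule sum.cong) (auto simp: at_z0_single monom_0)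
 thus ?thesis by simp
qed

context staircase
begin

definition relation_matrix :: "(nat \<Rightarrow> nat \<Rightarrow> 'a::field poly) \<Rightarrow> 'a ring_S mat" where
 "relation_matrix C = mat (Suc t) t (\<lambda>(r, c).
  hm (D (Suc c) + 1 - D r) (C r (Suc c)) - (if r = Suc c then xS else 0))"

definition minors :: "(nat \<Rightarrow> nat \<Rightarrow> 'a::field poly) \<Rightarrow> nat \<Rightarrow> 'a ring_S" where
 "minors C k = (-1) ^ (t - k) * det (delete_row k (relation_matrix C))"

lemma relation_matrix_carrier: "relation_matrix C \<in> carrier_mat (Suc t) t"
 by (simp add: relation_matrix_def)

lemma relation_minors: "relation (minors C) C"
 unfolding relation_def
proof
 fix j assume j: "j \<in> {1..t}"
 then obtain c where c: "j = Suc c" "c < t" by (cases j) auto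
 have "(\<Sum>k\<le>t. relation_matrix C $$ (k, c) * minors C k) = 0"
  unfolding minors_def by (rule minors_relation[OF relation_matrix_carrier c(2)])
 moreover have "(\<Sum>k\<le>t. relation_matrix C $$ (k, c) * minors C k) =
   (\<Sum>k\<le>t. hm (D j + 1 - D k) (C k j) * minors C k - (if k = j then xS * minors C j else 0))"
  by (rule sum.cong) (use c in \<open>auto simp: relation_matrix_def left_diff_distrib\<close>)
 moreover have "(\<Sum>k\<le>t. if k = j then xS * minors C j else 0) = xS * minors C j" using j by simp
 ultimately show "xS * minors C j = (\<Sum>k\<le>t. hm (D j + 1 - D k) (C k j) * minors C k)"
  by (simp add: sum_subtractf)
qed

text \<open>The rows and columns have degrees such that each product in the Leibniz formula has the same degree.\<close>

lemma minors_forms: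
 assumes gr: "graded C" and k: "k \<le> t"
 shows "minors C k \<in> forms (D k)"
proof -
 let ?M = "relation_matrix C"
 let ?\<rho> = "\<lambda>r. if r < k then r else Suc r"
 let ?A = "delete_row k ?M"
 have A: "?A \<in> carrier_mat t t" by (simp add: delete_row_def relation_matrix_def)
 have entry: "?M $$ (r, c) \<in> forms (D (Suc c) + 1 - D r) \<and> (?M $$ (r, c) = 0 \<or> D r \<le> D (Suc c) + 1)"
  if "r \<le> t" "c < t" for r c
 proof -
  have "hm (D (Suc c) + 1 - D r) (C r (Suc c)) = 0 \<or> D r \<le> D (Suc c) + 1"
   using gr that unfolding graded_def by force
  moreover have "(if r = Suc c then xS else 0) \<in> (forms (D (Suc c) + 1 - D r) :: 'a ring_S set)"
   using forms_Var[of 0] by auto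
  moreover have "(if r = Suc c then xS else 0) = (0 :: 'a ring_S) \<or> D r \<le> D (Suc c) + 1" by auto
  ultimately show ?thesis
   using that forms_diff[OF hm_forms, of "if r = Suc c then xS else 0" "D (Suc c) + 1 - D r" "C r (Suc c)"]
   unfolding relation_matrix_def by auto
 qed
 have Aentry: "?A $$ (i, c) = ?M $$ (?\<rho> i, c)" if "i < t" "c < t" for i c
  using that by (simp add: delete_row_def relation_matrix_def)
 have total: "(\<Sum>i<t. D (Suc i) + 1) = (\<Sum>i<t. D (?\<rho> i)) + D k"
 proof -
  have "(\<Sum>i<t. D (Suc i) + 1) + D 0 = (\<Sum>i<Suc t. D i) + t"
   by (subst sum.lessThan_Suc_shift) (simp add: sum_Suc)
  also have "(\<Sum>i<Suc t. D i) = (\<Sum>i<t. D (?\<rho> i)) + D k"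
  proof -
   have img: "?\<rho> ` {..<t} = {..<Suc t} - {k}"
   proof (intro equalityI subsetI)
    fix i assume i: "i \<in> {..<Suc t} - {k}"
    show "i \<in> ?\<rho> ` {..<t}"
    proof (cases "i < k")
     case True
     thus ?thesis using k by (intro image_eqI[of _ _ i]) auto
    next
     case False
     hence "i = ?\<rho> (i - 1)" "i - 1 \<in> {..<t}" using i by auto
     thus ?thesis by (rule image_eqI)
    qed
   qed auto
   have "inj_on ?\<rho> {..<t}" by (auto simp: inj_on_def split: if_splits)
   hence "(\<Sum>i<t. D (?\<rho> i)) = (\<Sum>i\<in>{..<Suc t} - {k}. D i)"
    unfolding img[symmetric] by (subst sum.reindex) (simp_all only: o_def)
   thus ?thesis using sum.remove[of "{..<Suc t}" k D] k by simp
  qed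
  finally show ?thesis by (simp add: D_def m_0)
 qed
 have "(\<Prod>i = 0..<t. ?A $$ (i, p i)) \<in> forms (D k)" if p: "p permutes {0..<t}" for p
 proof (cases "\<exists>i<t. ?A $$ (i, p i) = 0")
  case True
  hence zero: "(\<Prod>i = 0..<t. ?A $$ (i, p i)) = 0" by (intro prod_zero) auto
  show ?thesis unfolding zero by (rule forms_zero)
 next
  case False
  have pi: "p i < t" if "i < t" for i using permutes_in_image[OF p, of i] that by simp
  have fi: "?A $$ (i, p i) \<in> forms (D (Suc (p i)) + 1 - D (?\<rho> i))" "D (?\<rho> i) \<le> D (Suc (p i)) + 1" if "i < t" for i
   using entry[of "?\<rho> i" "p i"] pi[OF that] that False Aentry[OF that pi[OF that]] by auto
  have "(\<Prod>i = 0..<t. ?A $$ (i, p i)) \<in> forms (\<Sum>i = 0..<t. D (Suc (p i)) + 1 - D (?\<rho> i))"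
   by (rule forms_prod) (use fi in auto)
  also have "(\<Sum>i = 0..<t. D (Suc (p i)) + 1 - D (?\<rho> i)) = (\<Sum>i = 0..<t. D (Suc (p i)) + 1) - (\<Sum>i = 0..<t. D (?\<rho> i))"
   by (rule sum_subtractf_nat) (use fi in auto)
  also have "(\<Sum>i = 0..<t. D (Suc (p i)) + 1) = (\<Sum>i<t. D (Suc i) + 1)"
   using sum.permute[OF p, of "\<lambda>i. D (Suc i) + 1"] by (simp add: o_def atLeast0LessThan)
  also have "(\<Sum>i<t. D (Suc i) + 1) - (\<Sum>i = 0..<t. D (?\<rho> i)) = D k"
   unfolding total by (simp add: atLeast0LessThan)
  finally show ?thesis .
 qed
 hence "signof p * (\<Prod>i = 0..<t. ?A $$ (i, p i)) \<in> forms (D k)" if "p permutes {0..<t}" for p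
  using that forms_uminus by (auto simp: sign_def)
 hence "det ?A \<in> forms (D k)" unfolding det_def'[OF A] by (intro forms_sum) simp
 hence "(-1) ^ n * det ?A \<in> forms (D k)" for n
  by (induction n) (auto intro: forms_uminus)
 thus ?thesis unfolding minors_def .
qed

text \<open>Modulo \<open>z\<close> the matrix without its last row is triangular with powers of \<open>y\<close> on the diagonal.\<close>

lemma minors_last:
 assumes tri: "triangular C"
 shows "at_z0 (minors C t) = [:monom 1 (m t):]"
proof -
 interpret h: comm_ring_hom "at_z0 :: 'a ring_S \<Rightarrow> _" by (rule comm_ring_hom_at_z0)
 let ?A = "delete_row t (relation_matrix C)"
 have A: "?A \<in> carrier_mat t t" by (simp add: delete_row_def relation_matrix_def)
 have entry: "map_mat at_z0 ?A $$ (r, c) = [:if r = c then monom 1 (m (Suc c) - m c) else 0:]"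
  if "r \<le> c" "c < t" for r c
 proof -
  have "map_mat at_z0 ?A $$ (r, c) = at_z0 (hm (D (Suc c) + 1 - D r) (C r (Suc c)))"
   using that by (simp add: delete_row_def relation_matrix_def)
  also have "\<dots> = [:monom (coeff (C r (Suc c)) (D (Suc c) + 1 - D r)) (D (Suc c) + 1 - D r):]"
   by (rule at_z0_hm)
  also have "coeff (C r (Suc c)) (D (Suc c) + 1 - D r) = (if r = c then 1 else 0)"
   using tri that unfolding triangular_def by auto
  finally show ?thesis using D_step[of "Suc c"] that by auto
 qed
 have "at_z0 (minors C t) = det (map_mat at_z0 ?A)"
  by (simp add: minors_def h.hom_det)
 also have "\<dots> = prod_list (diag_mat (map_mat at_z0 ?A))"
  by (rule det_lower_triangular[of t]) (use entry A in auto)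
 also have "\<dots> = (\<Prod>c<t. map_mat at_z0 ?A $$ (c, c))"
  using A by (simp add: prod_list_diag_prod atLeast0LessThan)
 also have "\<dots> = (\<Prod>c<t. [:monom 1 (m (Suc c) - m c):])"
  by (rule prod.cong) (use entry in auto)
 also have "\<dots> = [:monom 1 (m t):]"
 proof -
  have "(\<Prod>c<n. [:monom 1 (m (Suc c) - m c):]) = [:monom (1::'a) (m n):]" if "n \<le> t" for n
   using that
  proof (induction n)
   case 0
   show ?case by (simp add: m_0 monom_0 one_pCons)
  next
   case (Suc n)
   thus ?case using m_less[of n] by (simp add: mult_monom)
  qed
  thus ?thesis by simp
 qed
 finally show ?thesis .
qed

lemma stair_basis_minors:
 assumes gr: "graded C" and tri: "triangular C"
 shows "stair_basis (minors C)"
proof (rule stair_basisI[OF relation_minors tri minors_forms[OF gr]])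
 note c = coeff_at_z0[of "minors C t", unfolded minors_last[OF tri], symmetric]
 show "lookup (minors C t) (mS 0 (m t) 0) = 1" unfolding c by (simp add: coeff_monom)
 show "lookup (minors C t) (mS a b 0) = 0" if "0 < a" for a b
  unfolding c using that by (cases a) (simp_all add: coeff_monom)
qed

lemma minors_ideal: "maximal_minors_ideal (relation_matrix C) = stair_ideal (minors C)"
 unfolding stair_ideal_def minors_def by (rule maximal_minors_ideal_delete_row[OF relation_matrix_carrier])

end

section \<open>Rank loci\<close>

text \<open>\<open>low_rank r R C F\<close>: the matrix with rows \<open>R\<close>, columns \<open>C\<close> and entries \<open>F i k\<close> factors
 through a space of dimension \<open>r\<close>.\<close>

definition low_rank :: "nat \<Rightarrow> 'i set \<Rightarrow> 'k set \<Rightarrow> ('i \<Rightarrow> 'k \<Rightarrow> 'a::field) \<Rightarrow> bool" where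
 "low_rank r R C F \<longleftrightarrow> (\<exists>U V. \<forall>i\<in>R. \<forall>k\<in>C. F i k = (\<Sum>l<r. U i l * V l k))"

definition indep_cols :: "'i set \<Rightarrow> ('i \<Rightarrow> 'k \<Rightarrow> 'a::field) \<Rightarrow> 'k set \<Rightarrow> bool" where
 "indep_cols R F K \<longleftrightarrow> (\<forall>c. (\<forall>i\<in>R. (\<Sum>k\<in>K. c k * F i k) = 0) \<longrightarrow> (\<forall>k\<in>K. c k = 0))"

definition column_basis :: "'i set \<Rightarrow> 'k set \<Rightarrow> ('i \<Rightarrow> 'k \<Rightarrow> 'a::field) \<Rightarrow> 'k set \<Rightarrow> bool" where
 "column_basis R C F K \<longleftrightarrow> K \<subseteq> C \<and> indep_cols R F K \<and>
  (\<forall>k\<in>C. \<exists>c. \<forall>i\<in>R. F i k = (\<Sum>k'\<in>K. c k' * F i k'))"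

lemma indep_colsD: "indep_cols R F K \<Longrightarrow> \<forall>i\<in>R. (\<Sum>k\<in>K. c k * F i k) = 0 \<Longrightarrow> \<forall>k\<in>K. c k = 0"
 unfolding indep_cols_def by (drule spec[of _ c]) (erule mp)

lemma column_basis_exists:
 assumes fin: "finite C"
 shows "\<exists>K. column_basis R C F K"
proof -
 let ?P = "\<lambda>K. K \<subseteq> C \<and> indep_cols R F K"
 have "finite {K. ?P K}" using finite_Collect_subsets[OF fin] by (rule finite_subset[rotated]) blast
 moreover have "{K. ?P K} \<noteq> {}"
 proof -
  have "?P {}" by (simp add: indep_cols_def)
  thus ?thesis by blast
 qed
 ultimately obtain K where K: "?P K" and max: "\<And>K'. ?P K' \<Longrightarrow> K \<subseteq> K' \<Longrightarrow> K' = K"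
  using finite_has_maximal[of "{K. ?P K}"] by (metis (no_types, lifting) mem_Collect_eq)
 have finK: "finite K" using K fin finite_subset by blast
 have "\<exists>c. \<forall>i\<in>R. F i k = (\<Sum>k'\<in>K. c k' * F i k')" if k: "k \<in> C" for k
 proof (cases "k \<in> K")
  case True
  have "F i k = (\<Sum>k'\<in>K. (if k' = k then 1 else 0) * F i k')" for i
  proof -
   have "(\<Sum>k'\<in>K. (if k' = k then 1 else 0) * F i k') = (\<Sum>k'\<in>K. if k' = k then F i k else 0)"
    by (rule sum.cong) auto
   thus ?thesis using True finK by simp
  qed
  thus ?thesis by (intro exI[of _ "\<lambda>k'. if k' = k then 1 else 0"]) simp
 next
  case False
  have "\<not> ?P (insert k K)" using max[of "insert k K"] False by blast
  hence "\<not> indep_cols R F (insert k K)" using K k by blast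
  then obtain c k0 where c: "\<forall>i\<in>R. (\<Sum>k'\<in>insert k K. c k' * F i k') = 0" "k0 \<in> insert k K" "c k0 \<noteq> 0"
   unfolding indep_cols_def by blast
  have sum: "c k * F i k + (\<Sum>k'\<in>K. c k' * F i k') = 0" if "i \<in> R" for i
   using c(1) that finK False by simp
  have "c k \<noteq> 0"
  proof
   assume 0: "c k = 0"
   hence "\<forall>i\<in>R. (\<Sum>k'\<in>K. c k' * F i k') = 0" using sum by simp
   hence "\<forall>k\<in>K. c k = 0" by (rule indep_colsD[OF conjunct2[OF K]])
   thus False using c(2,3) 0 by blast
  qed
  have "F i k = (\<Sum>k'\<in>K. (- c k' / c k) * F i k')" if "i \<in> R" for i
  proof -
   have "(\<Sum>k'\<in>K. (- c k' / c k) * F i k') = - (\<Sum>k'\<in>K. c k' * F i k') / c k"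
    by (simp add: sum_divide_distrib sum_negf)
   also have "\<dots> = F i k"
   proof -
    have "- (\<Sum>k'\<in>K. c k' * F i k') = F i k * c k"
     using sum[OF that] by (metis add.commute add_eq_0_iff mult.commute)
    thus ?thesis using \<open>c k \<noteq> 0\<close> by simp
   qed
   finally show ?thesis ..
  qed
  thus ?thesis by (intro exI[of _ "\<lambda>k'. - c k' / c k"]) blast
 qed
 thus ?thesis using K unfolding column_basis_def by blast
qed

lemma indep_cols_subset:
 assumes "indep_cols R F K" "K' \<subseteq> K" "finite K"
 shows "indep_cols R F K'"
 unfolding indep_cols_def
proof (intro allI impI)
 fix c assume c: "\<forall>i\<in>R. (\<Sum>k\<in>K'. c k * F i k) = 0"
 let ?c = "\<lambda>k. if k \<in> K' then c k else 0"
 have "(\<Sum>k\<in>K. ?c k * F i k) = (\<Sum>k\<in>K'. c k * F i k)" for i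
  by (rule sum.mono_neutral_cong_right) (use assms(2,3) in auto)
 hence "\<forall>i\<in>R. (\<Sum>k\<in>K. ?c k * F i k) = 0" using c by metis
 hence "\<forall>k\<in>K. ?c k = 0" by (rule indep_colsD[OF assms(1)])
 thus "\<forall>k\<in>K'. c k = 0" using assms(2) by (metis subsetD)
qed

lemma low_rank_mono:
 assumes "low_rank r R C F" "r \<le> r'"
 shows "low_rank r' R C F"
proof -
 obtain U V where UV: "\<forall>i\<in>R. \<forall>k\<in>C. F i k = (\<Sum>l<r. U i l * V l k)" using assms(1) unfolding low_rank_def by blast
 have "(\<Sum>l<r'. (if l < r then U i l else 0) * V l k) = (\<Sum>l<r. U i l * V l k)" for i k
  by (rule sum.mono_neutral_cong_right) (use assms(2) in auto)
 thus ?thesis unfolding low_rank_def using UV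
  by (intro exI[of _ "\<lambda>i l. if l < r then U i l else 0"] exI[of _ V]) simp
qed

lemma low_rank_column_basis:
 assumes basis: "column_basis R C F K" and fin: "finite C"
 shows "low_rank (card K) R C F"
proof -
 have "finite K" using basis fin unfolding column_basis_def using finite_subset by blast
 then obtain e where e: "bij_betw e {..<card K} K" using bij_betw_from_nat_into_finite[of K] by blast
 have "\<forall>k\<in>C. \<exists>c. \<forall>i\<in>R. F i k = (\<Sum>k'\<in>K. c k' * F i k')" using basis unfolding column_basis_def by blast
 from bchoice[OF this] obtain c where c: "\<forall>k\<in>C. \<forall>i\<in>R. F i k = (\<Sum>k'\<in>K. c k k' * F i k')" by (elim exE)
 have "F i k = (\<Sum>l<card K. F i (e l) * c k (e l))" if "i \<in> R" "k \<in> C" for i k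
 proof -
  have "F i k = (\<Sum>k'\<in>K. c k k' * F i k')" using c that by blast
  also have "\<dots> = (\<Sum>l<card K. c k (e l) * F i (e l))" by (rule sum.reindex_bij_betw[OF e, symmetric])
  finally show ?thesis by (simp only: mult.commute)
 qed
 thus ?thesis unfolding low_rank_def
  by (intro exI[of _ "\<lambda>i l. F i (e l)"] exI[of _ "\<lambda>l k. c k (e l)"]) simp
qed

lemma low_rank_dependent:
 assumes low: "low_rank r R C F" and K: "K \<subseteq> C" "finite K" "r < card K"
 shows "\<not> indep_cols R F K"
proof -
 obtain U V where UV: "\<forall>i\<in>R. \<forall>k\<in>C. F i k = (\<Sum>l<r. U i l * V l k)" using low unfolding low_rank_def by blast
 obtain c where c: "\<exists>k\<in>K. c k \<noteq> 0" "\<forall>l<r. (\<Sum>k\<in>K. V l k * c k) = 0"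
  using underdetermined_system[OF K(2,3), of V] by blast
 have "(\<Sum>k\<in>K. c k * F i k) = 0" if "i \<in> R" for i
 proof -
  have "(\<Sum>k\<in>K. c k * F i k) = (\<Sum>k\<in>K. \<Sum>l<r. U i l * (V l k * c k))"
   by (rule sum.cong) (use UV that K(1) in \<open>auto simp: sum_distrib_left mult_ac\<close>)
  also have "\<dots> = (\<Sum>l<r. U i l * (\<Sum>k\<in>K. V l k * c k))" by (subst sum.swap) (simp only: sum_distrib_left)
  also have "\<dots> = 0" using c(2) by simp
  finally show ?thesis .
 qed
 hence "\<forall>i\<in>R. (\<Sum>k\<in>K. c k * F i k) = 0" by blast
 thus ?thesis using c(1) indep_colsD[of R F K c] by blast
qed

lemma low_rank_iff:
 assumes basis: "column_basis R C F K" and fin: "finite C"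
 shows "low_rank r R C F \<longleftrightarrow> card K \<le> r"
proof
 have K: "K \<subseteq> C" "indep_cols R F K" using basis unfolding column_basis_def by auto
 assume "low_rank r R C F"
 thus "card K \<le> r" using low_rank_dependent[OF _ K(1) finite_subset[OF K(1) fin]] K(2) not_le by blast
next
 assume "card K \<le> r"
 thus "low_rank r R C F" using low_rank_mono[OF low_rank_column_basis[OF basis fin]] by blast
qed

subsection \<open>Rank of library matrices\<close>

text \<open>This links bases of columns, as sets of indices, to the rank of the library, which is the size of a
 maximal independent set of column vectors.\<close>

lemma matrix_rank_column_basis:
 fixes N :: "'a::field mat"
 assumes N: "N \<in> carrier_mat p q" and basis: "column_basis {..<p} {..<q} (\<lambda>r c. N $$ (r, c)) K"
 shows "matrix_rank N = card K"
proof -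
 interpret vec_space "TYPE('a)" p .
 have K: "K \<subseteq> {..<q}" and ind: "indep_cols {..<p} (\<lambda>r c. N $$ (r, c)) K"
  and span: "\<forall>k\<in>{..<q}. \<exists>c. \<forall>i\<in>{..<p}. N $$ (i, k) = (\<Sum>k'\<in>K. c k' * N $$ (i, k'))"
  using basis unfolding column_basis_def by auto
 have finK: "finite K" using K finite_subset by blast
 let ?S = "col N ` K"
 have col: "col N k \<in> carrier_vec p" "vec_index (col N k) i = N $$ (i, k)" if "k < q" "i < p" for i k
  using N that by auto
 have colc: "col N k \<in> carrier_vec p" for k using N by auto
 have Sc: "?S \<subseteq> carrier_vec p" using colc by blast
 have cols: "set (cols N) = col N ` {..<q}" using N unfolding cols_def by (auto simp: lessThan_atLeast0)
 have inj: "inj_on (col N) K"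
 proof (rule inj_onI, rule ccontr)
  fix k k' assume kk: "k \<in> K" "k' \<in> K" "col N k = col N k'" "k \<noteq> k'"
  let ?c = "\<lambda>l. if l = k then 1 else if l = k' then - 1 else 0 :: 'a"
  have kq: "k < q" "k' < q" using K kk(1,2) by auto
  have "(\<Sum>l\<in>K. ?c l * N $$ (i, l)) = 0" if i: "i < p" for i
  proof -
   have "(\<Sum>l\<in>K. ?c l * N $$ (i, l)) = (\<Sum>l\<in>K. (if l = k then N $$ (i, k) else 0) - (if l = k' then N $$ (i, k') else 0))"
    by (rule sum.cong) (use kk(4) in auto)
   also have "\<dots> = N $$ (i, k) - N $$ (i, k')" using finK kk(1,2) by (simp add: sum_subtractf)
   also have "\<dots> = vec_index (col N k) i - vec_index (col N k') i" using kq by (simp only: col(2)[OF _ i])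
   finally show ?thesis using kk(3) by simp
  qed
  hence "\<forall>i\<in>{..<p}. (\<Sum>l\<in>K. ?c l * N $$ (i, l)) = 0" by blast
  hence "\<forall>l\<in>K. ?c l = 0" by (rule indep_colsD[OF ind])
  hence "?c k = 0" using kk(1) by blast
  thus False by simp
 qed
 have "lin_indpt ?S"
 proof
  assume "lin_dep ?S"
  then obtain A a v where A: "finite A" "A \<subseteq> ?S" "lincomb a A = 0\<^sub>v p" "v \<in> A" "a v \<noteq> 0"
   unfolding lin_dep_def by (auto simp: module_vec_simps)
  let ?c = "\<lambda>k. if col N k \<in> A then a (col N k) else 0"
  have "(\<Sum>k\<in>K. ?c k * N $$ (i, k)) = 0" if i: "i < p" for i
  proof -
   have "(\<Sum>k\<in>K. ?c k * N $$ (i, k)) = (\<Sum>k\<in>K. (\<lambda>w. (if w \<in> A then a w else 0) * vec_index w i) (col N k))"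
    by (rule sum.cong) (use K col(2) i in auto)
   also have "\<dots> = (\<Sum>w\<in>?S. (if w \<in> A then a w else 0) * vec_index w i)"
    by (simp only: sum.reindex[OF inj] o_def)
   also have "\<dots> = (\<Sum>w\<in>A. a w * vec_index w i)"
    by (rule sum.mono_neutral_cong_right) (use A finK in auto)
   also have "\<dots> = vec_index (lincomb a A) i"
    by (rule lincomb_index[symmetric]) (use i A(2) Sc in auto)
   finally show ?thesis using A(3) i by simp
  qed
  hence "\<forall>i\<in>{..<p}. (\<Sum>k\<in>K. ?c k * N $$ (i, k)) = 0" by blast
  hence c0: "\<forall>k\<in>K. ?c k = 0" by (rule indep_colsD[OF ind])
  obtain k where "k \<in> K" "v = col N k" using A(2,4) by blast
  thus False using c0 A(4,5) by auto
 qed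
 moreover have "T = ?S" if T: "?S \<subseteq> T" "T \<subseteq> set (cols N)" "lin_indpt T" for T
 proof (rule ccontr)
  assume "T \<noteq> ?S"
  then obtain k where k: "k < q" "col N k \<in> T" "col N k \<notin> ?S" using T(1,2) unfolding cols by blast
  obtain c where c: "\<forall>i\<in>{..<p}. N $$ (i, k) = (\<Sum>k'\<in>K. c k' * N $$ (i, k'))" using span k(1) by blast
  define a where "a = (\<lambda>w. if w = col N k then - 1 else c (inv_into K (col N) w))"
  have "lincomb a (insert (col N k) ?S) = 0\<^sub>v p"
  proof (rule eq_vecI)
   have fS: "finite (insert (col N k) ?S)" using finK by simp
   have sub: "insert (col N k) ?S \<subseteq> carrier_vec p" using colc by auto
   show dim: "dim_vec (lincomb a (insert (col N k) ?S)) = dim_vec (0\<^sub>v p :: 'a vec)"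
    using lincomb_dim[OF fS sub] by simp
   fix i assume "i < dim_vec (0\<^sub>v p :: 'a vec)"
   hence i: "i < p" by simp
   have "vec_index (lincomb a (insert (col N k) ?S)) i = (\<Sum>w\<in>insert (col N k) ?S. a w * vec_index w i)"
    by (rule lincomb_index) (use i colc in auto)
   also have "\<dots> = - N $$ (i, k) + (\<Sum>w\<in>?S. a w * vec_index w i)"
    using k(3) finK col(2)[OF k(1) i] by (simp add: a_def)
   also have "(\<Sum>w\<in>?S. a w * vec_index w i) = (\<Sum>k'\<in>K. c k' * N $$ (i, k'))"
    unfolding sum.reindex[OF inj] o_def
   proof (rule sum.cong[OF refl])
    fix k' assume k': "k' \<in> K"
    hence "col N k' \<noteq> col N k" using k(3) by (metis imageI)
    thus "a (col N k') * vec_index (col N k') i = c k' * N $$ (i, k')"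
     using k' K col(2)[of k' i] i by (auto simp: a_def inv_into_f_f[OF inj k'])
   qed
   also have "\<dots> = N $$ (i, k)" using c i by simp
   finally show "vec_index (lincomb a (insert (col N k) ?S)) i = vec_index (0\<^sub>v p) i" using i by simp
  qed
  hence "lin_dep T"
   unfolding lin_dep_def
   by (intro exI[of _ "insert (col N k) ?S"] exI[of _ a] exI[of _ "col N k"])
    (use T(1) k(2) finK in \<open>auto simp: module_vec_simps a_def\<close>)
  thus False using T(3) by simp
 qed
 ultimately have "maximal ?S (\<lambda>T. T \<subseteq> set (cols N) \<and> lin_indpt T)"
  unfolding maximal_def using K cols by blast
 hence "rank N = card ?S" by (rule rank_card_indpt[OF N])
 thus ?thesis unfolding matrix_rank_def using N card_image[OF inj] by simp
qed

text \<open>The blocks list their rows and columns in increasing order, the loci refer to the original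
 indices; this transfers the rank between the two.\<close>

lemma matrix_rank_reindexed:
 fixes N :: "'a::field mat"
 assumes N: "N \<in> carrier_mat p q"
  and \<rho>: "bij_betw \<rho> {..<p} R" and \<kappa>: "bij_betw \<kappa> {..<q} C"
  and F: "\<And>r c. r < p \<Longrightarrow> c < q \<Longrightarrow> N $$ (r, c) = F (\<rho> r) (\<kappa> c)"
  and basis: "column_basis R C F K"
 shows "matrix_rank N = card K"
proof -
 let ?K = "{c. c < q \<and> \<kappa> c \<in> K}"
 have K: "K \<subseteq> C" using basis unfolding column_basis_def by blast
 have bij: "bij_betw \<kappa> ?K K"
 proof -
  have "inj_on \<kappa> ?K" using \<kappa> unfolding bij_betw_def by (auto simp: inj_on_def)
  moreover have "\<kappa> ` ?K = K" using \<kappa> K unfolding bij_betw_def by auto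
  ultimately show ?thesis unfolding bij_betw_def by blast
 qed
 have sum: "(\<Sum>c\<in>?K. x (\<kappa> c) * N $$ (r, c)) = (\<Sum>k\<in>K. x k * F (\<rho> r) k)" if "r < p" for x r
 proof -
  have "(\<Sum>c\<in>?K. x (\<kappa> c) * N $$ (r, c)) = (\<Sum>c\<in>?K. x (\<kappa> c) * F (\<rho> r) (\<kappa> c))"
   by (rule sum.cong) (use F that in auto)
  also have "\<dots> = (\<Sum>k\<in>K. x k * F (\<rho> r) k)" by (rule sum.reindex_bij_betw[OF bij])
  finally show ?thesis .
 qed
 have R: "\<forall>i\<in>R. \<exists>r<p. i = \<rho> r" using \<rho> unfolding bij_betw_def by auto
 let ?i = "inv_into ?K \<kappa>"
 have inv: "?i (\<kappa> c) = c" if "c \<in> ?K" for c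
  using bij that unfolding bij_betw_def by (simp add: inv_into_f_f)
 have "column_basis {..<p} {..<q} (\<lambda>r c. N $$ (r, c)) ?K"
  unfolding column_basis_def indep_cols_def
 proof (intro conjI allI impI ballI)
  show "?K \<subseteq> {..<q}" by auto
  fix x c assume x: "\<forall>r\<in>{..<p}. (\<Sum>c\<in>?K. x c * N $$ (r, c)) = 0" and c: "c \<in> ?K"
  let ?y = "\<lambda>k. x (?i k)"
  have "(\<Sum>k\<in>K. ?y k * F i k) = 0" if "i \<in> R" for i
  proof -
   obtain r where r: "r < p" "i = \<rho> r" using R \<open>i \<in> R\<close> by blast
   have "(\<Sum>k\<in>K. ?y k * F i k) = (\<Sum>c\<in>?K. ?y (\<kappa> c) * N $$ (r, c))" unfolding r(2) by (rule sum[OF r(1), symmetric])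
   also have "\<dots> = (\<Sum>c\<in>?K. x c * N $$ (r, c))" by (rule sum.cong) (simp_all only: inv)
   finally show ?thesis using x r(1) by simp
  qed
  hence "\<forall>i\<in>R. (\<Sum>k\<in>K. ?y k * F i k) = 0" by blast
  moreover have "indep_cols R F K" using basis unfolding column_basis_def by blast
  ultimately have "\<forall>k\<in>K. ?y k = 0" by (rule indep_colsD[rotated])
  hence "?y (\<kappa> c) = 0" using c by blast
  thus "x c = 0" using inv[OF c] by simp
 next
  fix c assume "c \<in> {..<q}"
  hence c: "c < q" "\<kappa> c \<in> C" using \<kappa> unfolding bij_betw_def by auto
  then obtain x where x: "\<forall>i\<in>R. F i (\<kappa> c) = (\<Sum>k\<in>K. x k * F i k)" using basis unfolding column_basis_def by blast
  have "N $$ (r, c) = (\<Sum>c'\<in>?K. x (\<kappa> c') * N $$ (r, c'))" if "r < p" for r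
  proof -
   have "\<rho> r \<in> R" using \<rho> that unfolding bij_betw_def by auto
   thus ?thesis unfolding sum[OF that] F[OF that c(1)] using x by blast
  qed
  thus "\<exists>x. \<forall>r\<in>{..<p}. N $$ (r, c) = (\<Sum>c'\<in>?K. x c' * N $$ (r, c'))" by (intro exI[of _ "\<lambda>c. x (\<kappa> c)"]) simp
 qed
 hence "matrix_rank N = card ?K" by (rule matrix_rank_column_basis[OF N])
 thus ?thesis using bij_betw_same_card[OF bij] by simp
qed

subsection \<open>Minors\<close>

definition minor :: "nat \<Rightarrow> (nat \<Rightarrow> 'i) \<Rightarrow> (nat \<Rightarrow> 'k) \<Rightarrow> ('i \<Rightarrow> 'k \<Rightarrow> 'a::comm_ring_1) \<Rightarrow> 'a" where
 "minor n \<rho> \<kappa> F = det (mat n n (\<lambda>(a, b). F (\<rho> a) (\<kappa> b)))"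

lemma minor_eq_0_iff:
 fixes F :: "'i \<Rightarrow> 'k \<Rightarrow> 'a::field"
 shows "minor n \<rho> \<kappa> F = 0 \<longleftrightarrow> \<not> indep_cols {..<n} (\<lambda>a b. F (\<rho> a) (\<kappa> b)) {..<n}"
proof -
 let ?A = "mat n n (\<lambda>(a, b). F (\<rho> a) (\<kappa> b))"
 have A: "?A \<in> carrier_mat n n" by simp
 have mv: "?A *\<^sub>v v = 0\<^sub>v n \<longleftrightarrow> (\<forall>a<n. (\<Sum>b<n. vec_index v b * F (\<rho> a) (\<kappa> b)) = 0)" if "v \<in> carrier_vec n" for v
 proof -
  have "vec_index (?A *\<^sub>v v) a = (\<Sum>b<n. vec_index v b * F (\<rho> a) (\<kappa> b))" if "a < n" for a
   using that \<open>v \<in> carrier_vec n\<close> by (auto simp: scalar_prod_def mult.commute lessThan_atLeast0 intro!: sum.cong)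
  thus ?thesis by (auto simp: vec_eq_iff)
 qed
 show ?thesis
  unfolding minor_def det_0_iff_vec_prod_zero_field[OF A] indep_cols_def
 proof
  assume "\<exists>v. v \<in> carrier_vec n \<and> v \<noteq> 0\<^sub>v n \<and> ?A *\<^sub>v v = 0\<^sub>v n"
  then obtain v where v: "v \<in> carrier_vec n" "v \<noteq> 0\<^sub>v n" "?A *\<^sub>v v = 0\<^sub>v n" by blast
  have "\<exists>b<n. vec_index v b \<noteq> 0" using v(1,2) by (auto simp: vec_eq_iff)
  thus "\<not> (\<forall>c. (\<forall>a\<in>{..<n}. (\<Sum>b<n. c b * F (\<rho> a) (\<kappa> b)) = 0) \<longrightarrow> (\<forall>b\<in>{..<n}. c b = 0))"
   using v(3) mv[OF v(1)] by auto
 next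
  assume "\<not> (\<forall>c. (\<forall>a\<in>{..<n}. (\<Sum>b<n. c b * F (\<rho> a) (\<kappa> b)) = 0) \<longrightarrow> (\<forall>b\<in>{..<n}. c b = 0))"
  then obtain c b where c: "\<forall>a<n. (\<Sum>b<n. c b * F (\<rho> a) (\<kappa> b)) = 0" "b < n" "c b \<noteq> 0" by auto
  have "vec n c \<in> carrier_vec n" "vec n c \<noteq> 0\<^sub>v n" using c(2,3) by (auto simp: vec_eq_iff)
  moreover have "?A *\<^sub>v vec n c = 0\<^sub>v n" using mv[of "vec n c"] c(1) by simp
  ultimately show "\<exists>v. v \<in> carrier_vec n \<and> v \<noteq> 0\<^sub>v n \<and> ?A *\<^sub>v v = 0\<^sub>v n" by blast
 qed
qed

lemma low_rank_minor:
 fixes F :: "'i \<Rightarrow> 'k \<Rightarrow> 'a::field"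
 assumes low: "low_rank r R C F" and n: "r < n" and \<rho>: "\<rho> ` {..<n} \<subseteq> R" and \<kappa>: "\<kappa> ` {..<n} \<subseteq> C"
 shows "minor n \<rho> \<kappa> F = 0"
proof -
 obtain U V where UV: "\<forall>i\<in>R. \<forall>k\<in>C. F i k = (\<Sum>l<r. U i l * V l k)" using low unfolding low_rank_def by blast
 have "low_rank r {..<n} {..<n} (\<lambda>a b. F (\<rho> a) (\<kappa> b))"
  unfolding low_rank_def
  by (intro exI[of _ "\<lambda>a. U (\<rho> a)"] exI[of _ "\<lambda>l b. V l (\<kappa> b)"]) (use UV \<rho> \<kappa> in \<open>auto simp: image_subset_iff\<close>)
 thus ?thesis unfolding minor_eq_0_iff by (rule low_rank_dependent) (use n in auto)
qed

text \<open>Choose a basis among the rows of the selected independent columns.\<close>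

lemma minor_exists:
 fixes F :: "'i \<Rightarrow> 'k \<Rightarrow> 'a::field"
 assumes K: "K \<subseteq> C" "indep_cols R F K" "finite K" and R: "finite R"
 shows "\<exists>\<rho> \<kappa>. \<rho> ` {..<card K} \<subseteq> R \<and> \<kappa> ` {..<card K} \<subseteq> C \<and> minor (card K) \<rho> \<kappa> F \<noteq> 0"
proof -
 let ?n = "card K" and ?G = "\<lambda>k i. F i k"
 obtain R' where R': "column_basis K R ?G R'" using column_basis_exists[OF R] by blast
 have R'R: "R' \<subseteq> R" "indep_cols K ?G R'" using R' unfolding column_basis_def by auto
 have finR': "finite R'" using R'R(1) R finite_subset by blast
 obtain \<kappa> where \<kappa>: "bij_betw \<kappa> {..<?n} K" using bij_betw_from_nat_into_finite[OF K(3)] by blast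
 have full: "low_rank ?n K R ?G"
 proof -
  have "low_rank ?n K R (\<lambda>k i. F i k) \<longleftrightarrow> True"
   unfolding low_rank_def
  proof (simp, intro exI ballI)
   fix k i assume ki: "k \<in> K" "i \<in> R"
   have "(\<Sum>l<?n. (if \<kappa> l = k then 1 else 0) * F i (\<kappa> l)) = (\<Sum>k'\<in>K. (if k' = k then 1 else 0) * F i k')"
    by (rule sum.reindex_bij_betw[OF \<kappa>])
   also have "\<dots> = (\<Sum>k'\<in>K. if k' = k then F i k else 0)" by (rule sum.cong) auto
   finally show "F i k = (\<Sum>l<?n. (if \<kappa> l = k then 1 else 0) * F i (\<kappa> l))" using ki(1) K(3) by simp
  qed
  thus ?thesis by simp
 qed
 have "card R' \<le> ?n" using full low_rank_iff[OF R' R] by blast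
 moreover have "?n \<le> card R'"
 proof -
  obtain U V where UV: "\<forall>k\<in>K. \<forall>i\<in>R. F i k = (\<Sum>l<card R'. U k l * V l i)"
   using low_rank_column_basis[OF R' R] unfolding low_rank_def by blast
  have "low_rank (card R') R K F"
   unfolding low_rank_def
   by (intro exI[of _ "\<lambda>i l. V l i"] exI[of _ "\<lambda>l k. U k l"]) (use UV in \<open>auto simp: mult.commute\<close>)
  thus ?thesis using low_rank_dependent[of "card R'" R K F K] K(2,3) not_le by blast
 qed
 ultimately have n: "card R' = ?n" by simp
 obtain \<rho> where \<rho>: "bij_betw \<rho> {..<?n} R'" using bij_betw_from_nat_into_finite[OF finR'] n by auto
 have "minor ?n \<rho> \<kappa> F \<noteq> 0"
  unfolding minor_eq_0_iff not_not indep_cols_def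
 proof (intro allI impI)
  fix c assume c: "\<forall>a\<in>{..<?n}. (\<Sum>b<?n. c b * F (\<rho> a) (\<kappa> b)) = 0"
  let ?d = "\<lambda>k. c (inv_into {..<?n} \<kappa> k)"
  have inv: "inv_into {..<?n} \<kappa> (\<kappa> b) = b" if "b < ?n" for b
   using \<kappa> that unfolding bij_betw_def by (simp add: inv_into_f_f)
  have "(\<Sum>k\<in>K. ?d k * F i k) = (\<Sum>b<?n. ?d (\<kappa> b) * F i (\<kappa> b))" for i
   by (rule sum.reindex_bij_betw[OF \<kappa>, symmetric])
  hence d: "(\<Sum>k\<in>K. ?d k * F i k) = (\<Sum>b<?n. c b * F i (\<kappa> b))" for i by (simp add: inv)
  have R'0: "(\<Sum>k\<in>K. ?d k * F i k) = 0" if "i \<in> R'" for i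
  proof -
   have "i \<in> \<rho> ` {..<?n}" using \<rho> \<open>i \<in> R'\<close> unfolding bij_betw_def by blast
   then obtain a where "a < ?n" "i = \<rho> a" by blast
   thus ?thesis unfolding d using c by simp
  qed
  have "(\<Sum>k\<in>K. ?d k * F i k) = 0" if i: "i \<in> R" for i
  proof -
   obtain x where x: "\<forall>k\<in>K. F i k = (\<Sum>i'\<in>R'. x i' * F i' k)" using R' i unfolding column_basis_def by blast
   have "(\<Sum>k\<in>K. ?d k * F i k) = (\<Sum>k\<in>K. \<Sum>i'\<in>R'. x i' * (?d k * F i' k))"
    by (rule sum.cong) (use x in \<open>auto simp: sum_distrib_left mult_ac\<close>)
   also have "\<dots> = (\<Sum>i'\<in>R'. x i' * (\<Sum>k\<in>K. ?d k * F i' k))" by (subst sum.swap) (simp only: sum_distrib_left)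
   also have "\<dots> = 0" using R'0 by simp
   finally show ?thesis .
  qed
  hence "\<forall>i\<in>R. (\<Sum>k\<in>K. ?d k * F i k) = 0" by blast
  hence d0: "\<forall>k\<in>K. ?d k = 0" by (rule indep_colsD[OF K(2)])
  show "\<forall>b\<in>{..<?n}. c b = 0"
  proof
   fix b assume b: "b \<in> {..<?n}"
   hence "\<kappa> b \<in> K" using \<kappa> unfolding bij_betw_def by auto
   thus "c b = 0" using d0 inv[of b] b by auto
  qed
 qed
 moreover have "\<rho> ` {..<?n} \<subseteq> R" "\<kappa> ` {..<?n} \<subseteq> C" using \<rho> \<kappa> R'R(1) K(1) unfolding bij_betw_def by auto
 ultimately show ?thesis by blast
qed

text \<open>The selections of rows and columns may have repetitions; this only adds minors that are zero.\<close>

lemma low_rank_iff_minors: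
 fixes F :: "'i \<Rightarrow> 'k \<Rightarrow> 'a::field"
 assumes fin: "finite R" "finite C"
 shows "low_rank r R C F \<longleftrightarrow>
  (\<forall>\<rho> \<kappa>. \<rho> ` {..<Suc r} \<subseteq> R \<longrightarrow> \<kappa> ` {..<Suc r} \<subseteq> C \<longrightarrow> minor (Suc r) \<rho> \<kappa> F = 0)"
proof
 assume "low_rank r R C F"
 thus "\<forall>\<rho> \<kappa>. \<rho> ` {..<Suc r} \<subseteq> R \<longrightarrow> \<kappa> ` {..<Suc r} \<subseteq> C \<longrightarrow> minor (Suc r) \<rho> \<kappa> F = 0"
  using low_rank_minor[of r R C F "Suc r"] by blast
next
 assume min: "\<forall>\<rho> \<kappa>. \<rho> ` {..<Suc r} \<subseteq> R \<longrightarrow> \<kappa> ` {..<Suc r} \<subseteq> C \<longrightarrow> minor (Suc r) \<rho> \<kappa> F = 0"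
 obtain K where K: "column_basis R C F K" using column_basis_exists[OF fin(2)] by blast
 have KC: "K \<subseteq> C" "indep_cols R F K" "finite K" using K finite_subset[OF _ fin(2)] unfolding column_basis_def by auto
 have "card K \<le> r"
 proof (rule ccontr)
  assume "\<not> card K \<le> r"
  then obtain K' where K': "K' \<subseteq> K" "card K' = Suc r" by (metis not_less_eq_eq obtain_subset_with_card_n)
  have "indep_cols R F K'" by (rule indep_cols_subset[OF KC(2) K'(1) KC(3)])
  thus False using minor_exists[of K' C R F] K' KC fin(1) min finite_subset by (metis subset_trans)
 qed
 thus "low_rank r R C F" unfolding low_rank_iff[OF K fin(2)] .
qed

section \<open>Rank loci in the affine space\<close>

lemma insertion_cong_vars: "(\<And>x. x \<in> vars f \<Longrightarrow> \<phi> x = \<psi> x) \<Longrightarrow> insertion c \<phi> f = insertion c \<psi> f"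
 unfolding insertion_def vars_def
 by (intro sum.cong arg_cong2[of _ _ _ _ "(*)"] refl prod.cong) (metis UN_I)

text \<open>Along a curve with polynomial coordinates every polynomial function is a polynomial in the parameter.\<close>

lemma insertion_path:
 fixes P :: "'v \<Rightarrow> 'a::comm_ring_1 poly"
 assumes "\<And>x. x \<in> vars f \<Longrightarrow> \<phi> x = poly (P x) s"
 shows "insertion (\<lambda>a. a) \<phi> f = poly (insertion (\<lambda>a. [:a:]) P f) s"
proof -
 have "insertion (\<lambda>a. a) \<phi> f = insertion (\<lambda>a. a) (\<lambda>x. poly (P x) s) f"
  by (rule insertion_cong_vars) (rule assms)
 thus ?thesis by (simp add: insertion_def poly_sum poly_prod)
qed

text \<open>The inverse of reading off coordinates: the affine space is the space of functions on them.\<close>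

definition mat_of :: "'a::comm_ring_1 ring_R set \<Rightarrow> (coordinate \<Rightarrow> 'a) \<Rightarrow> 'a poly mat" where
 "mat_of I w = mat (t_of I + 1) (t_of I) (\<lambda>(r, c).
  \<Sum>e\<in>{e. (r + 1, c + 1, e) \<in> coordinates I}. monom (w (r + 1, c + 1, e)) e)"

lemma coeff_mat_of:
 assumes "r < t_of I + 1" "c < t_of I"
 shows "coeff (mat_of I w $$ (r, c)) e = (if (r + 1, c + 1, e) \<in> coordinates I then w (r + 1, c + 1, e) else 0)"
proof -
 let ?T = "{e. (r + 1, c + 1, e) \<in> coordinates I}"
 have fin: "finite ?T"
  by (rule finite_subset[of _ "{..nat (deg_bound I (r + 1) (c + 1))}"]) (auto simp: coordinates_def)
 have "coeff (mat_of I w $$ (r, c)) e = (\<Sum>e'\<in>?T. if e' = e then w (r + 1, c + 1, e) else 0)"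
  unfolding mat_of_def using assms by (auto simp: coeff_sum coeff_monom intro!: sum.cong)
 thus ?thesis using fin by simp
qed

lemma mat_of_A_space: "mat_of I w \<in> A_space I"
 unfolding A_space_def
proof (intro CollectI conjI ballI)
 show "mat_of I w \<in> carrier_mat (t_of I + 1) (t_of I)" by (simp add: mat_of_def)
 fix i j assume ij: "i \<in> {1..t_of I + 1}" "j \<in> {1..t_of I}"
 let ?p = "mat_of I w $$ (i - 1, j - 1)"
 show "?p = 0 \<or> int (degree ?p) \<le> deg_bound I i j"
 proof (cases "?p = 0")
  case False
  hence "coeff ?p (degree ?p) \<noteq> 0" by simp
  moreover have ij': "i - 1 < t_of I + 1" "j - 1 < t_of I" "i - 1 + 1 = i" "j - 1 + 1 = j" using ij by auto
  have "coeff ?p e = (if (i, j, e) \<in> coordinates I then w (i, j, e) else 0)" for e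
   using coeff_mat_of[OF ij'(1,2), of w e] unfolding ij'(3,4) .
  ultimately have "(i, j, degree ?p) \<in> coordinates I" by (metis (no_types))
  thus ?thesis by (simp add: coordinates_def)
 qed simp
qed

lemma coord_mat_of: "x \<in> coordinates I \<Longrightarrow> coord (mat_of I w) x = w x"
proof -
 assume x: "x \<in> coordinates I"
 obtain i j e where ije: "x = (i, j, e)" by (cases x)
 have "i \<in> {1..t_of I + 1}" "j \<in> {1..t_of I}" using x unfolding ije coordinates_def by auto
 thus ?thesis using x coeff_mat_of[of "i - 1" I "j - 1" w e] by (auto simp: ije coord_def)
qed

lemma coeff_outside_coordinates:
 assumes A: "A \<in> A_space I" and ij: "i \<in> {1..t_of I + 1}" "j \<in> {1..t_of I}" and e: "(i, j, e) \<notin> coordinates I"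
 shows "coeff (A $$ (i - 1, j - 1)) e = 0"
proof -
 have "A $$ (i - 1, j - 1) = 0 \<or> int (degree (A $$ (i - 1, j - 1))) \<le> deg_bound I i j"
  using A ij unfolding A_space_def by blast
 moreover have "deg_bound I i j < int e" using e ij unfolding coordinates_def by auto
 ultimately show ?thesis by (elim disjE) (simp_all add: coeff_eq_0)
qed

lemma mat_of_coord:
 assumes A: "A \<in> A_space I"
 shows "mat_of I (coord A) = A"
proof (rule eq_matI)
 have c: "A \<in> carrier_mat (t_of I + 1) (t_of I)" using A unfolding A_space_def by blast
 show "dim_row (mat_of I (coord A)) = dim_row A" "dim_col (mat_of I (coord A)) = dim_col A"
  using c by (auto simp: mat_of_def)
 fix r c assume "r < dim_row A" "c < dim_col A"
 hence rc: "r < t_of I + 1" "c < t_of I" using c by auto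
 show "mat_of I (coord A) $$ (r, c) = A $$ (r, c)"
 proof (rule poly_eqI)
  fix e
  show "coeff (mat_of I (coord A) $$ (r, c)) e = coeff (A $$ (r, c)) e"
   using coeff_outside_coordinates[OF A, of "r + 1" "c + 1" e] rc
   by (auto simp: coeff_mat_of[OF rc] coord_def)
 qed
qed

lemma poly_zero_everywhere:
 fixes p :: "'a::idom poly"
 assumes "infinite (UNIV :: 'a set)" "\<And>s. poly p s = 0"
 shows "p = 0"
proof (rule ccontr)
 assume "p \<noteq> 0"
 hence "finite {s. poly p s = 0}" by (rule poly_roots_finite)
 thus False using assms by simp
qed

lemma minor_hom:
 assumes "comm_ring_hom h"
 shows "minor n \<rho> \<kappa> (\<lambda>i k. h (F i k)) = h (minor n \<rho> \<kappa> F)"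
proof -
 interpret comm_ring_hom h by fact
 have "mat n n (\<lambda>(a, b). h (F (\<rho> a) (\<kappa> b))) = map_mat h (mat n n (\<lambda>(a, b). F (\<rho> a) (\<kappa> b)))"
  by (rule eq_matI) auto
 thus ?thesis unfolding minor_def by simp
qed

lemma vars_minor:
 assumes "\<rho> ` {..<n} \<subseteq> R" "\<kappa> ` {..<n} \<subseteq> C"
 shows "vars (minor n \<rho> \<kappa> (\<lambda>i k. Var (g i k) :: ('v, 'a::comm_ring_1) mpoly)) \<subseteq> {g i k | i k. i \<in> R \<and> k \<in> C}"
proof -
 let ?A = "mat n n (\<lambda>(a, b). Var (g (\<rho> a) (\<kappa> b)) :: ('v, 'a) mpoly)"
 let ?W = "{g i k | i k. i \<in> R \<and> k \<in> C}"
 have A: "?A \<in> carrier_mat n n" by simp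
 have one: "vars (1 :: ('v, 'a) mpoly) = {}" "vars (- 1 :: ('v, 'a) mpoly) = {}"
  by (auto simp: vars_def in_keys_iff lookup_one when_def split: if_splits)
 have sum: "vars (sum F T) \<subseteq> ?W" if "\<And>x. x \<in> T \<Longrightarrow> vars (F x) \<subseteq> ?W" for F :: "'z \<Rightarrow> ('v, 'a) mpoly" and T
  using keys_sum_subset[of F T] that unfolding vars_def by blast
 have prod: "vars (prod F T) \<subseteq> ?W" if "\<And>x. x \<in> T \<Longrightarrow> vars (F x) \<subseteq> ?W" for F :: "nat \<Rightarrow> ('v, 'a) mpoly" and T
  using that
 proof (induction T rule: infinite_finite_induct)
  case (insert x T)
  have "vars (F x) \<subseteq> ?W" "vars (prod F T) \<subseteq> ?W" using insert by blast+
  thus ?case using insert.hyps vars_mult[of "F x" "prod F T"] by auto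
 qed (simp_all add: one)
 have entry: "vars (?A $$ (a, p a)) \<subseteq> ?W" if "p permutes {0..<n}" "a \<in> {0..<n}" for a p
 proof -
  have a: "a < n" "p a < n" using that permutes_in_image[OF that(1), of a] by auto
  have "vars (Var v :: ('v, 'a) mpoly) \<subseteq> {v}" for v by (auto simp: vars_def Var_def monomial_def)
  hence "vars (?A $$ (a, p a)) \<subseteq> {g (\<rho> a) (\<kappa> (p a))}" using a by simp
  moreover have "\<rho> a \<in> R" "\<kappa> (p a) \<in> C" using assms a by auto
  ultimately show ?thesis by blast
 qed
 have "vars (signof p * (\<Prod>i = 0..<n. ?A $$ (i, p i))) \<subseteq> ?W" if "p permutes {0..<n}" for p
 proof -
  have "vars (signof p :: ('v, 'a) mpoly) = {}" by (auto simp: sign_def one)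
  moreover have "vars (\<Prod>i = 0..<n. ?A $$ (i, p i)) \<subseteq> ?W" by (rule prod) (rule entry[OF that])
  ultimately show ?thesis using vars_mult[of "signof p" "\<Prod>i = 0..<n. ?A $$ (i, p i)"] by blast
 qed
 hence "vars (det ?A) \<subseteq> ?W" unfolding det_def'[OF A] by (intro sum) blast
 thus ?thesis unfolding minor_def .
qed

definition rank_locus :: "'a::field ring_R set \<Rightarrow> nat set \<Rightarrow> nat set \<Rightarrow> nat \<Rightarrow> 'a poly mat set" where
 "rank_locus I R C r = {A \<in> A_space I. low_rank r R C (\<lambda>i k. coord A (i, k, 0))}"

lemma rank_locus_zero_locus:
 fixes I :: "'a::field ring_R set"
 assumes fin: "finite R" "finite C"
 shows "\<exists>E. (\<forall>f\<in>E. vars f \<subseteq> {(i, k, 0) | i k. i \<in> R \<and> k \<in> C}) \<and> rank_locus I R C r = zero_locus I E"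
proof -
 let ?v = "\<lambda>i k. (i, k, 0) :: coordinate"
 define E where "E = {minor (Suc r) \<rho> \<kappa> (\<lambda>i k. Var (?v i k) :: (coordinate, 'a) mpoly) | \<rho> \<kappa>. \<rho> ` {..<Suc r} \<subseteq> R \<and> \<kappa> ` {..<Suc r} \<subseteq> C}"
 have "vars f \<subseteq> {(i, k, 0) | i k. i \<in> R \<and> k \<in> C}" if f: "f \<in> E" for f
 proof -
  obtain \<rho> \<kappa> where *: "f = minor (Suc r) \<rho> \<kappa> (\<lambda>i k. Var (?v i k))" "\<rho> ` {..<Suc r} \<subseteq> R" "\<kappa> ` {..<Suc r} \<subseteq> C"
   using f unfolding E_def by blast
  show ?thesis unfolding *(1) by (rule vars_minor[OF *(2,3)])
 qed
 moreover have "rank_locus I R C r = zero_locus I E"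
 proof -
  have "low_rank r R C (\<lambda>i k. coord A (i, k, 0)) \<longleftrightarrow> (\<forall>f\<in>E. insertion (\<lambda>a. a) (coord A) f = 0)" for A
  proof -
   have ins: "insertion (\<lambda>a. a) (coord A) (minor (Suc r) \<rho> \<kappa> (\<lambda>i k. Var (?v i k))) = minor (Suc r) \<rho> \<kappa> (\<lambda>i k. coord A (?v i k))" for \<rho> \<kappa>
    unfolding minor_hom[OF comm_ring_hom_insertion[OF comm_ring_hom_id], symmetric]
    by (simp add: insertion_Var[OF comm_ring_hom_id])
   show ?thesis unfolding low_rank_iff_minors[OF fin] E_def by (simp only: ins[symmetric]) blast
  qed
  thus ?thesis unfolding rank_locus_def zero_locus_def by blast
 qed
 ultimately show ?thesis by blast
qed

text \<open>Two points of a rank locus are joined by a polynomial curve inside it: interpolate the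
 factors of the two factorizations.\<close>

lemma rank_locus_path:
 fixes I :: "'a::field ring_R set"
 assumes RC: "\<And>i k. i \<in> R \<Longrightarrow> k \<in> C \<Longrightarrow> (i, k, 0) \<in> coordinates I"
  and A: "A \<in> rank_locus I R C r" and A': "A' \<in> rank_locus I R C r"
 shows "\<exists>\<phi> P. (\<forall>s. \<phi> s \<in> rank_locus I R C r) \<and> \<phi> 0 = A \<and> \<phi> 1 = A' \<and>
  (\<forall>s. \<forall>x\<in>coordinates I. coord (\<phi> s) x = poly (P x) s)"
proof -
 obtain U V where UV: "\<forall>i\<in>R. \<forall>k\<in>C. coord A (i, k, 0) = (\<Sum>l<r. U i l * V l k)"
  using A unfolding rank_locus_def low_rank_def by blast
 obtain U' V' where UV': "\<forall>i\<in>R. \<forall>k\<in>C. coord A' (i, k, 0) = (\<Sum>l<r. U' i l * V' l k)"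
  using A' unfolding rank_locus_def low_rank_def by blast
 have sp: "A \<in> A_space I" "A' \<in> A_space I" using A A' unfolding rank_locus_def by auto
 define P where "P = (\<lambda>x. case x of (i, k, e) \<Rightarrow> if e = 0 \<and> i \<in> R \<and> k \<in> C
  then \<Sum>l<r. [:U i l, U' i l - U i l:] * [:V l k, V' l k - V l k:]
  else [:coord A x, coord A' x - coord A x:])"
 define \<phi> where "\<phi> = (\<lambda>s. mat_of I (\<lambda>x. poly (P x) s))"
 have P: "coord (\<phi> s) x = poly (P x) s" if "x \<in> coordinates I" for s x
  unfolding \<phi>_def by (rule coord_mat_of[OF that])
 have "\<phi> s \<in> rank_locus I R C r" for s
 proof -
  have "coord (\<phi> s) (i, k, 0) = (\<Sum>l<r. (U i l + s * (U' i l - U i l)) * (V l k + s * (V' l k - V l k)))"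
   if "i \<in> R" "k \<in> C" for i k
   unfolding P[OF RC[OF that]] using that by (simp add: P_def poly_sum del: mult_pCons_left mult_pCons_right)
  hence "low_rank r R C (\<lambda>i k. coord (\<phi> s) (i, k, 0))"
   unfolding low_rank_def
   by (intro exI[of _ "\<lambda>i l. U i l + s * (U' i l - U i l)"] exI[of _ "\<lambda>l k. V l k + s * (V' l k - V l k)"]) blast
  thus ?thesis unfolding rank_locus_def by (simp add: \<phi>_def mat_of_A_space)
 qed
 moreover have "\<phi> 0 = A"
 proof -
  have "(\<lambda>x. poly (P x) 0) = coord A" using UV by (auto simp: P_def poly_sum fun_eq_iff simp del: mult_pCons_left mult_pCons_right)
  thus ?thesis unfolding \<phi>_def by (simp add: mat_of_coord[OF sp(1)])
 qed
 moreover have "\<phi> 1 = A'"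
 proof -
  have "(\<lambda>x. poly (P x) 1) = coord A'" using UV' by (auto simp: P_def poly_sum fun_eq_iff simp del: mult_pCons_left mult_pCons_right)
  thus ?thesis unfolding \<phi>_def by (simp add: mat_of_coord[OF sp(2)])
 qed
 ultimately show ?thesis using P by blast
qed

text \<open>If neither closed set contained the locus, two points witnessing this would lie on a curve inside the
 locus; on it a product of two nonzero polynomials would vanish everywhere.\<close>

lemma rank_locus_irreducible:
 fixes I :: "'a::field ring_R set"
 assumes inf: "infinite (UNIV :: 'a set)"
  and RC: "\<And>i k. i \<in> R \<Longrightarrow> k \<in> C \<Longrightarrow> (i, k, 0) \<in> coordinates I"
  and E: "\<forall>f\<in>E. vars f \<subseteq> coordinates I" and F: "\<forall>f\<in>F. vars f \<subseteq> coordinates I"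
  and sub: "rank_locus I R C r \<subseteq> zero_locus I E \<union> zero_locus I F"
 shows "rank_locus I R C r \<subseteq> zero_locus I E \<or> rank_locus I R C r \<subseteq> zero_locus I F"
proof (rule ccontr)
 let ?i = "\<lambda>A f. insertion (\<lambda>a. a) (coord A) f"
 assume "\<not> ?thesis"
 then obtain A A' where A: "A \<in> rank_locus I R C r" "A \<notin> zero_locus I E"
  and A': "A' \<in> rank_locus I R C r" "A' \<notin> zero_locus I F" by blast
 obtain f where f: "f \<in> E" "?i A f \<noteq> 0" using A unfolding zero_locus_def rank_locus_def by blast
 obtain g where g: "g \<in> F" "?i A' g \<noteq> 0" using A' unfolding zero_locus_def rank_locus_def by blast
 obtain \<phi> P where \<phi>: "\<forall>s. \<phi> s \<in> rank_locus I R C r" "\<phi> 0 = A" "\<phi> 1 = A'"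
  and P: "\<forall>s. \<forall>x\<in>coordinates I. coord (\<phi> s) x = poly (P x) s"
  using rank_locus_path[of R C I, OF RC A(1) A'(1)] by blast
 have pf: "?i (\<phi> s) f = poly (insertion (\<lambda>a. [:a:]) P f) s" for s
  by (rule insertion_path) (use P E f(1) in blast)
 have pg: "?i (\<phi> s) g = poly (insertion (\<lambda>a. [:a:]) P g) s" for s
  by (rule insertion_path) (use P F g(1) in blast)
 have "?i (\<phi> s) f = 0 \<or> ?i (\<phi> s) g = 0" for s
  using \<phi>(1) sub f(1) g(1) unfolding zero_locus_def by blast
 hence "poly (insertion (\<lambda>a. [:a:]) P f * insertion (\<lambda>a. [:a:]) P g) s = 0" for s
  unfolding pf pg by auto
 hence "insertion (\<lambda>a. [:a:]) P f * insertion (\<lambda>a. [:a:]) P g = 0" by (rule poly_zero_everywhere[OF inf])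
 hence "insertion (\<lambda>a. [:a:]) P f = 0 \<or> insertion (\<lambda>a. [:a:]) P g = 0" by simp
 thus False using pf[of 0] pg[of 1] \<phi>(2,3) f(2) g(2) by auto
qed

text \<open>If the rank \<open>r\<close> is attained at all, the points of rank exactly \<open>r\<close> are dense: on a curve
 through such a point some \<open>r\<close>-minor is a nonzero polynomial.\<close>

lemma rank_locus_dense:
 fixes I :: "'a::field ring_R set"
 assumes inf: "infinite (UNIV :: 'a set)" and fin: "finite R" "finite C"
  and RC: "\<And>i k. i \<in> R \<Longrightarrow> k \<in> C \<Longrightarrow> (i, k, 0) \<in> coordinates I"
  and E: "\<forall>f\<in>E. vars f \<subseteq> coordinates I"
  and A': "A' \<in> rank_locus I R C r" "\<And>r'. r' < r \<Longrightarrow> A' \<notin> rank_locus I R C r'"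
  and sub: "\<And>A. A \<in> rank_locus I R C r \<Longrightarrow> (\<And>r'. r' < r \<Longrightarrow> A \<notin> rank_locus I R C r') \<Longrightarrow> A \<in> zero_locus I E"
 shows "rank_locus I R C r \<subseteq> zero_locus I E"
proof
 let ?i = "\<lambda>A f. insertion (\<lambda>a. a) (coord A) f" and ?F = "\<lambda>A i k. coord A (i, k, 0)"
 fix A assume A: "A \<in> rank_locus I R C r"
 obtain K where K: "column_basis R C (?F A') K" using column_basis_exists[OF fin(2)] by blast
 have KC: "K \<subseteq> C" "indep_cols R (?F A') K" "finite K"
  using K finite_subset[OF _ fin(2)] unfolding column_basis_def by auto
 have "card K = r"
  using A' low_rank_iff[OF K fin(2)] unfolding rank_locus_def by (metis (mono_tags, lifting) le_neq_implies_less mem_Collect_eq order_refl)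
 then obtain \<rho> \<kappa> where \<rho>: "\<rho> ` {..<r} \<subseteq> R" "\<kappa> ` {..<r} \<subseteq> C" "minor r \<rho> \<kappa> (?F A') \<noteq> 0"
  using minor_exists[OF KC fin(1)] by blast
 obtain \<phi> P where \<phi>: "\<forall>s. \<phi> s \<in> rank_locus I R C r" "\<phi> 0 = A" "\<phi> 1 = A'"
  and P: "\<forall>s. \<forall>x\<in>coordinates I. coord (\<phi> s) x = poly (P x) s"
  using rank_locus_path[of R C I, OF RC A A'(1)] by blast
 have sp: "A \<in> A_space I" using A unfolding rank_locus_def by blast
 have "?i A f = 0" if f: "f \<in> E" for f
 proof -
  have pf: "?i (\<phi> s) f = poly (insertion (\<lambda>a. [:a:]) P f) s" for s
   by (rule insertion_path) (use P E f in blast)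
  let ?d = "minor r \<rho> \<kappa> (\<lambda>i k. P (i, k, 0))"
  have pd: "minor r \<rho> \<kappa> (?F (\<phi> s)) = poly ?d s" for s
  proof -
   have hom: "comm_ring_hom (\<lambda>p. poly p s)" by unfold_locales simp_all
   have "?F (\<phi> s) (\<rho> a) (\<kappa> b) = poly (P (\<rho> a, \<kappa> b, 0)) s" if "a < r" "b < r" for a b
    using P RC \<rho>(1,2) that by (auto simp: image_subset_iff)
   hence "minor r \<rho> \<kappa> (?F (\<phi> s)) = minor r \<rho> \<kappa> (\<lambda>i k. poly (P (i, k, 0)) s)"
    unfolding minor_def by (intro arg_cong[of _ _ det] eq_matI) auto
   thus ?thesis unfolding minor_hom[OF hom] .
  qed
  have "poly (?d * insertion (\<lambda>a. [:a:]) P f) s = 0" for s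
  proof (cases "poly ?d s = 0")
   case False
   have "\<phi> s \<notin> rank_locus I R C r'" if "r' < r" for r'
    using low_rank_minor[OF _ that \<rho>(1,2), of "?F (\<phi> s)"] False pd[of s] unfolding rank_locus_def by auto
   hence "\<phi> s \<in> zero_locus I E" using \<phi>(1) by (intro sub) auto
   hence "?i (\<phi> s) f = 0" using f unfolding zero_locus_def by blast
   thus ?thesis unfolding pf by simp
  qed simp
  hence "?d * insertion (\<lambda>a. [:a:]) P f = 0" by (rule poly_zero_everywhere[OF inf])
  moreover have "?d \<noteq> 0" using pd[of 1] \<rho>(3) \<phi>(3) by auto
  ultimately have "insertion (\<lambda>a. [:a:]) P f = 0" by simp
  thus ?thesis using pf[of 0] \<phi>(2) by simp
 qed
 thus "A \<in> zero_locus I E" using sp unfolding zero_locus_def by blast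
qed

lemma bij_betw_pick:
 assumes "finite S"
 shows "bij_betw (pick S) {..<card S} S"
proof -
 have inj: "inj_on (pick S) {..<card S}"
 proof (rule inj_onI, rule ccontr)
  fix a b assume "a \<in> {..<card S}" "b \<in> {..<card S}" "pick S a = pick S b" "a \<noteq> b"
  thus False using pick_mono[of a S b] pick_mono[of b S a] by (metis lessThan_iff less_irrefl nat_neq_iff)
 qed
 moreover have "pick S ` {..<card S} \<subseteq> S" using pick_in_set by auto
 ultimately have "pick S ` {..<card S} = S" using card_image[OF inj] assms by (intro card_subset_eq) auto
 thus ?thesis using inj unfolding bij_betw_def by blast
qed

lemma matrix_rank_M_block:
 fixes I :: "'a::field ring_R set"
 assumes entry: "\<And>i k. i \<in> deg_rows I j \<Longrightarrow> k \<in> deg_cols I j \<Longrightarrow>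
   M_mat I A $$ (i - 1, k - 1) = Const (coord A (i, k, 0))"
  and basis: "column_basis (deg_rows I j) (deg_cols I j) (\<lambda>i k. coord A (i, k, 0)) K"
 shows "matrix_rank (M_block I j A) = card K"
proof -
 let ?M = "M_mat I A" and ?R = "(\<lambda>i. i - 1) ` deg_rows I j" and ?C = "(\<lambda>i. i - 1) ` deg_cols I j"
 have dims: "dim_row ?M = t_of I + 1" "dim_col ?M = t_of I" by (simp_all add: M_mat_def A_hom_def)
 have R: "{i. i < dim_row ?M \<and> i \<in> ?R} = ?R" "{i. i < dim_col ?M \<and> i \<in> ?C} = ?C"
  unfolding dims by (auto simp: deg_rows_def deg_cols_def)
 have fin: "finite ?R" "finite ?C" by (auto simp: deg_rows_def deg_cols_def)
 have N: "M_block I j A \<in> carrier_mat (card ?R) (card ?C)"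
  unfolding M_block_def by (intro carrier_matI) (simp_all only: index_map_mat dim_submatrix R)
 have Suc_bij: "bij_betw Suc ?R (deg_rows I j)" "bij_betw Suc ?C (deg_cols I j)"
 proof -
  have "Suc ` ?R = deg_rows I j" "Suc ` ?C = deg_cols I j"
   unfolding image_image by (force simp: deg_rows_def deg_cols_def image_iff)+
  thus "bij_betw Suc ?R (deg_rows I j)" "bij_betw Suc ?C (deg_cols I j)"
   unfolding bij_betw_def by auto
 qed
 have b: "bij_betw (Suc \<circ> pick ?R) {..<card ?R} (deg_rows I j)" "bij_betw (Suc \<circ> pick ?C) {..<card ?C} (deg_cols I j)"
  by (rule bij_betw_trans[OF bij_betw_pick[OF fin(1)] Suc_bij(1)], rule bij_betw_trans[OF bij_betw_pick[OF fin(2)] Suc_bij(2)])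
 show ?thesis
 proof (rule matrix_rank_reindexed[OF N b _ basis])
  fix r c assume rc: "r < card ?R" "c < card ?C"
  have in_sets: "(Suc \<circ> pick ?R) r \<in> deg_rows I j" "(Suc \<circ> pick ?C) c \<in> deg_cols I j"
   using b rc unfolding bij_betw_def by auto
  have "M_block I j A $$ (r, c) = lookup (submatrix ?M ?R ?C $$ (r, c)) 0"
   unfolding M_block_def by (rule index_map_mat) (use rc R in \<open>simp_all add: dim_submatrix\<close>)
  also have "submatrix ?M ?R ?C $$ (r, c) = ?M $$ (pick ?R r, pick ?C c)"
   by (rule submatrix_index) (use rc R in simp_all)
  also have "\<dots> = Const (coord A ((Suc \<circ> pick ?R) r, (Suc \<circ> pick ?C) c, 0))"
   using entry[OF in_sets] by simp
  finally show "M_block I j A $$ (r, c) = coord A ((Suc \<circ> pick ?R) r, (Suc \<circ> pick ?C) c, 0)"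
   by (simp add: Const_def)
 qed
qed

section \<open>Lex-segment ideals in two variables\<close>

lemma forms_Collect: "forms n = {f. keys f \<subseteq> {m. mdeg m = n}}"
 by (auto simp: forms_def)

lemma less_mR:
 assumes "a + b = a' + b'"
 shows "mR a b < mR a' b' \<longleftrightarrow> a < a'"
proof -
 have "\<forall>w::2. \<not> w < 0 \<and> (w < 1 \<longleftrightarrow> w = 0)"
  by (subst all_2) (simp add: less_bit0_def bit0.Rep_0 bit0.Rep_1)
 hence l: "\<not> (w::2) < 0" "(w::2) < 1 \<longleftrightarrow> w = 0" for w by blast+
 show ?thesis
  unfolding less_poly_mapping.rep_eq less_fun_def
  by (subst ex_2) (use assms in \<open>auto simp: l\<close>)
qed

lemma hilbert_function_monomial_R:
 fixes L :: "'a::field ring_R set"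
 assumes L: "L = ideal_gen (monomial ` B)"
 shows "hilbert_function L n = std_count (\<lambda>a b. (monomial (mR a b) :: 'a ring_R) \<in> L) n"
proof -
 let ?T = "{m. mdeg m = n \<and> (monomial m :: 'a ring_R) \<in> L}"
 have mem: "f \<in> L \<longleftrightarrow> (\<forall>m\<in>keys f. (monomial m :: 'a ring_R) \<in> L)" for f
  unfolding L monomial_mem_monomial_ideal by (rule mem_monomial_ideal)
 have "f \<in> L \<inter> forms n \<longleftrightarrow> keys f \<subseteq> ?T" for f
  unfolding forms_Collect Int_iff mem_Collect_eq using mem[of f] by blast
 hence "L \<inter> forms n = {f. keys f \<subseteq> ?T}" by blast
 hence "mpoly_vs.dim (L \<inter> forms n) = card ?T"
  using dim_monomial_span[of ?T] finite_subset[OF _ finite_mdeg[of n], of ?T] by (simp add: Collect_mono)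
 moreover have "card {m :: 2 \<Rightarrow>\<^sub>0 nat. mdeg m = n} - card ?T = card ({m. mdeg m = n} - ?T)"
  by (rule card_Diff_subset[symmetric]) (auto intro: finite_subset[OF _ finite_mdeg[of n]])
 ultimately have "hilbert_function L n = card ({m. mdeg m = n} - ?T)"
  unfolding hilbert_function_def dim_forms by simp
 also have "{m. mdeg m = n} - ?T = (\<lambda>a. mR a (n - a)) ` {a. a \<le> n \<and> (monomial (mR a (n - a)) :: 'a ring_R) \<notin> L}"
 proof (intro equalityI subsetI)
  fix \<mu> assume \<mu>: "\<mu> \<in> {m. mdeg m = n} - ?T"
  obtain a b where ab: "\<mu> = mR a b" by (rule mR_cases)
  have "b = n - a" "a \<le> n" using \<mu> unfolding ab by auto
  thus "\<mu> \<in> (\<lambda>a. mR a (n - a)) ` {a. a \<le> n \<and> (monomial (mR a (n - a)) :: 'a ring_R) \<notin> L}"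
   using \<mu> unfolding ab by (intro image_eqI[of _ _ a]) auto
 qed auto
 also have "card \<dots> = card {a. a \<le> n \<and> (monomial (mR a (n - a)) :: 'a ring_R) \<notin> L}"
  by (rule card_image) (auto simp: inj_on_def)
 finally show ?thesis unfolding std_count_def .
qed

lemma down_closed_eq_lessThan:
 fixes A :: "nat set"
 assumes fin: "finite A" and down: "\<And>a b. b \<in> A \<Longrightarrow> a \<le> b \<Longrightarrow> a \<in> A"
 shows "A = {..<card A}"
proof -
 define k where "k = (LEAST k. k \<notin> A)"
 have "\<exists>k. k \<notin> A" using fin infinite_UNIV_nat by (metis UNIV_eq_I)
 hence "k \<notin> A" unfolding k_def by (rule LeastI_ex)
 moreover have "i \<in> A" if "i < k" for i using not_less_Least that unfolding k_def by blast
 ultimately have "A = {..<k}" using down[of _ k] by (intro equalityI subsetI) (auto simp: not_le[symmetric])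
 thus ?thesis by simp
qed

text \<open>The numerical conditions on the \<open>h\<close>-vector of a zero-dimensional scheme in the plane.\<close>

locale h_vector =
 fixes hn :: "nat \<Rightarrow> nat"
 assumes hn_0: "hn 0 = 1" and hn_le: "\<And>n. hn n \<le> n + 1"
  and hn_dec: "\<And>n. hn n \<le> n \<Longrightarrow> hn (Suc n) \<le> hn n"
  and hn_zero: "\<exists>N. \<forall>n\<ge>N. hn n = 0"
begin

definition in_lex :: "nat \<Rightarrow> nat \<Rightarrow> bool" where
 "in_lex a b \<longleftrightarrow> hn (a + b) \<le> a"

lemma in_lex_Suc: "in_lex a b \<Longrightarrow> in_lex (Suc a) b \<and> in_lex a (Suc b)"
 using hn_dec[of "a + b"] unfolding in_lex_def by auto

lemma in_lex_add: "in_lex a b \<Longrightarrow> in_lex (a + i) (b + j)"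
proof -
 assume "in_lex a b"
 hence "in_lex (a + i) b" by (induction i) (simp_all add: in_lex_Suc)
 thus ?thesis by (induction j) (simp_all add: in_lex_Suc)
qed

lemma in_lex_mono: "in_lex a b \<Longrightarrow> a \<le> a' \<Longrightarrow> b \<le> b' \<Longrightarrow> in_lex a' b'"
 using in_lex_add[of a b "a' - a" "b' - b"] by simp

text \<open>In degree \<open>n\<close> the \<open>hn n\<close> standard monomials are those with the smallest powers of \<open>x\<close>.\<close>

definition lex_ideal :: "'a::field ring_R set" where
 "lex_ideal = ideal_gen (monomial ` {mR a b | a b. in_lex a b})"

lemma monomial_in_lex_ideal: "(monomial (mR a b) :: 'a::field ring_R) \<in> lex_ideal \<longleftrightarrow> in_lex a b"
 unfolding lex_ideal_def monomial_mem_monomial_ideal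
proof
 assume "\<exists>\<mu>\<in>{mR a b | a b. in_lex a b}. \<exists>k. mR a b = \<mu> + k"
 then obtain a' b' k where *: "in_lex a' b'" "mR a b = mR a' b' + k" by blast
 obtain i j where "k = mR i j" by (rule mR_cases)
 thus "in_lex a b" using *(2) in_lex_add[OF *(1), of i j] by (simp add: mR_add)
next
 assume "in_lex a b"
 thus "\<exists>\<mu>\<in>{mR a b | a b. in_lex a b}. \<exists>k. mR a b = \<mu> + k"
  by (intro bexI[of _ "mR a b"] exI[of _ 0]) auto
qed

lemma std_count_in_lex: "std_count in_lex n = hn n"
proof -
 have "{a. a \<le> n \<and> \<not> in_lex a (n - a)} = {..<hn n}"
  using hn_le[of n] unfolding in_lex_def by auto
 thus ?thesis unfolding std_count_def by simp
qed

lemma lex_segment_lex_ideal: "lex_segment_ideal (lex_ideal :: 'a::field ring_R set)"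
 unfolding lex_segment_ideal_def
proof (intro conjI allI impI)
 show "\<exists>B. (lex_ideal :: 'a ring_R set) = ideal_gen (monomial ` B)" unfolding lex_ideal_def by blast
 fix \<mu> \<mu>' :: "2 \<Rightarrow>\<^sub>0 nat"
 assume *: "mdeg \<mu> = mdeg \<mu>' \<and> \<mu> < \<mu>' \<and> (monomial \<mu> :: 'a ring_R) \<in> lex_ideal"
 obtain a b where ab: "\<mu> = mR a b" by (rule mR_cases)
 obtain a' b' where ab': "\<mu>' = mR a' b'" by (rule mR_cases)
 have deg: "a + b = a' + b'" using * by (simp add: ab ab')
 hence "a < a'" using * less_mR[OF deg] by (simp add: ab ab')
 moreover have "in_lex a b" using * by (simp add: ab monomial_in_lex_ideal)
 ultimately show "(monomial \<mu>' :: 'a ring_R) \<in> lex_ideal"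
  unfolding ab' monomial_in_lex_ideal by (simp add: in_lex_def deg[symmetric])
qed

lemma hilbert_series_lex_ideal: "hilbert_series (lex_ideal :: 'a::field ring_R set) = Abs_fps (\<lambda>n. int (hn n))"
 unfolding hilbert_series_def hilbert_function_monomial_R[OF lex_ideal_def] monomial_in_lex_ideal
 by (simp add: std_count_in_lex)

text \<open>In each degree the \<open>x\<close>-exponents of the standard monomials of a lex-segment ideal form an initial
 segment, and the Hilbert function fixes its length.\<close>

lemma lex_segment_unique:
 fixes L :: "'a::field ring_R set"
 assumes lex: "lex_segment_ideal L" and H: "hilbert_series L = Abs_fps (\<lambda>n. int (hn n))"
 shows "L = lex_ideal"
proof -
 obtain B where L: "L = ideal_gen (monomial ` B)" using lex unfolding lex_segment_ideal_def by blast
 have up: "(monomial \<mu>' :: 'a ring_R) \<in> L" if "mdeg \<mu> = mdeg \<mu>'" "\<mu> < \<mu>'" "(monomial \<mu> :: 'a ring_R) \<in> L" for \<mu> \<mu>'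
  using lex that unfolding lex_segment_ideal_def by blast
 have mon: "(monomial (mR a b) :: 'a ring_R) \<in> L \<longleftrightarrow> in_lex a b" for a b
 proof -
  let ?A = "{i. i \<le> a + b \<and> (monomial (mR i (a + b - i)) :: 'a ring_R) \<notin> L}"
  have "int (hilbert_function L (a + b)) = int (hn (a + b))"
   using arg_cong[OF H, of "\<lambda>F. fps_nth F (a + b)"] by (simp add: hilbert_series_def)
  hence card: "card ?A = hn (a + b)"
   unfolding hilbert_function_monomial_R[OF L] std_count_def by simp
  have "i \<in> ?A" if "k \<in> ?A" "i \<le> k" for i k
  proof (cases "i = k")
   case False
   hence "mR i (a + b - i) < mR k (a + b - k)" using that less_mR[of i "a + b - i" k "a + b - k"] by auto
   thus ?thesis using that up[of "mR i (a + b - i)" "mR k (a + b - k)"] by auto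
  qed (use that in simp)
  hence "?A = {..<card ?A}" by (intro down_closed_eq_lessThan) auto
  hence "a \<in> ?A \<longleftrightarrow> a < hn (a + b)" unfolding card by blast
  thus ?thesis unfolding in_lex_def by auto
 qed
 have "f \<in> L \<longleftrightarrow> f \<in> lex_ideal" for f
 proof -
  have "f \<in> L \<longleftrightarrow> (\<forall>\<mu>\<in>keys f. (monomial \<mu> :: 'a ring_R) \<in> L)"
   unfolding L monomial_mem_monomial_ideal by (rule mem_monomial_ideal)
  also have "\<dots> \<longleftrightarrow> (\<forall>\<mu>\<in>keys f. (monomial \<mu> :: 'a ring_R) \<in> lex_ideal)"
  proof (rule ball_cong[OF refl])
   fix \<mu> :: "2 \<Rightarrow>\<^sub>0 nat"
   obtain a b where ab: "\<mu> = mR a b" by (rule mR_cases)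
   show "(monomial \<mu> :: 'a ring_R) \<in> L \<longleftrightarrow> (monomial \<mu> :: 'a ring_R) \<in> lex_ideal"
    unfolding ab mon monomial_in_lex_ideal ..
  qed
  also have "\<dots> \<longleftrightarrow> f \<in> lex_ideal"
   unfolding lex_ideal_def monomial_mem_monomial_ideal by (rule mem_monomial_ideal[symmetric])
  finally show ?thesis .
 qed
 thus ?thesis by blast
qed

lemma Lex_eq_lex_ideal: "Lex (Abs_fps (\<lambda>n. int (hn n))) = (lex_ideal :: 'a::field ring_R set)"
 unfolding Lex_def
 by (rule the_equality) (use lex_segment_lex_ideal hilbert_series_lex_ideal lex_segment_unique in blast)+

definition lex_t :: nat where "lex_t = (LEAST j. in_lex j 0)"

definition lex_m :: "nat \<Rightarrow> nat" where
 "lex_m i = (if i = 0 then 0 else LEAST j. in_lex (lex_t - i) j)"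

lemma t_of_lex_ideal: "t_of (lex_ideal :: 'a::field ring_R set) = lex_t"
 unfolding t_of_def lex_t_def Var_R_power monomial_def[symmetric] monomial_in_lex_ideal ..

lemma m_of_lex_ideal: "m_of (lex_ideal :: 'a::field ring_R set) = lex_m"
proof
 fix i
 have "(xR ^ a * yR ^ b :: 'a ring_R) = monomial (mR a b)" for a b
  by (simp add: Var_R_power monomial_def mult_single mR_add)
 thus "m_of (lex_ideal :: 'a ring_R set) i = lex_m i"
  unfolding m_of_def lex_m_def t_of_lex_ideal by (simp only: monomial_in_lex_ideal)
qed

lemma in_lex_exists: "\<exists>b. in_lex a b"
proof -
 obtain N where "\<forall>n\<ge>N. hn n = 0" using hn_zero by blast
 hence "in_lex a N" unfolding in_lex_def by simp
 thus ?thesis ..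
qed

lemma in_lex_t: "in_lex a 0 \<longleftrightarrow> lex_t \<le> a"
proof
 obtain N where "\<forall>n\<ge>N. hn n = 0" using hn_zero by blast
 hence "in_lex N 0" unfolding in_lex_def by simp
 hence "in_lex lex_t 0" unfolding lex_t_def by (rule LeastI)
 thus "lex_t \<le> a \<Longrightarrow> in_lex a 0" by (rule in_lex_mono) auto
 show "in_lex a 0 \<Longrightarrow> lex_t \<le> a" unfolding lex_t_def by (rule Least_le)
qed

lemma in_lex_iff: "in_lex a b \<longleftrightarrow> lex_m (lex_t - a) \<le> b"
proof (cases "lex_t \<le> a")
 case True
 thus ?thesis using in_lex_t[of a] in_lex_mono[of a 0 a b] by (simp add: lex_m_def)
next
 case False
 hence m: "lex_m (lex_t - a) = (LEAST j. in_lex a j)" by (simp add: lex_m_def)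
 have "in_lex a (LEAST j. in_lex a j)" by (rule LeastI_ex[OF in_lex_exists])
 thus ?thesis unfolding m using in_lex_mono[of a _ a b] Least_le[of "in_lex a" b] by blast
qed

text \<open>If \<open>x^(t - k - 1) y^(b + 1)\<close> lies in the ideal, so does \<open>x^(t - k) y^b\<close> of the same degree; hence \<open>m\<close>
 increases strictly.\<close>

sublocale staircase lex_t lex_m
proof
 show "lex_m 0 = 0" by (simp add: lex_m_def)
 have "\<not> in_lex 0 0" by (simp add: in_lex_def hn_0)
 thus "0 < lex_t" unfolding in_lex_t by simp
 fix k assume k: "k < lex_t"
 let ?a = "lex_t - Suc k" and ?b = "lex_m (Suc k)"
 have ab: "in_lex ?a ?b" unfolding in_lex_iff using k by simp
 have "?b \<noteq> 0"
 proof
  assume "?b = 0"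
  hence "in_lex ?a 0" using ab by simp
  thus False using k unfolding in_lex_t by simp
 qed
 then obtain b where b: "?b = Suc b" by (cases ?b) auto
 have "in_lex (lex_t - k) b"
 proof -
  have "Suc ?a = lex_t - k" using k by simp
  hence "lex_t - k + b = ?a + ?b" "?a \<le> lex_t - k" unfolding b by linarith+
  thus ?thesis using ab unfolding in_lex_def by simp
 qed
 thus "lex_m k < ?b" unfolding in_lex_iff b using k by simp
qed

lemma stairs_iff: "mS a b c \<in> stairs \<longleftrightarrow> in_lex a b"
 unfolding mS_in_stairs in_lex_iff ..

lemma R_to_S_monomial: "R_to_S (monomial (mR a b) :: 'a::field ring_R) = monomial (mS a b 0)"
proof -
 interpret h: comm_ring_hom "R_to_S :: 'a ring_R \<Rightarrow> 'a ring_S"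
  unfolding R_to_S_def by (rule comm_ring_hom_insertion[OF comm_ring_hom_Const])
 have "(monomial (mR a b) :: 'a ring_R) = xR ^ a * yR ^ b"
  by (simp add: Var_R_power monomial_def mult_single mR_add)
 moreover have "R_to_S (xR :: 'a ring_R) = xS" "R_to_S (yR :: 'a ring_R) = yS"
  by (simp_all add: R_to_S_def insertion_Var[OF comm_ring_hom_Const])
 ultimately show ?thesis
  by (simp add: h.hom_mult h.hom_power Var_S_power monomial_def mult_single mS_add)
qed

lemma extend_to_S_lex_ideal: "extend_to_S (lex_ideal :: 'a::field ring_R set) = ideal_gen (monomial ` stairs)"
proof
 interpret h: comm_ring_hom "R_to_S :: 'a ring_R \<Rightarrow> 'a ring_S"
  unfolding R_to_S_def by (rule comm_ring_hom_insertion[OF comm_ring_hom_Const])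
 have "R_to_S f \<in> ideal_gen (monomial ` stairs :: 'a ring_S set)" if "f \<in> lex_ideal" for f :: "'a ring_R"
  using that unfolding lex_ideal_def
 proof (induction rule: ring_module.span_induct_alt)
  case base
  thus ?case by (simp add: ring_module.span_zero)
 next
  case (step c x y)
  then obtain a b where ab: "in_lex a b" "x = monomial (mR a b)" by blast
  have "(monomial (mS a b 0) :: 'a ring_S) \<in> ideal_gen (monomial ` stairs)"
   by (rule ring_module.span_base) (use ab stairs_iff in blast)
  thus ?case unfolding h.hom_add h.hom_mult ab(2) R_to_S_monomial
   by (intro ring_module.span_add ring_module.span_scale step)
 qed
 thus "extend_to_S (lex_ideal :: 'a ring_R set) \<subseteq> ideal_gen (monomial ` stairs)"
  unfolding extend_to_S_def by (intro ring_module.span_minimal ring_module.subspace_span) blast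
 show "ideal_gen (monomial ` stairs) \<subseteq> extend_to_S (lex_ideal :: 'a ring_R set)"
  unfolding extend_to_S_def
 proof (intro ring_module.span_minimal ring_module.subspace_span image_subsetI)
  fix \<mu> :: "3 \<Rightarrow>\<^sub>0 nat" assume \<mu>: "\<mu> \<in> stairs"
  obtain a b c where abc: "\<mu> = mS a b c" by (rule mS_cases)
  have "monomial (mS a b 0) = R_to_S (monomial (mR a b) :: 'a ring_R)" by (rule R_to_S_monomial[symmetric])
  hence "(monomial (mS a b 0) :: 'a ring_S) \<in> ideal_gen (R_to_S ` lex_ideal)"
   using \<mu> unfolding abc stairs_iff
   by (simp only:) (rule ring_module.span_base, rule imageI, simp only: monomial_in_lex_ideal)
  hence "monomial (mS 0 0 c) * (monomial (mS a b 0) :: 'a ring_S) \<in> ideal_gen (R_to_S ` lex_ideal)"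
   by (rule ring_module.span_scale)
  moreover have "monomial (mS 0 0 c) * (monomial (mS a b 0) :: 'a ring_S) = monomial \<mu>"
   unfolding abc by (simp add: monomial_def mult_single mS_add)
  ultimately show "(monomial \<mu> :: 'a ring_S) \<in> ideal_gen (R_to_S ` lex_ideal)" by simp
 qed
qed

lemma initial_ideal_eq_extend:
 fixes J :: "'a::field ring_S set"
 assumes J: "is_ideal J"
 shows "initial_ideal J = extend_to_S (lex_ideal :: 'a ring_R set) \<longleftrightarrow> lead_mons J = stairs"
proof
 have mem: "(monomial \<mu> :: 'a ring_S) \<in> ideal_gen (monomial ` stairs) \<longleftrightarrow> \<mu> \<in> stairs" for \<mu>
  unfolding monomial_mem_monomial_ideal
 proof
  assume "\<exists>\<nu>\<in>stairs. \<exists>k. \<mu> = \<nu> + k"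
  then obtain \<nu> k where *: "\<nu> \<in> stairs" "\<mu> = \<nu> + k" by blast
  obtain a b c where abc: "\<nu> = mS a b c" by (rule mS_cases)
  obtain i j l where ijl: "k = mS i j l" by (rule mS_cases)
  show "\<mu> \<in> stairs" using * in_lex_add[of a b i j] unfolding abc ijl by (simp add: mS_add stairs_iff)
 qed (metis add.right_neutral)
 assume "initial_ideal J = extend_to_S (lex_ideal :: 'a ring_R set)"
 hence "\<mu> \<in> lead_mons J \<longleftrightarrow> \<mu> \<in> stairs" for \<mu>
  unfolding monomial_mem_initial_ideal[OF J, symmetric] mem[symmetric] extend_to_S_lex_ideal by simp
 thus "lead_mons J = stairs" by blast
next
 assume "lead_mons J = stairs"
 thus "initial_ideal J = extend_to_S (lex_ideal :: 'a ring_R set)"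
  unfolding initial_ideal_eq extend_to_S_lex_ideal by simp
qed

text \<open>The corners generate minimally, since none divides another one.\<close>

lemma beta0_lex_ideal: "beta0 (lex_ideal :: 'a::field ring_R set) (Suc i) = card {k. k \<le> lex_t \<and> D k = Suc i}"
proof -
 let ?g = "\<lambda>k. monomial (mR (lex_t - k) (lex_m k)) :: 'a ring_R"
 let ?G = "?g ` {..lex_t}"
 have inj: "inj_on ?g {..lex_t}"
 proof (rule inj_onI)
  fix k l assume kl: "k \<in> {..lex_t}" "l \<in> {..lex_t}" "?g k = ?g l"
  hence "keys (?g k) = keys (?g l)" by simp
  hence "lex_t - k = lex_t - l" by (simp add: monomial_def)
  thus "k = l" using kl by simp
 qed
 have in_lex: "in_lex (lex_t - k) (lex_m k)" if "k \<le> lex_t" for k using that by (simp add: in_lex_iff)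
 have deg: "?g k \<in> forms n \<longleftrightarrow> D k = n" for k n
  by (simp add: forms_def monomial_def D_def)
 have gen: "ideal_gen ?G = lex_ideal"
 proof
  show "ideal_gen ?G \<subseteq> lex_ideal"
  proof (rule ring_module.span_minimal)
   show "?G \<subseteq> lex_ideal" using in_lex monomial_in_lex_ideal by blast
  qed (simp only: lex_ideal_def ring_module.subspace_span)
  show "lex_ideal \<subseteq> ideal_gen ?G"
   unfolding lex_ideal_def
  proof (intro ring_module.span_minimal ring_module.subspace_span image_subsetI)
   fix \<mu> assume "\<mu> \<in> {mR a b | a b. in_lex a b}"
   then obtain a b where ab: "\<mu> = mR a b" "in_lex a b" by blast
   let ?k = "lex_t - a"
   have "lex_m ?k \<le> b" using ab(2) by (simp add: in_lex_iff)
   hence "monomial \<mu> = monomial (mR (a - (lex_t - ?k)) (b - lex_m ?k)) * ?g ?k"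
    unfolding ab(1) by (simp add: monomial_def mult_single mR_add)
   moreover have "?g ?k \<in> ideal_gen ?G" by (rule ring_module.span_base) simp
   ultimately show "(monomial \<mu> :: 'a ring_R) \<in> ideal_gen ?G" by (simp only: ring_module.span_scale)
  qed
 qed
 have "minimal_homogeneous_generators ?G lex_ideal"
  unfolding minimal_homogeneous_generators_def
 proof (intro conjI allI impI gen)
  show "?G \<subseteq> (\<Union>n. forms n)" using deg by blast
  fix G' assume G': "G' \<subset> ?G"
  then obtain k where k: "k \<le> lex_t" "?g k \<notin> G'" by blast
  let ?B = "(\<lambda>l. mR (lex_t - l) (lex_m l)) ` ({..lex_t} - {k})"
  have "G' \<subseteq> monomial ` ?B" using G' k(2) by blast
  hence sub: "ideal_gen G' \<subseteq> ideal_gen (monomial ` ?B)" by (rule ring_module.span_mono)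
  have "?g k \<notin> ideal_gen (monomial ` ?B)"
  proof
   assume "?g k \<in> ideal_gen (monomial ` ?B)"
   then obtain l \<kappa> where l: "l \<le> lex_t" "l \<noteq> k" "mR (lex_t - k) (lex_m k) = mR (lex_t - l) (lex_m l) + \<kappa>"
    unfolding monomial_mem_monomial_ideal by blast
   obtain i j where "\<kappa> = mR i j" by (rule mR_cases)
   hence *: "lex_t - k = lex_t - l + i" "lex_m k = lex_m l + j" using l(3) by (simp_all add: mR_add)
   hence "k < l" using l(1,2) k(1) by linarith
   thus False using m_mono[of k l] *(2) l(1) by linarith
  qed
  moreover have "?g k \<in> lex_ideal" using in_lex[OF k(1)] by (simp add: monomial_in_lex_ideal)
  ultimately show "ideal_gen G' \<noteq> lex_ideal" using sub by blast
 qed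
 hence "beta0 (lex_ideal :: 'a ring_R set) (Suc i) = card (?G \<inter> forms (Suc i))" by (rule beta0_card)
 also have "?G \<inter> forms (Suc i) = ?g ` {k. k \<le> lex_t \<and> D k = Suc i}" using deg by blast
 also have "card \<dots> = card {k. k \<le> lex_t \<and> D k = Suc i}"
  by (rule card_image) (rule inj_on_subset[OF inj], blast)
 finally show ?thesis .
qed

end

section \<open>Every ideal of the stratum has a canonical relation matrix\<close>

lemma hm_sum: "hm u (sum F A) = (\<Sum>i\<in>A. hm u (F i))"
 by (induction A rule: infinite_finite_induct) (simp_all add: hm_add)

lemma hm_monom: "e \<le> u \<Longrightarrow> hm u (monom c e) = single (mS 0 e (u - e)) c"
proof -
 assume e: "e \<le> u"
 have "hm u (monom c e) = (\<Sum>i\<le>u. if i = e then single (mS 0 e (u - e)) c else 0)"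
  unfolding hm_def by (rule sum.cong) (auto simp: coeff_monom)
 thus ?thesis using e by simp
qed

lemma poly_as_sum_of_monoms': "degree p \<le> n \<Longrightarrow> p = (\<Sum>i\<le>n. monom (coeff p i) i)"
 by (rule poly_eqI) (auto simp: coeff_sum coeff_monom coeff_eq_0)

lemma hm_mult:
 fixes p q :: "'a::comm_ring_1 poly"
 assumes "degree p \<le> u" "degree q \<le> v"
 shows "hm u p * hm v q = hm (u + v) (p * q)"
proof -
 let ?m = "\<lambda>p i. monom (coeff p i) i"
 have "p * q = (\<Sum>i\<le>u. ?m p i) * (\<Sum>k\<le>v. ?m q k)"
  using poly_as_sum_of_monoms'[OF assms(1)] poly_as_sum_of_monoms'[OF assms(2)] by simp
 hence pq: "p * q = (\<Sum>i\<le>u. \<Sum>k\<le>v. ?m p i * ?m q k)" unfolding sum_product .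
 have "hm (u + v) (p * q) = (\<Sum>i\<le>u. \<Sum>k\<le>v. hm (u + v) (?m p i * ?m q k))"
  unfolding pq hm_sum ..
 also have "\<dots> = (\<Sum>i\<le>u. \<Sum>k\<le>v. single (mS 0 i (u - i)) (coeff p i) * single (mS 0 k (v - k)) (coeff q k))"
  by (intro sum.cong refl) (simp add: mult_monom hm_monom mult_single mS_add)
 also have "\<dots> = hm u p * hm v q" unfolding hm_def sum_product ..
 finally show ?thesis ..
qed

lemma lookup_forms_eq_0: "f \<in> forms n \<Longrightarrow> mdeg \<mu> \<noteq> n \<Longrightarrow> lookup f \<mu> = 0"
 by (rule ccontr) (auto simp: forms_def Ball_def in_keys_iff)

context staircase
begin

lemma ideal_degree_span:
 fixes J :: "'a::field ring_S set"
 assumes J: "homogeneous_ideal J" and lm: "lead_mons J = stairs"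
  and sb: "stair_basis f" and fJ: "\<And>k. k \<le> t \<Longrightarrow> f k \<in> J"
  and g: "g \<in> J" "g \<in> forms n"
 shows "g \<in> mpoly_vs.span (stair_elem f ` {\<mu> \<in> stairs. mdeg \<mu> = n})"
proof -
 let ?L = "{\<mu> \<in> stairs. mdeg \<mu> = n}"
 have idJ: "is_ideal J" by (rule homogeneous_ideal_is_ideal[OF J])
 have w: "lead (rank_drl n) \<mu> (stair_elem f \<mu>) \<and> keys (stair_elem f \<mu>) \<subseteq> {m. mdeg m = n}" if "\<mu> \<in> ?L" for \<mu>
 proof -
  have \<mu>: "\<mu> \<in> stairs" "mdeg \<mu> = n" using that by auto
  have "stair_elem f \<mu> \<in> forms n" using stair_elem_lead(2)[OF sb \<mu>(1)] \<mu>(2) by simp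
  thus ?thesis
   using stair_elem_lead(1)[OF sb \<mu>(1)] lead_rank_drl_iff[of "stair_elem f \<mu>" n \<mu>] keys_forms by auto
 qed
 obtain v where v: "v \<in> mpoly_vs.span (stair_elem f ` ?L)" "keys (g - v) \<subseteq> {m. mdeg m = n} - ?L"
 proof -
  have "\<exists>v\<in>mpoly_vs.span (stair_elem f ` ?L). keys (g - v) \<subseteq> {m. mdeg m = n} - ?L"
   by (rule lead_division[OF inj_rank_drl w keys_forms[OF g(2)]])
  thus ?thesis by (elim bexE) (rule that)
 qed
 have "mpoly_vs.span (stair_elem f ` ?L) \<subseteq> J"
 proof (rule mpoly_vs.span_minimal[OF image_subsetI is_ideal_imp_subspace[OF idJ]])
  fix \<mu>
  show "stair_elem f \<mu> \<in> J"
   unfolding stair_elem_def by (rule ring_module.subspace_scale[OF idJ fJ]) simp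
 qed
 hence gvJ: "g - v \<in> J" using g(1) v(1) by (intro ring_module.subspace_diff[OF idJ]) auto
 have "g - v = 0"
 proof (rule ccontr)
  assume nz: "g - v \<noteq> 0"
  have "inj_on (rank_drl n) (keys (g - v))" by (rule inj_on_subset[OF inj_rank_drl]) (use v(2) in blast)
  then obtain \<mu> where \<mu>: "lead (rank_drl n) \<mu> (g - v)" using lead_exists[OF nz] by blast
  have "g - v \<in> forms n" using v(2) unfolding forms_iff by blast
  hence "is_leading_monomial \<mu> (g - v)" using \<mu> lead_rank_drl_iff by blast
  hence "\<mu> \<in> stairs" using gvJ lm unfolding lead_mons_def by blast
  thus False using \<mu> v(2) unfolding lead_def by blast
 qed
 thus ?thesis using v(1) by simp
qed

text \<open>A Groebner basis generates, by comparing normal forms degree by degree.\<close>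

lemma ideal_eq_stair_ideal:
 fixes J :: "'a::field ring_S set"
 assumes J: "homogeneous_ideal J" and lm: "lead_mons J = stairs"
  and sb: "stair_basis f" and fJ: "\<And>k. k \<le> t \<Longrightarrow> f k \<in> J"
 shows "J = stair_ideal f"
proof
 have idJ: "is_ideal J" by (rule homogeneous_ideal_is_ideal[OF J])
 show "stair_ideal f \<subseteq> J" unfolding stair_ideal_def
  by (rule ring_module.span_minimal[OF _ idJ]) (use fJ in auto)
 have idI: "is_ideal (stair_ideal f)" unfolding stair_ideal_def by (rule ring_module.subspace_span)
 show "J \<subseteq> stair_ideal f"
 proof
  fix g assume g: "g \<in> J"
  have sub: "mpoly_vs.span (stair_elem f ` {\<mu> \<in> stairs. mdeg \<mu> = n}) \<subseteq> stair_ideal f" for n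
  proof (rule mpoly_vs.span_minimal[OF image_subsetI is_ideal_imp_subspace[OF idI]])
   fix \<mu> :: "3 \<Rightarrow>\<^sub>0 nat"
   have "f (t - lookup \<mu> 0) \<in> stair_ideal f" unfolding stair_ideal_def by (rule ring_module.span_base) simp
   thus "stair_elem f \<mu> \<in> stair_ideal f"
    unfolding stair_elem_def by (rule ring_module.subspace_scale[OF idI])
  qed
  have "hcomp n g \<in> stair_ideal f" for n
   using ideal_degree_span[OF J lm sb fJ homogeneous_ideal_hcomp[OF J g] hcomp_forms] sub by blast
  moreover obtain N where "\<forall>m\<in>keys g. mdeg m \<le> N" using mdeg_bound by blast
  hence "g = (\<Sum>n\<le>N. hcomp n g)" by (intro sum_hcomp) auto
  ultimately show "g \<in> stair_ideal f"
   using ring_module.subspace_sum[OF idI, of "{..N}" "\<lambda>n. hcomp n g"] by simp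
 qed
qed

text \<open>The reduced Groebner basis: each corner minus its normal form.\<close>

lemma reduced_basis_exists:
 fixes J :: "'a::field ring_S set"
 assumes J: "homogeneous_ideal J" and lm: "lead_mons J = stairs"
 shows "\<exists>f. stair_basis f \<and> (\<forall>k\<le>t. f k \<in> J) \<and> (\<forall>k\<in>{1..t}. \<forall>\<mu>\<in>keys (f k). lookup \<mu> 0 < t)"
proof -
 have "\<exists>v\<in>J \<inter> forms (D k). keys (monomial (corner k) - v) \<subseteq> {m. mdeg m = D k} - stairs" for k
  using normal_form[OF J forms_monomial, of "corner k"] lm by simp
 hence "\<forall>k. \<exists>v. v \<in> J \<and> v \<in> forms (D k) \<and> keys (monomial (corner k) - v) \<subseteq> {m. mdeg m = D k} - stairs"
  by blast
 from choice[OF this] obtain f where f0: "\<forall>k. f k \<in> J \<and> f k \<in> forms (D k) \<and>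
   keys (monomial (corner k) - f k) \<subseteq> {m. mdeg m = D k} - stairs" by (elim exE)
 have f: "f k \<in> J" "f k \<in> forms (D k)" "keys (monomial (corner k) - f k) \<subseteq> {m. mdeg m = D k} - stairs" for k
  using f0 by blast+
 have val: "lookup (f k) \<mu> = (if \<mu> = corner k then 1 else 0)" if "\<mu> \<in> stairs" for k \<mu>
 proof -
  have "\<mu> \<notin> keys (monomial (corner k) - f k)" using f(3)[of k] that by blast
  thus ?thesis by (auto simp: in_keys_iff lookup_minus monomial_def lookup_single when_def)
 qed
 have sb: "stair_basis f"
  unfolding stair_basis_def
 proof (intro allI impI conjI)
  fix k assume k: "k \<le> t"
  show "f k \<in> forms (D k)" by (rule f(2))
  show "lookup (f k) (mS (t - k) (m k) 0) = 1"
   using val[OF corner_in_stairs[OF k], of k] by (simp add: corner_def)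
  fix a b assume a: "t - k < a"
  show "lookup (f k) (mS a b 0) = 0"
  proof (cases "mS a b 0 \<in> stairs")
   case True
   thus ?thesis using val[OF True, of k] a by (simp add: corner_def)
  next
   case False
   hence at: "a < t" "b < m (t - a)" using m_0 by (auto simp: mS_in_stairs not_le intro: ccontr)
   hence "D (t - a) \<le> D k" using a by (intro D_mono[OF _ k]) simp
   hence "a + b < D k" using at unfolding D_def by simp
   hence "mdeg (mS a b 0) \<noteq> D k" by simp
   thus ?thesis by (rule lookup_forms_eq_0[OF f(2)])
  qed
 qed
 have "lookup \<mu> 0 < t" if k: "k \<in> {1..t}" and \<mu>: "\<mu> \<in> keys (f k)" for k \<mu>
 proof (cases "\<mu> \<in> stairs")
  case True
  hence "\<mu> = corner k" using \<mu> val[OF True, of k] by (auto simp: in_keys_iff split: if_splits)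
  thus ?thesis using k by (simp add: corner_def)
 next
  case False
  thus ?thesis by (cases \<mu> rule: mS_cases) (auto simp: mS_in_stairs m_0 not_le intro: ccontr)
 qed
 with sb f(1) show ?thesis by blast
qed

text \<open>In the product with a polynomial of positive \<open>x\<close>-degree, the power \<open>x\<close> to the \<open>t\<close> in \<open>f 0\<close>
 produces a monomial with more than \<open>t\<close> factors \<open>x\<close>.\<close>

lemma x_degree_f0:
 fixes f :: "nat \<Rightarrow> 'a::field ring_S"
 assumes sb: "stair_basis f" and F: "F \<noteq> 0" and pos: "\<forall>\<nu>\<in>keys F. 0 < lookup \<nu> 0"
 shows "\<exists>\<mu>. t < lookup \<mu> 0 \<and> lookup (F * f 0) \<mu> \<noteq> 0"
proof -
 let ?X = "(\<lambda>\<nu>. lookup \<nu> 0) ` keys F"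
 have X: "finite ?X" "?X \<noteq> {}" using F by auto
 hence "Max ?X \<in> ?X" by (rule Max_in)
 then obtain \<nu> where \<nu>: "\<nu> \<in> keys F" "lookup \<nu> 0 = Max ?X" by (metis imageE)
 have max: "lookup \<nu>' 0 \<le> lookup \<nu> 0" if "\<nu>' \<in> keys F" for \<nu>'
  unfolding \<nu>(2) by (rule Max_ge[OF X(1)]) (rule imageI[OF that])
 obtain i b c where ibc: "\<nu> = mS i b c" by (rule mS_cases)
 have f0: "f 0 \<in> forms t" "lookup (f 0) (mS t 0 0) = 1"
  using sb unfolding stair_basis_def by (auto simp: D_def m_0)
 have f0x: "lookup (f 0) (mS a b' c') = 0" if "t < a \<or> a = t \<and> (b' \<noteq> 0 \<or> c' \<noteq> 0)" for a b' c'
 proof -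
  have "mdeg (mS a b' c') \<noteq> t" using that by auto
  thus ?thesis by (rule lookup_forms_eq_0[OF f0(1)])
 qed
 have "lookup (F * f 0) (mS (i + t) b c) = (\<Sum>\<nu>'\<in>keys F. lookup (single \<nu>' (lookup F \<nu>') * f 0) (mS (i + t) b c))"
 proof -
  have "F * f 0 = (\<Sum>\<nu>'\<in>keys F. single \<nu>' (lookup F \<nu>') * f 0)"
   unfolding sum_distrib_right[symmetric] mpoly_as_sum[symmetric] ..
  thus ?thesis by (simp only: lookup_sum)
 qed
 also have "\<dots> = (\<Sum>\<nu>'\<in>keys F. if \<nu>' = \<nu> then lookup F \<nu> else 0)"
 proof (rule sum.cong[OF refl])
  fix \<nu>' assume \<nu>': "\<nu>' \<in> keys F"
  obtain i' b' c' where ibc': "\<nu>' = mS i' b' c'" by (rule mS_cases)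
  have "i' \<le> i" using max[OF \<nu>'] by (simp add: ibc ibc')
  hence "lookup (f 0) (mS (i + t - i') (b - b') (c - c')) = 0" if "b' \<le> b" "c' \<le> c" "\<nu>' \<noteq> \<nu>"
   using that by (intro f0x) (auto simp: ibc ibc')
  thus "lookup (single \<nu>' (lookup F \<nu>') * f 0) (mS (i + t) b c) = (if \<nu>' = \<nu> then lookup F \<nu> else 0)"
   using f0(2) by (auto simp: ibc ibc' lookup_mS_times)
 qed
 also have "\<dots> = lookup F \<nu>" using \<nu>(1) by simp
 finally have "lookup (F * f 0) (mS (i + t) b c) \<noteq> 0" using \<nu>(1) by (simp add: in_keys_iff)
 moreover have "t < lookup (mS (i + t) b c) 0" using pos \<nu>(1) by (auto simp: ibc)
 ultimately show ?thesis by blast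
qed

text \<open>Expand \<open>x f j\<close> in the basis \<open>stair_elem\<close>. Terms with a further factor \<open>x\<close> in front of \<open>f 0\<close> cannot
 occur, because all \<open>f k\<close> with \<open>k > 0\<close> have \<open>x\<close>-degree below \<open>t\<close>.\<close>

lemma relation_exists:
 fixes J :: "'a::field ring_S set"
 assumes J: "homogeneous_ideal J" and lm: "lead_mons J = stairs"
  and sb: "stair_basis f" and fJ: "\<And>k. k \<le> t \<Longrightarrow> f k \<in> J"
  and xdeg: "\<forall>k\<in>{1..t}. \<forall>\<mu>\<in>keys (f k). lookup \<mu> 0 < t" and j: "j \<in> {1..t}"
 shows "\<exists>c. xS * f j = (\<Sum>k\<le>t. hm (D j + 1 - D k) (c k) * f k) \<and>
  (\<forall>k\<le>t. c k \<noteq> 0 \<longrightarrow> D k \<le> D j + 1 \<and> degree (c k) \<le> D j + 1 - D k)"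
proof -
 let ?n = "D j + 1"
 let ?T = "{\<mu> \<in> stairs. mdeg \<mu> = ?n}"
 have idJ: "is_ideal J" by (rule homogeneous_ideal_is_ideal[OF J])
 have fin: "finite ?T" by (rule finite_subset[OF _ finite_mdeg[of ?n]]) auto
 have fj: "f j \<in> forms (D j)" "f j \<in> J" using sb fJ j unfolding stair_basis_def by auto
 have xJ: "xS * f j \<in> J" by (rule ring_module.subspace_scale[OF idJ fj(2)])
 have xn: "xS * f j \<in> forms ?n" using forms_mult[OF forms_Var fj(1), of 0] by simp
 have "xS * f j \<in> mpoly_vs.span (stair_elem f ` ?T)"
  by (rule ideal_degree_span[OF J lm sb _ xJ xn]) (erule fJ)
 from span_image_sum[OF fin this] obtain e where e: "xS * f j = (\<Sum>\<mu>\<in>?T. scale (e \<mu>) (stair_elem f \<mu>))" by blast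
 let ?T1 = "{\<mu> \<in> ?T. lookup \<mu> 0 \<le> t}"
 let ?T2 = "{\<mu> \<in> ?T. t < lookup \<mu> 0}"
 define F where "F = (\<Sum>\<mu>\<in>?T2. single (mS (lookup \<mu> 0 - t) (lookup \<mu> 1) (lookup \<mu> 2)) (e \<mu>))"
 have T2: "(\<Sum>\<mu>\<in>?T2. scale (e \<mu>) (stair_elem f \<mu>)) = F * f 0"
  unfolding F_def sum_distrib_right
  by (rule sum.cong) (simp_all add: stair_elem_def m_0 scale_mult_left[symmetric] monomial_def scale_single)
 have split: "xS * f j = (\<Sum>\<mu>\<in>?T1. scale (e \<mu>) (stair_elem f \<mu>)) + F * f 0"
 proof -
  have T: "?T = ?T1 \<union> ?T2" by auto
  have "(\<Sum>\<mu>\<in>?T1 \<union> ?T2. scale (e \<mu>) (stair_elem f \<mu>)) =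
    (\<Sum>\<mu>\<in>?T1. scale (e \<mu>) (stair_elem f \<mu>)) + (\<Sum>\<mu>\<in>?T2. scale (e \<mu>) (stair_elem f \<mu>))"
   by (rule sum.union_disjoint) (auto intro!: finite_subset[OF _ finite_mdeg[of ?n]])
  thus ?thesis unfolding e T2 T[symmetric] .
 qed
 have fx: "lookup (f k) (mS a b c) = 0" if "k \<le> t" "t < a" for k a b c
 proof (cases "k = 0")
  case True
  have "mdeg (mS a b c) \<noteq> D 0" using that by (simp add: D_def m_0)
  thus ?thesis using sb True unfolding stair_basis_def by (intro lookup_forms_eq_0[of _ "D 0"]) auto
 next
  case False
  hence "mS a b c \<notin> keys (f k)" using xdeg that by force
  thus ?thesis by (simp add: in_keys_iff)
 qed
 have F0: "F = 0"
 proof (rule ccontr)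
  assume "F \<noteq> 0"
  moreover have "\<forall>\<nu>\<in>keys F. 0 < lookup \<nu> 0"
  proof
   fix \<nu> assume "\<nu> \<in> keys F"
   hence "\<nu> \<in> (\<Union>\<mu>\<in>?T2. keys (single (mS (lookup \<mu> 0 - t) (lookup \<mu> 1) (lookup \<mu> 2)) (e \<mu>)))"
    unfolding F_def by (rule subsetD[OF keys_sum_subset])
   thus "0 < lookup \<nu> 0" by (auto split: if_splits)
  qed
  ultimately obtain \<mu> where \<mu>: "t < lookup \<mu> 0" "lookup (F * f 0) \<mu> \<noteq> 0" using x_degree_f0[OF sb] by blast
  obtain a b c where abc: "\<mu> = mS a b c" by (rule mS_cases)
  have a: "t < a" using \<mu>(1) by (simp add: abc)
  have "lookup (xS * f j) \<mu> = 0"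
  proof -
   have "mS (a - 1) b c \<notin> keys (f j)" using xdeg j a by force
   thus ?thesis by (simp add: abc Var_S lookup_mS_times in_keys_iff)
  qed
  moreover have "lookup (\<Sum>\<mu>\<in>?T1. scale (e \<mu>) (stair_elem f \<mu>)) \<mu> = 0"
   unfolding lookup_sum
  proof (rule sum.neutral, rule ballI)
   fix \<nu> assume \<nu>: "\<nu> \<in> ?T1"
   obtain a' b' c' where abc': "\<nu> = mS a' b' c'" by (rule mS_cases)
   have "a' \<le> t" using \<nu> by (simp add: abc')
   thus "lookup (scale (e \<nu>) (stair_elem f \<nu>)) \<mu> = 0"
    using fx[of "t - a'" a] a by (simp add: abc abc' stair_elem_def monomial_def lookup_mS_times)
  qed
  ultimately have "lookup (F * f 0) \<mu> = 0" using split by (simp add: lookup_add)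
  with \<mu>(2) show False by simp
 qed
 define c where "c = (\<lambda>k. if D k \<le> ?n then \<Sum>i\<le>?n - D k. monom (e (mS (t - k) (m k + i) (?n - D k - i))) i else 0)"
 have hc: "hm (?n - D k) (c k) * f k = (\<Sum>\<mu>\<in>{\<mu> \<in> ?T. lookup \<mu> 0 = t - k}. scale (e \<mu>) (stair_elem f \<mu>))" if k: "k \<le> t" for k
 proof -
  let ?S = "{\<mu> \<in> ?T. lookup \<mu> 0 = t - k}"
  have tk: "t - (t - k) = k" using k by simp
  show ?thesis
  proof (cases "D k \<le> ?n")
   case False
   have "?S = {}"
   proof (rule ccontr)
    assume "?S \<noteq> {}"
    then obtain \<mu> where \<mu>: "\<mu> \<in> ?S" by blast
    obtain a b d where abd: "\<mu> = mS a b d" by (rule mS_cases)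
    have a: "a = t - k" using \<mu> abd by simp
    have "m (t - (t - k)) \<le> b" "t - k + b + d = ?n" using \<mu> unfolding abd a by (simp_all add: mS_in_stairs)
    thus False using False unfolding tk D_def by linarith
   qed
   hence "(\<Sum>\<mu>\<in>?S. scale (e \<mu>) (stair_elem f \<mu>)) = 0" by (simp only: sum.empty)
   thus ?thesis using False by (simp add: c_def)
  next
   case True
   let ?g = "\<lambda>i. mS (t - k) (m k + i) (?n - D k - i)"
   have img: "?S = ?g ` {..?n - D k}"
   proof (intro equalityI subsetI)
    fix \<mu> assume \<mu>: "\<mu> \<in> ?S"
    obtain a b d where abd: "\<mu> = mS a b d" by (rule mS_cases)
    have "a = t - k" "m k \<le> b" "a + b + d = ?n" using \<mu> tk by (auto simp: abd mS_in_stairs)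
    hence "\<mu> = ?g (b - m k)" "b - m k \<in> {..?n - D k}" unfolding abd D_def by auto
    thus "\<mu> \<in> ?g ` {..?n - D k}" by (rule image_eqI)
   next
    fix \<mu> assume "\<mu> \<in> ?g ` {..?n - D k}"
    then obtain i where i: "i \<le> ?n - D k" "\<mu> = ?g i" by auto
    show "\<mu> \<in> ?S" using i True tk unfolding D_def by (simp add: mS_in_stairs)
   qed
   have inj: "inj_on ?g {..?n - D k}" by (rule inj_onI) simp
   have "(\<Sum>\<mu>\<in>?S. scale (e \<mu>) (stair_elem f \<mu>)) = (\<Sum>i\<le>?n - D k. scale (e (?g i)) (stair_elem f (?g i)))"
    unfolding img sum.reindex[OF inj] o_def ..
   also have "\<dots> = (\<Sum>i\<le>?n - D k. single (mS 0 i (?n - D k - i)) (e (?g i)) * f k)"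
   proof (rule sum.cong[OF refl])
    fix i
    show "scale (e (?g i)) (stair_elem f (?g i)) = single (mS 0 i (?n - D k - i)) (e (?g i)) * f k"
     using tk by (simp add: stair_elem_def scale_mult_left[symmetric] monomial_def scale_single)
   qed
   also have "\<dots> = hm (?n - D k) (c k) * f k"
    using True by (simp add: c_def hm_sum hm_monom sum_distrib_right)
   finally show ?thesis ..
  qed
 qed
 have "xS * f j = (\<Sum>\<mu>\<in>?T1. scale (e \<mu>) (stair_elem f \<mu>))" using split F0 by simp
 also have "\<dots> = (\<Sum>k\<le>t. \<Sum>\<mu>\<in>{\<mu> \<in> ?T. lookup \<mu> 0 = t - k}. scale (e \<mu>) (stair_elem f \<mu>))"
 proof -
  have "?T1 = (\<Union>k\<in>{..t}. {\<mu> \<in> ?T. lookup \<mu> 0 = t - k})"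
  proof (intro equalityI subsetI)
   fix \<mu> assume \<mu>: "\<mu> \<in> ?T1"
   hence "\<mu> \<in> {\<mu> \<in> ?T. lookup \<mu> 0 = t - (t - lookup \<mu> 0)}" by auto
   thus "\<mu> \<in> (\<Union>k\<in>{..t}. {\<mu> \<in> ?T. lookup \<mu> 0 = t - k})" by (intro UN_I[of "t - lookup \<mu> 0"]) auto
  qed auto
  thus ?thesis
   by (simp only:) (rule sum.UNION_disjoint, auto intro!: finite_subset[OF _ finite_mdeg[of ?n]])
 qed
 also have "\<dots> = (\<Sum>k\<le>t. hm (?n - D k) (c k) * f k)"
  by (rule sum.cong[OF refl], rule hc[symmetric]) simp
 finally have "xS * f j = (\<Sum>k\<le>t. hm (?n - D k) (c k) * f k)" .
 moreover have "degree (c k) \<le> ?n - D k" for k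
 proof (cases "D k \<le> ?n")
  case True
  have "degree (\<Sum>i\<le>?n - D k. monom (e (mS (t - k) (m k + i) (?n - D k - i))) i) \<le> ?n - D k"
   by (intro degree_sum_le) (auto intro: order_trans[OF degree_monom_le])
  thus ?thesis using True by (simp add: c_def)
 qed (simp add: c_def)
 moreover have "D k \<le> ?n" if "c k \<noteq> 0" for k using that by (auto simp: c_def split: if_splits)
 ultimately show ?thesis by blast
qed

text \<open>Compare coefficients at \<open>x^(t - k) y^b\<close> for increasing \<open>k\<close>: the earlier coefficients vanish, the later
 basis elements do not contain this power of \<open>x\<close>.\<close>

lemma relation_triangular:
 assumes sb: "stair_basis f" and rel: "relation f C"
 shows "triangular C"
 unfolding triangular_def
proof (intro ballI allI impI)
 fix j k assume j: "j \<in> {1..t}" and "k < j"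
 have f: "lookup (f k) (mS (t - k) (m k) 0) = 1" "\<And>a b. t - k < a \<Longrightarrow> lookup (f k) (mS a b 0) = 0" if "k \<le> t" for k
  using sb that unfolding stair_basis_def by auto
 let ?w = "\<lambda>k. D j + 1 - D k"
 let ?c = "\<lambda>k. coeff (C k j) (?w k)"
 have "?c k = (if k = j - 1 then 1 else 0)" using \<open>k < j\<close>
 proof (induction k rule: less_induct)
  case (less k)
  have kt: "k \<le> t" "j \<le> t" using less.prems j by auto
  let ?\<mu> = "mS (t - k) (m k + ?w k) 0"
  let ?T = "\<lambda>l. if ?w l \<le> m k + ?w k then ?c l * lookup (f l) (mS (t - k) (m k + ?w k - ?w l) 0) else 0"
  have "lookup (xS * f j) ?\<mu> = (\<Sum>l\<le>t. lookup (hm (?w l) (C l j) * f l) ?\<mu>)"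
   using rel j unfolding relation_def by (simp add: lookup_sum)
  also have "\<dots> = (\<Sum>l\<le>t. ?T l)" by (rule sum.cong[OF refl]) (simp add: lookup_hm_times_level)
  also have "\<dots> = (\<Sum>l\<le>t. if l = k then ?c k else 0)"
  proof (rule sum.cong[OF refl])
   fix l assume l: "l \<in> {..t}"
   consider "l < k" | "l = k" | "k < l" by linarith
   thus "?T l = (if l = k then ?c k else 0)"
   proof cases
    case 1
    hence "?c l = 0" using less by auto
    thus ?thesis using 1 by simp
   next
    case 2
    thus ?thesis using f(1)[OF kt(1)] by simp
   next
    case 3
    hence "lookup (f l) (mS (t - k) b 0) = 0" for b using l kt by (intro f(2)) auto
    thus ?thesis using 3 by simp
   qed
  qed
  also have "\<dots> = ?c k" using kt by simp
  finally have eq: "lookup (xS * f j) ?\<mu> = ?c k" .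
  have tk: "0 < t - k" using less.prems kt by simp
  have eq2: "lookup (xS * f j) ?\<mu> = lookup (f j) (mS (t - k - 1) (m k + ?w k) 0)"
   using tk by (simp add: Var_S lookup_mS_times)
  show ?case
  proof (cases "k = j - 1")
   case True
   hence "t - k - 1 = t - j" "m k + ?w k = m j"
    using D_step[of j] m_mono[of k j] j kt less.prems by auto
   thus ?thesis using eq eq2 f(1)[OF kt(2)] True by simp
  next
   case False
   hence "t - j < t - k - 1" using less.prems kt by auto
   thus ?thesis using eq eq2 f(2)[OF kt(2)] False by simp
  qed
 qed
 thus "?c k = (if k = j - 1 then 1 else 0)" .
qed

text \<open>A change of basis \<open>f b \<mapsto> f b - q f a\<close> acts on the relation matrix by a column operation,
 which keeps the entries \<open>-x\<close> in place together with a row operation.\<close>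

definition op_col :: "nat \<Rightarrow> nat \<Rightarrow> 'a poly \<Rightarrow> (nat \<Rightarrow> nat \<Rightarrow> 'a::field poly) \<Rightarrow> nat \<Rightarrow> nat \<Rightarrow> 'a poly" where
 "op_col a b q C k j = (if j = b then C k j - q * C k a else C k j)"

definition op_mat :: "nat \<Rightarrow> nat \<Rightarrow> 'a poly \<Rightarrow> (nat \<Rightarrow> nat \<Rightarrow> 'a::field poly) \<Rightarrow> nat \<Rightarrow> nat \<Rightarrow> 'a poly" where
 "op_mat a b q C k j = (if k = a then op_col a b q C k j + q * op_col a b q C b j else op_col a b q C k j)"

definition op_basis :: "nat \<Rightarrow> nat \<Rightarrow> 'a poly \<Rightarrow> (nat \<Rightarrow> 'a::field ring_S) \<Rightarrow> nat \<Rightarrow> 'a ring_S" where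
 "op_basis a b q f = f(b := f b - hm (D b - D a) q * f a)"

definition good_system :: "'a::field ring_S set \<Rightarrow> (nat \<Rightarrow> 'a ring_S) \<Rightarrow> (nat \<Rightarrow> nat \<Rightarrow> 'a poly) \<Rightarrow> bool" where
 "good_system J f C \<longleftrightarrow> stair_basis f \<and> relation f C \<and> graded C \<and> triangular C \<and> (\<forall>k\<le>t. f k \<in> J)"

lemma good_system_op:
 assumes good: "good_system J f C" and J: "is_ideal J"
  and a: "a \<in> {1..t}" and b: "b \<le> t" and ab: "a \<noteq> b" and Dab: "D a \<le> D b"
  and q: "degree q \<le> D b - D a" and top: "coeff q (D b - D a) = 0 \<or> b < a"
 shows "good_system J (op_basis a b q f) (op_mat a b q C)"
proof -
 let ?C1 = "op_col a b q C" and ?C' = "op_mat a b q C" and ?f = "op_basis a b q f"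
 let ?\<delta> = "D b - D a"
 let ?Q = "hm ?\<delta> q"
 have sb: "stair_basis f" and rel: "relation f C" and gr: "graded C" and tri: "triangular C"
  and fJ: "\<And>k. k \<le> t \<Longrightarrow> f k \<in> J"
  using good unfolding good_system_def by auto
 have gr0: "C k j = 0 \<or> D k \<le> D j + 1 \<and> degree (C k j) \<le> D j + 1 - D k" if "k \<le> t" "j \<in> {1..t}" for k j
  using gr that unfolding graded_def by blast
 have qcol: "q * C k a = 0 \<or> D k \<le> D b + 1 \<and> degree (q * C k a) \<le> D b + 1 - D k" if "k \<le> t" for k
 proof (cases "C k a = 0")
  case False
  hence "D k \<le> D a + 1" "degree (C k a) \<le> D a + 1 - D k" using gr0[OF that a] by auto
  thus ?thesis using Dab q degree_mult_le[of q "C k a"] by linarith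
 qed simp
 have gr1: "?C1 k j = 0 \<or> D k \<le> D j + 1 \<and> degree (?C1 k j) \<le> D j + 1 - D k" if "k \<le> t" "j \<in> {1..t}" for k j
  using gr0[OF that] qcol[OF that(1)] degree_diff_le[of "C k j" "D j + 1 - D k" "q * C k a"]
  unfolding op_col_def by auto
 have qrow: "q * ?C1 b j = 0 \<or> D a \<le> D j + 1 \<and> degree (q * ?C1 b j) \<le> D j + 1 - D a" if "j \<in> {1..t}" for j
 proof (cases "?C1 b j = 0")
  case False
  hence "D b \<le> D j + 1" "degree (?C1 b j) \<le> D j + 1 - D b" using gr1[OF b that] by auto
  thus ?thesis using Dab q degree_mult_le[of q "?C1 b j"] by linarith
 qed simp
 have gr': "graded ?C'"
  unfolding graded_def
 proof (intro allI ballI impI)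
  fix k j assume kj: "k \<le> t" "j \<in> {1..t}" "?C' k j \<noteq> 0"
  show "D k \<le> D j + 1 \<and> degree (?C' k j) \<le> D j + 1 - D k"
   using kj(3) gr1[OF kj(1,2)] qrow[OF kj(2)] degree_add_le[of "?C1 k j" "D j + 1 - D k" "q * ?C1 b j"]
   unfolding op_mat_def by (auto split: if_splits)
 qed
 have hmcol: "?Q * hm (D a + 1 - D k) (C k a) = hm (D b + 1 - D k) (q * C k a)" if "k \<le> t" for k
 proof (cases "C k a = 0")
  case False
  hence "D k \<le> D a + 1" "degree (C k a) \<le> D a + 1 - D k" using gr0[OF that a] by auto
  hence "?Q * hm (D a + 1 - D k) (C k a) = hm (?\<delta> + (D a + 1 - D k)) (q * C k a)" by (intro hm_mult q)
  also have "?\<delta> + (D a + 1 - D k) = D b + 1 - D k" using \<open>D k \<le> D a + 1\<close> Dab by simp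
  finally show ?thesis .
 qed simp
 have hmrow: "hm (D j + 1 - D b) (?C1 b j) * ?Q = hm (D j + 1 - D a) (q * ?C1 b j)" if "j \<in> {1..t}" for j
 proof (cases "?C1 b j = 0")
  case False
  hence "D b \<le> D j + 1" "degree (?C1 b j) \<le> D j + 1 - D b" using gr1[OF b that] by auto
  hence "hm (D j + 1 - D b) (?C1 b j) * ?Q = hm ((D j + 1 - D b) + ?\<delta>) (?C1 b j * q)" by (intro hm_mult q)
  also have "(D j + 1 - D b) + ?\<delta> = D j + 1 - D a" using \<open>D b \<le> D j + 1\<close> Dab by simp
  finally show ?thesis by (simp add: mult.commute)
 qed simp
 have rel': "relation ?f ?C'"
  unfolding relation_def
 proof
  fix j assume j: "j \<in> {1..t}"
  have 1: "xS * ?f j = (\<Sum>k\<le>t. hm (D j + 1 - D k) (?C1 k j) * f k)"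
  proof (cases "j = b")
   case False
   thus ?thesis using rel j unfolding relation_def op_basis_def op_col_def by simp
  next
   case True
   have "xS * ?f j = xS * f b - ?Q * (xS * f a)"
    by (simp add: op_basis_def True right_diff_distrib mult.left_commute)
   also have "xS * f b = (\<Sum>k\<le>t. hm (D b + 1 - D k) (C k b) * f k)"
    using rel j True unfolding relation_def by blast
   also have "xS * f a = (\<Sum>k\<le>t. hm (D a + 1 - D k) (C k a) * f k)"
    using rel a unfolding relation_def by blast
   also have "(\<Sum>k\<le>t. hm (D b + 1 - D k) (C k b) * f k) - ?Q * (\<Sum>k\<le>t. hm (D a + 1 - D k) (C k a) * f k) =
     (\<Sum>k\<le>t. hm (D b + 1 - D k) (C k b) * f k - (?Q * hm (D a + 1 - D k) (C k a)) * f k)"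
    by (simp only: sum_distrib_left sum_subtractf mult.assoc)
   also have "\<dots> = (\<Sum>k\<le>t. hm (D j + 1 - D k) (?C1 k j) * f k)"
   proof (rule sum.cong[OF refl])
    fix k assume "k \<in> {..t}"
    hence k: "k \<le> t" by simp
    show "hm (D b + 1 - D k) (C k b) * f k - (?Q * hm (D a + 1 - D k) (C k a)) * f k =
      hm (D j + 1 - D k) (?C1 k j) * f k"
     unfolding hmcol[OF k] by (simp add: True op_col_def hm_diff left_diff_distrib)
   qed
   finally show ?thesis .
  qed
  have fb: "f b = ?f b + ?Q * f a" by (simp add: op_basis_def)
  have "(\<Sum>k\<le>t. hm (D j + 1 - D k) (?C1 k j) * f k) =
    (\<Sum>k\<le>t. hm (D j + 1 - D k) (?C1 k j) * ?f k + (if k = b then hm (D j + 1 - D b) (?C1 b j) * (?Q * f a) else 0))"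
   by (rule sum.cong) (auto simp: op_basis_def right_diff_distrib)
  also have "\<dots> = (\<Sum>k\<le>t. hm (D j + 1 - D k) (?C1 k j) * ?f k) + hm (D j + 1 - D a) (q * ?C1 b j) * f a"
   using b by (simp only: sum.distrib mult.assoc[symmetric] hmrow[OF j]) simp
  also have "\<dots> = (\<Sum>k\<le>t. hm (D j + 1 - D k) (?C1 k j) * ?f k + (if k = a then hm (D j + 1 - D a) (q * ?C1 b j) * f a else 0))"
   using a by (simp add: sum.distrib)
  also have "\<dots> = (\<Sum>k\<le>t. hm (D j + 1 - D k) (?C' k j) * ?f k)"
   by (rule sum.cong) (use ab in \<open>auto simp: op_mat_def op_basis_def hm_add distrib_right\<close>)
  finally show "xS * ?f j = (\<Sum>k\<le>t. hm (D j + 1 - D k) (?C' k j) * ?f k)" using 1 by simp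
 qed
 have sb': "stair_basis ?f"
  unfolding stair_basis_def
 proof (intro allI impI conjI)
  fix k assume k: "k \<le> t"
  have f: "f k \<in> forms (D k)" "lookup (f k) (mS (t - k) (m k) 0) = 1" "\<And>a b. t - k < a \<Longrightarrow> lookup (f k) (mS a b 0) = 0" if "k \<le> t" for k
   using sb that unfolding stair_basis_def by auto
  have a': "a \<le> t" using a by simp
  have "?Q * f a \<in> forms (?\<delta> + D a)" by (rule forms_mult[OF hm_forms f(1)[OF a']])
  hence Qf: "?Q * f a \<in> forms (D b)" using Dab by simp
  show "?f k \<in> forms (D k)" using f(1)[OF k] forms_diff[OF f(1)[OF b] Qf] by (simp add: op_basis_def)
  have low: "lookup (?Q * f a) (mS x y 0) = 0" if "t - b \<le> x" for x y
  proof -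
   have "coeff q ?\<delta> * lookup (f a) (mS x (y - ?\<delta>) 0) = 0"
    using top
   proof
    assume "b < a"
    hence "t - a < x" using that a' by simp
    thus ?thesis using f(3)[OF a'] by simp
   qed simp
   thus ?thesis by (simp add: lookup_hm_times_level)
  qed
  show "lookup (?f k) (mS (t - k) (m k) 0) = 1" using f(2)[OF k] low by (auto simp: op_basis_def lookup_minus)
  fix x y assume "t - k < x"
  thus "lookup (?f k) (mS x y 0) = 0" using f(3)[OF k] low by (auto simp: op_basis_def lookup_minus)
 qed
 have "?f k \<in> J" if "k \<le> t" for k
  using fJ[OF that] fJ[OF b] fJ[of a] a
  by (auto simp: op_basis_def intro!: ring_module.subspace_diff[OF J] ring_module.subspace_scale[OF J])
 thus ?thesis unfolding good_system_def using sb' rel' gr' relation_triangular[OF sb' rel'] by blast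
qed

lemma good_system_exists:
 fixes J :: "'a::field ring_S set"
 assumes J: "homogeneous_ideal J" and lm: "lead_mons J = stairs"
 shows "\<exists>f C. good_system J f C"
proof -
 obtain f where f: "stair_basis f" "\<forall>k\<le>t. f k \<in> J" "\<forall>k\<in>{1..t}. \<forall>\<mu>\<in>keys (f k). lookup \<mu> 0 < t"
  using reduced_basis_exists[OF J lm] by blast
 have "\<forall>j\<in>{1..t}. \<exists>c. xS * f j = (\<Sum>k\<le>t. hm (D j + 1 - D k) (c k) * f k) \<and>
  (\<forall>k\<le>t. c k \<noteq> 0 \<longrightarrow> D k \<le> D j + 1 \<and> degree (c k) \<le> D j + 1 - D k)"
  using relation_exists[OF J lm f(1) _ f(3)] f(2) by blast
 from bchoice[OF this] obtain c where c: "\<forall>j\<in>{1..t}. xS * f j = (\<Sum>k\<le>t. hm (D j + 1 - D k) (c j k) * f k) \<and>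
  (\<forall>k\<le>t. c j k \<noteq> 0 \<longrightarrow> D k \<le> D j + 1 \<and> degree (c j k) \<le> D j + 1 - D k)" by (elim exE)
 define C where "C = (\<lambda>k j. c j k)"
 have rel: "relation f C" and gr: "graded C" using c unfolding relation_def graded_def C_def by auto
 have "good_system J f C"
  unfolding good_system_def using f(1,2) rel gr relation_triangular[OF f(1) rel] by blast
 thus ?thesis by blast
qed

text \<open>The two kinds of entries that the canonical form forbids. Entries below the diagonal have
 degree at most one; there, only multiples of \<open>y\<close> in columns with \<open>d = 1\<close> are excluded. Above the
 diagonal, \<open>top_clean s\<close> excludes the terms with factor exactly \<open>z\<close> to the \<open>s\<close> whose \<open>y\<close>-degree is
 not below that of the diagonal entry of their row.\<close>

definition low_clean :: "(nat \<Rightarrow> nat \<Rightarrow> 'a::field poly) \<Rightarrow> nat \<Rightarrow> nat \<Rightarrow> bool" where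
 "low_clean C k j \<longleftrightarrow> (j \<le> k \<and> m j = m (j - 1) + 1 \<and> D k = D j \<longrightarrow> coeff (C k j) 1 = 0)"

definition top_clean :: "nat \<Rightarrow> (nat \<Rightarrow> nat \<Rightarrow> 'a::field poly) \<Rightarrow> nat \<Rightarrow> nat \<Rightarrow> bool" where
 "top_clean s C k j \<longleftrightarrow> (Suc k < j \<and> s \<le> D j + 1 - D k \<and> m (Suc k) - m k \<le> D j + 1 - D k - s \<longrightarrow>
  coeff (C k j) (D j + 1 - D k - s) = 0)"

text \<open>The offending coefficient at \<open>(k, j)\<close> is cancelled against the entry \<open>y\<close> of row \<open>j - 1\<close>; as modulo
 \<open>z\<close> this is the only entry of row \<open>j - 1\<close> in the columns from \<open>j\<close> on, working from the last column to the first
 destroys nothing.\<close>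

lemma low_normal_form:
 fixes J :: "'a::field ring_S set"
 assumes J: "homogeneous_ideal J" and lm: "lead_mons J = stairs"
 shows "\<exists>f C. good_system J f C \<and> (\<forall>k\<le>t. \<forall>j\<in>{1..t}. (t - j) * Suc t + k < N \<longrightarrow> low_clean C k j)"
proof (induction N)
 case 0
 thus ?case using good_system_exists[OF J lm] by auto
next
 case (Suc N)
 then obtain f C where good: "good_system J f C"
  and clean: "\<And>k j. k \<le> t \<Longrightarrow> j \<in> {1..t} \<Longrightarrow> (t - j) * Suc t + k < N \<Longrightarrow> low_clean C k j" by blast
 have idJ: "is_ideal J" by (rule homogeneous_ideal_is_ideal[OF J])
 show ?case
 proof (cases "\<exists>k\<le>t. \<exists>j\<in>{1..t}. (t - j) * Suc t + k = N \<and> \<not> low_clean C k j")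
  case False
  hence "low_clean C k j" if "k \<le> t" "j \<in> {1..t}" "(t - j) * Suc t + k < Suc N" for k j
   using that clean[of k j] less_Suc_eq by blast
  with good show ?thesis by blast
 next
  case True
  then obtain k j where kj: "k \<le> t" "j \<in> {1..t}" "(t - j) * Suc t + k = N" "\<not> low_clean C k j" by blast
  hence jk: "j \<le> k" "m j = m (j - 1) + 1" "D k = D j" and nz: "coeff (C k j) 1 \<noteq> 0"
   unfolding low_clean_def by auto
  let ?b = "j - 1"
  let ?q = "[:- coeff (C k j) 1:]"
  let ?C = "op_mat k ?b ?q C"
  have Db: "D ?b = D k" using jk kj(2) unfolding D_def by auto
  have tri: "triangular C" using good unfolding good_system_def by blast
  have good': "good_system J (op_basis k ?b ?q f) ?C"
   by (rule good_system_op[OF good idJ]) (use kj jk Db in auto)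
  have tri': "coeff (C ?b j') (D j' + 1 - D ?b) = (if j' = j then 1 else 0)" if "j' \<in> {1..t}" "j \<le> j'" for j'
   using tri that kj(2) unfolding triangular_def by (auto split: if_splits)
  have "low_clean ?C k' j'" if k'j': "k' \<le> t" "j' \<in> {1..t}" "(t - j') * Suc t + k' < Suc N" for k' j'
  proof -
   have "(t - j') * Suc t + k' \<le> (t - j) * Suc t + k" using k'j'(3) kj(3) by simp
   hence jj: "j \<le> j'"
   proof -
    have "\<not> j' < j"
    proof
     assume "j' < j"
     hence "Suc (t - j) * Suc t \<le> (t - j') * Suc t" using kj(2) by (intro mult_le_mono1) auto
     thus False using \<open>(t - j') * Suc t + k' \<le> (t - j) * Suc t + k\<close> kj(1) by simp
    qed
    thus ?thesis by simp
   qed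
   hence col: "op_col k ?b ?q C l j' = C l j'" for l using kj(2) unfolding op_col_def by auto
   show ?thesis
    unfolding low_clean_def
   proof
    assume l: "j' \<le> k' \<and> m j' = m (j' - 1) + 1 \<and> D k' = D j'"
    show "coeff (?C k' j') 1 = 0"
    proof (cases "k' = k")
     case False
     hence eq: "?C k' j' = C k' j'" unfolding op_mat_def col by simp
     have "(t - j') * Suc t + k' < N"
     proof -
      have "(t - j') * Suc t + k' \<noteq> N"
      proof
       assume "(t - j') * Suc t + k' = N"
       hence "((t - j') * Suc t + k') mod Suc t = ((t - j) * Suc t + k) mod Suc t" using kj(3) by simp
       thus False
        using False kj(1) k'j'(1) by (simp only: add.commute[of "_ * Suc t"] mod_mult_self1) simp
      qed
      thus ?thesis using k'j'(3) by simp
     qed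
     thus ?thesis using clean[OF k'j'(1,2)] l unfolding low_clean_def eq by blast
    next
     case True
     have Dj': "D j' = D k" using l True by simp
     have eq: "?C k' j' = C k j' + ?q * C ?b j'" unfolding op_mat_def col using True by simp
     have w: "D j' + 1 - D ?b = 1" using Dj' Db by simp
     have top: "coeff (C ?b j') 1 = (if j' = j then 1 else 0)" using tri'[OF k'j'(2) jj] w by simp
     show ?thesis
     proof (cases "j' = j")
      case True
      thus ?thesis unfolding eq using top by simp
     next
      case False
      hence "(t - j') * Suc t + k < N"
      proof -
       have "Suc (t - j') * Suc t \<le> (t - j) * Suc t" using False jj k'j'(2) by (intro mult_le_mono1) auto
       thus ?thesis using kj(3) by simp
      qed
      hence "low_clean C k j'" by (rule clean[OF kj(1) k'j'(2)])
      hence "coeff (C k j') 1 = 0" using l True unfolding low_clean_def by auto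
      thus ?thesis unfolding eq using top False by simp
     qed
    qed
   qed
  qed
  with good' show ?thesis by blast
 qed
qed

text \<open>The offending term at \<open>(k, j)\<close> is cancelled against the diagonal entry of its row with a multiplier of
 order \<open>s\<close> in \<open>z\<close>. This changes only later positions in the order by \<open>s\<close>, then \<open>k\<close>, then \<open>j\<close>.\<close>

lemma top_normal_form:
 fixes J :: "'a::field ring_S set"
 assumes J: "homogeneous_ideal J" and lm: "lead_mons J = stairs"
 shows "\<exists>f C. good_system J f C \<and> (\<forall>k\<le>t. \<forall>j\<in>{1..t}. low_clean C k j) \<and>
  (\<forall>s k j. 0 < s \<longrightarrow> k \<le> t \<longrightarrow> j \<in> {1..t} \<longrightarrow> (s * Suc t + k) * Suc t + j < N \<longrightarrow> top_clean s C k j)"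
proof (induction N)
 case 0
 obtain f C where fC: "good_system J f C" "\<forall>k\<le>t. \<forall>j\<in>{1..t}. (t - j) * Suc t + k < Suc t * Suc t \<longrightarrow> low_clean C k j"
  using low_normal_form[OF J lm, of "Suc t * Suc t"] by blast
 have "(t - j) * Suc t + k < Suc t * Suc t" if "k \<le> t" for k j
 proof -
  have "(t - j) * Suc t \<le> t * Suc t" by (rule mult_le_mono1) simp
  thus ?thesis using that by simp
 qed
 hence "\<forall>k\<le>t. \<forall>j\<in>{1..t}. low_clean C k j" using fC(2) by blast
 with fC(1) show ?case by (intro exI[of _ f] exI[of _ C]) simp
next
 case (Suc N)
 then obtain f C where good: "good_system J f C" and low: "\<And>k j. k \<le> t \<Longrightarrow> j \<in> {1..t} \<Longrightarrow> low_clean C k j"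
  and clean: "\<And>s k j. 0 < s \<Longrightarrow> k \<le> t \<Longrightarrow> j \<in> {1..t} \<Longrightarrow> (s * Suc t + k) * Suc t + j < N \<Longrightarrow> top_clean s C k j" by blast
 have idJ: "is_ideal J" by (rule homogeneous_ideal_is_ideal[OF J])
 show ?case
 proof (cases "\<exists>s k j. 0 < s \<and> k \<le> t \<and> j \<in> {1..t} \<and> (s * Suc t + k) * Suc t + j = N \<and> \<not> top_clean s C k j")
  case False
  hence "top_clean s C k j" if "0 < s" "k \<le> t" "j \<in> {1..t}" "(s * Suc t + k) * Suc t + j < Suc N" for s k j
   using that clean[of s k j] less_Suc_eq by blast
  with good low show ?thesis by blast
 next
  case True
  then obtain s k j where skj: "0 < s" "k \<le> t" "j \<in> {1..t}" "(s * Suc t + k) * Suc t + j = N" "\<not> top_clean s C k j" by blast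
  let ?w = "D j + 1 - D k"
  have kj: "Suc k < j" "s \<le> ?w" "m (Suc k) - m k \<le> ?w - s"
   using skj(5) unfolding top_clean_def by auto
  define a where "a = Suc k"
  define c where "c = coeff (C k j) (?w - s)"
  define n where "n = D j - D a - s"
  define q where "q = monom c n"
  have a: "a \<in> {1..t}" "a < j" "j \<le> t" using kj(1) skj(3) unfolding a_def by auto
  have Daj: "D a \<le> D j" by (rule D_mono) (use a in auto)
  have da: "D a + 1 - D k = m (Suc k) - m k" "D k \<le> D a + 1" using D_step[of a] a unfolding a_def by auto
  have ns: "n + s = D j - D a" using kj(3) kj(2) da Daj unfolding n_def by linarith
  have q: "degree q \<le> D j - D a" using degree_monom_le[of c n] ns unfolding q_def by linarith
  have topq: "coeff q (D j - D a) = 0" using ns skj(1) unfolding q_def by (simp add: coeff_monom)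
  let ?C = "op_mat a j q C"
  have good': "good_system J (op_basis a j q f) ?C"
   by (rule good_system_op[OF good idJ]) (use a Daj q topq in auto)
  have gr: "graded C" and tri: "triangular C" using good unfolding good_system_def by auto
  have deg: "degree (C l i) \<le> D i + 1 - D l" if "l \<le> t" "i \<in> {1..t}" for l i
   using gr that unfolding graded_def by (cases "C l i = 0") auto
  \<comment> \<open>Multiplication by \<open>q\<close> raises the power of \<open>z\<close> by exactly \<open>s\<close>.\<close>
  have qcoeff: "coeff (q * p) (D j - D a + v - s') =
    (if s' < s then 0 else c * coeff p v)"
   if "degree p \<le> v" "s' \<le> s" for p v s'
  proof -
   have "coeff (q * p) e = (if n \<le> e then c * coeff p (e - n) else 0)" for e
    unfolding q_def by (simp add: coeff_monom_mult)
   moreover have "coeff p (D j - D a + v - s' - n) = 0" if "s' < s"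
    using ns \<open>degree p \<le> v\<close> that by (intro coeff_eq_0) linarith
   moreover have "D j - D a + v - s - n = v" "n \<le> D j - D a + v - s" using ns by auto
   moreover have "s' < s \<or> s' = s" using that(2) by auto
   ultimately show ?thesis by auto
  qed
  have tc: "coeff (C l a) (D a + 1 - D l) = (if l = k then 1 else 0)" if "l \<le> k" for l
   using tri a(1) that unfolding triangular_def a_def by auto
  \<comment> \<open>Changes in column \<open>j\<close> and in row \<open>a\<close>.\<close>
  have colchange: "coeff (op_col a j q C l j) (D j + 1 - D l - s') = coeff (C l j) (D j + 1 - D l - s') -
    (if s' < s then 0 else c * (if l = k then 1 else 0))"
   if l: "l \<le> t" "s' < s \<or> s' = s \<and> l \<le> k" "D l \<le> D a + 1" for l s'
  proof -
   have e: "D j + 1 - D l - s' = D j - D a + (D a + 1 - D l) - s'" using l(3) Daj by simp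
   have "coeff (q * C l a) (D j + 1 - D l - s') = (if s' < s then 0 else c * (if l = k then 1 else 0))"
    unfolding e using qcoeff[OF deg[OF l(1) a(1)], of s'] l(2) tc[of l] by auto
   thus ?thesis unfolding op_col_def by simp
  qed
  have colzero: "op_col a j q C l j = C l j" if "l \<le> t" "\<not> D l \<le> D a + 1" for l
  proof -
   have "C l a = 0" using gr that a(1) unfolding graded_def by blast
   thus ?thesis unfolding op_col_def by simp
  qed
  have low': "low_clean ?C k' j'" if k'j': "k' \<le> t" "j' \<in> {1..t}" for k' j'
   unfolding low_clean_def
  proof
   assume l: "j' \<le> k' \<and> m j' = m (j' - 1) + 1 \<and> D k' = D j'"
   hence old: "coeff (C k' j') 1 = 0" using low[OF k'j'] unfolding low_clean_def by blast
   have one: "D j' + 1 - D k' - 0 = 1" using l by simp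
   have 1: "coeff (op_col a j q C k' j') 1 = 0"
   proof (cases "j' = j \<and> D k' \<le> D a + 1")
    case True
    thus ?thesis using colchange[OF k'j'(1), of 0] one old skj(1) by simp
   next
    case False
    thus ?thesis using old colzero[OF k'j'(1)] by (auto simp: op_col_def)
   qed
   show "coeff (?C k' j') 1 = 0"
   proof (cases "k' = a")
    case False
    thus ?thesis using 1 by (simp add: op_mat_def)
   next
    case True
    have lt: "j' < j" using l True a by linarith
    hence cj: "op_col a j q C j j' = C j j'" by (simp add: op_col_def)
    have "coeff (q * C j j') 1 = 0"
    proof (cases "C j j' = 0")
     case False
     hence "D j \<le> D j' + 1" using gr k'j'(2) a(3) unfolding graded_def by blast
     hence "D j - D a + (D j' + 1 - D j) - 0 = 1" using l True Daj by simp
     thus ?thesis using qcoeff[OF deg[OF a(3) k'j'(2)], of 0] skj(1) by simp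
    qed simp
    thus ?thesis using 1 True unfolding op_mat_def cj by simp
   qed
  qed
  have "top_clean s' ?C k' j'"
   if p: "0 < s'" "k' \<le> t" "j' \<in> {1..t}" "(s' * Suc t + k') * Suc t + j' < Suc N" for s' k' j'
   unfolding top_clean_def
  proof
   let ?e = "D j' + 1 - D k' - s'"
   assume l: "Suc k' < j' \<and> s' \<le> D j' + 1 - D k' \<and> m (Suc k') - m k' \<le> ?e"
   have le: "(s' * Suc t + k') * Suc t + j' \<le> (s * Suc t + k) * Suc t + j" using p(4) skj(4) by simp
   have le2: "s' * Suc t + k' \<le> s * Suc t + k"
   proof (rule ccontr)
    assume "\<not> ?thesis"
    hence "Suc (s * Suc t + k) * Suc t \<le> (s' * Suc t + k') * Suc t" by (intro mult_le_mono1) simp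
    thus False using le a(3) by simp
   qed
   have "s' \<le> s"
   proof (rule ccontr)
    assume "\<not> ?thesis"
    hence "Suc s * Suc t \<le> s' * Suc t" by (intro mult_le_mono1) simp
    thus False using le2 skj(2) by simp
   qed
   hence lex: "s' < s \<or> s' = s \<and> k' \<le> k" using le2 by auto
   have k'k: "D k' \<le> D a + 1" if "s' = s" using D_mono[of k' a] lex that a unfolding a_def by auto
   have old: "coeff (C k' j') ?e = 0" if "\<not> (s' = s \<and> k' = k \<and> j' = j)"
   proof -
    have "(s' * Suc t + k') * Suc t + j' \<noteq> N"
    proof
     assume eq: "(s' * Suc t + k') * Suc t + j' = N"
     hence eq2: "(s' * Suc t + k') * Suc t + j' = (s * Suc t + k) * Suc t + j" using skj(4) by simp
     have "j' < Suc t" "j < Suc t" using p(3) a(3) by auto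
     hence jj: "j' = j" "s' * Suc t + k' = s * Suc t + k"
      using arg_cong[OF eq2, of "\<lambda>n. n mod Suc t"] arg_cong[OF eq2, of "\<lambda>n. n div Suc t"] by (simp_all del: mult_Suc_right)
     have "k' < Suc t" "k < Suc t" using p(2) skj(2) by auto
     hence "k' = k" "s' = s"
      using arg_cong[OF jj(2), of "\<lambda>n. n mod Suc t"] arg_cong[OF jj(2), of "\<lambda>n. n div Suc t"] by (simp_all del: mult_Suc_right)
     with jj(1) that show False by blast
    qed
    hence "top_clean s' C k' j'" using p(4) by (intro clean[OF p(1-3)]) simp
    thus ?thesis using l unfolding top_clean_def by blast
   qed
   have 1: "coeff (op_col a j q C k' j') ?e = 0"
   proof (cases "j' = j \<and> D k' \<le> D a + 1")
    case True
    hence "coeff (op_col a j q C k' j) (D j + 1 - D k' - s') =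
      coeff (C k' j) (D j + 1 - D k' - s') - (if s' < s then 0 else c * (if k' = k then 1 else 0))"
     using lex by (intro colchange[OF p(2)]) auto
    thus ?thesis using True old lex c_def by (auto split: if_splits)
   next
    case False
    hence "\<not> (s' = s \<and> k' = k \<and> j' = j)" using k'k by auto
    thus ?thesis using old colzero[OF p(2)] False by (auto simp: op_col_def)
   qed
   show "coeff (?C k' j') ?e = 0"
   proof (cases "k' = a")
    case False
    thus ?thesis using 1 by (simp add: op_mat_def)
   next
    case True
    hence s's: "s' < s" using lex unfolding a_def by auto
    let ?p = "op_col a j q C j j'"
    have "coeff (q * ?p) ?e = 0"
    proof (cases "?p = 0")
     case nz: False
     have grp: "D j \<le> D j' + 1 \<and> degree ?p \<le> D j' + 1 - D j"
     proof (cases "j' = j")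
      case True
      have "degree (q * C j a) \<le> 1"
      proof (cases "C j a = 0")
       case False
       hence "D j \<le> D a + 1" "degree (C j a) \<le> D a + 1 - D j"
        using gr a unfolding graded_def by blast+
       thus ?thesis using degree_mult_le[of q "C j a"] q Daj by linarith
      qed simp
      hence "degree (C j j - q * C j a) \<le> 1"
       using deg[OF a(3) skj(3)] by (intro degree_diff_le) simp_all
      thus ?thesis using True by (simp add: op_col_def)
     next
      case False
      hence "?p = C j j'" by (simp add: op_col_def)
      thus ?thesis using nz gr p(3) a(3) unfolding graded_def by metis
     qed
     have "D j - D a + (D j' + 1 - D j) - s' = ?e" using grp True Daj by simp
     thus ?thesis using qcoeff[OF conjunct2[OF grp], of s'] s's by simp
    qed simp
    thus ?thesis using 1 True by (simp add: op_mat_def)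
   qed
  qed
  with good' low' show ?thesis by blast
 qed
qed

text \<open>Canonical form: the differences to the powers of \<open>y\<close> on the diagonal have \<open>y\<close>-degree below
 \<open>d\<close> of their row above the diagonal, and below \<open>d\<close> of their column under it.\<close>

definition canonical :: "(nat \<Rightarrow> nat \<Rightarrow> 'a::field poly) \<Rightarrow> bool" where
 "canonical C \<longleftrightarrow> graded C \<and> triangular C \<and>
  (\<forall>k\<le>t. \<forall>j\<in>{1..t}. \<forall>e.
    (Suc k < j \<and> m (Suc k) - m k \<le> e \<longrightarrow> coeff (C k j) e = 0) \<and>
    (j \<le> k \<and> m j - m (j - 1) \<le> e \<longrightarrow> coeff (C k j) e = 0))"

text \<open>After normalization the basis satisfies the same relations as the minors and has the same last leading
 coefficient, so it consists of the minors.\<close>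

theorem canonical_minors_exist:
 fixes J :: "'a::field ring_S set"
 assumes J: "homogeneous_ideal J" and lm: "lead_mons J = stairs"
 shows "\<exists>C. canonical C \<and> J = stair_ideal (minors C)"
proof -
 let ?N = "((D t + 2) * Suc t + t) * Suc t + t"
 obtain f C where good: "good_system J f C" and low: "\<And>k j. k \<le> t \<Longrightarrow> j \<in> {1..t} \<Longrightarrow> low_clean C k j"
  and top: "\<And>s k j. 0 < s \<Longrightarrow> k \<le> t \<Longrightarrow> j \<in> {1..t} \<Longrightarrow> (s * Suc t + k) * Suc t + j < ?N \<Longrightarrow> top_clean s C k j"
  using top_normal_form[OF J lm, of ?N] by blast
 have sb: "stair_basis f" and rel: "relation f C" and gr: "graded C" and tri: "triangular C" and fJ: "\<And>k. k \<le> t \<Longrightarrow> f k \<in> J"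
  using good unfolding good_system_def by auto
 have deg: "degree (C l i) \<le> D i + 1 - D l" if "l \<le> t" "i \<in> {1..t}" for l i
  using gr that unfolding graded_def by (cases "C l i = 0") auto
 have can: "canonical C"
  unfolding canonical_def
 proof (intro conjI gr tri allI impI ballI; elim conjE)
  fix k j e assume kj: "k \<le> t" "j \<in> {1..t}" "Suc k < j" "m (Suc k) - m k \<le> e"
  let ?w = "D j + 1 - D k"
  consider "e > ?w" | "e = ?w" | "e < ?w" by linarith
  thus "coeff (C k j) e = 0"
  proof cases
   case 1
   thus ?thesis using deg[OF kj(1,2)] by (intro coeff_eq_0) simp
  next
   case 2
   thus ?thesis using tri kj unfolding triangular_def by auto
  next
   case 3
   define s where "s = ?w - e"
   have s: "0 < s" "s \<le> ?w" "?w - s = e" using 3 unfolding s_def by auto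
   have "s \<le> D t + 1" using s(2) D_mono[of j t] kj(2) by auto
   hence "s * Suc t + k \<le> (D t + 1) * Suc t + t" using kj(1) by (intro add_mono mult_le_mono1) auto
   hence "(s * Suc t + k) * Suc t \<le> ((D t + 1) * Suc t + t) * Suc t" by (rule mult_le_mono1)
   also have "\<dots> < ((D t + 2) * Suc t + t) * Suc t" by (rule mult_less_mono1) simp_all
   finally have "(s * Suc t + k) * Suc t + j < ?N" using kj(2) by (intro add_less_le_mono) auto
   hence "top_clean s C k j" by (rule top[OF s(1) kj(1,2)])
   thus ?thesis using kj(3,4) s unfolding top_clean_def by simp
  qed
 next
  fix k j e assume kj: "k \<le> t" "j \<in> {1..t}" "j \<le> k" "m j - m (j - 1) \<le> e"
  have dpos: "1 \<le> m j - m (j - 1)" using m_mono[of "j - 1" j] kj(2) by auto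
  have "D j \<le> D k" by (rule D_mono[OF kj(3,1)])
  show "coeff (C k j) e = 0"
  proof (cases "degree (C k j) < e")
   case True
   thus ?thesis by (rule coeff_eq_0)
  next
   case False
   hence e1: "e = 1" "D k = D j" "m j = m (j - 1) + 1"
    using deg[OF kj(1,2)] dpos kj(4) \<open>D j \<le> D k\<close> by auto
   thus ?thesis using low[OF kj(1,2)] kj(3) unfolding low_clean_def by simp
  qed
 qed
 have sbm: "stair_basis (minors C)" by (rule stair_basis_minors[OF gr tri])
 define e where "e = (\<lambda>k. f k - minors C k)"
 have "relation e C"
  unfolding relation_def
 proof
  fix j assume j: "j \<in> {1..t}"
  have "xS * f j = (\<Sum>k\<le>t. hm (D j + 1 - D k) (C k j) * f k)"
   "xS * minors C j = (\<Sum>k\<le>t. hm (D j + 1 - D k) (C k j) * minors C k)"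
   using rel relation_minors[of C] j unfolding relation_def by blast+
  thus "xS * e j = (\<Sum>k\<le>t. hm (D j + 1 - D k) (C k j) * e k)"
   unfolding e_def by (simp only: right_diff_distrib sum_subtractf)
 qed
 moreover have "e k \<in> forms (D k)" if "k \<le> t" for k
  using sb sbm that unfolding e_def stair_basis_def by (intro forms_diff) auto
 moreover have "lookup (e t) (mS 0 (m t) 0) = 0"
 proof -
  have "lookup (f t) (mS (t - t) (m t) 0) = 1" "lookup (minors C t) (mS (t - t) (m t) 0) = 1"
   using sb sbm unfolding stair_basis_def by blast+
  thus ?thesis by (simp add: e_def lookup_minus)
 qed
 ultimately have "e k = 0" if "k \<le> t" for k using relation_unique[OF _ tri] that by blast
 hence "f k = minors C k" if "k \<le> t" for k using that unfolding e_def by auto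
 hence "\<And>k. k \<le> t \<Longrightarrow> minors C k \<in> J" using fJ by metis
 from ideal_eq_stair_ideal[OF J lm sbm this] can show ?thesis by blast
qed

end

section \<open>A general linear form is a nonzerodivisor\<close>

lemma infinite_UNIV_alg_closed: "infinite (UNIV :: 'a::alg_closed_field set)"
proof
 assume fin: "finite (UNIV :: 'a set)"
 define P where "P = (\<Prod>a\<in>(UNIV :: 'a set). [:- a, 1:]) + 1"
 have "poly P x = 1" for x
 proof -
  have "(\<Prod>a\<in>(UNIV :: 'a set). x - a) = 0" using fin by (intro prod_zero) auto
  thus ?thesis by (simp add: P_def poly_prod)
 qed
 moreover have "degree (\<Prod>a\<in>(UNIV :: 'a set). [:- a, 1:]) > 0"
 proof -
  have "degree (\<Prod>a\<in>(UNIV :: 'a set). [:- a, 1:]) = (\<Sum>a\<in>(UNIV :: 'a set). degree [:- a, 1:])"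
   by (rule degree_prod_eq_sum_degree) simp
  also have "\<dots> = card (UNIV :: 'a set)" by simp
  finally show ?thesis using fin by (simp add: card_gt_0_iff)
 qed
 hence "degree P > 0" unfolding P_def by (subst degree_add_eq_left) auto
 ultimately show False using root_exists[of P] by auto
qed

lemma infinite_subset_card:
 assumes "infinite A"
 shows "\<exists>B\<subseteq>A. finite B \<and> card B = n"
 using infinite_arbitrarily_large[OF assms, of n] by blast

lemma Const_mult_mult: "Const a * (Const b * v) = (Const (a * b) * v :: ('v, 'a::comm_ring_1) mpoly)"
 by (simp add: Const_def mult_single mult.assoc[symmetric])

lemma Const_inverse_mult: "a \<noteq> 0 \<Longrightarrow> Const (inverse a) * (Const a * v) = (v :: ('v, 'a::field) mpoly)"
 by (simp add: Const_mult_mult) (simp add: Const_def)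

lemma dependent_modulo:
 fixes J :: "'a::field ring_S set"
 assumes J: "homogeneous_ideal J" and I: "finite I" "hilbert_function J N < card I"
  and e: "\<And>i. i \<in> I \<Longrightarrow> e i \<in> forms N"
 shows "\<exists>c. (\<exists>i\<in>I. c i \<noteq> 0) \<and> (\<Sum>i\<in>I. scale (c i) (e i)) \<in> J"
proof -
 note subJ = is_ideal_imp_subspace[OF homogeneous_ideal_is_ideal[OF J]]
 let ?T = "{m. mdeg m = N \<and> m \<notin> lead_mons J}"
 have finT: "finite ?T" by (rule finite_subset[OF _ finite_mdeg[of N]]) auto
 have "\<forall>i\<in>I. \<exists>v. v \<in> J \<and> e i - v \<in> mpoly_vs.span (monomial ` ?T)"
 proof
  fix i assume i: "i \<in> I"
  obtain v where v: "v \<in> J \<inter> forms N" "keys (e i - v) \<subseteq> {m. mdeg m = N} - lead_mons J"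
   using normal_form[OF J e[OF i]] by blast
  have "(\<Sum>m\<in>keys (e i - v). scale (lookup (e i - v) m) (single m 1)) \<in> mpoly_vs.span (monomial ` ?T)"
   unfolding monomial_def
   by (intro mpoly_vs.span_sum mpoly_vs.span_scale mpoly_vs.span_base imageI) (use v(2) in auto)
  hence "e i - v \<in> mpoly_vs.span (monomial ` ?T)" by (simp only: mpoly_scale_as_sum[symmetric])
  with v(1) show "\<exists>v. v \<in> J \<and> e i - v \<in> mpoly_vs.span (monomial ` ?T)" by blast
 qed
 from bchoice[OF this] obtain v where v0: "\<forall>i\<in>I. v i \<in> J \<and> e i - v i \<in> mpoly_vs.span (monomial ` ?T)"
  by (elim exE)
 have v: "v i \<in> J" "e i - v i \<in> mpoly_vs.span (monomial ` ?T)" if "i \<in> I" for i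
  using bspec[OF v0 that] by blast+
 have "card (monomial ` ?T :: 'a ring_S set) \<le> card ?T" by (rule card_image_le[OF finT])
 also have "\<dots> < card I" using I(2) hilbert_function_lead_mons[OF J, of N] by simp
 finally have card: "card (monomial ` ?T :: 'a ring_S set) < card I" .
 have "\<exists>c. (\<exists>i\<in>I. c i \<noteq> 0) \<and> (\<Sum>i\<in>I. scale (c i) (e i - v i)) = 0"
  by (rule family_dependent[OF I(1) finite_imageI[OF finT] v(2) card])
 then obtain c where c: "\<exists>i\<in>I. c i \<noteq> 0" "(\<Sum>i\<in>I. scale (c i) (e i - v i)) = 0"
  by (elim exE conjE) (rule that)
 have "(\<Sum>i\<in>I. scale (c i) (v i)) \<in> J"
  by (rule mpoly_vs.subspace_sum[OF subJ], rule mpoly_vs.subspace_scale[OF subJ], rule v(1))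
 moreover have "(\<Sum>i\<in>I. scale (c i) (e i)) = (\<Sum>i\<in>I. scale (c i) (v i))"
  using c(2) by (simp add: mpoly_vs.scale_right_diff_distrib sum_subtractf)
 ultimately show ?thesis using c(1) by auto
qed

text \<open>The two properties of a zero-dimensional subscheme that are used: no element outside \<open>J\<close> is
 annihilated by all variables, and the Hilbert function is bounded by \<open>N0\<close>.\<close>

locale saturated_bounded =
 fixes J :: "'a::alg_closed_field ring_S set" and N0 :: nat
 assumes J: "homogeneous_ideal J"
  and sat: "\<And>v. (\<And>w. Var w * v \<in> J) \<Longrightarrow> v \<in> J"
  and bounded: "\<And>n. hilbert_function J n \<le> N0"
begin

lemma idJ: "is_ideal J"
 by (rule homogeneous_ideal_is_ideal[OF J])

lemma J_scale: "v \<in> J \<Longrightarrow> r * v \<in> J"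
 by (rule ring_module.subspace_scale[OF idJ])

lemma J_add: "v \<in> J \<Longrightarrow> w \<in> J \<Longrightarrow> v + w \<in> J"
 by (rule ring_module.subspace_add[OF idJ])

lemma J_diff: "v \<in> J \<Longrightarrow> w \<in> J \<Longrightarrow> v - w \<in> J"
 by (rule ring_module.subspace_diff[OF idJ])

text \<open>\<open>v\<close> is an eigenvector with eigenvalues \<open>p, r\<close>: in the quotient, the linear forms \<open>X\<close> and
 \<open>Z\<close> act on it as \<open>p w\<close> and \<open>r w\<close>. Such a \<open>v\<close> is supported at one point of the subscheme.\<close>

definition eigenvector :: "'a ring_S \<Rightarrow> 'a ring_S \<Rightarrow> 'a ring_S \<Rightarrow> 'a \<Rightarrow> 'a \<Rightarrow> 'a ring_S \<Rightarrow> bool" where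
 "eigenvector X Z w p r v \<longleftrightarrow> v \<notin> J \<and> (X - Const p * w) * v \<in> J \<and> (Z - Const r * w) * v \<in> J"

text \<open>The third linear form \<open>w\<close> acts injectively on an eigenvector, because otherwise all variables would
 annihilate it.\<close>

lemma eigenvector_power:
 assumes gen: "{X, Z, w} = range Var" and ev: "eigenvector X Z w p r v"
 shows "eigenvector X Z w p r (w ^ k * v)"
proof (induction k)
 case 0
 thus ?case using ev by simp
next
 case (Suc k)
 let ?u = "w ^ k * v"
 have u: "?u \<notin> J" "(X - Const p * w) * ?u \<in> J" "(Z - Const r * w) * ?u \<in> J"
  using Suc unfolding eigenvector_def by auto
 have "w * ?u \<notin> J"
 proof
  assume wu: "w * ?u \<in> J"
  have "(X - Const p * w) * ?u + Const p * (w * ?u) \<in> J" by (rule J_add[OF u(2) J_scale[OF wu]])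
  hence X: "X * ?u \<in> J" by (simp add: algebra_simps)
  have "(Z - Const r * w) * ?u + Const r * (w * ?u) \<in> J" by (rule J_add[OF u(3) J_scale[OF wu]])
  hence Z: "Z * ?u \<in> J" by (simp add: algebra_simps)
  have "Var x * ?u \<in> J" for x
  proof -
   have "Var x \<in> {X, Z, w}" unfolding gen by simp
   thus ?thesis using X Z wu by auto
  qed
  thus False using sat u(1) by blast
 qed
 moreover have "(X - Const p * w) * (w * ?u) \<in> J" "(Z - Const r * w) * (w * ?u) \<in> J"
  using J_scale[OF u(2), of w] J_scale[OF u(3), of w] by (simp_all add: mult.left_commute)
 ultimately show ?case unfolding eigenvector_def by (simp add: mult.assoc)
qed

text \<open>Eigenvectors at different points are independent: the product of forms that vanish at all
 points but one annihilates all but one of them.\<close>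

lemma eigenvectors_card:
 assumes gen: "{X, Z, w} = range Var"
  and P: "finite P" "\<And>p r. (p, r) \<in> P \<Longrightarrow> \<exists>n v. v \<in> forms n \<and> eigenvector X Z w p r v"
 shows "card P \<le> N0"
proof (rule ccontr)
 assume big: "\<not> card P \<le> N0"
 have "\<forall>pr\<in>P. \<exists>nv. snd nv \<in> forms (fst nv) \<and> eigenvector X Z w (fst pr) (snd pr) (snd nv)"
  using P(2) by fastforce
 from bchoice[OF this] obtain F where F0: "\<forall>pr\<in>P. snd (F pr) \<in> forms (fst (F pr)) \<and>
   eigenvector X Z w (fst pr) (snd pr) (snd (F pr))" by (elim exE)
 have F: "snd (F pr) \<in> forms (fst (F pr))" "eigenvector X Z w (fst pr) (snd pr) (snd (F pr))" if "pr \<in> P" for pr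
  using bspec[OF F0 that] by blast+
 define N where "N = (\<Sum>pr\<in>P. fst (F pr))"
 define e where "e = (\<lambda>pr. w ^ (N - fst (F pr)) * snd (F pr))"
 have "w \<in> range Var" unfolding gen[symmetric] by simp
 hence w1: "w \<in> forms 1" using forms_Var by auto
 have wpow: "w ^ k \<in> forms k" for k
 proof (induction k)
  case (Suc k)
  thus ?case using forms_mult[OF w1 Suc] by simp
 qed (simp add: forms_one)
 have e: "e pr \<in> forms N" "eigenvector X Z w (fst pr) (snd pr) (e pr)" if "pr \<in> P" for pr
 proof -
  have "fst (F pr) \<le> N" unfolding N_def by (rule member_le_sum[OF that _ P(1)]) simp
  thus "e pr \<in> forms N"
   using forms_mult[OF wpow F(1)[OF that], of "N - fst (F pr)"] unfolding e_def by simp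
  show "eigenvector X Z w (fst pr) (snd pr) (e pr)"
   unfolding e_def by (rule eigenvector_power[OF gen F(2)[OF that]])
 qed
 have "hilbert_function J N < card P" using bounded[of N] big by simp
 hence "\<exists>c. (\<exists>i\<in>P. c i \<noteq> 0) \<and> (\<Sum>i\<in>P. scale (c i) (e i)) \<in> J"
  by (rule dependent_modulo[OF J P(1) _ e(1)])
 then obtain c where c: "\<exists>i\<in>P. c i \<noteq> 0" "(\<Sum>i\<in>P. scale (c i) (e i)) \<in> J" by (elim exE conjE) (rule that)
 then obtain k where k: "k \<in> P" "c k \<noteq> 0" by blast
 define M where "M = (\<lambda>i. if fst i \<noteq> fst k then X - Const (fst i) * w else Z - Const (snd i) * w)"
 define \<delta> where "\<delta> = (\<lambda>i. if fst i \<noteq> fst k then fst k - fst i else snd k - snd i)"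
 have Mi: "M i * e i \<in> J" if "i \<in> P" for i
  using e(2)[OF that] unfolding M_def eigenvector_def by auto
 have Cdiff: "Const a - Const b = (Const (a - b) :: 'a ring_S)" for a b
  by (simp add: Const_def single_diff)
 have Mk: "M i * e k - Const (\<delta> i) * w * e k \<in> J" for i
 proof -
  have "(X - Const (fst i) * w) * e k - Const (fst k - fst i) * w * e k = (X - Const (fst k) * w) * e k"
   "(Z - Const (snd i) * w) * e k - Const (snd k - snd i) * w * e k = (Z - Const (snd k) * w) * e k"
   unfolding Cdiff[symmetric] by (simp_all add: algebra_simps)
  thus ?thesis using e(2)[OF k(1)] unfolding M_def \<delta>_def eigenvector_def by auto
 qed
 have prodk: "(\<Prod>i\<in>A. M i) * e k - Const (\<Prod>i\<in>A. \<delta> i) * w ^ card A * e k \<in> J" if "finite A" for A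
  using that
 proof (induction A rule: finite_induct)
  case empty
  thus ?case using ring_module.subspace_0[OF idJ] by (simp add: Const_def)
 next
  case (insert i A)
  have "M i * ((\<Prod>i\<in>A. M i) * e k - Const (\<Prod>i\<in>A. \<delta> i) * w ^ card A * e k) +
    (Const (\<Prod>i\<in>A. \<delta> i) * w ^ card A) * (M i * e k - Const (\<delta> i) * w * e k) \<in> J"
   by (intro J_add J_scale insert.IH Mk)
  also have "M i * ((\<Prod>i\<in>A. M i) * e k - Const (\<Prod>i\<in>A. \<delta> i) * w ^ card A * e k) +
    (Const (\<Prod>i\<in>A. \<delta> i) * w ^ card A) * (M i * e k - Const (\<delta> i) * w * e k) =
    (M i * (\<Prod>i\<in>A. M i)) * e k - (Const (\<delta> i) * Const (\<Prod>i\<in>A. \<delta> i)) * (w * w ^ card A) * e k"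
   by (simp add: algebra_simps)
  also have "Const (\<delta> i) * Const (\<Prod>i\<in>A. \<delta> i) = (Const (\<delta> i * (\<Prod>i\<in>A. \<delta> i)) :: 'a ring_S)"
   by (simp add: Const_def mult_single)
  finally show ?case using insert.hyps by simp
 qed
 let ?A = "P - {k}"
 let ?M = "\<Prod>i\<in>?A. M i"
 have finA: "finite ?A" using P(1) by simp
 have MeJ: "?M * e i \<in> J" if "i \<in> ?A" for i
 proof -
  have "?M = M i * (\<Prod>i\<in>?A - {i}. M i)" by (rule prod.remove[OF finA that])
  hence eq: "?M * e i = (\<Prod>i\<in>?A - {i}. M i) * (M i * e i)" by (simp add: mult_ac)
  show ?thesis unfolding eq by (rule J_scale, rule Mi) (use that in blast)
 qed
 have "(\<Sum>i\<in>?A. Const (c i) * (?M * e i)) \<in> J"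
  by (rule ring_module.subspace_sum[OF idJ], rule J_scale, rule MeJ)
 moreover have "?M * (\<Sum>i\<in>P. scale (c i) (e i)) \<in> J" by (rule J_scale[OF c(2)])
 moreover have "?M * (\<Sum>i\<in>P. scale (c i) (e i)) = Const (c k) * (?M * e k) + (\<Sum>i\<in>?A. Const (c i) * (?M * e i))"
 proof -
  have eq: "(\<Sum>i\<in>P. scale (c i) (e i)) = scale (c k) (e k) + (\<Sum>i\<in>?A. scale (c i) (e i))"
   by (rule sum.remove[OF P(1) k(1)])
  show ?thesis unfolding eq by (simp only: scale_def distrib_left sum_distrib_left mult.left_commute[of ?M])
 qed
 ultimately have "Const (c k) * (?M * e k) \<in> J"
  using J_diff by (metis (no_types, lifting) add_diff_cancel_right')
 hence "Const (c k) * (?M * e k) - Const (c k) * (?M * e k - Const (\<Prod>i\<in>?A. \<delta> i) * w ^ card ?A * e k) \<in> J"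
  by (rule J_diff[OF _ J_scale[OF prodk[OF finA]]])
 hence 1: "Const (c k) * (Const (\<Prod>i\<in>?A. \<delta> i) * (w ^ card ?A * e k)) \<in> J" by (simp add: algebra_simps)
 have nz: "c k * (\<Prod>i\<in>?A. \<delta> i) \<noteq> 0"
  using k(2) finA by (auto simp: \<delta>_def prod_eq_iff)
 have "Const (c k * (\<Prod>i\<in>?A. \<delta> i)) * (w ^ card ?A * e k) \<in> J"
  using 1 by (simp only: Const_mult_mult)
 hence "Const (inverse (c k * (\<Prod>i\<in>?A. \<delta> i))) * (Const (c k * (\<Prod>i\<in>?A. \<delta> i)) * (w ^ card ?A * e k)) \<in> J"
  by (rule J_scale)
 hence "w ^ card ?A * e k \<in> J" by (simp only: Const_inverse_mult[OF nz])
 thus False using eigenvector_power[OF gen e(2)[OF k(1)], of "card ?A"] unfolding eigenvector_def by blast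
qed

text \<open>The binary form with coefficients \<open>c\<close>, used to find an annihilator in \<open>x, y\<close> of an element killed by
 a linear form in \<open>z\<close>.\<close>

definition binary_form :: "nat \<Rightarrow> (nat \<Rightarrow> 'a) \<Rightarrow> 'a ring_S" where
 "binary_form d c = (\<Sum>i\<le>d. Const (c i) * (xS ^ i * yS ^ (d - i)))"

lemma binary_form_factor:
 "binary_form (Suc d) (\<lambda>i. (if i = 0 then 0 else g (i - 1)) - p * (if i \<le> d then g i else 0)) =
  (xS - Const p * yS) * binary_form d g"
proof -
 have "(\<Sum>i\<le>Suc d. Const (if i = 0 then 0 else g (i - 1)) * (xS ^ i * yS ^ (Suc d - i))) = xS * binary_form d g"
  unfolding sum.atMost_Suc_shift binary_form_def sum_distrib_left
  by (simp add: Const_def mult.left_commute mult.assoc)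
 moreover have "(\<Sum>i\<le>Suc d. Const (p * (if i \<le> d then g i else 0)) * (xS ^ i * yS ^ (Suc d - i))) = Const p * yS * binary_form d g"
 proof -
  have "(\<Sum>i\<le>Suc d. Const (p * (if i \<le> d then g i else 0)) * (xS ^ i * yS ^ (Suc d - i))) =
    (\<Sum>i\<le>d. Const (p * g i) * (xS ^ i * yS ^ (Suc d - i)))"
   by (simp add: Const_def)
  also have "\<dots> = (\<Sum>i\<le>d. Const p * yS * (Const (g i) * (xS ^ i * yS ^ (d - i))))"
  proof (rule sum.cong[OF refl])
   fix i assume "i \<in> {..d}"
   hence "yS ^ (Suc d - i) = yS * (yS ^ (d - i) :: 'a ring_S)" by (simp add: Suc_diff_le)
   moreover have "Const (p * g i) = Const p * (Const (g i) :: 'a ring_S)" by (simp add: Const_def mult_single)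
   ultimately show "Const (p * g i) * (xS ^ i * yS ^ (Suc d - i)) = Const p * yS * (Const (g i) * (xS ^ i * yS ^ (d - i)))"
    by (simp only: mult_ac)
  qed
  finally show ?thesis unfolding binary_form_def sum_distrib_left .
 qed
 moreover have "binary_form (Suc d) (\<lambda>i. (if i = 0 then 0 else g (i - 1)) - p * (if i \<le> d then g i else 0)) =
   (\<Sum>i\<le>Suc d. Const (if i = 0 then 0 else g (i - 1)) * (xS ^ i * yS ^ (Suc d - i))) -
   (\<Sum>i\<le>Suc d. Const (p * (if i \<le> d then g i else 0)) * (xS ^ i * yS ^ (Suc d - i)))"
 proof -
  have "Const (a - b) = Const a - (Const b :: 'a ring_S)" for a b by (simp add: Const_def single_diff)
  thus ?thesis unfolding binary_form_def by (simp only: left_diff_distrib sum_subtractf)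
 qed
 ultimately show ?thesis by (simp add: left_diff_distrib)
qed

text \<open>Over an algebraically closed field a binary form is a product of linear forms; one of them
 annihilates a suitable multiple of \<open>v\<close>.\<close>

lemma binary_form_eigen:
 assumes "v \<in> forms n" "v \<notin> J" "l * v \<in> J" "\<exists>i\<le>d. c i \<noteq> 0" "binary_form d c * v \<in> J"
 shows "\<exists>n u. u \<in> forms n \<and> u \<notin> J \<and> l * u \<in> J \<and> (yS * u \<in> J \<or> (\<exists>p. (xS - Const p * yS) * u \<in> J))"
 using assms
proof (induction d arbitrary: v n c)
 case 0
 hence cv: "Const (c 0) * v \<in> J" "c 0 \<noteq> 0" by (simp_all add: binary_form_def)
 have "Const (inverse (c 0)) * (Const (c 0) * v) \<in> J" by (rule J_scale[OF cv(1)])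
 hence "v \<in> J" by (simp only: Const_inverse_mult[OF cv(2)])
 with 0 show ?case by blast
next
 case (Suc d)
 have step: ?case if F: "binary_form (Suc d) c = L * binary_form d g" and g: "\<exists>i\<le>d. g i \<noteq> 0"
  and L: "L \<in> forms 1" "L = yS \<or> (\<exists>p. L = xS - Const p * yS)" for L g
 proof (cases "L * v \<in> J")
  case True
  thus ?thesis using Suc.prems(1-3) L(2) by blast
 next
  case False
  have 1: "L * v \<in> forms (1 + n)" by (rule forms_mult[OF L(1) Suc.prems(1)])
  have 2: "l * (L * v) \<in> J" using J_scale[OF Suc.prems(3), of L] by (simp add: mult.left_commute)
  have 3: "binary_form d g * (L * v) \<in> J" using Suc.prems(5) unfolding F by (simp add: mult_ac)
  show ?thesis by (rule Suc.IH[OF 1 False 2 g 3])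
 qed
 show ?case
 proof (cases "c (Suc d) = 0")
  case True
  have "binary_form (Suc d) c = yS * binary_form d c"
  proof -
   have "binary_form (Suc d) c = (\<Sum>i\<le>d. Const (c i) * (xS ^ i * yS ^ (Suc d - i)))"
    by (simp add: binary_form_def True Const_def)
   also have "\<dots> = (\<Sum>i\<le>d. yS * (Const (c i) * (xS ^ i * yS ^ (d - i))))"
   proof (rule sum.cong[OF refl])
    fix i assume "i \<in> {..d}"
    hence "yS ^ (Suc d - i) = yS * (yS ^ (d - i) :: 'a ring_S)" by (simp add: Suc_diff_le)
    thus "Const (c i) * (xS ^ i * yS ^ (Suc d - i)) = yS * (Const (c i) * (xS ^ i * yS ^ (d - i)))"
     by (simp only: mult_ac)
   qed
   finally show ?thesis unfolding binary_form_def sum_distrib_left .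
  qed
  moreover have "\<exists>i\<le>d. c i \<noteq> 0" using Suc.prems(4) True by (metis le_Suc_eq)
  ultimately show ?thesis by (rule step) (use forms_Var in auto)
 next
  case False
  define P where "P = (\<Sum>i\<le>Suc d. monom (c i) i)"
  have Pc: "coeff P i = (if i \<le> Suc d then c i else 0)" for i
   unfolding P_def coeff_sum by (simp add: coeff_monom)
  have "Suc d \<le> degree P" by (rule le_degree) (simp add: Pc False)
  hence "degree P > 0" by simp
  then obtain p where "poly P p = 0" using root_exists by blast
  then obtain G where G: "P = [:- p, 1:] * G" by (metis poly_eq_0_iff_dvd dvdE)
  have P0: "P \<noteq> 0" using \<open>degree P > 0\<close> by auto
  have G0: "G \<noteq> 0" using P0 G by auto
  have degP: "degree P \<le> Suc d" by (rule degree_le) (simp add: Pc)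
  have degG: "degree G \<le> d"
  proof -
   have "degree P = 1 + degree G" unfolding G using G0 by (subst degree_mult_eq) auto
   thus ?thesis using degP by simp
  qed
  let ?g = "coeff G"
  have cP: "coeff P i = (if i = 0 then 0 else ?g (i - 1)) - p * ?g i" for i
   unfolding G by (cases i) simp_all
  have "binary_form (Suc d) c = binary_form (Suc d) (\<lambda>i. (if i = 0 then 0 else ?g (i - 1)) - p * (if i \<le> d then ?g i else 0))"
   unfolding binary_form_def
  proof (rule sum.cong[OF refl])
   fix i assume i: "i \<in> {..Suc d}"
   have "?g i = (if i \<le> d then ?g i else 0)" using degG by (auto intro: coeff_eq_0)
   hence "c i = (if i = 0 then 0 else ?g (i - 1)) - p * (if i \<le> d then ?g i else 0)"
    using cP[of i] Pc[of i] i by simp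
   thus "Const (c i) * (xS ^ i * yS ^ (Suc d - i)) =
     Const ((if i = 0 then 0 else ?g (i - 1)) - p * (if i \<le> d then ?g i else 0)) * (xS ^ i * yS ^ (Suc d - i))"
    by (simp only:)
  qed
  also have "\<dots> = (xS - Const p * yS) * binary_form d ?g" by (rule binary_form_factor)
  finally have F: "binary_form (Suc d) c = (xS - Const p * yS) * binary_form d ?g" .
  have g: "\<exists>i\<le>d. ?g i \<noteq> 0" using G0 degG by (metis leading_coeff_0_iff)
  have "xS - Const p * yS \<in> forms 1"
   using forms_diff[OF forms_Var forms_scale[OF forms_Var], of 0 p 1] by (simp add: scale_def)
  thus ?thesis by (rule step[OF F g]) blast
 qed
qed

text \<open>Every zero divisor of the form \<open>z + s x + s\<^sup>2 y\<close> vanishes at one of finitely many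
 points, and each point lies on at most two of these lines.\<close>

lemma linear_nonzerodivisor_exists:
 "\<exists>s. nonzerodivisor_on_quotient (zS + Const s * xS + Const (s ^ 2) * yS) J"
proof -
 define l where "l = (\<lambda>s. zS + Const s * xS + Const (s ^ 2) * yS :: 'a ring_S)"
 define PA where "PA = {(p, r). \<exists>n v. v \<in> forms n \<and> eigenvector xS zS yS p r v}"
 define PB where "PB = {(p, r). \<exists>n v. v \<in> forms n \<and> eigenvector yS zS xS p r v}"
 have rV: "range (Var :: 3 \<Rightarrow> 'a ring_S) = {xS, yS, zS}" unfolding UNIV_3_eq by auto
 have finA: "finite PA"
 proof (rule ccontr)
  assume "infinite PA"
  then obtain P where P: "P \<subseteq> PA" "finite P" "card P = Suc N0" using infinite_subset_card by blast
  have "card P \<le> N0"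
   by (rule eigenvectors_card[of xS zS yS]) (use P rV in \<open>auto simp: PA_def\<close>)
  thus False using P by simp
 qed
 have finB: "finite PB"
 proof (rule ccontr)
  assume "infinite PB"
  then obtain P where P: "P \<subseteq> PB" "finite P" "card P = Suc N0" using infinite_subset_card by blast
  have "card P \<le> N0"
   by (rule eigenvectors_card[of yS zS xS]) (use P rV in \<open>auto simp: PB_def\<close>)
  thus False using P by simp
 qed
 have bad: "(\<exists>(p, r)\<in>PA. poly [:r, p, 1:] s = 0) \<or> (\<exists>(p, r)\<in>PB. s = - r)"
  if nz: "\<not> nonzerodivisor_on_quotient (l s) J" for s
 proof -
  obtain g where g: "l s * g \<in> J" "g \<notin> J" using nz unfolding nonzerodivisor_on_quotient_def by blast
  have ls: "l s \<in> forms 1"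
   unfolding l_def using forms_add[OF forms_add[OF forms_Var forms_scale[OF forms_Var]] forms_scale[OF forms_Var], of 2 s 0 "s ^ 2" 1]
   by (simp add: scale_def)
  obtain N where "\<forall>m\<in>keys g. mdeg m \<le> N" using mdeg_bound by blast
  hence gs: "g = (\<Sum>n\<le>N. hcomp n g)" by (intro sum_hcomp) auto
  have "\<exists>n. hcomp n g \<notin> J"
  proof (rule ccontr)
   assume "\<not> ?thesis"
   hence "(\<Sum>n\<le>N. hcomp n g) \<in> J" by (intro ring_module.subspace_sum[OF idJ]) simp
   thus False using g(2) gs by simp
  qed
  then obtain n where n: "hcomp n g \<notin> J" by blast
  let ?v = "hcomp n g"
  have "hcomp (Suc n) (g * l s) = ?v * l s" using hcomp_mult_form[OF ls, of "Suc n" g] by simp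
  hence lv: "l s * ?v \<in> J"
   using homogeneous_ideal_hcomp[OF J g(1), of "Suc n"] by (simp add: mult.commute)
  let ?e = "\<lambda>i. xS ^ i * yS ^ (N0 - i) * ?v"
  have "?e i \<in> forms (n + N0)" if "i \<in> {..N0}" for i
  proof -
   have "single (mS i (N0 - i) 0) 1 * ?v \<in> forms (mdeg (mS i (N0 - i) 0) + n)"
    by (rule forms_mult[OF forms_single hcomp_forms])
   thus ?thesis using that by (simp add: Var_S_power mult_single mS_add add.commute)
  qed
  moreover have "hilbert_function J (n + N0) < card {..N0}" using bounded[of "n + N0"] by simp
  ultimately obtain c where c: "\<exists>i\<in>{..N0}. c i \<noteq> 0" "(\<Sum>i\<in>{..N0}. scale (c i) (?e i)) \<in> J"
   using dependent_modulo[OF J, of "{..N0}" "n + N0" ?e] by auto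
  have "binary_form N0 c * ?v \<in> J"
   using c(2) unfolding binary_form_def sum_distrib_right scale_def by (simp only: mult.assoc)
  moreover have "\<exists>i\<le>N0. c i \<noteq> 0" using c(1) by blast
  ultimately obtain k u where u: "u \<in> forms k" "u \<notin> J" "l s * u \<in> J"
   "yS * u \<in> J \<or> (\<exists>p. (xS - Const p * yS) * u \<in> J)"
   using binary_form_eigen[OF hcomp_forms n lv] by blast
  from u(4) show ?thesis
  proof
   assume y: "yS * u \<in> J"
   have "l s * u - Const (s ^ 2) * (yS * u) \<in> J" by (rule J_diff[OF u(3) J_scale[OF y]])
   also have "l s * u - Const (s ^ 2) * (yS * u) = (zS - Const (- s) * xS) * u"
    by (simp add: l_def algebra_simps Const_def single_uminus)
   finally have "eigenvector yS zS xS 0 (- s) u"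
    unfolding eigenvector_def using u(2) y by (simp add: Const_def)
   hence "(0, - s) \<in> PB" unfolding PB_def using u(1) by blast
   thus ?thesis by force
  next
   assume "\<exists>p. (xS - Const p * yS) * u \<in> J"
   then obtain p where p: "(xS - Const p * yS) * u \<in> J" by blast
   define r where "r = - (s * p + s ^ 2)"
   have "l s * u - Const s * ((xS - Const p * yS) * u) \<in> J" by (rule J_diff[OF u(3) J_scale[OF p]])
   also have "l s * u - Const s * ((xS - Const p * yS) * u) = (zS - Const r * yS) * u"
   proof -
    have r: "Const r = - (Const s * Const p + Const (s ^ 2) :: 'a ring_S)"
     by (simp add: r_def Const_def mult_single single_add[symmetric] single_uminus[symmetric])
    show ?thesis unfolding r by (simp add: l_def algebra_simps)
   qed
   finally have "eigenvector xS zS yS p r u" unfolding eigenvector_def using u(2) p by blast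
   hence "(p, r) \<in> PA" unfolding PA_def using u(1) by blast
   moreover have "poly [:r, p, 1:] s = 0" by (simp add: r_def algebra_simps power2_eq_square)
   ultimately show ?thesis by blast
  qed
 qed
 have "finite (\<Union>(p, r)\<in>PA. {s. poly [:r, p, 1:] s = 0})"
 proof (rule finite_UN_I[OF finA])
  fix pr assume "pr \<in> PA"
  show "finite (case pr of (p, r) \<Rightarrow> {s. poly [:r, p, 1:] s = 0})"
   by (cases pr) (simp only: prod.case, rule poly_roots_finite, simp)
 qed
 moreover have "finite (\<Union>(p, r)\<in>PB. {- r})" using finB by (intro finite_UN_I) auto
 ultimately have "finite ((\<Union>(p, r)\<in>PA. {s. poly [:r, p, 1:] s = 0}) \<union> (\<Union>(p, r)\<in>PB. {- r}))" by simp
 then obtain s where "s \<notin> (\<Union>(p, r)\<in>PA. {s. poly [:r, p, 1:] s = 0}) \<union> (\<Union>(p, r)\<in>PB. {- r})"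
  using infinite_UNIV_alg_closed by (metis UNIV_eq_I)
 hence "nonzerodivisor_on_quotient (l s) J" using bad[of s] by auto
 thus ?thesis unfolding l_def by blast
qed

end

section \<open>The difference of the Hilbert function\<close>

lemma dim_linear_image_le:
 fixes \<theta> :: "'a::field ring_S \<Rightarrow> 'a ring_S"
 assumes lin: "\<And>f g. \<theta> (f + g) = \<theta> f + \<theta> g" "\<And>c f. \<theta> (scale c f) = scale c (\<theta> f)"
  and V: "V \<subseteq> forms n" "W \<subseteq> \<theta> ` V"
 shows "mpoly_vs.dim W \<le> mpoly_vs.dim V"
proof -
 obtain B where B: "B \<subseteq> V" "mpoly_vs.independent B" "V \<subseteq> mpoly_vs.span B" "card B = mpoly_vs.dim V"
  using mpoly_vs.basis_exists by blast
 obtain B0 :: "'a ring_S set" where B0: "finite B0" "forms n \<subseteq> mpoly_vs.span B0" using finite_dim_forms by blast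
 have finB: "finite B"
  using mpoly_vs.independent_span_bound[OF B0(1) B(2)] B(1) V(1) B0(2) by auto
 have zero: "\<theta> 0 = 0" using lin(2)[of 0 0] by simp
 have "\<theta> v \<in> mpoly_vs.span (\<theta> ` B)" if "v \<in> mpoly_vs.span B" for v
  using that
 proof (induction rule: mpoly_vs.span_induct_alt)
  case base
  thus ?case by (simp add: zero mpoly_vs.span_zero)
 next
  case (step c x y)
  have "\<theta> x \<in> mpoly_vs.span (\<theta> ` B)" by (rule mpoly_vs.span_base) (rule imageI[OF step(1)])
  thus ?case unfolding lin using step(2) by (intro mpoly_vs.span_add mpoly_vs.span_scale)
 qed
 hence "W \<subseteq> mpoly_vs.span (\<theta> ` B)" using V(2) B(3) by blast
 hence "mpoly_vs.dim W \<le> card (\<theta> ` B)" by (rule mpoly_vs.dim_le_card) (simp add: finB)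
 also have "\<dots> \<le> card B" by (rule card_image_le[OF finB])
 finally show ?thesis using B(4) by simp
qed

text \<open>The substitution \<open>z \<mapsto> z + a x + b y\<close>, which moves a general linear form to \<open>z\<close>.\<close>

definition shear :: "'a::comm_ring_1 \<Rightarrow> 'a \<Rightarrow> 'a ring_S \<Rightarrow> 'a ring_S" where
 "shear a b = insertion Const (\<lambda>v. if v = 2 then zS + Const a * xS + Const b * yS else Var v)"

lemma comm_ring_hom_shear: "comm_ring_hom (shear a b :: 'a::comm_ring_1 ring_S \<Rightarrow> _)"
 unfolding shear_def by (rule comm_ring_hom_insertion[OF comm_ring_hom_Const])

lemma shear_Const: "shear a b (Const c) = Const c"
 unfolding shear_def by (rule insertion_Const[OF comm_ring_hom_Const])

lemma shear_Var: "shear a b (Var v) = (if v = 2 then zS + Const a * xS + Const b * yS else Var v)"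
 unfolding shear_def by (rule insertion_Var[OF comm_ring_hom_Const])

lemma shear_inverse: "shear a b (shear (- a) (- b) f) = f"
proof (induction f rule: ring_S_induct)
 case (Const c)
 thus ?case by (simp add: shear_Const)
next
 case (Var v)
 interpret h: comm_ring_hom "shear a b :: 'a ring_S \<Rightarrow> _" by (rule comm_ring_hom_shear)
 have "shear a b (shear (- a) (- b) (Var v)) =
   (if v = 2 then zS + Const a * xS + Const b * yS + Const (- a) * xS + Const (- b) * yS else Var v)"
  by (simp add: shear_Var h.hom_add h.hom_mult shear_Const)
 also have "\<dots> = Var v" by (simp add: Const_def single_uminus)
 finally show ?case .
next
 case (add f g)
 interpret h: comm_ring_hom "shear a b :: 'a ring_S \<Rightarrow> _" by (rule comm_ring_hom_shear)
 interpret h': comm_ring_hom "shear (- a) (- b) :: 'a ring_S \<Rightarrow> _" by (rule comm_ring_hom_shear)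
 show ?case using add by (simp add: h.hom_add h'.hom_add)
next
 case (mult f g)
 interpret h: comm_ring_hom "shear a b :: 'a ring_S \<Rightarrow> _" by (rule comm_ring_hom_shear)
 interpret h': comm_ring_hom "shear (- a) (- b) :: 'a ring_S \<Rightarrow> _" by (rule comm_ring_hom_shear)
 show ?case using mult by (simp add: h.hom_mult h'.hom_mult)
qed

lemma shear_scale: "shear a b (scale c f) = scale c (shear a b f)"
proof -
 interpret h: comm_ring_hom "shear a b :: 'a ring_S \<Rightarrow> _" by (rule comm_ring_hom_shear)
 show ?thesis by (simp add: scale_def h.hom_mult shear_Const)
qed

lemma shear_forms:
 fixes f :: "'a::comm_ring_1 ring_S"
 assumes "f \<in> forms n"
 shows "shear a b f \<in> forms n"
proof -
 interpret h: comm_ring_hom "shear a b :: 'a ring_S \<Rightarrow> _" by (rule comm_ring_hom_shear)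
 have var: "shear a b (Var v) \<in> (forms 1 :: 'a ring_S set)" for v
 proof (cases "v = 2")
  case True
  have "zS + scale a xS + scale b yS \<in> (forms 1 :: 'a ring_S set)" by (intro forms_add forms_scale forms_Var)
  thus ?thesis using True by (simp add: shear_Var scale_def)
 next
  case False
  thus ?thesis using forms_Var[of v] by (simp add: shear_Var)
 qed
 have pow: "shear a b (Var v) ^ k \<in> (forms k :: 'a ring_S set)" for v k
 proof (induction k)
  case (Suc k)
  thus ?case using forms_mult[OF var Suc, of v] by simp
 qed (simp add: forms_one)
 have "shear a b (single \<mu> c) \<in> (forms (mdeg \<mu>) :: 'a ring_S set)" for \<mu> c
 proof -
  obtain i j k where ijk: "\<mu> = mS i j k" by (rule mS_cases)
  have "single \<mu> c = scale c (xS ^ i * (yS ^ j * zS ^ k))"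
   by (simp add: Var_S_power ijk mult_single mS_add scale_single)
  hence "shear a b (single \<mu> c) = scale c (shear a b xS ^ i * (shear a b yS ^ j * shear a b zS ^ k))"
   by (simp add: shear_scale h.hom_mult h.hom_power)
  also have "\<dots> \<in> forms (i + (j + k))" by (intro forms_scale forms_mult pow)
  finally show ?thesis by (simp add: ijk add.assoc)
 qed
 hence "(\<Sum>\<mu>\<in>keys f. shear a b (single \<mu> (lookup f \<mu>))) \<in> forms n"
  using assms by (intro forms_sum) (auto simp: forms_def)
 also have "(\<Sum>\<mu>\<in>keys f. shear a b (single \<mu> (lookup f \<mu>))) = shear a b f"
  unfolding h.hom_sum[symmetric] mpoly_as_sum[symmetric] ..
 finally show ?thesis .
qed

text \<open>After a linear change of coordinates \<open>z\<close> is a nonzerodivisor, so the difference of the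
 Hilbert function counts the monomials in \<open>x, y\<close> outside an initial ideal.\<close>

lemma h_vector_std_count:
 fixes J :: "'a::alg_closed_field ring_S set"
 assumes zd: "zero_dim_subscheme_ideal J" and h: "hilbert_series J * (1 - fps_X) = fps_of_poly h"
 shows "\<exists>E. (\<forall>a b. E a b \<longrightarrow> E (Suc a) b \<and> E a (Suc b)) \<and> \<not> E 0 0 \<and>
  (\<forall>n. coeff h n = int (std_count E n))"
proof -
 have J: "homogeneous_ideal J" and depth: "quotient_depth J = 1" and dim: "quotient_krull_dim J = 1"
  using zd unfolding zero_dim_subscheme_ideal_def cohen_macaulay_quotient_def by auto
 have idJ: "is_ideal J" by (rule homogeneous_ideal_is_ideal[OF J])
 have one: "1 \<notin> J"
 proof
  assume "1 \<in> J"
  hence "g * 1 \<in> J" for g by (rule ring_module.subspace_scale[OF idJ])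
  hence JU: "J = UNIV" by auto
  have S: "{n. \<exists>P :: nat \<Rightarrow> 'a ring_S set. (\<forall>i\<le>n. prime_ideal (P i) \<and> J \<subseteq> P i) \<and> (\<forall>i<n. P i \<subset> P (Suc i))} = {}"
   using JU unfolding prime_ideal_def by auto
  have "quotient_krull_dim J = - \<infinity>" unfolding quotient_krull_dim_def S by (simp add: bot_ereal_def)
  thus False using dim by simp
 qed
 have "\<exists>fs. set fs \<subseteq> irrelevant_ideal \<and> regular_sequence J fs \<and> fs \<noteq> []"
 proof (rule ccontr)
  assume no: "\<not> ?thesis"
  have "quotient_depth J \<le> 0"
   unfolding quotient_depth_def by (rule SUP_least) (use no in auto)
  thus False using depth by simp
 qed
 then obtain f fs where fs: "set (f # fs) \<subseteq> irrelevant_ideal" "regular_sequence J (f # fs)"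
  by (metis neq_Nil_conv)
 have fnz: "nonzerodivisor_on_quotient f J"
 proof -
  have "nonzerodivisor_on_quotient ((f # fs) ! 0) (ideal_gen (J \<union> set (take 0 (f # fs))))"
   using fs(2) unfolding regular_sequence_def by blast
  thus ?thesis by (simp add: ideal_gen_of_ideal[OF idJ])
 qed
 have sat: "v \<in> J" if v: "\<And>w. Var w * v \<in> J" for v
 proof -
  have "g * v \<in> J" if "g \<in> irrelevant_ideal" for g
   using that unfolding irrelevant_ideal_def
  proof (induction rule: ring_module.span_induct_alt)
   case base
   thus ?case using ring_module.subspace_0[OF idJ] by simp
  next
   case (step r x y)
   then obtain w where x: "x = Var w" by blast
   have "r * (x * v) \<in> J" unfolding x by (rule ring_module.subspace_scale[OF idJ v])
   hence "r * (x * v) + y * v \<in> J" by (rule ring_module.subspace_add[OF idJ]) (use step in blast)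
   thus ?case by (simp add: distrib_right mult.assoc)
  qed
  hence "f * v \<in> J" using fs(1) by simp
  thus ?thesis using fnz unfolding nonzerodivisor_on_quotient_def by blast
 qed
 define N0 where "N0 = nat (\<Sum>k\<le>degree h. \<bar>coeff h k\<bar>)"
 have H: "int (hilbert_function J n) = (\<Sum>k\<le>n. coeff h k)" for n
 proof (induction n)
  case 0
  have "fps_nth (hilbert_series J * (1 - fps_X)) 0 = coeff h 0" unfolding h by simp
  thus ?case unfolding fps_times_one_minus_X_nth by (simp add: hilbert_series_def)
 next
  case (Suc n)
  have "fps_nth (hilbert_series J * (1 - fps_X)) (Suc n) = coeff h (Suc n)" unfolding h by simp
  thus ?case using Suc unfolding fps_times_one_minus_X_nth by (simp add: hilbert_series_def)
 qed
 have bounded: "hilbert_function J n \<le> N0" for n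
 proof -
  have "(\<Sum>k\<le>n. coeff h k) \<le> (\<Sum>k\<le>n. \<bar>coeff h k\<bar>)" by (rule sum_mono) simp
  also have "\<dots> = (\<Sum>k\<in>{..n} \<inter> {..degree h}. \<bar>coeff h k\<bar>)"
   by (rule sum.mono_neutral_right) (auto intro: coeff_eq_0)
  also have "\<dots> \<le> (\<Sum>k\<le>degree h. \<bar>coeff h k\<bar>)" by (rule sum_mono2) auto
  finally show ?thesis using H[of n] unfolding N0_def by simp
 qed
 interpret saturated_bounded J N0 by unfold_locales (rule J, rule sat, assumption, rule bounded)
 obtain s where s: "nonzerodivisor_on_quotient (zS + Const s * xS + Const (s ^ 2) * yS) J"
  using linear_nonzerodivisor_exists by blast
 let ?\<theta> = "shear s (s ^ 2)" and ?\<eta> = "shear (- s) (- (s ^ 2))"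
 interpret h: comm_ring_hom "?\<theta> :: 'a ring_S \<Rightarrow> _" by (rule comm_ring_hom_shear)
 interpret h': comm_ring_hom "?\<eta> :: 'a ring_S \<Rightarrow> _" by (rule comm_ring_hom_shear)
 define K where "K = {f. ?\<theta> f \<in> J}"
 have idK: "is_ideal K"
  unfolding ring_module.subspace_def K_def
  using ring_module.subspace_0[OF idJ] ring_module.subspace_add[OF idJ] ring_module.subspace_scale[OF idJ]
  by (simp add: h.hom_add h.hom_mult)
 have K: "homogeneous_ideal K"
 proof (rule homogeneous_idealI[OF idK])
  fix f n assume f: "f \<in> K"
  obtain N where N: "\<forall>m\<in>keys f. mdeg m \<le> N" using mdeg_bound by blast
  hence fs: "f = (\<Sum>n\<le>max N n. hcomp n f)" by (intro sum_hcomp) auto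
  have "hcomp n (?\<theta> f) = hcomp n (\<Sum>k\<le>max N n. ?\<theta> (hcomp k f))"
   using fs by (metis h.hom_sum)
  also have "\<dots> = (\<Sum>k\<le>max N n. if k = n then ?\<theta> (hcomp n f) else 0)"
   unfolding hcomp_sum
   by (rule sum.cong[OF refl]) (auto simp: hcomp_of_form[OF shear_forms[OF hcomp_forms]])
  also have "\<dots> = ?\<theta> (hcomp n f)" by simp
  finally show "hcomp n f \<in> K"
   using homogeneous_ideal_hcomp[OF J, of "?\<theta> f" n] f unfolding K_def by simp
 qed
 have zK: "nonzerodivisor_on_quotient zS K"
  using s unfolding nonzerodivisor_on_quotient_def K_def by (simp add: h.hom_mult shear_Var)
 have \<eta>: "?\<eta> (?\<theta> f) = f" for f using shear_inverse[of "- s" "- (s ^ 2)" f] by simp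
 have \<theta>: "?\<theta> (?\<eta> f) = f" for f by (rule shear_inverse)
 have "mpoly_vs.dim (K \<inter> forms n) = mpoly_vs.dim (J \<inter> forms n)" for n
 proof (rule antisym)
  show "mpoly_vs.dim (K \<inter> forms n) \<le> mpoly_vs.dim (J \<inter> forms n)"
  proof (rule dim_linear_image_le[of ?\<eta> _ n])
   show "K \<inter> forms n \<subseteq> ?\<eta> ` (J \<inter> forms n)"
   proof
    fix f assume "f \<in> K \<inter> forms n"
    hence "?\<theta> f \<in> J \<inter> forms n" unfolding K_def using shear_forms by auto
    thus "f \<in> ?\<eta> ` (J \<inter> forms n)" using \<eta>[of f] by (metis imageI)
   qed
  qed (simp_all add: h'.hom_add shear_scale)
  show "mpoly_vs.dim (J \<inter> forms n) \<le> mpoly_vs.dim (K \<inter> forms n)"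
  proof (rule dim_linear_image_le[of ?\<theta> _ n])
   show "J \<inter> forms n \<subseteq> ?\<theta> ` (K \<inter> forms n)"
   proof
    fix f assume "f \<in> J \<inter> forms n"
    hence "?\<eta> f \<in> K \<inter> forms n" unfolding K_def using shear_forms \<theta> by auto
    thus "f \<in> ?\<theta> ` (K \<inter> forms n)" using \<theta>[of f] by (metis imageI)
   qed
  qed (simp_all add: h.hom_add shear_scale)
 qed
 hence "hilbert_series K = hilbert_series J"
  unfolding hilbert_series_def hilbert_function_def by simp
 hence eq: "fps_of_poly h = Abs_fps (\<lambda>k. int (std_count (\<lambda>a b. mS a b 0 \<in> lead_mons K) k))"
  using hilbert_series_z_extended[OF K nonzerodivisor_imp_z_extended[OF K zK]] h by simp
 have co: "coeff h n = int (std_count (\<lambda>a b. mS a b 0 \<in> lead_mons K) n)" for n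
  using arg_cong[OF eq, of "\<lambda>F. fps_nth F n"] by simp
 have up: "mS (Suc a) b 0 \<in> lead_mons K \<and> mS a (Suc b) 0 \<in> lead_mons K" if "mS a b 0 \<in> lead_mons K" for a b
  using lead_mons_add[OF idK that, of "mS 1 0 0"] lead_mons_add[OF idK that, of "mS 0 1 0"] by (simp add: mS_add)
 have "mS 0 0 0 \<notin> lead_mons K"
 proof
  assume "mS 0 0 0 \<in> lead_mons K"
  then obtain g where g: "g \<in> K" "g \<in> forms 0" "lead (rank_drl 0) (mS 0 0 0) g"
   unfolding lead_mons_homogeneous[OF K] by auto
  have "lookup g 0 \<noteq> 0" using g(3) unfolding lead_def mS_0 by (simp add: in_keys_iff)
  moreover have "g = Const (lookup g 0)"
  proof (rule poly_mapping_eqI)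
   fix \<mu>
   show "lookup g \<mu> = lookup (Const (lookup g 0)) \<mu>"
   proof (cases "\<mu> = 0")
    case False
    hence "mdeg \<mu> \<noteq> 0" using mdeg_eq_0_iff[of \<mu>] by blast
    hence "lookup g \<mu> = 0" by (rule lookup_forms_eq_0[OF g(2)])
    thus ?thesis using False by (simp add: Const_def lookup_single)
   qed (simp add: Const_def)
  qed
  moreover have "?\<theta> g \<in> J" using g(1) unfolding K_def by simp
  ultimately have "Const (lookup g 0) \<in> J" by (metis shear_Const)
  hence "Const (inverse (lookup g 0)) * Const (lookup g 0) \<in> J" by (rule ring_module.subspace_scale[OF idJ])
  thus False using one \<open>lookup g 0 \<noteq> 0\<close> by (simp add: Const_def mult_single)
 qed
 thus ?thesis using up co by (intro exI[of _ "\<lambda>a b. mS a b 0 \<in> lead_mons K"]) blast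
qed

section \<open>The chart of the stratum\<close>

lemma hm_eq_hom_yz:
 assumes "degree p \<le> u"
 shows "hm u p = zS ^ (u - degree p) * hom_yz (p :: 'a::comm_ring_1 poly)"
proof -
 let ?d = "degree p"
 have z: "zS ^ c = (single (mS 0 0 c) 1 :: 'a ring_S)" for c
  by (induction c) (simp_all add: Var_S mult_single mS_add mS_0)
 have "zS ^ (u - ?d) * hom_yz p = (\<Sum>e\<le>?d. single (mS 0 e (u - e)) (coeff p e))"
  unfolding hom_yz_def sum_distrib_left
 proof (rule sum.cong[OF refl])
  fix e assume "e \<in> {..?d}"
  hence e: "u - ?d + (?d - e) = u - e" using assms by simp
  show "zS ^ (u - ?d) * (Const (coeff p e) * yS ^ e * zS ^ (?d - e)) = single (mS 0 e (u - e)) (coeff p e)"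
   unfolding z Var_S_power Const_def mS_0[symmetric] mult_single mS_add by (simp add: e)
 qed
 also have "\<dots> = hm u p"
  unfolding hm_def by (rule sum.mono_neutral_left) (use assms in \<open>auto simp: coeff_eq_0\<close>)
 finally show ?thesis ..
qed

lemma hm_0_eq_Const: "hm 0 p = Const (coeff p 0)"
 by (simp add: hm_def Const_def mS_0)

lemma degree_less_or_0: "degree p \<le> n \<Longrightarrow> coeff p n = 0 \<Longrightarrow> p = 0 \<or> degree p < n"
 by (metis le_neq_implies_less leading_coeff_0_iff)

context h_vector
begin

abbreviation I0 :: "'a::field ring_R set" where "I0 \<equiv> lex_ideal"

text \<open>The coefficients of the relations: the entries of \<open>X + A\<close> except for the entries \<open>-x\<close>, which become
 the left-hand sides \<open>x f j\<close>.\<close>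

definition C_of :: "'a::field poly mat \<Rightarrow> nat \<Rightarrow> nat \<Rightarrow> 'a poly" where
 "C_of A k j = A $$ (k, j - 1) + (if Suc k = j then monom 1 (lex_m j - lex_m (j - 1)) else 0)"

lemma u_of_eq: "k \<le> lex_t \<Longrightarrow> j \<in> {1..lex_t} \<Longrightarrow> u_of (I0 :: 'a::field ring_R set) (Suc k) j = int (D j) + 1 - int (D k)"
 unfolding u_of_def m_of_lex_ideal D_def by auto

lemma d_of_eq: "j \<in> {1..lex_t} \<Longrightarrow> d_of (I0 :: 'a::field ring_R set) j = int (lex_m j - lex_m (j - 1))"
 unfolding d_of_def m_of_lex_ideal using m_mono[of "j - 1" j] by auto

lemma d_pos: "j \<in> {1..lex_t} \<Longrightarrow> 0 < lex_m j - lex_m (j - 1)"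
 using m_mono[of "j - 1" j] by auto

lemma A_space_entry:
 assumes A: "A \<in> A_space (I0 :: 'a::field ring_R set)" and kj: "k \<le> lex_t" "j \<in> {1..lex_t}"
 shows "A $$ (k, j - 1) = 0 \<or> (D k \<le> D j + 1 \<and> degree (A $$ (k, j - 1)) \<le> D j + 1 - D k \<and>
  (k < j \<longrightarrow> degree (A $$ (k, j - 1)) < D j + 1 - D k \<and>
   degree (A $$ (k, j - 1)) < lex_m (Suc k) - lex_m k) \<and>
  (j \<le> k \<longrightarrow> degree (A $$ (k, j - 1)) < lex_m j - lex_m (j - 1)))"
proof -
 let ?p = "A $$ (k, j - 1)"
 have "\<forall>i\<in>{1..lex_t + 1}. \<forall>j\<in>{1..lex_t}.
   A $$ (i - 1, j - 1) = 0 \<or> int (degree (A $$ (i - 1, j - 1))) \<le> deg_bound (I0 :: 'a ring_R set) i j"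
  using A unfolding A_space_def t_of_lex_ideal by blast
 moreover have "Suc k \<in> {1..lex_t + 1}" using kj by simp
 ultimately have "A $$ (Suc k - 1, j - 1) = 0 \<or>
   int (degree (A $$ (Suc k - 1, j - 1))) \<le> deg_bound (I0 :: 'a ring_R set) (Suc k) j"
  using kj(2) by blast
 hence bound: "?p = 0 \<or> int (degree ?p) \<le> deg_bound (I0 :: 'a ring_R set) (Suc k) j" by simp
 have dj: "d_of (I0 :: 'a ring_R set) j = int (lex_m j - lex_m (j - 1))" by (rule d_of_eq[OF kj(2)])
 show ?thesis
 proof (cases "?p = 0")
  case nz: False
  show ?thesis
  proof (cases "k < j")
   case True
   hence "Suc k \<in> {1..lex_t}" using kj by auto
   from d_of_eq[OF this] have di: "d_of (I0 :: 'a ring_R set) (Suc k) = int (lex_m (Suc k) - lex_m k)" by simp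
   have "int (degree ?p) \<le> int (D j) + 1 - int (D k) - 1"
    "int (degree ?p) \<le> int (lex_m (Suc k) - lex_m k) - 1"
    using bound nz True unfolding deg_bound_def u_of_eq[OF kj] di by (simp_all only: if_True Suc_le_eq simp_thms min.bounded_iff)
   thus ?thesis using True by (intro disjI2 conjI impI) linarith+
  next
   case False
   have "int (degree ?p) \<le> int (D j) + 1 - int (D k)"
    "int (degree ?p) \<le> int (lex_m j - lex_m (j - 1)) - 1"
    using bound nz False unfolding deg_bound_def u_of_eq[OF kj] dj by (simp_all only: if_False Suc_le_eq simp_thms min.bounded_iff)
   thus ?thesis using False by (intro disjI2 conjI impI) linarith+
  qed
 qed simp
qed

text \<open>The degree bounds of the affine space say exactly that the relation system is canonical.\<close>

lemma canonical_C_of: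
 assumes A: "A \<in> A_space (I0 :: 'a::field ring_R set)"
 shows "canonical (C_of A)"
proof -
 have diag: "D j + 1 - D k = lex_m j - lex_m (j - 1)" "D k \<le> D j + 1" if "j \<in> {1..lex_t}" "Suc k = j" for k j
  using D_step[of j] that by auto
 have "graded (C_of A)"
  unfolding graded_def
 proof (intro allI ballI impI)
  fix k j assume kj: "k \<le> lex_t" "j \<in> {1..lex_t}" "C_of A k j \<noteq> 0"
  show "D k \<le> D j + 1 \<and> degree (C_of A k j) \<le> D j + 1 - D k"
  proof (cases "Suc k = j")
   case True
   have "degree (A $$ (k, j - 1)) \<le> D j + 1 - D k" using A_space_entry[OF A kj(1,2)] by auto
   moreover have "degree (monom (1::'a) (lex_m j - lex_m (j - 1))) \<le> D j + 1 - D k"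
    using diag[OF kj(2) True] degree_monom_le[of "1::'a" "lex_m j - lex_m (j - 1)"] by simp
   ultimately show ?thesis using diag[OF kj(2) True] True unfolding C_of_def by (auto intro: degree_add_le)
  next
   case False
   thus ?thesis using A_space_entry[OF A kj(1,2)] kj(3) unfolding C_of_def by auto
  qed
 qed
 moreover have "triangular (C_of A)"
  unfolding triangular_def
 proof (intro ballI allI impI)
  fix j k assume j: "j \<in> {1..lex_t}" and k: "k < j"
  have "coeff (A $$ (k, j - 1)) (D j + 1 - D k) = 0"
   using A_space_entry[OF A _ j, of k] k j by (auto intro: coeff_eq_0)
  thus "coeff (C_of A k j) (D j + 1 - D k) = (if k = j - 1 then 1 else 0)"
   using diag[OF j] k by (auto simp: C_of_def coeff_monom)
 qed
 moreover have "coeff (C_of A k j) e = 0"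
  if "k \<le> lex_t" "j \<in> {1..lex_t}" "Suc k < j \<and> lex_m (Suc k) - lex_m k \<le> e \<or> j \<le> k \<and> lex_m j - lex_m (j - 1) \<le> e" for k j e
 proof -
  have "coeff (A $$ (k, j - 1)) e = 0"
   using A_space_entry[OF A that(1,2)] that(3)
   by (cases "A $$ (k, j - 1) = 0") (simp, auto intro!: coeff_eq_0)
  thus ?thesis using that(3) unfolding C_of_def by auto
 qed
 ultimately show ?thesis unfolding canonical_def by blast
qed

lemma C_of_surj:
 assumes can: "canonical C"
 shows "\<exists>A\<in>A_space (I0 :: 'a::field ring_R set). \<forall>k\<le>lex_t. \<forall>j\<in>{1..lex_t}. C_of A k j = C k j"
proof -
 have gr: "graded C" and tri: "triangular C"
  and high: "\<And>k j e. k \<le> lex_t \<Longrightarrow> j \<in> {1..lex_t} \<Longrightarrow> Suc k < j \<Longrightarrow> lex_m (Suc k) - lex_m k \<le> e \<Longrightarrow> coeff (C k j) e = 0"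
  and low: "\<And>k j e. k \<le> lex_t \<Longrightarrow> j \<in> {1..lex_t} \<Longrightarrow> j \<le> k \<Longrightarrow> lex_m j - lex_m (j - 1) \<le> e \<Longrightarrow> coeff (C k j) e = 0"
  using can unfolding canonical_def by blast+
 define A where "A = mat (lex_t + 1) lex_t (\<lambda>(r, c). C r (Suc c) - (if r = c then monom 1 (lex_m (Suc c) - lex_m c) else 0))"
 have A: "A $$ (k, j - 1) = C k j - (if Suc k = j then monom 1 (lex_m j - lex_m (j - 1)) else 0)"
  if "k \<le> lex_t" "j \<in> {1..lex_t}" for k j
  using that unfolding A_def by (cases j) auto
 have "A $$ (i - 1, j - 1) = 0 \<or> int (degree (A $$ (i - 1, j - 1))) \<le> deg_bound (I0 :: 'a ring_R set) i j"
  if i: "i \<in> {1..lex_t + 1}" and j: "j \<in> {1..lex_t}" for i j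
 proof -
  obtain k where k: "i = Suc k" "k \<le> lex_t" using i by (cases i) auto
  let ?p = "A $$ (k, j - 1)"
  show ?thesis
  proof (cases "?p = 0")
   case nz: False
   have top: "coeff ?p (degree ?p) \<noteq> 0" using nz by simp
   consider "Suc k = j" | "Suc k < j" | "j \<le> k" by linarith
   hence "int (degree ?p) \<le> deg_bound (I0 :: 'a ring_R set) (Suc k) j"
   proof cases
    case 1
    let ?d = "lex_m j - lex_m (j - 1)"
    have step: "D j + 1 - D k = ?d" "D k \<le> D j + 1" using D_step[of j] j 1 by auto
    have p: "?p = C k j - monom 1 ?d" using A[OF k(2) j] 1 by simp
    have "C k j = 0 \<or> degree (C k j) \<le> D j + 1 - D k"
     using gr k(2) j unfolding graded_def by blast
    hence "degree (C k j) \<le> ?d" unfolding step(1) by auto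
    hence "degree ?p \<le> ?d" unfolding p by (intro degree_diff_le degree_monom_le)
    moreover have "k < j" using 1 by simp
    hence "coeff (C k j) (D j + 1 - D k) = (if k = j - 1 then 1 else 0)"
     using tri j unfolding triangular_def by blast
    hence "coeff (C k j) ?d = 1" unfolding step(1) using 1 by auto
    hence "coeff ?p ?d = 0" unfolding p by (simp add: coeff_monom)
    ultimately have "degree ?p < ?d" using degree_less_or_0 nz by blast
    moreover have "int (D j) + 1 - int (D k) = int ?d" using step by linarith
    moreover have "Suc k \<le> j" using 1 by simp
    ultimately show ?thesis unfolding deg_bound_def u_of_eq[OF k(2) j] unfolding 1 d_of_eq[OF j] by simp
   next
    case 2
    have p: "?p = C k j" using A[OF k(2) j] 2 by simp
    have Sk: "Suc k \<in> {1..lex_t}" using 2 j by simp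
    have g: "D k \<le> D j + 1" "degree ?p \<le> D j + 1 - D k" using gr k(2) j nz unfolding p graded_def by blast+
    moreover have "coeff ?p (D j + 1 - D k) = 0" using tri j 2 unfolding p triangular_def by auto
    ultimately have "degree ?p < D j + 1 - D k" using degree_less_or_0 nz by blast
    moreover have "degree ?p < lex_m (Suc k) - lex_m k"
     using high[OF k(2) j 2, of "degree ?p"] top p not_le by auto
    ultimately show ?thesis
     unfolding deg_bound_def u_of_eq[OF k(2) j] d_of_eq[OF Sk] using 2 g(1) by auto
   next
    case 3
    have p: "?p = C k j" using A[OF k(2) j] 3 by simp
    have g: "D k \<le> D j + 1" "degree ?p \<le> D j + 1 - D k" using gr k(2) j nz unfolding p graded_def by blast+
    moreover have "degree ?p < lex_m j - lex_m (j - 1)"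
     using low[OF k(2) j 3, of "degree ?p"] top p not_le by auto
    ultimately show ?thesis unfolding deg_bound_def u_of_eq[OF k(2) j] d_of_eq[OF j] using 3 by auto
   qed
   thus ?thesis unfolding k(1) by simp
  qed (simp add: k(1))
 qed
 moreover have "A \<in> carrier_mat (lex_t + 1) lex_t" by (simp add: A_def)
 ultimately have "A \<in> A_space (I0 :: 'a ring_R set)" unfolding A_space_def t_of_lex_ideal by blast
 moreover have "C_of A k j = C k j" if "k \<le> lex_t" "j \<in> {1..lex_t}" for k j
  unfolding C_of_def A[OF that] by simp
 ultimately show ?thesis by blast
qed

lemma M_mat_eq_relation_matrix:
 assumes A: "A \<in> A_space (I0 :: 'a::field ring_R set)"
 shows "M_mat (I0 :: 'a ring_R set) A = relation_matrix (C_of A)"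
proof (rule eq_matI)
 show "dim_row (M_mat (I0 :: 'a ring_R set) A) = dim_row (relation_matrix (C_of A))"
  "dim_col (M_mat (I0 :: 'a ring_R set) A) = dim_col (relation_matrix (C_of A))"
  by (simp_all add: M_mat_def A_hom_def relation_matrix_def t_of_lex_ideal)
 fix r c assume "r < dim_row (relation_matrix (C_of A))" "c < dim_col (relation_matrix (C_of A))"
 hence rc: "r \<le> lex_t" "c < lex_t" by (simp_all add: relation_matrix_def)
 let ?j = "Suc c" and ?a = "A $$ (r, c)"
 let ?w = "D ?j + 1 - D r"
 have j: "?j \<in> {1..lex_t}" using rc by simp
 note entry = A_space_entry[OF A rc(1) j]
 have hom: "(if ?a = 0 then 0 else zS ^ nat (u_of (I0 :: 'a ring_R set) (r + 1) (c + 1) - int (degree ?a)) * hom_yz ?a) = hm ?w ?a"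
 proof (cases "?a = 0")
  case False
  hence *: "D r \<le> D ?j + 1" "degree ?a \<le> ?w" using entry by auto
  hence "nat (u_of (I0 :: 'a ring_R set) (r + 1) (c + 1) - int (degree ?a)) = ?w - degree ?a"
   using u_of_eq[OF rc(1) j, where 'a = 'a] by simp
  thus ?thesis using False hm_eq_hom_yz[OF *(2)] by simp
 qed simp
 have diag: "hm ?w (monom 1 (lex_m ?j - lex_m c)) = (yS ^ (lex_m ?j - lex_m c) :: 'a ring_S)" if "r = c"
 proof -
  have "?w = lex_m ?j - lex_m c" using D_step[of ?j] j that by simp
  thus ?thesis by (simp add: hm_monom Var_S_power)
 qed
 have d: "nat (d_of (I0 :: 'a ring_R set) (c + 1)) = lex_m ?j - lex_m c" using d_of_eq[OF j, where 'a = 'a] by simp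
 have "M_mat (I0 :: 'a ring_R set) A $$ (r, c) =
   (if r = c then yS ^ (lex_m ?j - lex_m c) else if r = c + 1 then - xS else 0) + hm ?w ?a"
  unfolding M_mat_def X_mat_def A_hom_def t_of_lex_ideal Let_def using rc hom d by simp
 also have "\<dots> = hm ?w (C_of A r ?j) - (if r = ?j then xS else 0)"
  using diag by (auto simp: C_of_def hm_add)
 finally show "M_mat (I0 :: 'a ring_R set) A $$ (r, c) = relation_matrix (C_of A) $$ (r, c)"
  using rc by (simp add: relation_matrix_def)
qed

lemma param_eq_stair_ideal:
 "A \<in> A_space (I0 :: 'a::field ring_R set) \<Longrightarrow> param (I0 :: 'a ring_R set) A = stair_ideal (minors (C_of A))"
 unfolding param_def by (simp only: M_mat_eq_relation_matrix minors_ideal)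

lemma param_in_G_Lex:
 fixes A :: "'a::alg_closed_field poly mat"
 assumes H: "H * (1 - fps_X) = Abs_fps (\<lambda>n. int (hn n))" and A: "A \<in> A_space (I0 :: 'a ring_R set)"
 shows "param (I0 :: 'a ring_R set) A \<in> G_Lex H"
proof -
 let ?J = "stair_ideal (minors (C_of A))"
 have can: "graded (C_of A)" "triangular (C_of A)" using canonical_C_of[OF A] unfolding canonical_def by auto
 have sb: "stair_basis (minors (C_of A))" by (rule stair_basis_minors[OF can])
 have hom: "homogeneous_ideal ?J" by (rule homogeneous_stair_ideal[OF sb])
 have idJ: "is_ideal ?J" by (rule homogeneous_ideal_is_ideal[OF hom])
 have lm: "lead_mons ?J = stairs" by (rule lead_mons_stair_ideal[OF sb relation_minors])
 have z: "z_extended (lead_mons ?J)" unfolding lm by (rule z_extended_stairs)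
 have "hilbert_series ?J * (1 - fps_X) = H * (1 - fps_X)"
  unfolding hilbert_series_z_extended[OF hom z] H lm stairs_iff by (simp add: std_count_in_lex)
 moreover have "(1 - fps_X :: int fps) \<noteq> 0"
 proof
  assume "(1 - fps_X :: int fps) = 0"
  hence "fps_nth (1 - fps_X :: int fps) 0 = 0" by simp
  thus False by simp
 qed
 ultimately have hs: "hilbert_series ?J = H" by simp
 have nz: "nonzerodivisor_on_quotient zS ?J" by (rule z_extended_imp_nonzerodivisor[OF hom z])
 have "initial_ideal ?J = extend_to_S (Lex (H * (1 - fps_X)))"
  unfolding H Lex_eq_lex_ideal initial_ideal_eq_extend[OF idJ] by (rule lm)
 moreover have "one_dimensional ?J lex_t (lex_m lex_t)"
 proof
  show "homogeneous_ideal ?J" by (rule hom)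
  show "z_extended (lead_mons ?J)" by (rule z)
  show "mS lex_t 0 0 \<in> lead_mons ?J" "mS 0 (lex_m lex_t) 0 \<in> lead_mons ?J"
   unfolding lm mS_in_stairs by (simp_all add: m_0)
  show "0 \<notin> lead_mons ?J" unfolding lm mS_0[symmetric] stairs_iff by (simp add: in_lex_def hn_0)
 qed
 hence "zero_dim_subscheme_ideal ?J" by (rule one_dimensional_zero_dim_subscheme)
 ultimately show ?thesis unfolding param_eq_stair_ideal[OF A] G_Lex_def using hs nz by blast
qed

lemma param_surj:
 fixes J :: "'a::alg_closed_field ring_S set"
 assumes H: "H * (1 - fps_X) = Abs_fps (\<lambda>n. int (hn n))" and J: "J \<in> G_Lex H"
 shows "\<exists>A\<in>A_space (I0 :: 'a ring_R set). J = param (I0 :: 'a ring_R set) A"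
proof -
 have hom: "homogeneous_ideal J" using J unfolding G_Lex_def zero_dim_subscheme_ideal_def by blast
 have "initial_ideal J = extend_to_S (I0 :: 'a ring_R set)"
  using J unfolding G_Lex_def H Lex_eq_lex_ideal by blast
 hence lm: "lead_mons J = stairs"
  unfolding initial_ideal_eq_extend[OF homogeneous_ideal_is_ideal[OF hom]] .
 obtain C where C: "canonical C" "J = stair_ideal (minors C)" using canonical_minors_exist[OF hom lm] by blast
 obtain A where A: "A \<in> A_space (I0 :: 'a ring_R set)" "\<forall>k\<le>lex_t. \<forall>j\<in>{1..lex_t}. C_of A k j = C k j"
  using C_of_surj[OF C(1)] by blast
 have "relation_matrix (C_of A) = relation_matrix C"
  unfolding relation_matrix_def by (rule eq_matI) (use A(2) in auto)
 hence "minors (C_of A) = minors C" unfolding minors_def by simp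
 thus ?thesis using A(1) C(2) param_eq_stair_ideal[OF A(1)] by auto
qed

section \<open>Betti numbers on the chart\<close>

lemma deg_rows_eq: "deg_rows (I0 :: 'a::field ring_R set) j = Suc ` {l. l \<le> lex_t \<and> D l = j}"
proof (intro equalityI subsetI)
 fix i assume "i \<in> deg_rows (I0 :: 'a ring_R set) j"
 hence "i = Suc (i - 1)" "i - 1 \<le> lex_t" "D (i - 1) = j"
  unfolding deg_rows_def t_of_lex_ideal m_of_lex_ideal D_def by auto
 thus "i \<in> Suc ` {l. l \<le> lex_t \<and> D l = j}" by blast
next
 fix i assume "i \<in> Suc ` {l. l \<le> lex_t \<and> D l = j}"
 thus "i \<in> deg_rows (I0 :: 'a ring_R set) j"
  unfolding deg_rows_def t_of_lex_ideal m_of_lex_ideal D_def by auto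
qed

lemma deg_cols_eq: "deg_cols (I0 :: 'a::field ring_R set) (Suc i) = {k \<in> {1..lex_t}. D k = i}"
 unfolding deg_cols_def t_of_lex_ideal m_of_lex_ideal D_def by auto

text \<open>In a block the degrees force \<open>k < l\<close>, that is, the position is below the diagonal and the entries
 \<open>y^d\<close> do not interfere.\<close>

lemma block_entry:
 assumes l: "l \<le> lex_t" "D l = Suc i" and k: "k \<in> {1..lex_t}" "D k = i"
 shows "k < l" "coeff (C_of A l k) 0 = coord A (Suc l, k, 0)"
proof -
 show "k < l" using D_mono[of l k] l k by (cases "k < l") auto
 thus "coeff (C_of A l k) 0 = coord A (Suc l, k, 0)" by (simp add: C_of_def coord_def)
qed

lemma block_coordinates:
 assumes "i \<in> deg_rows (I0 :: 'a::field ring_R set) (Suc n)" "k \<in> deg_cols (I0 :: 'a ring_R set) (Suc n)"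
 shows "(i, k, 0) \<in> coordinates (I0 :: 'a ring_R set)"
proof -
 obtain l where l: "i = Suc l" "l \<le> lex_t" "D l = Suc n" using assms(1) unfolding deg_rows_eq by blast
 have k: "k \<in> {1..lex_t}" "D k = n" using assms(2) unfolding deg_cols_eq by auto
 have "u_of (I0 :: 'a ring_R set) (Suc l) k = 0" using u_of_eq[OF l(2) k(1), where 'a = 'a] l k by simp
 hence "0 \<le> deg_bound (I0 :: 'a ring_R set) (Suc l) k"
  using block_entry(1)[OF l(2,3) k] d_pos[OF k(1)] unfolding deg_bound_def d_of_eq[OF k(1)] by auto
 thus ?thesis unfolding coordinates_def t_of_lex_ideal l(1) using l k by simp
qed

lemma block_matrix_entry:
 fixes A :: "'a::field poly mat"
 assumes A: "A \<in> A_space (I0 :: 'a ring_R set)"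
  and ik: "i \<in> deg_rows (I0 :: 'a ring_R set) (Suc n)" "k \<in> deg_cols (I0 :: 'a ring_R set) (Suc n)"
 shows "M_mat (I0 :: 'a ring_R set) A $$ (i - 1, k - 1) = Const (coord A (i, k, 0))"
proof -
 obtain l where l: "i = Suc l" "l \<le> lex_t" "D l = Suc n" using ik(1) unfolding deg_rows_eq by blast
 have k: "k \<in> {1..lex_t}" "D k = n" using ik(2) unfolding deg_cols_eq by auto
 have "M_mat (I0 :: 'a ring_R set) A $$ (l, k - 1) = hm (D k + 1 - D l) (C_of A l k) - (if l = k then xS else 0)"
  unfolding M_mat_eq_relation_matrix[OF A] relation_matrix_def using l k by auto
 also have "\<dots> = Const (coord A (Suc l, k, 0))"
  using l k block_entry(1)[OF l(2,3) k] block_entry(2)[OF l(2,3) k, of A] by (auto simp: hm_0_eq_Const)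
 finally show ?thesis by (simp add: l(1))
qed

lemma M_block_rank:
 fixes A :: "'a::field poly mat"
 assumes A: "A \<in> A_space (I0 :: 'a ring_R set)"
 shows "matrix_rank (M_block (I0 :: 'a ring_R set) (Suc n) A) \<le> r \<longleftrightarrow>
   A \<in> rank_locus I0 (deg_rows (I0 :: 'a ring_R set) (Suc n)) (deg_cols (I0 :: 'a ring_R set) (Suc n)) r"
proof -
 let ?R = "deg_rows (I0 :: 'a ring_R set) (Suc n)" and ?C = "deg_cols (I0 :: 'a ring_R set) (Suc n)"
 have fin: "finite ?C" unfolding deg_cols_def by simp
 obtain K where K: "column_basis ?R ?C (\<lambda>i k. coord A (i, k, 0)) K" using column_basis_exists[OF fin] by blast
 have "matrix_rank (M_block (I0 :: 'a ring_R set) (Suc n) A) = card K"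
  by (rule matrix_rank_M_block[OF block_matrix_entry[OF A] K])
 thus ?thesis unfolding rank_locus_def using A low_rank_iff[OF K fin] by simp
qed

lemma beta0_param:
 fixes A :: "'a::field poly mat"
 assumes A: "A \<in> A_space (I0 :: 'a ring_R set)"
 shows "beta0 (param (I0 :: 'a ring_R set) A) (Suc n) + matrix_rank (M_block (I0 :: 'a ring_R set) (Suc n) A) =
  beta0 (I0 :: 'a ring_R set) (Suc n)"
proof -
 let ?R = "deg_rows (I0 :: 'a ring_R set) (Suc n)" and ?C = "deg_cols (I0 :: 'a ring_R set) (Suc n)"
 let ?L = "{l. l \<le> lex_t \<and> D l = Suc n}"
 have fin: "finite ?C" unfolding deg_cols_def by simp
 obtain K where K: "column_basis ?R ?C (\<lambda>i k. coord A (i, k, 0)) K" using column_basis_exists[OF fin] by blast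
 have rank: "matrix_rank (M_block (I0 :: 'a ring_R set) (Suc n) A) = card K"
  by (rule matrix_rank_M_block[OF block_matrix_entry[OF A] K])
 have KC: "K \<subseteq> {k \<in> {1..lex_t}. D k = n}" using K unfolding column_basis_def deg_cols_eq by blast
 have entry: "coeff (C_of A l k) 0 = coord A (Suc l, k, 0)" if "l \<in> ?L" "k \<in> {1..lex_t}" "D k = n" for l k
  using block_entry(2)[of l n k A] that by blast
 have can: "graded (C_of A)" "triangular (C_of A)" using canonical_C_of[OF A] unfolding canonical_def by auto
 have "beta0 (stair_ideal (minors (C_of A))) (Suc n) + card K = card ?L"
 proof (rule beta0_stair_ideal[OF stair_basis_minors[OF can] relation_minors can(1) KC])
  fix c assume c: "\<forall>l\<in>?L. (\<Sum>k\<in>K. c k * coeff (C_of A l k) 0) = 0"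
  have "(\<Sum>k\<in>K. c k * coord A (i, k, 0)) = 0" if "i \<in> ?R" for i
  proof -
   obtain l where l: "i = Suc l" "l \<in> ?L" using \<open>i \<in> ?R\<close> unfolding deg_rows_eq by blast
   have "(\<Sum>k\<in>K. c k * coord A (i, k, 0)) = (\<Sum>k\<in>K. c k * coeff (C_of A l k) 0)"
    unfolding l(1) by (rule sum.cong[OF refl]) (use entry[OF l(2)] KC in auto)
   thus ?thesis using c l(2) by simp
  qed
  hence "\<forall>i\<in>?R. (\<Sum>k\<in>K. c k * coord A (i, k, 0)) = 0" by blast
  moreover have "indep_cols ?R (\<lambda>i k. coord A (i, k, 0)) K" using K unfolding column_basis_def by blast
  ultimately show "\<forall>k\<in>K. c k = 0" by (rule indep_colsD[rotated])
 next
  fix k assume k: "k \<in> {1..lex_t}" "D k = n"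
  hence "k \<in> ?C" unfolding deg_cols_eq by simp
  then obtain c where c: "\<forall>i\<in>?R. coord A (i, k, 0) = (\<Sum>k'\<in>K. c k' * coord A (i, k', 0))"
   using K unfolding column_basis_def by blast
  have "coeff (C_of A l k) 0 = (\<Sum>k'\<in>K. c k' * coeff (C_of A l k') 0)" if l: "l \<in> ?L" for l
  proof -
   have "(\<Sum>k'\<in>K. c k' * coeff (C_of A l k') 0) = (\<Sum>k'\<in>K. c k' * coord A (Suc l, k', 0))"
    by (rule sum.cong[OF refl]) (use entry[OF l] KC in auto)
   moreover have "Suc l \<in> ?R" using l unfolding deg_rows_eq by blast
   ultimately show ?thesis using c entry[OF l k] by simp
  qed
  thus "\<exists>c. \<forall>l\<in>?L. coeff (C_of A l k) 0 = (\<Sum>k'\<in>K. c k' * coeff (C_of A l k') 0)" by blast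
 qed
 thus ?thesis unfolding param_eq_stair_ideal[OF A] rank beta0_lex_ideal .
qed

end

section \<open>Closed sets of the stratum\<close>

lemma insertion_one: "insertion (\<lambda>a. a) \<phi> 1 = (1 :: 'a::comm_ring_1)"
 by (simp add: insertion_def)

lemma vars_one: "vars (1 :: ('v, 'a::comm_ring_1) mpoly) = {}"
 by (simp add: vars_def)

lemma topspace_stratum_topology:
 fixes H :: "int fps"
 assumes "\<forall>A\<in>A_space (Lex (H * (1 - fps_X)) :: 'a::field ring_R set). param (Lex (H * (1 - fps_X))) A \<in> G_Lex H"
 shows "topspace (stratum_topology H) = (G_Lex H :: 'a ring_S set set)"
proof
 let ?I = "Lex (H * (1 - fps_X)) :: 'a ring_R set"
 show "topspace (stratum_topology H) \<subseteq> (G_Lex H :: 'a ring_S set set)"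
  unfolding topspace_def openin_stratum_topology stratum_open_def by blast
 have "in_chart ?I (G_Lex H) = A_space ?I - zero_locus ?I {1}"
  using assms by (auto simp: in_chart_def zero_locus_def insertion_one)
 hence "zariski_open ?I (in_chart ?I (G_Lex H))"
  unfolding zariski_open_def by (intro exI[of _ "{1}"]) (simp add: vars_one)
 hence "openin (stratum_topology H) (G_Lex H :: 'a ring_S set set)"
  unfolding openin_stratum_topology stratum_open_def openin_zariski by simp
 thus "(G_Lex H :: 'a ring_S set set) \<subseteq> topspace (stratum_topology H)" by (rule openin_subset)
qed

text \<open>The topology is transported from the affine space, so closed sets are those with algebraic preimage.\<close>

lemma closedin_stratum_topology:
 fixes H :: "int fps" and V :: "'a::field ring_S set set"
 assumes param: "\<forall>A\<in>A_space (Lex (H * (1 - fps_X)) :: 'a ring_R set). param (Lex (H * (1 - fps_X))) A \<in> G_Lex H"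
 shows "closedin (stratum_topology H) V \<longleftrightarrow> V \<subseteq> G_Lex H \<and>
  (\<exists>E. (\<forall>f\<in>E. vars f \<subseteq> coordinates (Lex (H * (1 - fps_X)) :: 'a ring_R set)) \<and>
   in_chart (Lex (H * (1 - fps_X))) V = zero_locus (Lex (H * (1 - fps_X))) E)"
proof -
 let ?I = "Lex (H * (1 - fps_X)) :: 'a ring_R set"
 have chart: "in_chart ?I (G_Lex H - V) = A_space ?I - in_chart ?I V"
  using param by (auto simp: in_chart_def)
 have iff: "A_space ?I - in_chart ?I V = A_space ?I - zero_locus ?I E \<longleftrightarrow> in_chart ?I V = zero_locus ?I E" for E
 proof -
  have "in_chart ?I V \<subseteq> A_space ?I" "zero_locus ?I E \<subseteq> A_space ?I"
   unfolding in_chart_def zero_locus_def by blast+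
  thus ?thesis by blast
 qed
 show ?thesis
  unfolding closedin_def topspace_stratum_topology[OF param] openin_stratum_topology stratum_open_def
   openin_zariski zariski_open_def chart iff by blast
qed

section \<open>The Betti loci\<close>

context h_vector
begin

lemma V_ge_chart:
 fixes A :: "'a::alg_closed_field poly mat"
 assumes H: "H * (1 - fps_X) = Abs_fps (\<lambda>n. int (hn n))" and A: "A \<in> A_space (I0 :: 'a ring_R set)"
 shows "param (I0 :: 'a ring_R set) A \<in> V_ge H (Suc n) b \<longleftrightarrow>
   int (matrix_rank (M_block (I0 :: 'a ring_R set) (Suc n) A)) \<le> int (beta0 (I0 :: 'a ring_R set) (Suc n)) - b"
  "param (I0 :: 'a ring_R set) A \<in> V_eq H (Suc n) b \<longleftrightarrow>
   int (matrix_rank (M_block (I0 :: 'a ring_R set) (Suc n) A)) = int (beta0 (I0 :: 'a ring_R set) (Suc n)) - b"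
 using beta0_param[OF A, of n] param_in_G_Lex[OF H A] unfolding V_ge_def V_eq_def by auto

lemma V_ge_eq_image:
 assumes H: "H * (1 - fps_X) = Abs_fps (\<lambda>n. int (hn n))"
 shows "(V_ge H (Suc n) b :: 'a::alg_closed_field ring_S set set) = param (I0 :: 'a ring_R set) `
  {A \<in> A_space I0. int (matrix_rank (M_block (I0 :: 'a ring_R set) (Suc n) A)) \<le> int (beta0 (I0 :: 'a ring_R set) (Suc n)) - b}"
proof (intro equalityI subsetI)
 fix J :: "'a ring_S set" assume J: "J \<in> V_ge H (Suc n) b"
 hence "J \<in> G_Lex H" unfolding V_ge_def by blast
 then obtain A where "A \<in> A_space (I0 :: 'a ring_R set)" "J = param (I0 :: 'a ring_R set) A"
  using param_surj[OF H] by blast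
 thus "J \<in> param (I0 :: 'a ring_R set) `
  {A \<in> A_space I0. int (matrix_rank (M_block (I0 :: 'a ring_R set) (Suc n) A)) \<le> int (beta0 (I0 :: 'a ring_R set) (Suc n)) - b}"
  using J V_ge_chart(1)[OF H] by blast
qed (use V_ge_chart(1)[OF H] in blast)

lemma in_chart_V_ge:
 assumes H: "H * (1 - fps_X) = Abs_fps (\<lambda>n. int (hn n))"
 shows "in_chart (I0 :: 'a::alg_closed_field ring_R set) (V_ge H (Suc n) b) =
  {A \<in> A_space I0. int (matrix_rank (M_block (I0 :: 'a ring_R set) (Suc n) A)) \<le> int (beta0 (I0 :: 'a ring_R set) (Suc n)) - b}"
 unfolding in_chart_def using V_ge_chart(1)[OF H] by blast

abbreviation block_locus :: "nat \<Rightarrow> nat \<Rightarrow> 'a::field poly mat set" where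
 "block_locus n r \<equiv> rank_locus (I0 :: 'a ring_R set) (deg_rows (I0 :: 'a ring_R set) (Suc n)) (deg_cols (I0 :: 'a ring_R set) (Suc n)) r"

lemma in_chart_V_ge_rank_locus:
 assumes H: "H * (1 - fps_X) = Abs_fps (\<lambda>n. int (hn n))"
 shows "in_chart (I0 :: 'a::alg_closed_field ring_R set) (V_ge H (Suc n) b) =
  (if b \<le> int (beta0 (I0 :: 'a ring_R set) (Suc n)) then block_locus n (nat (int (beta0 (I0 :: 'a ring_R set) (Suc n)) - b)) else {})"
proof -
 let ?B = "int (beta0 (I0 :: 'a ring_R set) (Suc n))"
 show ?thesis
 proof (cases "b \<le> ?B")
  case True
  have "int x \<le> ?B - b \<longleftrightarrow> x \<le> nat (?B - b)" for x using True by linarith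
  hence "in_chart (I0 :: 'a ring_R set) (V_ge H (Suc n) b) =
   {A \<in> A_space I0. A \<in> block_locus n (nat (?B - b))}"
   unfolding in_chart_V_ge[OF H] using M_block_rank by blast
  also have "\<dots> = block_locus n (nat (?B - b))" unfolding rank_locus_def by blast
  finally show ?thesis using True by simp
 next
  case False
  hence "\<not> int x \<le> ?B - b" for x by linarith
  thus ?thesis unfolding in_chart_V_ge[OF H] using False by simp
 qed
qed

lemma V_ge_zero_locus:
 assumes H: "H * (1 - fps_X) = Abs_fps (\<lambda>n. int (hn n))"
 shows "\<exists>E. (\<forall>f\<in>E. vars f \<subseteq> M_block_coordinates (I0 :: 'a::alg_closed_field ring_R set) (Suc n)) \<and>
  in_chart (I0 :: 'a ring_R set) (V_ge H (Suc n) b) = zero_locus I0 E"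
proof (cases "b \<le> int (beta0 (I0 :: 'a ring_R set) (Suc n))")
 case True
 have fin: "finite (deg_rows (I0 :: 'a ring_R set) (Suc n))" "finite (deg_cols (I0 :: 'a ring_R set) (Suc n))"
  by (auto simp: deg_rows_def deg_cols_def)
 show ?thesis
  unfolding in_chart_V_ge_rank_locus[OF H] M_block_coordinates_def
  using rank_locus_zero_locus[OF fin, of I0] True by simp
next
 case False
 hence "in_chart (I0 :: 'a ring_R set) (V_ge H (Suc n) b) = zero_locus I0 {1}"
  unfolding in_chart_V_ge_rank_locus[OF H] by (simp add: zero_locus_def insertion_one)
 thus ?thesis by (intro exI[of _ "{1}"]) (simp add: vars_one)
qed

lemma M_block_coordinates_subset:
 "M_block_coordinates (I0 :: 'a::field ring_R set) (Suc n) \<subseteq> coordinates (I0 :: 'a ring_R set)"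
 using block_coordinates[where ?'a = 'a] unfolding M_block_coordinates_def by blast

lemma disjoint_M_block_coordinates:
 "disjoint_family_on (M_block_coordinates (I0 :: 'a::field ring_R set)) T"
 unfolding disjoint_family_on_def M_block_coordinates_def deg_rows_def by auto

lemma V_ge_irreducible:
 assumes H: "H * (1 - fps_X) = Abs_fps (\<lambda>n. int (hn n))"
  and ne: "(V_ge H (Suc n) b :: 'a::alg_closed_field ring_S set set) \<noteq> {}"
 shows "irreducible_in (stratum_topology H) (V_ge H (Suc n) b :: 'a ring_S set set)"
proof -
 let ?V = "V_ge H (Suc n) b :: 'a ring_S set set"
 let ?r = "nat (int (beta0 (I0 :: 'a ring_R set) (Suc n)) - b)"
 have Lex: "Lex (H * (1 - fps_X)) = (I0 :: 'a ring_R set)" unfolding H by (rule Lex_eq_lex_ideal)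
 have param: "\<forall>A\<in>A_space (Lex (H * (1 - fps_X)) :: 'a ring_R set). param (Lex (H * (1 - fps_X))) A \<in> G_Lex H"
  unfolding Lex using param_in_G_Lex[OF H] by blast
 have image: "?V = param (I0 :: 'a ring_R set) ` in_chart (I0 :: 'a ring_R set) ?V"
  unfolding in_chart_V_ge[OF H] by (rule V_ge_eq_image[OF H])
 hence "in_chart (I0 :: 'a ring_R set) ?V \<noteq> {}" using ne by (metis image_empty)
 hence chart: "in_chart (I0 :: 'a ring_R set) ?V = block_locus n ?r"
  unfolding in_chart_V_ge_rank_locus[OF H] by (simp split: if_splits)
 show ?thesis
  unfolding irreducible_in_def
 proof (intro conjI allI impI; (elim conjE)?)
  show "?V \<subseteq> topspace (stratum_topology H)"
   unfolding topspace_stratum_topology[OF param] V_ge_def by blast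
  show "?V \<noteq> {}" by (rule ne)
  fix C D :: "'a ring_S set set"
  assume C: "closedin (stratum_topology H) C" and D: "closedin (stratum_topology H) D" and sub: "?V \<subseteq> C \<union> D"
  obtain E where E: "\<forall>f\<in>E. vars f \<subseteq> coordinates (I0 :: 'a ring_R set)" "in_chart (I0 :: 'a ring_R set) C = zero_locus I0 E"
   using C unfolding closedin_stratum_topology[OF param] Lex by blast
  obtain F where F: "\<forall>f\<in>F. vars f \<subseteq> coordinates (I0 :: 'a ring_R set)" "in_chart (I0 :: 'a ring_R set) D = zero_locus I0 F"
   using D unfolding closedin_stratum_topology[OF param] Lex by blast
  have "in_chart (I0 :: 'a ring_R set) ?V \<subseteq> in_chart (I0 :: 'a ring_R set) C \<union> in_chart (I0 :: 'a ring_R set) D"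
   using sub unfolding in_chart_def by blast
  hence "in_chart (I0 :: 'a ring_R set) ?V \<subseteq> in_chart (I0 :: 'a ring_R set) C \<or> in_chart (I0 :: 'a ring_R set) ?V \<subseteq> in_chart (I0 :: 'a ring_R set) D"
   unfolding chart E(2) F(2)
   by (intro rank_locus_irreducible[OF infinite_UNIV_alg_closed _ E(1) F(1)] block_coordinates)
  moreover have "?V \<subseteq> W" if "in_chart (I0 :: 'a ring_R set) ?V \<subseteq> in_chart (I0 :: 'a ring_R set) W" for W
  proof
   fix J assume "J \<in> ?V"
   then obtain A where "A \<in> in_chart (I0 :: 'a ring_R set) ?V" "J = param (I0 :: 'a ring_R set) A" using image by blast
   thus "J \<in> W" using that unfolding in_chart_def by blast
  qed
  ultimately show "?V \<subseteq> C \<or> ?V \<subseteq> D" by blast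
 qed
qed

text \<open>The locus is closed by its equations; conversely an equation of a closed set above the points of exact
 rank vanishes on the whole rank locus by density.\<close>

lemma V_ge_closure:
 assumes H: "H * (1 - fps_X) = Abs_fps (\<lambda>n. int (hn n))"
  and ne: "(V_eq H (Suc n) b :: 'a::alg_closed_field ring_S set set) \<noteq> {}"
 shows "V_ge H (Suc n) b = stratum_topology H closure_of (V_eq H (Suc n) b :: 'a ring_S set set)"
proof (rule antisym)
 let ?V = "V_ge H (Suc n) b :: 'a ring_S set set" and ?W = "V_eq H (Suc n) b :: 'a ring_S set set"
 let ?I = "I0 :: 'a ring_R set"
 let ?B = "int (beta0 ?I (Suc n))"
 let ?r = "nat (?B - b)"
 have Lex: "Lex (H * (1 - fps_X)) = ?I" unfolding H by (rule Lex_eq_lex_ideal)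
 have param: "\<forall>A\<in>A_space (Lex (H * (1 - fps_X)) :: 'a ring_R set). param (Lex (H * (1 - fps_X))) A \<in> G_Lex H"
  unfolding Lex using param_in_G_Lex[OF H] by blast
 obtain E where E: "\<forall>f\<in>E. vars f \<subseteq> M_block_coordinates ?I (Suc n)" "in_chart ?I ?V = zero_locus ?I E"
  using V_ge_zero_locus[OF H] by blast
 have "closedin (stratum_topology H) ?V"
  unfolding closedin_stratum_topology[OF param] Lex
  using E M_block_coordinates_subset by (fastforce simp: V_ge_def)
 moreover have "?W \<subseteq> ?V" unfolding V_eq_def V_ge_def by auto
 ultimately show "stratum_topology H closure_of ?W \<subseteq> ?V" by (rule closure_of_minimal[rotated])
 obtain J where J: "J \<in> ?W" using ne by blast
 hence "J \<in> G_Lex H" unfolding V_eq_def by blast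
 then obtain A' where A': "A' \<in> A_space ?I" "J = param ?I A'" using param_surj[OF H] by blast
 have rank': "int (matrix_rank (M_block ?I (Suc n) A')) = ?B - b"
  using J V_ge_chart(2)[OF H A'(1)] A'(2) by blast
 hence b: "b \<le> ?B" "matrix_rank (M_block ?I (Suc n) A') = ?r" by linarith+
 have chart: "in_chart ?I ?V = block_locus n ?r" unfolding in_chart_V_ge_rank_locus[OF H] using b by simp
 let ?C = "stratum_topology H closure_of ?W"
 have "closedin (stratum_topology H) ?C" by (rule closedin_closure_of)
 then obtain F where F: "\<forall>f\<in>F. vars f \<subseteq> coordinates ?I" "in_chart ?I ?C = zero_locus ?I F"
  unfolding closedin_stratum_topology[OF param] Lex by blast
 have WC: "?W \<subseteq> ?C"
  by (rule closure_of_subset) (auto simp: topspace_stratum_topology[OF param] V_eq_def)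
 have fin: "finite (deg_rows ?I (Suc n))" "finite (deg_cols ?I (Suc n))" by (auto simp: deg_rows_def deg_cols_def)
 have exact: "A \<in> zero_locus ?I F"
  if A: "A \<in> block_locus n ?r" and low: "\<And>r'. r' < ?r \<Longrightarrow> A \<notin> block_locus n r'" for A
 proof -
  have sp: "A \<in> A_space ?I" using A unfolding rank_locus_def by blast
  have "matrix_rank (M_block ?I (Suc n) A) \<le> ?r" using A M_block_rank[OF sp] by blast
  moreover have "\<not> matrix_rank (M_block ?I (Suc n) A) < ?r"
   using low[of "matrix_rank (M_block ?I (Suc n) A)"] M_block_rank[OF sp, of n "matrix_rank (M_block ?I (Suc n) A)"] by blast
  ultimately have "int (matrix_rank (M_block ?I (Suc n) A)) = ?B - b" using b by linarith
  hence "param ?I A \<in> ?W" using V_ge_chart(2)[OF H sp] by blast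
  hence "A \<in> in_chart ?I ?C" using WC sp unfolding in_chart_def by blast
  thus ?thesis unfolding F(2) .
 qed
 have "block_locus n ?r \<subseteq> zero_locus ?I F"
 proof (rule rank_locus_dense[OF infinite_UNIV_alg_closed fin block_coordinates F(1)])
  show "A' \<in> block_locus n ?r" using M_block_rank[OF A'(1), of n ?r] b by simp
  show "A' \<notin> block_locus n r'" if "r' < ?r" for r' using M_block_rank[OF A'(1), of n r'] b that by simp
 qed (assumption | rule exact)+
 hence sub: "in_chart ?I ?V \<subseteq> in_chart ?I ?C" unfolding chart F(2) .
 show "?V \<subseteq> ?C"
 proof
  fix J assume J: "J \<in> ?V"
  hence "J \<in> G_Lex H" unfolding V_ge_def by blast
  then obtain A where A: "A \<in> A_space ?I" "J = param ?I A" using param_surj[OF H] by blast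
  hence "A \<in> in_chart ?I ?V" using J unfolding in_chart_def by blast
  thus "J \<in> ?C" using sub A(2) unfolding in_chart_def by blast
 qed
qed

end

theorem proposition7p1:
  fixes J' :: "'a::alg_closed_field ring_S set"
    and H :: "int fps" and h :: "int poly" and I0 :: "'a ring_R set" and \<beta> :: "nat \<Rightarrow> int"
  assumes "zero_dim_subscheme_ideal J'"
    and "hilbert_series J' = H"
    and "H * (1 - fps_X) = fps_of_poly h"
    and "CHAR('a) = 0 \<or> CHAR('a) > Max {j. Polynomial.coeff h j \<noteq> 0}"
    and "I0 = Lex (fps_of_poly h)"
  shows
    \<comment> \<open>(a)\<close>
    "(\<forall>j\<ge>1.
        M_block_coordinates I0 j \<subseteq> coordinates I0 \<and>
        (\<forall>A\<in>A_space I0. \<forall>i\<in>deg_rows I0 j. \<forall>k\<in>deg_cols I0 j.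
           M_mat I0 A $$ (i - 1, k - 1) = Const (coord A (i, k, 0))) \<and>
        in_chart I0 (V_ge H j (\<beta> j)) =
          {A \<in> A_space I0. int (matrix_rank (M_block I0 j A)) \<le> int (beta0 I0 j) - \<beta> j} \<and>
        V_ge H j (\<beta> j) = param I0 `
          {A \<in> A_space I0. int (matrix_rank (M_block I0 j A)) \<le> int (beta0 I0 j) - \<beta> j}) \<and>
    \<comment> \<open>(b)\<close>
     (V_ge_all H \<beta> :: 'a ring_S set set) = (\<Inter>j\<in>{1..}. V_ge H j (\<beta> j)) \<and>
     disjoint_family_on (M_block_coordinates I0) {1..} \<and>
     (\<forall>j\<ge>1. \<exists>E. (\<forall>f\<in>E. vars f \<subseteq> M_block_coordinates I0 j) \<and>
        in_chart I0 (V_ge H j (\<beta> j)) = zero_locus I0 E) \<and>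
    \<comment> \<open>(c)\<close>
     (\<forall>j\<ge>1.
        ((V_ge H j (\<beta> j) :: 'a ring_S set set) \<noteq> {} \<longrightarrow>
           irreducible_in (stratum_topology H) (V_ge H j (\<beta> j) :: 'a ring_S set set)) \<and>
        ((V_eq H j (\<beta> j) :: 'a ring_S set set) \<noteq> {} \<longrightarrow>
           V_ge H j (\<beta> j) =
             stratum_topology H closure_of (V_eq H j (\<beta> j) :: 'a ring_S set set)))"
proof -
 obtain E where up: "\<forall>a b. E a b \<longrightarrow> E (Suc a) b \<and> E a (Suc b)" and E0: "\<not> E 0 0"
  and h: "\<forall>n. coeff h n = int (std_count E n)"
  using h_vector_std_count[OF assms(1)] assms(2,3) by blast
 interpret h_vector "std_count E"
 proof
  have "{a. a \<le> 0 \<and> \<not> E a (0 - a)} = {0}" using E0 by auto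
  thus "std_count E 0 = 1" unfolding std_count_def by simp
  show "std_count E n \<le> n + 1" for n by (rule std_count_bounds(1)) (use up in blast)
  show "std_count E (Suc n) \<le> std_count E n" if "std_count E n \<le> n" for n
   by (rule std_count_bounds(2)[OF _ that]) (use up in blast)
  have "std_count E n = 0" if "degree h < n" for n
  proof -
   have "int (std_count E n) = 0" using h coeff_eq_0[OF that] by simp
   thus ?thesis by simp
  qed
  thus "\<exists>N. \<forall>n\<ge>N. std_count E n = 0" by (intro exI[of _ "Suc (degree h)"]) auto
 qed
 have hpoly: "fps_of_poly h = Abs_fps (\<lambda>n. int (std_count E n))" by (rule fps_ext) (simp add: h)
 have H: "H * (1 - fps_X) = Abs_fps (\<lambda>n. int (std_count E n))" using assms(3) hpoly by simp
 have I0: "I0 = lex_ideal" unfolding assms(5) hpoly by (rule Lex_eq_lex_ideal)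
 have Suc: "\<exists>n. j = Suc n" if "1 \<le> j" for j using that by (cases j) auto
 show ?thesis
  unfolding I0
 proof (intro conjI allI impI ballI)
  fix j :: nat assume "1 \<le> j"
  then obtain n where j: "j = Suc n" using Suc by blast
  show "M_block_coordinates (lex_ideal :: 'a ring_R set) j \<subseteq> coordinates (lex_ideal :: 'a ring_R set)"
   unfolding j by (rule M_block_coordinates_subset)
  show "M_mat lex_ideal A $$ (i - 1, k - 1) = Const (coord A (i, k, 0))"
   if "A \<in> A_space (lex_ideal :: 'a ring_R set)" "i \<in> deg_rows (lex_ideal :: 'a ring_R set) j"
    "k \<in> deg_cols (lex_ideal :: 'a ring_R set) j" for A i k
   using that unfolding j by (rule block_matrix_entry)
  show "in_chart lex_ideal (V_ge H j (\<beta> j)) = {A \<in> A_space (lex_ideal :: 'a ring_R set).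
    int (matrix_rank (M_block lex_ideal j A)) \<le> int (beta0 (lex_ideal :: 'a ring_R set) j) - \<beta> j}"
   unfolding j by (rule in_chart_V_ge[OF H])
  show "V_ge H j (\<beta> j) = param lex_ideal ` {A \<in> A_space (lex_ideal :: 'a ring_R set).
    int (matrix_rank (M_block lex_ideal j A)) \<le> int (beta0 (lex_ideal :: 'a ring_R set) j) - \<beta> j}"
   unfolding j by (rule V_ge_eq_image[OF H])
  show "\<exists>E. (\<forall>f\<in>E. vars f \<subseteq> M_block_coordinates (lex_ideal :: 'a ring_R set) j) \<and>
    in_chart lex_ideal (V_ge H j (\<beta> j)) = zero_locus (lex_ideal :: 'a ring_R set) E"
   unfolding j by (rule V_ge_zero_locus[OF H])
  show "irreducible_in (stratum_topology H) (V_ge H j (\<beta> j) :: 'a ring_S set set)"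
   if "(V_ge H j (\<beta> j) :: 'a ring_S set set) \<noteq> {}"
   using that unfolding j by (rule V_ge_irreducible[OF H])
  show "V_ge H j (\<beta> j) = stratum_topology H closure_of (V_eq H j (\<beta> j) :: 'a ring_S set set)"
   if "(V_eq H j (\<beta> j) :: 'a ring_S set set) \<noteq> {}"
   using that unfolding j by (rule V_ge_closure[OF H])
 next
  show "(V_ge_all H \<beta> :: 'a ring_S set set) = (\<Inter>j\<in>{1..}. V_ge H j (\<beta> j))" unfolding V_ge_all_def ..
  show "disjoint_family_on (M_block_coordinates (lex_ideal :: 'a ring_R set)) {1..}"
   by (rule disjoint_M_block_coordinates)
 qed
qed

end
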